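(* Let $n\ge4$ be an integer and assume that the couplings $J_e$ are independent and identically distributed real random variables whose law has a density bounded by $\phi<\infty$. There is $\beta_0=\beta_0(n,\phi)<\infty$ such that for every $\beta\ge\beta_0$ there is a certificate at $\beta$, with sequence $(r_k,w_k)_{k\ge0}$, whose constants $\ell_{\rm s},\ell_{\rm b},S,P$ lie in $[0,1)$ and satisfy $2\ell_{\rm s}+S<1$ and $2\ell_{\rm b}+\sqrt P<1$ (equivalently $(1-2\ell_{\rm b})_+^2>P$), and the following hold, the inequalities for every $N\ge1$. (i) (Pole order.) With free poles, $\mathbb E\langle\sigma_A\sigma_B\rangle^2\ge1-S$, and $\mathbb E\langle\sigma_A\sigma_B\rangle^2\to1$ as $N\to\infty$. (ii) (Edwards--Anderson order with fixed poles.) For all $s_A,s_B\in\{-1,1\}$ and every $x\in\mathcal V_N\setminus\{A,B\}$, $\mathbb E\langle\sigma_x\rangle_{s_A,s_B}^2\ge1-2\ell_{\rm s}$. If the law of $J_e$ is symmetric, then also $\mathbb E\langle\sigma_x\rangle_{s_A,s_B}=0$. (iii) (Site-overlap order.) With free poles, $\mathbb E\langle R_{12}^2\rangle\ge(1-2\ell_{\rm s}-S)_+^2>0$. (iv) (A giant blue cluster containing the poles.) With free poles, for every $\theta\in(0,1)$, $$\mathbb P\big(B\in C(A),\ |C(A)|>(1-\theta)|\mathcal V_N|\big)\ge1-\ell_{\rm b}/\theta-P,$$ which is positive for $\theta\in(\ell_{\rm b}/(1-P),1)$. (v) (At most one giant blue cluster.) With free poles, for $1\le m\le N$, $$\mathbb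 P\big(M_N>(2n)^{-m}|\mathcal V_N|\big)\le\epsilon_{N,m},\qquad \mathbb E M_N/|\mathcal V_N|\le(2n)^{-m}+\epsilon_{N,m},$$ where $\epsilon_{N,m}:=w_N+2\ln2\,r_N+v_m\sum_{k=N-m+1}^{N}\bar a^{\rm b}(r_{k-1},w_{k-1})$ tends to $0$ as $N\to\infty$ for each fixed $m$. Hence $M_N/|\mathcal V_N|\to0$ in probability and in $L^1$. (vi) (Blue imbalance.) With free poles, $\mathbb E\,\mathcal I_N^2\ge(1-2\ell_{\rm b})_+^2-P>0$. For these certificates the constants $\ell_{\rm s},\ell_{\rm b},S,P$ are $O(1/\beta)$ as $\beta\to\infty$ for fixed $(n,\phi)$, so the lower bounds in (i)--(iii) and (vi) tend to $1$. Moreover, items (i)--(vi) hold, with the constants and the sequence of the certificate, at every $\beta$ at which a certificate exists, except that the positivity assertions in (iii) require $2\ell_{\rm s}+S<1$ and those in (iv) and (vi) require $2\ell_{\rm b}+\sqrt P<1$; and a certificate at $\beta_1$ is a certificate at every $\beta\ge\beta_1$.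
   Context: Lattice. $\mathbb D_0$ is the graph with two vertices (poles) $A,B$ and one edge. For $N\ge1$, $\mathbb D_N$ consists of $n$ branches in parallel between its poles $A$ and $B$; each branch is two copies of $\mathbb D_{N-1}$ (its halves) glued in series at a new vertex (the midpoint of the branch). $\mathcal V_N$ is the vertex set of $\mathbb D_N$, and $v_k$ is the number of non-pole vertices of $\mathbb D_k$: $v_0=0$, $v_k=n(1+2v_{k-1})$. Gibbs measures and replicas. For couplings $J=(J_e)_{e\in E(\mathbb D_N)}$ and inverse temperature $\beta\ge0$, the free-pole Gibbs measure on $\{-1,1\}^{\mathcal V_N}$ is $\propto\exp(\beta\sum_{e=xy}J_e\sigma_x\sigma_y)$ (all spins, including the poles, summed). The fixed-pole measure with pole spins $(s_A,s_B)$ is this measure conditioned on $\sigma_A=s_A,\sigma_B=s_B$. $\langle\cdot\rangle$ is the free-pole Gibbs expectation, $\langle\cdot\rangle_{s_A,s_B}$ the fixed-pole one. Two replicas $\sigma,\tau$ are independent given $J$ with the same Gibbs measure; $\langle\cdot\rangle$ also denotes their joint expectation. Put $q_x=\sigma_x\tau_x$, $R_{12}=|\mathcal V_N|^{-1}\sum_{x\in\mathcal V_N}q_x$. $\mathbb P,\mathbb E$ refer to the joint law of couplings, replicas and blue bonds. Blue bonds. Given $(J,\sigma,\tau)$, each edge $e=xy$ is independently blue with probability $1-e^{-4\beta|J_e|}$ if $J_e\sigma_x\sigma_y>0$ and $J_e\tau_x\tau_y>0$, and is not blue otherwise. $C(x)$ is the blue cluster (connected component of the graph of blue edges, on all of $\mathcal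 V_N$) containing $x$; $q$ is constant on blue clusters. $C_\pm$ is a largest blue cluster with $q\equiv\pm1$ (empty if there is none), $\mathcal I_N:=(|C_+|-|C_-|)/|\mathcal V_N|$, and $M_N:=\max\{|C|:C\text{ a blue cluster},\ A\notin C\}$ ($0$ if there is none). Certificates. Let $p_2(x)=2(1-2|x|)_+$ and $\kappa_g=p_2^{*g}(0)$ ($g$-fold convolution). For $r\ge0$, $0\le w<1$, $L,R>0$ put $$\rho=\frac r{1-w},\quad\varpi(r,w;L,R)=2w+(2\rho R)^2+4\rho L,\quad\vartheta=\frac{1+e^{-2L}}{\tanh R},\quad\Gamma(r,w;L,R)=\vartheta\sum_{g=1}^n\binom ng\kappa_g\,\varpi^{\,n-g}.$$ A certificate at $\beta$ consists of an integer $K\ge0$, numbers $r_0\ge\phi/\beta$ and $w_0=0$, parameters $L_k,R_k>0$ ($0\le k<K$), numbers $(r_k,w_k)_{1\le k\le K}$ with $w_k<1$, $r_{k+1}\ge r_k\Gamma(r_k,w_k;L_k,R_k)$ and $w_{k+1}\ge\varpi(r_k,w_k;L_k,R_k)^n$ for $0\le k<K$, and tail parameters $A,\gamma,L,R>0$ (this $A$ is a number, not the pole) with: (T0) $w_K\le Ar_K^2$ and $Ar_K^2<1$; (T1) $\Gamma(r_K,Ar_K^2;L,R)\le\gamma<1$; (T2) $\varpi(r_K,Ar_K^2;L,R)^n\le A\gamma^2r_K^2$. Its sequence $(r_k,w_k)_{k\ge0}$ is continued by $r_k:=r_K\gamma^{k-K}$ and $w_k:=Ar_K^2\gamma^{2(k-K)}$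 for all $k\ge K$ (this redefines $w_K$ as $Ar_K^2$; in particular $w_0=Ar_0^2$ if $K=0$). Constants of a certificate (computed from the continued sequence). With $$\bar a^{\rm b}(r,w):=\tfrac34w+(1+2\ln2)r+w^2+wr+\tfrac12r^2,$$ $$\ell_{\rm s}:=\sum_{k\ge0}\big(\tfrac12w_k+2r_k\big),\quad\ell_{\rm b}:=\sum_{k\ge0}\bar a^{\rm b}(r_k,w_k),\quad S:=\sup_{N\ge0}(w_N+2r_N),\quad P:=\sup_{N\ge0}(w_N+2\ln2\,r_N).$$ Also $x_+=\max(x,0)$. *)

theory Defs
  imports "HOL-Probability.Probability" "HOL-Library.Landau_Symbols"
begin

section \<open>The hierarchical lattice\<close>

text \<open>
  \<open>Mid i\<close> is the midpoint of branch \<open>i\<close>; \<open>Sub i h x\<close> is the copy, in half \<open>h\<close> of branch \<open>i\<close>, of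
  the non-pole vertex \<open>x\<close> of the lattice one generation below. The map \<open>emb i h\<close> places that lattice
  as half \<open>h\<close> of branch \<open>i\<close>: half \<open>False\<close> has poles \<open>PoleA\<close>, \<open>Mid i\<close>, and half \<open>True\<close> has poles
  \<open>Mid i\<close>, \<open>PoleB\<close>. The graph is simple, so an edge is its two-element set of end points.
\<close>

datatype vertex = PoleA | PoleB | Mid nat | Sub nat bool vertex

type_synonym edge = "vertex set"

fun emb :: "nat \<Rightarrow> bool \<Rightarrow> vertex \<Rightarrow> vertex" where
  "emb i h PoleA = (if h then Mid i else PoleA)"
| "emb i h PoleB = (if h then PoleB else Mid i)"
| "emb i h x = Sub i h x"

primrec verts :: "nat \<Rightarrow> nat \<Rightarrow> vertex set" where
  "verts n 0 = {PoleA, PoleB}"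
| "verts n (Suc N) = (\<Union>i<n. \<Union>h. emb i h ` verts n N)"

primrec edges :: "nat \<Rightarrow> nat \<Rightarrow> edge set" where
  "edges n 0 = {{PoleA, PoleB}}"
| "edges n (Suc N) = (\<Union>i<n. \<Union>h. (`) (emb i h) ` edges n N)"

definition inner_count :: "nat \<Rightarrow> nat \<Rightarrow> nat" where
  "inner_count n k = card (verts n k - {PoleA, PoleB})"

section \<open>Couplings\<close>

definition law_with_density_le :: "real \<Rightarrow> real measure \<Rightarrow> bool" where
  "law_with_density_le \<phi> \<nu> \<longleftrightarrow> prob_space \<nu> \<and>
     (\<exists>f \<in> borel_measurable borel. \<nu> = density lborel f \<and> (\<forall>x. f x \<le> ennreal \<phi>))"

definition symmetric_law :: "real measure \<Rightarrow> bool" where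
  "symmetric_law \<nu> \<longleftrightarrow> distr \<nu> borel uminus = \<nu>"

text \<open>Independent couplings, one for each edge, all with law \<open>\<nu>\<close>.\<close>

definition coupling_law :: "nat \<Rightarrow> nat \<Rightarrow> real measure \<Rightarrow> (edge \<Rightarrow> real) measure" where
  "coupling_law n N \<nu> = (\<Pi>\<^sub>M e\<in>edges n N. \<nu>)"

section \<open>Gibbs measures, replicas and blue bonds\<close>

type_synonym config = "vertex \<Rightarrow> real"

definition configs :: "nat \<Rightarrow> nat \<Rightarrow> config set" where
  "configs n N = (\<Pi>\<^sub>E x\<in>verts n N. {-1, 1})"

definition bond :: "config \<Rightarrow> edge \<Rightarrow> real" where
  "bond \<sigma> e = (\<Prod>x\<in>e. \<sigma> x)"

definition gibbs_weight :: "nat \<Rightarrow> nat \<Rightarrow> real \<Rightarrow> (edge \<Rightarrow> real) \<Rightarrow> config \<Rightarrow> real" where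
  "gibbs_weight n N \<beta> J \<sigma> = exp (\<beta> * (\<Sum>e\<in>edges n N. J e * bond \<sigma> e))"

definition gibbs :: "nat \<Rightarrow> nat \<Rightarrow> real \<Rightarrow> (edge \<Rightarrow> real) \<Rightarrow> config pmf" where
  "gibbs n N \<beta> J = embed_pmf (\<lambda>\<sigma>. if \<sigma> \<in> configs n N
     then gibbs_weight n N \<beta> J \<sigma> / (\<Sum>\<sigma>'\<in>configs n N. gibbs_weight n N \<beta> J \<sigma>') else 0)"

definition gibbs_fixed ::
  "nat \<Rightarrow> nat \<Rightarrow> real \<Rightarrow> real \<Rightarrow> real \<Rightarrow> (edge \<Rightarrow> real) \<Rightarrow> config pmf" where
  "gibbs_fixed n N \<beta> sA sB J = cond_pmf (gibbs n N \<beta> J) {\<sigma>. \<sigma> PoleA = sA \<and> \<sigma> PoleB = sB}"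

definition blue_prob :: "real \<Rightarrow> (edge \<Rightarrow> real) \<Rightarrow> config \<Rightarrow> config \<Rightarrow> edge \<Rightarrow> real" where
  "blue_prob \<beta> J \<sigma> \<tau> e =
     (if J e * bond \<sigma> e > 0 \<and> J e * bond \<tau> e > 0 then 1 - exp (- 4 * \<beta> * \<bar>J e\<bar>) else 0)"

text \<open>A sample consists of the two replicas and of the indicator of the set of blue edges.\<close>

type_synonym sample = "config \<times> config \<times> (edge \<Rightarrow> bool)"

definition sample_pmf :: "nat \<Rightarrow> nat \<Rightarrow> real \<Rightarrow> (edge \<Rightarrow> real) \<Rightarrow> sample pmf" where
  "sample_pmf n N \<beta> J =
     bind_pmf (pair_pmf (gibbs n N \<beta> J) (gibbs n N \<beta> J)) (\<lambda>(\<sigma>, \<tau>).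
       map_pmf (\<lambda>b. (\<sigma>, \<tau>, b))
         (Pi_pmf (edges n N) False (\<lambda>e. bernoulli_pmf (blue_prob \<beta> J \<sigma> \<tau> e))))"

text \<open>
  Expectation and probability under the joint law of couplings, replicas and blue bonds, which is
  given by the law of the couplings and the conditional law \<open>sample_pmf\<close> given the couplings.
\<close>

definition joint_expectation ::
  "nat \<Rightarrow> nat \<Rightarrow> real \<Rightarrow> real measure \<Rightarrow> (sample \<Rightarrow> real) \<Rightarrow> real" where
  "joint_expectation n N \<beta> \<nu> F =
     (\<integral>J. measure_pmf.expectation (sample_pmf n N \<beta> J) F \<partial>coupling_law n N \<nu>)"

definition joint_prob ::
  "nat \<Rightarrow> nat \<Rightarrow> real \<Rightarrow> real measure \<Rightarrow> (sample \<Rightarrow> bool) \<Rightarrow> real" where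
  "joint_prob n N \<beta> \<nu> Q =
     (\<integral>J. measure_pmf.prob (sample_pmf n N \<beta> J) {\<omega>. Q \<omega>} \<partial>coupling_law n N \<nu>)"

definition site_overlap :: "nat \<Rightarrow> nat \<Rightarrow> sample \<Rightarrow> real" where
  "site_overlap n N = (\<lambda>(\<sigma>, \<tau>, b). (\<Sum>x\<in>verts n N. \<sigma> x * \<tau> x) / card (verts n N))"

definition cluster :: "nat \<Rightarrow> nat \<Rightarrow> (edge \<Rightarrow> bool) \<Rightarrow> vertex \<Rightarrow> vertex set" where
  "cluster n N b x = {(y, z). {y, z} \<in> edges n N \<and> b {y, z}}\<^sup>* `` {x}"

definition clusters :: "nat \<Rightarrow> nat \<Rightarrow> (edge \<Rightarrow> bool) \<Rightarrow> vertex set set" where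
  "clusters n N b = cluster n N b ` verts n N"

text \<open>
  \<open>max_signed_cluster n N s\<close> is the size of a largest blue cluster on which the overlap is \<open>s\<close>; the
  \<open>insert 0\<close>, here and in \<open>max_nonpole_cluster\<close>, gives \<open>0\<close> if there is no such cluster.
\<close>

definition max_signed_cluster :: "nat \<Rightarrow> nat \<Rightarrow> real \<Rightarrow> sample \<Rightarrow> nat" where
  "max_signed_cluster n N s =
     (\<lambda>(\<sigma>, \<tau>, b). Max (insert 0 (card ` {C \<in> clusters n N b. \<forall>x\<in>C. \<sigma> x * \<tau> x = s})))"

definition blue_imbalance :: "nat \<Rightarrow> nat \<Rightarrow> sample \<Rightarrow> real" where
  "blue_imbalance n N \<omega> =
     (real (max_signed_cluster n N 1 \<omega>) - real (max_signed_cluster n N (-1) \<omega>)) / card (verts n N)"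

definition max_nonpole_cluster :: "nat \<Rightarrow> nat \<Rightarrow> sample \<Rightarrow> nat" where
  "max_nonpole_cluster n N =
     (\<lambda>(\<sigma>, \<tau>, b). Max (insert 0 (card ` {C \<in> clusters n N b. PoleA \<notin> C})))"

section \<open>Certificates\<close>

definition p2 :: "real \<Rightarrow> real" where
  "p2 x = 2 * max 0 (1 - 2 * \<bar>x\<bar>)"

definition convolve :: "(real \<Rightarrow> real) \<Rightarrow> (real \<Rightarrow> real) \<Rightarrow> real \<Rightarrow> real" where
  "convolve f g x = (\<integral>y. f y * g (x - y) \<partial>lborel)"

text \<open>The \<open>g\<close>-fold convolution of \<open>p2\<close> with itself at \<open>0\<close>, for \<open>g \<ge> 1\<close>.\<close>

definition kappa :: "nat \<Rightarrow> real" where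
  "kappa g = (convolve p2 ^^ (g - 1)) p2 0"

definition varpi :: "real \<Rightarrow> real \<Rightarrow> real \<Rightarrow> real \<Rightarrow> real" where
  "varpi r w L R = (let \<rho> = r / (1 - w) in 2 * w + (2 * \<rho> * R)\<^sup>2 + 4 * \<rho> * L)"

definition Gam :: "nat \<Rightarrow> real \<Rightarrow> real \<Rightarrow> real \<Rightarrow> real \<Rightarrow> real" where
  "Gam n r w L R =
     (1 + exp (- 2 * L)) / tanh R *
     (\<Sum>g = 1..n. real (n choose g) * kappa g * varpi r w L R ^ (n - g))"

text \<open>Only the values \<open>cr k\<close>, \<open>cw k\<close> for \<open>k \<le> depth\<close> and \<open>cL k\<close>, \<open>cR k\<close> for \<open>k < depth\<close> matter.\<close>

record certificate =
  depth :: nat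
  cr :: "nat \<Rightarrow> real"
  cw :: "nat \<Rightarrow> real"
  cL :: "nat \<Rightarrow> real"
  cR :: "nat \<Rightarrow> real"
  tailA :: real
  tail\<gamma> :: real
  tailL :: real
  tailR :: real

definition is_certificate :: "nat \<Rightarrow> real \<Rightarrow> real \<Rightarrow> certificate \<Rightarrow> bool" where
  "is_certificate n \<phi> \<beta> c \<longleftrightarrow>
     (let K = depth c; r = cr c; w = cw c; A = tailA c; \<gamma> = tail\<gamma> c; L = tailL c; R = tailR c in
       0 < \<beta> \<and> \<phi> / \<beta> \<le> r 0 \<and> w 0 = 0 \<and>
       (\<forall>k<K. 0 < cL c k \<and> 0 < cR c k) \<and>
       (\<forall>k\<in>{1..K}. w k < 1) \<and>
       (\<forall>k<K. r k * Gam n (r k) (w k) (cL c k) (cR c k) \<le> r (Suc k) \<and>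
              varpi (r k) (w k) (cL c k) (cR c k) ^ n \<le> w (Suc k)) \<and>
       0 < A \<and> 0 < \<gamma> \<and> 0 < L \<and> 0 < R \<and>
       w K \<le> A * (r K)\<^sup>2 \<and> A * (r K)\<^sup>2 < 1 \<and>
       Gam n (r K) (A * (r K)\<^sup>2) L R \<le> \<gamma> \<and> \<gamma> < 1 \<and>
       varpi (r K) (A * (r K)\<^sup>2) L R ^ n \<le> A * \<gamma>\<^sup>2 * (r K)\<^sup>2)"

text \<open>The sequence of a certificate, with the tail that replaces \<open>w\<close> at \<open>depth\<close> as well.\<close>

definition rseq :: "certificate \<Rightarrow> nat \<Rightarrow> real" where
  "rseq c k = (if k < depth c then cr c k else cr c (depth c) * tail\<gamma> c ^ (k - depth c))"

definition wseq :: "certificate \<Rightarrow> nat \<Rightarrow> real" where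
  "wseq c k = (if k < depth c then cw c k
     else tailA c * (cr c (depth c))\<^sup>2 * tail\<gamma> c ^ (2 * (k - depth c)))"

definition abar :: "real \<Rightarrow> real \<Rightarrow> real" where
  "abar r w = 3/4 * w + (1 + 2 * ln 2) * r + w\<^sup>2 + w * r + 1/2 * r\<^sup>2"

definition ell_s :: "certificate \<Rightarrow> real" where
  "ell_s c = (\<Sum>k. 1/2 * wseq c k + 2 * rseq c k)"

definition ell_b :: "certificate \<Rightarrow> real" where
  "ell_b c = (\<Sum>k. abar (rseq c k) (wseq c k))"

definition S_const :: "certificate \<Rightarrow> real" where
  "S_const c = (SUP N. wseq c N + 2 * rseq c N)"

definition P_const :: "certificate \<Rightarrow> real" where
  "P_const c = (SUP N. wseq c N + 2 * ln 2 * rseq c N)"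

definition eps :: "nat \<Rightarrow> certificate \<Rightarrow> nat \<Rightarrow> nat \<Rightarrow> real" where
  "eps n c N m = wseq c N + 2 * ln 2 * rseq c N +
     real (inner_count n m) * (\<Sum>k = N - m + 1..N. abar (rseq c (k - 1)) (wseq c (k - 1)))"

abbreviation pos_part :: "real \<Rightarrow> real" where
  "pos_part x \<equiv> max x 0"

section \<open>The ordering properties\<close>

definition pole_corr :: "nat \<Rightarrow> nat \<Rightarrow> real \<Rightarrow> real measure \<Rightarrow> real" where
  "pole_corr n N \<beta> \<nu> =
     (\<integral>J. (measure_pmf.expectation (gibbs n N \<beta> J) (\<lambda>\<sigma>. \<sigma> PoleA * \<sigma> PoleB))\<^sup>2 \<partial>coupling_law n N \<nu>)"

definition pole_order :: "nat \<Rightarrow> real \<Rightarrow> real measure \<Rightarrow> certificate \<Rightarrow> bool" where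
  "pole_order n \<beta> \<nu> c \<longleftrightarrow>
     (\<forall>N\<ge>1. pole_corr n N \<beta> \<nu> \<ge> 1 - S_const c) \<and>
     (\<lambda>N. pole_corr n N \<beta> \<nu>) \<longlonglongrightarrow> 1"

definition EA_order :: "nat \<Rightarrow> real \<Rightarrow> real measure \<Rightarrow> certificate \<Rightarrow> bool" where
  "EA_order n \<beta> \<nu> c \<longleftrightarrow>
     (\<forall>N\<ge>1. \<forall>sA\<in>{-1, 1}. \<forall>sB\<in>{-1, 1}. \<forall>x\<in>verts n N - {PoleA, PoleB}.
        (\<integral>J. (measure_pmf.expectation (gibbs_fixed n N \<beta> sA sB J) (\<lambda>\<sigma>. \<sigma> x))\<^sup>2 \<partial>coupling_law n N \<nu>)
          \<ge> 1 - 2 * ell_s c \<and>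
        (symmetric_law \<nu> \<longrightarrow>
          (\<integral>J. measure_pmf.expectation (gibbs_fixed n N \<beta> sA sB J) (\<lambda>\<sigma>. \<sigma> x) \<partial>coupling_law n N \<nu>)
            = 0))"

definition site_overlap_order :: "nat \<Rightarrow> real \<Rightarrow> real measure \<Rightarrow> certificate \<Rightarrow> bool" where
  "site_overlap_order n \<beta> \<nu> c \<longleftrightarrow>
     (\<forall>N\<ge>1. joint_expectation n N \<beta> \<nu> (\<lambda>\<omega>. (site_overlap n N \<omega>)\<^sup>2)
        \<ge> (pos_part (1 - 2 * ell_s c - S_const c))\<^sup>2)"

definition giant_pole_cluster :: "nat \<Rightarrow> real \<Rightarrow> real measure \<Rightarrow> certificate \<Rightarrow> bool" where
  "giant_pole_cluster n \<beta> \<nu> c \<longleftrightarrow>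
     (\<forall>N\<ge>1. \<forall>\<theta>. 0 < \<theta> \<and> \<theta> < 1 \<longrightarrow>
        joint_prob n N \<beta> \<nu> (\<lambda>(\<sigma>, \<tau>, b).
            PoleB \<in> cluster n N b PoleA \<and>
            real (card (cluster n N b PoleA)) > (1 - \<theta>) * card (verts n N))
          \<ge> 1 - ell_b c / \<theta> - P_const c)"

definition unique_giant_cluster :: "nat \<Rightarrow> real \<Rightarrow> real measure \<Rightarrow> certificate \<Rightarrow> bool" where
  "unique_giant_cluster n \<beta> \<nu> c \<longleftrightarrow>
     (\<forall>N m. 1 \<le> m \<and> m \<le> N \<longrightarrow>
        joint_prob n N \<beta> \<nu> (\<lambda>\<omega>. real (max_nonpole_cluster n N \<omega>) > card (verts n N) / (2 * real n) ^ m)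
          \<le> eps n c N m \<and>
        joint_expectation n N \<beta> \<nu> (\<lambda>\<omega>. real (max_nonpole_cluster n N \<omega>)) / card (verts n N)
          \<le> 1 / (2 * real n) ^ m + eps n c N m) \<and>
     (\<forall>m\<ge>1. (\<lambda>N. eps n c N m) \<longlonglongrightarrow> 0) \<and>
     (\<forall>\<delta>>0. (\<lambda>N. joint_prob n N \<beta> \<nu>
        (\<lambda>\<omega>. real (max_nonpole_cluster n N \<omega>) / card (verts n N) > \<delta>)) \<longlonglongrightarrow> 0) \<and>
     (\<lambda>N. joint_expectation n N \<beta> \<nu>
        (\<lambda>\<omega>. \<bar>real (max_nonpole_cluster n N \<omega>) / card (verts n N)\<bar>)) \<longlonglongrightarrow> 0"

definition blue_imbalance_order :: "nat \<Rightarrow> real \<Rightarrow> real measure \<Rightarrow> certificate \<Rightarrow> bool" where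
  "blue_imbalance_order n \<beta> \<nu> c \<longleftrightarrow>
     (\<forall>N\<ge>1. joint_expectation n N \<beta> \<nu> (\<lambda>\<omega>. (blue_imbalance n N \<omega>)\<^sup>2)
        \<ge> (pos_part (1 - 2 * ell_b c))\<^sup>2 - P_const c)"

definition ordered_phase :: "nat \<Rightarrow> real \<Rightarrow> real measure \<Rightarrow> certificate \<Rightarrow> bool" where
  "ordered_phase n \<beta> \<nu> c \<longleftrightarrow>
     pole_order n \<beta> \<nu> c \<and> EA_order n \<beta> \<nu> c \<and> site_overlap_order n \<beta> \<nu> c \<and>
     giant_pole_cluster n \<beta> \<nu> c \<and> unique_giant_cluster n \<beta> \<nu> c \<and> blue_imbalance_order n \<beta> \<nu> c"

definition site_positivity :: "certificate \<Rightarrow> bool" where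
  "site_positivity c \<longleftrightarrow> (pos_part (1 - 2 * ell_s c - S_const c))\<^sup>2 > 0"

definition blue_positivity :: "certificate \<Rightarrow> bool" where
  "blue_positivity c \<longleftrightarrow>
     (\<forall>\<theta>. ell_b c / (1 - P_const c) < \<theta> \<and> \<theta> < 1 \<longrightarrow> 1 - ell_b c / \<theta> - P_const c > 0) \<and>
     (pos_part (1 - 2 * ell_b c))\<^sup>2 - P_const c > 0"

section \<open>Well-definedness\<close>

text \<open>
  The series and suprema defining the constants of a certificate converge, the normalisation of
  the Gibbs measure is meaningful, and \<open>inner_count\<close> satisfies the expected recursion.
\<close>

lemma rseq_tail: "rseq c (j + depth c) = cr c (depth c) * tail\<gamma> c ^ j"
  by (simp add: rseq_def)

lemma wseq_tail: "wseq c (j + depth c) = tailA c * (cr c (depth c))\<^sup>2 * (tail\<gamma> c ^ j)\<^sup>2"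
  by (simp add: wseq_def power_mult mult.commute)

lemma certificate_rate:
  assumes "is_certificate n \<phi> \<beta> c"
  shows "0 < tail\<gamma> c" "tail\<gamma> c < 1"
  using assms by (auto simp: is_certificate_def Let_def)

lemma summable_tail:
  assumes "is_certificate n \<phi> \<beta> c" "k \<ge> 1"
  shows "summable (\<lambda>j. a * (tail\<gamma> c ^ j) ^ k)"
proof -
  have "(tail\<gamma> c ^ j) ^ k = (tail\<gamma> c ^ k) ^ j" for j
    by (simp flip: power_mult add: mult.commute)
  moreover have "norm (tail\<gamma> c ^ k) < 1"
    using certificate_rate[OF assms(1)] assms(2) by (simp add: power_less_one_iff)
  ultimately show ?thesis by (simp add: summable_geometric summable_mult)
qed

lemma certificate_summable:
  assumes "is_certificate n \<phi> \<beta> c"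
  shows "summable (rseq c)" "summable (wseq c)"
    "summable (\<lambda>k. 1/2 * wseq c k + 2 * rseq c k)"
    "summable (\<lambda>k. abar (rseq c k) (wseq c k))"
proof -
  show r: "summable (rseq c)"
    using summable_tail[OF assms, of 1 "cr c (depth c)"]
    by (subst summable_iff_shift[of _ "depth c", symmetric]) (simp add: rseq_tail)
  show w: "summable (wseq c)"
    using summable_tail[OF assms, of 2 "tailA c * (cr c (depth c))\<^sup>2"]
    by (subst summable_iff_shift[of _ "depth c", symmetric]) (simp add: wseq_tail)
  show "summable (\<lambda>k. 1/2 * wseq c k + 2 * rseq c k)"
    using r w by (intro summable_add summable_mult)
  have ww: "summable (\<lambda>k. (wseq c k)\<^sup>2)"
    using summable_tail[OF assms, of 4 "(tailA c * (cr c (depth c))\<^sup>2)\<^sup>2"]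
    by (subst summable_iff_shift[of _ "depth c", symmetric])
       (simp add: wseq_tail power_mult_distrib mult.commute[of 4] flip: power_mult)
  have wr: "summable (\<lambda>k. wseq c k * rseq c k)"
    using summable_tail[OF assms, of 3 "tailA c * (cr c (depth c)) ^ 3"]
    by (subst summable_iff_shift[of _ "depth c", symmetric])
       (simp add: wseq_tail rseq_tail power2_eq_square power3_eq_cube mult_ac)
  have rr: "summable (\<lambda>k. (rseq c k)\<^sup>2)"
    using summable_tail[OF assms, of 2 "(cr c (depth c))\<^sup>2"]
    by (subst summable_iff_shift[of _ "depth c", symmetric])
       (simp add: rseq_tail power_mult_distrib)
  show "summable (\<lambda>k. abar (rseq c k) (wseq c k))"
    unfolding abar_def using r w ww wr rr by (intro summable_add summable_mult)
qed

lemma certificate_bdd: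
  assumes "is_certificate n \<phi> \<beta> c"
  shows "bdd_above (range (\<lambda>N. wseq c N + a * rseq c N))"
proof -
  have "(\<lambda>N. wseq c N + a * rseq c N) \<longlonglongrightarrow> 0"
    using certificate_summable(1,2)[OF assms]
    by (intro summable_LIMSEQ_zero summable_add summable_mult)
  then have "Bseq (\<lambda>N. wseq c N + a * rseq c N)"
    by (intro convergent_imp_Bseq) (auto simp: convergent_def)
  then show ?thesis by (simp add: Bseq_bdd_above)
qed

lemma poles_in_verts:
  assumes "0 < n" shows "PoleA \<in> verts n N" "PoleB \<in> verts n N"
proof -
  have "PoleA \<in> verts n N \<and> PoleB \<in> verts n N"
  proof (induction N)
    case (Suc N)
    have "PoleA \<in> emb 0 False ` verts n N" "PoleB \<in> emb 0 True ` verts n N"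
      using Suc by (simp_all add: image_iff bexI[of _ PoleA] bexI[of _ PoleB])
    with assms show ?case by (simp only: verts.simps) blast
  qed simp
  then show "PoleA \<in> verts n N" "PoleB \<in> verts n N" by auto
qed

lemma finite_verts: "finite (verts n N)" and finite_edges: "finite (edges n N)"
  by (induction N) auto

lemma inner_verts_Suc:
  assumes "0 < n"
  shows "verts n (Suc N) - {PoleA, PoleB} =
    Mid ` {..<n} \<union> (\<lambda>(i, h, x). Sub i h x) ` ({..<n} \<times> UNIV \<times> (verts n N - {PoleA, PoleB}))"
    (is "?L = ?R")
proof
  show "?L \<subseteq> ?R"
  proof
    fix y assume "y \<in> ?L"
    then obtain i h x where *: "i < n" "x \<in> verts n N" "y = emb i h x" "y \<noteq> PoleA" "y \<noteq> PoleB"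
      by auto
    then show "y \<in> ?R" by (cases x) (auto split: if_splits simp: image_iff)
  qed
  show "?R \<subseteq> ?L"
  proof
    fix y assume "y \<in> ?R"
    then consider i where "i < n" "y = Mid i"
      | i h x where "i < n" "x \<in> verts n N" "x \<noteq> PoleA" "x \<noteq> PoleB" "y = Sub i h x" by auto
    then show "y \<in> ?L"
    proof cases
      case 1
      then have "y \<in> emb i True ` verts n N"
        using poles_in_verts[OF assms] by (simp add: image_iff bexI[of _ PoleA])
      with 1 show ?thesis by (simp only: verts.simps) blast
    next
      case 2
      then have "y = emb i h x" by (cases x) auto
      with 2(2) have "y \<in> emb i h ` verts n N" by blast
      with 2 show ?thesis by (simp only: verts.simps) blast
    qed
  qed
qed

lemma inner_count_rec:
  assumes "0 < n"
  shows "inner_count n 0 = 0" "inner_count n (Suc k) = n * (1 + 2 * inner_count n k)"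
proof -
  let ?V = "verts n k - {PoleA, PoleB}"
  show "inner_count n 0 = 0" by (simp add: inner_count_def)
  have "inner_count n (Suc k) = card (Mid ` {..<n}) +
      card ((\<lambda>(i, h, x). Sub i h x) ` ({..<n} \<times> (UNIV :: bool set) \<times> ?V))"
    unfolding inner_count_def inner_verts_Suc[OF assms]
    by (intro card_Un_disjoint) (auto simp: finite_verts)
  also have "card (Mid ` {..<n}) = n" by (simp add: card_image inj_on_def)
  also have "card ((\<lambda>(i, h, x). Sub i h x) ` ({..<n} \<times> (UNIV :: bool set) \<times> ?V)) = n * (2 * card ?V)"
    by (subst card_image) (auto simp: inj_on_def card_cartesian_product)
  finally show "inner_count n (Suc k) = n * (1 + 2 * inner_count n k)"
    by (simp add: inner_count_def algebra_simps)
qed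

lemma pmf_gibbs:
  "pmf (gibbs n N \<beta> J) \<sigma> = (if \<sigma> \<in> configs n N
     then gibbs_weight n N \<beta> J \<sigma> / (\<Sum>\<sigma>'\<in>configs n N. gibbs_weight n N \<beta> J \<sigma>') else 0)"
  unfolding gibbs_def
proof (rule pmf_embed_pmf)
  let ?Z = "\<Sum>\<sigma>'\<in>configs n N. gibbs_weight n N \<beta> J \<sigma>'"
  have fin: "finite (configs n N)"
    unfolding configs_def by (intro finite_PiE finite_verts) auto
  have "configs n N \<noteq> {}"
    by (auto simp: configs_def PiE_eq_empty_iff)
  with fin have Z: "0 < ?Z" by (intro sum_pos) (auto simp: gibbs_weight_def)
  show "0 \<le> (if \<sigma> \<in> configs n N then gibbs_weight n N \<beta> J \<sigma> / ?Z else 0)" for \<sigma>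
    using Z by (simp add: gibbs_weight_def)
  have "(\<integral>\<^sup>+ \<sigma>. ennreal (if \<sigma> \<in> configs n N then gibbs_weight n N \<beta> J \<sigma> / ?Z else 0)
      \<partial>count_space UNIV) = (\<Sum>\<sigma>\<in>configs n N. ennreal (gibbs_weight n N \<beta> J \<sigma> / ?Z))"
    by (subst nn_integral_count_space'[OF fin]) auto
  also have "\<dots> = ennreal (\<Sum>\<sigma>\<in>configs n N. gibbs_weight n N \<beta> J \<sigma> / ?Z)"
    using Z by (intro sum_ennreal) (simp add: gibbs_weight_def)
  also have "\<dots> = 1" using Z by (simp flip: sum_divide_distrib)
  finally show "(\<integral>\<^sup>+ \<sigma>. ennreal (if \<sigma> \<in> configs n N then gibbs_weight n N \<beta> J \<sigma> / ?Z else 0)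
      \<partial>count_space UNIV) = 1" .
qed

end

theory Submission
  imports Defs
begin

text \<open>Integrating out all vertices but the poles leaves an Ising bond between the poles, whose strength,
  the effective coupling \<open>eff\<close>, is computed from generation to generation by the series rule in each
  branch and addition over the \<open>n\<close> branches. The theorem holds because at low temperature the law of
  this random coupling spreads out over the line at a geometric rate, so that the
  probability of a small coupling decays geometrically, and because all losses of order come from
  small couplings.

  Spreading. Suppose that, outside a bad event of probability at most \<open>w\<close>, the coupling has a density
  bounded by \<open>r\<close>. In a branch one half usually dominates the other, and the series rule then passes the
  smaller one through with slope close to \<open>1\<close>. Of two independent uniform variables, the smaller in
  modulus has a triangular law; correspondingly the good part of a branch is dominated, in the sense
  of rearrangements, by the density \<open>p2\<close>, rescaled to height \<open>2 * r\<close> up to a factor close to \<open>1\<close>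
  (\<open>branch_law_conc\<close>). Adding independent branches convolves these densities by the Riesz
  inequality (\<open>conc_le_convolution\<close>), so that \<open>g\<close> good branches
  have a density bounded by \<open>r * kappa g\<close> (\<open>branches_sum\<close>). For \<open>n \<ge> 4\<close> one has \<open>kappa n < 1\<close>
  (\<open>kappa_le\<close>), and the bad events only give corrections, since all branches have to be bad at once.
  A certificate records one such recursion, and \<open>sequence_bounds\<close> says that its sequence
  bounds the law of the effective coupling in every generation.

  Order. Two replicas and the blue bonds form a Markov field on the hierarchy. Given equal overlaps at
  the poles, the probability that a midpoint has the opposite overlap, or that it is blue-connected to
  neither pole, is bounded by a function of the effective couplings of the adjacent halves that is
  integrable in each of them (\<open>site_mid\<close>, \<open>blue_mid\<close>). The blue case needs the fact that the
  connection probability of the poles given their spins is at least that of a single bond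
  of the effective strength (\<open>cex_nc\<close>). A vertex of generation \<open>d\<close> is reached through \<open>d\<close> midpoints,
  so its loss is a sum over generations (\<open>loss_bound\<close>), whose expectation is at most \<open>ell_s\<close> or
  \<open>ell_b\<close>. Together with the loss for the poles themselves (\<open>ens_poles_differ\<close>, \<open>ens_disconnected\<close>), which gives \<open>S_const\<close>
  and \<open>P_const\<close>, this yields all items by first- and second-moment arguments (\<open>certified.ordered\<close>).

  Existence. If the initial bound \<open>\<phi> / \<beta>\<close> is small, the recursion contracts from the start, so a
  geometric sequence is a certificate (\<open>certificates_exist\<close>), and all constants are of order \<open>1 / \<beta>\<close>.
\<close>

abbreviation lint :: "(real \<Rightarrow> ennreal) \<Rightarrow> ennreal" (binder \<open>LI \<close> 10) where
  "lint f \<equiv> nn_integral lborel f"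

abbreviation len :: "real set \<Rightarrow> ennreal" where "len A \<equiv> emeasure lborel A"

abbreviation ind :: "'a set \<Rightarrow> 'a \<Rightarrow> 'b::zero_neq_one" where "ind \<equiv> indicator"

section \<open>Symmetrically decreasing majorants\<close>

text \<open>
  Statements about concentration have the form: the mass that a density gives to a set \<open>A\<close> is at most
  the mass that \<open>h\<close> gives to the centred interval of the same length as \<open>A\<close>. Here \<open>symint c\<close> is the
  centred open interval of length \<open>c\<close>, which is the whole line for infinite \<open>c\<close>.\<close>
definition symint :: "ennreal \<Rightarrow> real set" where
  "symint c = {x. ennreal (2 * \<bar>x\<bar>) < c}"

lemma symint_sets [measurable]: "symint c \<in> sets borel"
  unfolding symint_def by measurable

lemma symint_ennreal: "0 \<le> a \<Longrightarrow> symint (ennreal a) = {- a / 2<..<a / 2}"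
  unfolding symint_def by (auto simp: ennreal_less_iff abs_if)

lemma symint_top: "symint \<top> = UNIV"
  by (auto simp: symint_def)

lemma emeasure_symint [simp]: "len (symint c) = c"
  by (cases c) (simp_all add: symint_ennreal symint_top)

text \<open>Finiteness is part of the definition because the proofs cut \<open>h\<close> at the level \<open>h (a / 2)\<close> and
  subtract that level from both sides.\<close>
definition symdec :: "(real \<Rightarrow> ennreal) \<Rightarrow> bool" where
  "symdec h \<longleftrightarrow> h \<in> borel_measurable borel \<and> (\<forall>x y. \<bar>x\<bar> \<le> \<bar>y\<bar> \<longrightarrow> h y \<le> h x) \<and> (\<forall>x. h x < \<top>)"

lemma symdecD:
  assumes "symdec h"
  shows "h \<in> borel_measurable borel" "\<bar>x\<bar> \<le> \<bar>y\<bar> \<Longrightarrow> h y \<le> h x" "h x < \<top>" "h (- x) = h x"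
  using assms unfolding symdec_def by (auto intro!: antisym)

definition dominated :: "(real \<Rightarrow> ennreal) \<Rightarrow> (real \<Rightarrow> ennreal) \<Rightarrow> bool" where
  "dominated f h \<longleftrightarrow> (\<forall>A\<in>sets borel. (LI x. f x * ind A x)
      \<le> (LI x. h x * ind (symint (len A)) x))"

lemma symdec_integral_symint:
  assumes h: "symdec h" and a: "0 \<le> a"
  shows "(LI x. h x * ind (symint (ennreal a)) x)
    = h (a / 2) * ennreal a + (LI x. (h x - h (a / 2)))"
proof -
  note [measurable] = symdecD(1)[OF h]
  have "h x * ind (symint (ennreal a)) x
      = h (a / 2) * ind (symint (ennreal a)) x + (h x - h (a / 2))" for x
  proof (cases "\<bar>x\<bar> < a / 2")
    case True
    then have "x \<in> symint (ennreal a)" using a by (auto simp: symint_ennreal)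
    moreover have "h (a / 2) \<le> h x" using True a by (intro symdecD(2)[OF h]) auto
    ultimately show ?thesis by (simp add: add_diff_inverse_ennreal)
  next
    case False
    then have "x \<notin> symint (ennreal a)" using a by (auto simp: symint_ennreal)
    moreover have "h x \<le> h (a / 2)" using False a by (intro symdecD(2)[OF h]) auto
    ultimately show ?thesis using symdecD(3)[OF h, of "a/2"] by (simp add: diff_eq_0_iff_ennreal)
  qed
  then have "(LI x. h x * ind (symint (ennreal a)) x)
      = (LI x. h (a / 2) * ind (symint (ennreal a)) x + (h x - h (a / 2)))" by (simp cong: nn_integral_cong)
  also have "... = h (a / 2) * ennreal a + (LI x. (h x - h (a / 2)))" by (subst nn_integral_add) (auto simp: nn_integral_cmult_indicator)
  finally show ?thesis .
qed

text \<open>With \<open>t = h (a / 2)\<close>, where \<open>a\<close> is the length of \<open>A\<close>, one has \<open>f \<le> t + (f - t)\<close> on \<open>A\<close>, and the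
  centred interval of length \<open>a\<close> attains equality for \<open>h\<close>. Together with \<open>dom_hinge\<close> this makes
  domination equivalent to an inequality between truncated integrals, which is what can be
  computed for overlaps of sets.\<close>
lemma domI_hinge:
  assumes f [measurable]: "f \<in> borel_measurable borel" and h: "symdec h"
    and hinge: "\<And>t. 0 \<le> t \<Longrightarrow>
      (LI x. (f x - ennreal t)) \<le> (LI x. (h x - ennreal t))"
  shows "dominated f h"
  unfolding dominated_def
proof
  fix A :: "real set" assume A [measurable]: "A \<in> sets borel"
  show "(LI x. f x * ind A x)
      \<le> (LI x. h x * ind (symint (len A)) x)"
  proof (cases "len A")
    case top
    have "(LI x. f x * ind A x) \<le> (LI x. f x)" by (intro nn_integral_mono) (auto split: split_indicator)
    also have "... \<le> (LI x. h x)" using hinge[of 0] by simp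
    finally show ?thesis by (simp add: top symint_top)
  next
    case (real a)
    obtain t where t: "h (a / 2) = ennreal t" "0 \<le> t" using symdecD(3)[OF h, of "a/2"] by (cases "h (a / 2)") auto
    have "f x * ind A x \<le> ennreal t * ind A x + (f x - ennreal t)" for x by (cases "x \<in> A"; cases "ennreal t \<le> f x")
         (auto simp: add_diff_inverse_ennreal intro: order.trans[of _ "ennreal t"])
    then have "(LI x. f x * ind A x)
        \<le> (LI x. ennreal t * ind A x + (f x - ennreal t))" by (intro nn_integral_mono) auto
    also have "... = ennreal t * ennreal a + (LI x. (f x - ennreal t))" by (subst nn_integral_add) (auto simp: nn_integral_cmult_indicator real)
    also have "... \<le> ennreal t * ennreal a + (LI x. (h x - ennreal t))" using hinge[OF t(2)] by (intro add_left_mono)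
    also have "... = (LI x. h x * ind (symint (len A)) x)" unfolding real using symdec_integral_symint[OF h, of a] real t by simp
    finally show ?thesis .
  qed
qed

lemma dom_mass:
  assumes "dominated f h" shows "(LI x. f x) \<le> (LI x. h x)"
  using assms[unfolded dominated_def, rule_format, of UNIV] by (simp add: symint_top)

lemma dom_hinge:
  assumes f [measurable]: "f \<in> borel_measurable borel" and h [measurable]: "h \<in> borel_measurable borel"
    and fin: "(LI x. f x) < \<top>" and dom: "dominated f h" and t: "0 \<le> t"
  shows "(LI x. (f x - ennreal t)) \<le> (LI x. (h x - ennreal t))"
proof (cases "t = 0")
  case True
  then show ?thesis using dom_mass[OF dom] by simp
next
  case False
  define A where "A = {x. ennreal t < f x}"
  have A [measurable]: "A \<in> sets borel" unfolding A_def by measurable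
  have "ennreal t * len A = (LI x. ennreal t * ind A x)" by (simp add: nn_integral_cmult_indicator)
  also have "... \<le> (LI x. f x)" by (intro nn_integral_mono) (auto simp: A_def split: split_indicator)
  finally have fin': "ennreal t * len A \<noteq> \<top>" using fin by (auto simp: top_unique)
  have eq: "f x * ind A x = ennreal t * ind A x + (f x - ennreal t)" for x by (cases "x \<in> A")
       (auto simp: A_def add_diff_inverse_ennreal diff_eq_0_iff_ennreal not_less intro: le_less_trans)
  have "ennreal t * len A + (LI x. (f x - ennreal t))
      = (LI x. f x * ind A x)" by (subst eq, subst nn_integral_add) (auto simp: nn_integral_cmult_indicator)
  also have "... \<le> (LI x. h x * ind (symint (len A)) x)" using dom A by (auto simp: dominated_def)
  also have "... \<le> (LI x. ennreal t * ind (symint (len A)) x + (h x - ennreal t))"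
  proof (intro nn_integral_mono)
    fix x show "h x * ind (symint (len A)) x
      \<le> ennreal t * ind (symint (len A)) x + (h x - ennreal t)" by (cases "x \<in> symint (len A)"; cases "ennreal t \<le> h x")
         (auto simp: add_diff_inverse_ennreal intro: order.trans[of _ "ennreal t"])
  qed
  also have "... = ennreal t * len A + (LI x. (h x - ennreal t))" by (subst nn_integral_add) (auto simp: nn_integral_cmult_indicator)
  finally show ?thesis using fin' by (simp add: ennreal_add_left_cancel_le)
qed

lemma emeasure_lborel_half_line: "len {t::real..} = \<top>"
proof (cases "len {t..}")
  case (real r)
  have "ennreal (r + 1) = len {t..t + (r + 1)}" using real by simp
  also have "... \<le> len {t..}" by (intro emeasure_mono) auto
  finally show ?thesis using real by (simp add: ennreal_le_iff2)
qed

lemma emeasure_layer: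
  assumes "0 \<le> t"
  shows "(LI s. ind {s. t \<le> s \<and> ennreal s < y} s) = y - ennreal t"
proof (cases y)
  case (real r)
  then have "{s. t \<le> s \<and> ennreal s < y} = {t..<r}" using assms by (auto simp: ennreal_less_iff)
  then show ?thesis using real assms
    by (cases "t \<le> r") (auto simp: ennreal_minus ennreal_neg)
next
  case top
  then have "{s. t \<le> s \<and> ennreal s < y} = {t..}" by auto
  then show ?thesis using top by (simp add: emeasure_lborel_half_line)
qed

lemma layer_cake:
  "(LI s. ind {s. 0 \<le> s \<and> ennreal s < y} s) = y" using emeasure_layer[of 0 y] by simp

text \<open>The minimum is bounded by \<open>c\<close> below the level \<open>h (c / 2)\<close> and by the length itself above it; the
  latter part integrates to a truncated integral of \<open>f\<close>, to which \<open>dom_hinge\<close> applies.\<close>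
lemma dom_layers:
  assumes f [measurable]: "f \<in> borel_measurable borel" and h: "symdec h"
    and fin: "(LI x. f x) < \<top>" and dom: "dominated f h"
  shows "(LI s. ind {0..} s * min (len {x. ennreal s < f x}) c)
    \<le> (LI x. h x * ind (symint c) x)"
proof -
  note [measurable] = symdecD(1)[OF h]
  have [measurable]: "(\<lambda>s::real. len {x. ennreal s < f x}) \<in> borel_measurable borel"
  proof -
    have "{p \<in> space (borel \<Otimes>\<^sub>M lborel). ennreal (fst p) < f (snd p)} \<in> sets (borel \<Otimes>\<^sub>M lborel)" by measurable
    from lborel.measurable_emeasure_Pair[OF this]
    show ?thesis by (simp add: space_pair_measure vimage_def)
  qed
  have tail: "(LI s. ind {t..} s * len {x. ennreal s < f x})
      = (LI x. (f x - ennreal t))" if "0 \<le> t" for t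
  proof -
    have "(LI s. ind {t..} s * len {x. ennreal s < f x})
        = (LI s. (LI x. ind {(s, x). t \<le> s \<and> ennreal s < f x} (s, x)))"
    proof (intro nn_integral_cong)
      fix s :: real
      have "(LI x. ind {(s, x). t \<le> s \<and> ennreal s < f x} (s, x))
          = (LI x. ind {t..} s * ind {x. ennreal s < f x} x)" by (intro nn_integral_cong) (auto split: split_indicator)
      also have "... = ind {t..} s * len {x. ennreal s < f x}" by (subst nn_integral_cmult_indicator) auto
      finally show "ind {t..} s * len {x. ennreal s < f x}
        = (LI x. ind {(s, x). t \<le> s \<and> ennreal s < f x} (s, x))" by simp
    qed
    also have "... = (LI x. (LI s. ind {(s, x). t \<le> s \<and> ennreal s < f x} (s, x)))" by (rule lborel_pair.Fubini') measurable
    also have "... = (LI x. (f x - ennreal t))" by (intro nn_integral_cong) (simp flip: emeasure_layer[OF that] add: indicator_def)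
    finally show ?thesis .
  qed
  show ?thesis
  proof (cases c)
    case top
    have "(LI s. ind {0..} s * min (len {x. ennreal s < f x}) c)
        = (LI x. f x)" using tail[of 0] top by simp
    also have "... \<le> (LI x. h x)" by (rule dom_mass[OF dom])
    finally show ?thesis by (simp add: top symint_top)
  next
    case (real a)
    obtain t where t: "h (a / 2) = ennreal t" "0 \<le> t" using symdecD(3)[OF h, of "a/2"] by (cases "h (a / 2)") auto
    have "(LI s. ind {0..} s * min (len {x. ennreal s < f x}) c)
        \<le> (LI s. c * ind {0..<t} s + ind {t..} s * len {x. ennreal s < f x})" by (intro nn_integral_mono) (auto split: split_indicator)
    also have "... = c * ennreal t + (LI x. (f x - ennreal t))" using t by (subst nn_integral_add) (auto simp: tail nn_integral_cmult_indicator)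
    also have "... \<le> c * ennreal t + (LI x. (h x - ennreal t))" by (intro add_left_mono dom_hinge f fin dom t) simp
    also have "... = (LI x. h x * ind (symint c) x)" using symdec_integral_symint[OF h, of a] real t by (simp add: mult.commute)
    finally show ?thesis .
  qed
qed

lemma symint_subset:
  assumes E: "E \<in> sets borel" and sd: "\<And>x y. x \<in> E \<Longrightarrow> \<bar>y\<bar> \<le> \<bar>x\<bar> \<Longrightarrow> y \<in> E"
  shows "symint (len E) \<subseteq> E"
proof
  fix x assume x: "x \<in> symint (len E)"
  show "x \<in> E"
  proof (rule ccontr)
    assume "x \<notin> E"
    then have "E \<subseteq> {-\<bar>x\<bar>..\<bar>x\<bar>}" using sd by (auto simp: abs_le_iff) (smt (verit))+
    then have "len E \<le> len {-\<bar>x\<bar>..\<bar>x\<bar>}" by (intro emeasure_mono) auto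
    also have "... = ennreal (2 * \<bar>x\<bar>)" by simp
    finally show False using x by (simp add: symint_def)
  qed
qed

text \<open>A layer-cake version of the Hardy--Littlewood inequality in which neither function has to be
  rearranged: \<open>f\<close> is cut into level sets, to which the domination of \<open>g\<close> applies, and the resulting
  centred intervals are intersected with the level sets of \<open>k\<close>.\<close>
lemma hardy_littlewood:
  assumes f [measurable]: "f \<in> borel_measurable borel" and g [measurable]: "g \<in> borel_measurable borel"
    and h: "symdec h" and k: "symdec k"
    and fin: "(LI x. f x) < \<top>" and fh: "dominated f h" and gk: "dominated g k"
  shows "(LI x. f x * g x) \<le> (LI x. h x * k x)"
proof -
  note [measurable] = symdecD(1)[OF h] symdecD(1)[OF k]
  define a where "a s = len {x. ennreal s < f x}" for s
  have a [measurable]: "a \<in> borel_measurable borel"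
  proof -
    have "{p \<in> space (borel \<Otimes>\<^sub>M lborel). ennreal (fst p) < f (snd p)} \<in> sets (borel \<Otimes>\<^sub>M lborel)" by measurable
    from lborel.measurable_emeasure_Pair[OF this]
    show ?thesis by (simp add: space_pair_measure vimage_def a_def[abs_def])
  qed
  let ?F = "\<lambda>s x. ind {(s, x). 0 \<le> s \<and> ennreal s < f x} (s, x) :: ennreal"
  let ?S = "\<lambda>s x. ind {(s, x). ennreal (2 * \<bar>x\<bar>) < a s} (s, x) :: ennreal"
  let ?K = "\<lambda>u x. ind {(u, x). 0 \<le> u \<and> ennreal u < k x} (u, x) :: ennreal"
  have "(LI x. f x * g x) = (LI x. (LI s. ?F s x * g x))"
  proof (intro nn_integral_cong)
    fix x
    have "(LI s. ?F s x * g x)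
        = (LI s. ind {s. 0 \<le> s \<and> ennreal s < f x} s * g x)" by (simp add: indicator_def)
    also have "... = (LI s. ind {s. 0 \<le> s \<and> ennreal s < f x} s) * g x" by (rule nn_integral_multc) measurable
    also have "(LI s. ind {s. 0 \<le> s \<and> ennreal s < f x} s) = f x" by (rule layer_cake)
    finally show "f x * g x = (LI s. ?F s x * g x)" by simp
  qed
  also have "... = (LI s. (LI x. ?F s x * g x))" by (rule lborel_pair.Fubini') measurable
  also have "... \<le> (LI s. (LI x. ind {0..} s * (k x * ?S s x)))"
  proof (rule nn_integral_mono)
    fix s :: real
    have "(LI x. ?F s x * g x)
        = (LI x. ind {0..} s * (g x * ind {x. ennreal s < f x} x))" by (intro nn_integral_cong) (auto split: split_indicator)
    also have "... = ind {0..} s * (LI x. g x * ind {x. ennreal s < f x} x)" by (rule nn_integral_cmult) measurable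
    also have "... \<le> ind {0..} s * (LI x. k x * ind (symint (a s)) x)"
      unfolding a_def using gk by (intro mult_left_mono) (auto simp: dominated_def)
    also have "... = (LI x. ind {0..} s * (k x * ind (symint (a s)) x))" by (rule nn_integral_cmult[symmetric]) measurable
    finally show "(LI x. ?F s x * g x) \<le> (LI x. ind {0..} s * (k x * ?S s x))" by (simp add: symint_def indicator_def)
  qed
  also have "... = (LI s. (LI x. (LI u. ind {0..} s * (?K u x * ?S s x))))"
  proof (intro nn_integral_cong)
    fix s x :: real
    have "(LI u. ind {0..} s * (?K u x * ?S s x))
        = (LI u. ind {u. 0 \<le> u \<and> ennreal u < k x} u * (ind {0..} s * ?S s x))" by (intro nn_integral_cong) (simp add: indicator_def)
    also have "... = (LI u. ind {u. 0 \<le> u \<and> ennreal u < k x} u) * (ind {0..} s * ?S s x)" by (rule nn_integral_multc) measurable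
    also have "... = ind {0..} s * (k x * ?S s x)" by (subst layer_cake) (simp add: mult_ac)
    finally show "ind {0..} s * (k x * ?S s x)
      = (LI u. ind {0..} s * (?K u x * ?S s x))" by simp
  qed
  also have "... = (LI s. (LI u. (LI x. ind {0..} s * (?K u x * ?S s x))))" by (intro nn_integral_cong lborel_pair.Fubini') measurable
  also have "... = (LI u. (LI s. (LI x. ind {0..} s * (?K u x * ?S s x))))" by (rule lborel_pair.Fubini') measurable
  also have "... \<le> (LI u. (LI x. h x * ?K u x))"
  proof (rule nn_integral_mono)
    fix u :: real
    define E where "E = {x. ennreal u < k x}"
    have [measurable]: "E \<in> sets borel" unfolding E_def by measurable
    have inner: "(LI x. ind {0..} s * (?K u x * ?S s x))
        \<le> ind {0..} u * (ind {0..} s * min (a s) (len E))" for s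
    proof -
      have "(LI x. ind {0..} s * (?K u x * ?S s x))
         = (LI x. ind {0..} u * ind {0..} s * ind (E \<inter> symint (a s)) x)"
        by (intro nn_integral_cong) (auto simp: E_def symint_def split: split_indicator)
      also have "... = ind {0..} u * ind {0..} s * len (E \<inter> symint (a s))" by (rule nn_integral_cmult_indicator) simp
      also have "... \<le> ind {0..} u * ind {0..} s * min (a s) (len E)"
      proof (intro mult_left_mono)
        have "len (E \<inter> symint (a s)) \<le> len E" by (intro emeasure_mono) auto
        moreover have "len (E \<inter> symint (a s)) \<le> len (symint (a s))" by (intro emeasure_mono) auto
        ultimately show "len (E \<inter> symint (a s)) \<le> min (a s) (len E)" by simp
      qed simp
      finally show ?thesis by (simp add: mult.assoc)
    qed
    have "(LI s. (LI x. ind {0..} s * (?K u x * ?S s x)))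
        \<le> (LI s. ind {0..} u * (ind {0..} s * min (a s) (len E)))" by (intro nn_integral_mono inner)
    also have "... = ind {0..} u * (LI s. ind {0..} s * min (a s) (len E))" by (rule nn_integral_cmult) measurable
    also have "... \<le> ind {0..} u * (LI x. h x * ind (symint (len E)) x)" unfolding a_def by (intro mult_left_mono dom_layers f h fin fh) simp
    also have "... \<le> ind {0..} u * (LI x. h x * ind E x)"
    proof (rule mult_left_mono, rule nn_integral_mono)
      fix x
      have "symint (len E) \<subseteq> E" by (rule symint_subset) (auto simp: E_def intro: less_le_trans symdecD(2)[OF k])
      then show "h x * ind (symint (len E)) x \<le> h x * ind E x" by (auto split: split_indicator)
    qed simp
    also have "... = (LI x. ind {0..} u * (h x * ind E x))" by (rule nn_integral_cmult[symmetric]) measurable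
    also have "... = (LI x. h x * ?K u x)" by (intro nn_integral_cong) (auto simp: E_def split: split_indicator)
    finally show "(LI s. (LI x. ind {0..} s * (?K u x * ?S s x)))
      \<le> (LI x. h x * ?K u x)" .
  qed
  also have "... = (LI x. (LI u. h x * ?K u x))" by (rule lborel_pair.Fubini') measurable
  also have "... = (LI x. h x * k x)"
  proof (intro nn_integral_cong)
    fix x
    have "(LI u. h x * ?K u x)
        = (LI u. h x * ind {u. 0 \<le> u \<and> ennreal u < k x} u)" by (intro nn_integral_cong) (simp add: indicator_def)
    also have "... = h x * (LI u. ind {u. 0 \<le> u \<and> ennreal u < k x} u)" by (rule nn_integral_cmult) measurable
    also have "... = h x * k x" by (subst layer_cake) simp
    finally show "(LI u. h x * ?K u x) = h x * k x" .
  qed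
  finally show ?thesis .
qed

section \<open>Pollard and Riesz inequalities on the line\<close>

definition nconv :: "(real \<Rightarrow> ennreal) \<Rightarrow> (real \<Rightarrow> ennreal) \<Rightarrow> real \<Rightarrow> ennreal" where
  "nconv f g x = (LI y. f y * g (x - y))"

lemma nconv_measurable [measurable]:
  assumes [measurable]: "f \<in> borel_measurable borel" "g \<in> borel_measurable borel"
  shows "nconv f g \<in> borel_measurable borel"
  unfolding nconv_def[abs_def] by measurable

lemma nconv_double:
  assumes [measurable]: "f \<in> borel_measurable borel" "g \<in> borel_measurable borel"
    "F \<in> borel_measurable borel"
  shows "(LI x. (LI y. f x * g y * F (x + y))) = (LI z. nconv f g z * F z)"
proof -
  have "(LI x. (LI y. f x * g y * F (x + y)))
      = (LI x. (LI z. f x * g (z - x) * F z))"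
  proof (rule nn_integral_cong)
    fix x
    show "(LI y. f x * g y * F (x + y)) = (LI z. f x * g (z - x) * F z)"
      using nn_integral_real_affine[of "\<lambda>y. f x * g y * F (x + y)" 1 "-x"] by simp
  qed
  also have "... = (LI z. (LI x. f x * g (z - x) * F z))" by (rule lborel_pair.Fubini') measurable
  also have "... = (LI z. nconv f g z * F z)" unfolding nconv_def by (intro nn_integral_cong nn_integral_multc) measurable
  finally show ?thesis .
qed

lemma nconv_mass:
  assumes [measurable]: "f \<in> borel_measurable borel" "g \<in> borel_measurable borel"
  shows "(LI z. nconv f g z) = (LI x. f x) * (LI x. g x)"
  using nconv_double[of f g "\<lambda>_. 1"]
  by (simp add: nn_integral_cmult nn_integral_multc)

lemma nn_integral_reflect:
  fixes f :: "real \<Rightarrow> ennreal"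
  assumes [measurable]: "f \<in> borel_measurable borel"
  shows "(LI x. f (c - x)) = (LI x. f x)"
  using nn_integral_real_affine[of f "-1" c] by simp

lemma nn_integral_fold:
  fixes f :: "real \<Rightarrow> ennreal"
  assumes [measurable]: "f \<in> borel_measurable borel"
  shows "(LI y. f y) = (LI y. (f y + f (2 * m - y)) * ind {m<..} y)"
proof -
  have "(LI y. f y) = (LI y. f y * ind {m<..} y + f y * ind {..m} y)" by (intro nn_integral_cong) (auto split: split_indicator)
  also have "... = (LI y. f y * ind {m<..} y) + (LI y. f y * ind {..m} y)" by (rule nn_integral_add) measurable
  also have "(LI y. f y * ind {..m} y)
      = (LI y. f (2 * m - y) * ind {..m} (2 * m - y))" using nn_integral_reflect[of "\<lambda>y. f y * ind {..m} y" "2 * m"] by simp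
  also have "... = (LI y. f (2 * m - y) * ind {m<..} y)" by (intro nn_integral_cong_AE eventually_mono[OF AE_lborel_singleton[of m]])
       (auto split: split_indicator)
  finally show ?thesis
    by (subst (asm) nn_integral_add[symmetric]) (auto simp: distrib_right)
qed

lemma cross_le_ennreal:
  fixes a b a' b' :: ennreal
  assumes "a \<le> a'" "b \<le> b'"
  shows "a * b' + a' * b \<le> a * b + a' * b'"
proof -
  obtain d where d: "a' = a + d" using assms(1) by (auto simp: le_iff_add)
  have "a * b' + a' * b = (a * b + a * b') + d * b" by (simp add: d algebra_simps)
  also have "... \<le> (a * b + a * b') + d * b'" using assms(2) by (intro add_left_mono mult_left_mono) auto
  also have "... = a * b + a' * b'" by (simp add: d algebra_simps)
  finally show ?thesis .
qed

text \<open>For \<open>\<bar>x\<bar> \<le> \<bar>y\<bar>\<close> the difference of the two convolutions is folded at the midpoint of \<open>x\<close> and \<open>y\<close>; the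
  folded integrand is ordered by the elementary inequality \<open>cross_le_ennreal\<close>.\<close>
lemma symdec_nconv:
  assumes k: "symdec k" and l: "symdec l" and fin: "(LI x. k x) < \<top>"
  shows "symdec (nconv k l)"
proof -
  note [measurable] = symdecD(1)[OF k] symdecD(1)[OF l]
  have even: "nconv k l (- x) = nconv k l x" for x
  proof -
    have "nconv k l (- x) = (LI y. k (0 - y) * l (- x - (0 - y)))"
      unfolding nconv_def using nn_integral_reflect[of "\<lambda>y. k y * l (- x - y)" 0] by simp
    also have "... = nconv k l x" unfolding nconv_def
    proof (intro nn_integral_cong)
      fix y show "k (0 - y) * l (- x - (0 - y)) = k y * l (x - y)" using symdecD(4)[OF k, of y] symdecD(4)[OF l, of "x - y"] by simp
    qed
    finally show ?thesis .
  qed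
  have mono: "nconv k l x' \<le> nconv k l x" if "0 \<le> x" "x \<le> x'" for x x'
  proof -
    define m where "m = (x + x') / 2"
    have m: "2 * m = x + x'" by (simp add: m_def)
    have "nconv k l x' = (LI y. (k y * l (x' - y) + k (2 * m - y) * l (x' - (2 * m - y))) * ind {m<..} y)"
      unfolding nconv_def by (rule nn_integral_fold) measurable
    also have "... \<le> (LI y. (k y * l (x - y) + k (2 * m - y) * l (x - (2 * m - y))) * ind {m<..} y)"
    proof (intro nn_integral_mono)
      fix y
      show "(k y * l (x' - y) + k (2 * m - y) * l (x' - (2 * m - y))) * ind {m<..} y
        \<le> (k y * l (x - y) + k (2 * m - y) * l (x - (2 * m - y))) * ind {m<..} y"
      proof (cases "m < y")
        case True
        have e: "x' - (2 * m - y) = - (x - y)" "x - (2 * m - y) = - (x' - y)" by (simp_all add: m)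
        have "k y \<le> k (2 * m - y)" using True that m by (intro symdecD(2)[OF k]) (auto simp: abs_if)
        moreover have "l (x - y) \<le> l (x' - y)" using True that m
          by (intro symdecD(2)[OF l]) (auto simp: abs_if)
        ultimately have "k y * l (x' - y) + k (2 * m - y) * l (x - y)
            \<le> k y * l (x - y) + k (2 * m - y) * l (x' - y)" by (rule cross_le_ennreal)
        then show ?thesis unfolding e symdecD(4)[OF l] using True by simp
      qed simp
    qed
    also have "... = nconv k l x" unfolding nconv_def by (rule nn_integral_fold[symmetric]) measurable
    finally show ?thesis .
  qed
  have abs: "nconv k l \<bar>x\<bar> = nconv k l x" for x by (cases "0 \<le> x") (auto simp: even)
  have "nconv k l x < \<top>" for x
  proof -
    have "nconv k l x \<le> (LI y. k y * l 0)" unfolding nconv_def by (intro nn_integral_mono mult_left_mono symdecD(2)[OF l]) auto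
    also have "... = (LI y. k y) * l 0" by (rule nn_integral_multc) measurable
    also have "... < \<top>" using fin symdecD(3)[OF l, of 0] by (simp add: ennreal_mult_less_top)
    finally show ?thesis .
  qed
  moreover have "nconv k l y \<le> nconv k l x" if "\<bar>x\<bar> \<le> \<bar>y\<bar>" for x y
    using mono[of "\<bar>x\<bar>" "\<bar>y\<bar>"] that by (simp add: abs)
  ultimately show ?thesis unfolding symdec_def by auto
qed

lemma symdec_indicator_symint: "symdec (ind (symint c))"
proof -
  have "x \<in> symint c" if "\<bar>x\<bar> \<le> \<bar>y\<bar>" "y \<in> symint c" for x y
    using that le_less_trans[OF ennreal_leI[of "2 * \<bar>x\<bar>" "2 * \<bar>y\<bar>"]] by (simp add: symint_def)
  then show ?thesis unfolding symdec_def by (auto split: split_indicator)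
qed

lemma nconv_indicators:
  assumes "0 \<le> b" "0 \<le> c"
  shows "nconv (ind (symint (ennreal b))) (ind (symint (ennreal c))) x
    = ennreal (min (b / 2) (x + c / 2) - max (- b / 2) (x - c / 2))"
proof -
  have "nconv (ind (symint (ennreal b))) (ind (symint (ennreal c))) x
      = (LI y. ind {max (- b / 2) (x - c / 2)<..<min (b / 2) (x + c / 2)} y)"
    unfolding nconv_def symint_ennreal[OF assms(1)] symint_ennreal[OF assms(2)]
    by (intro nn_integral_cong) (auto split: split_indicator)
  also have "... = len {max (- b / 2) (x - c / 2)<..<min (b / 2) (x + c / 2)}" by simp
  also have "... = ennreal (min (b / 2) (x + c / 2) - max (- b / 2) (x - c / 2))"
    by (cases "max (- b / 2) (x - c / 2) \<le> min (b / 2) (x + c / 2)")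
       (auto simp del: max.bounded_iff min.bounded_iff min_less_iff_disj less_max_iff_disj simp add: ennreal_neg)
  finally show ?thesis .
qed

lemma lipschitz_ivt:
  fixes F :: "real \<Rightarrow> real"
  assumes lip: "\<And>x y. x \<le> y \<Longrightarrow> \<bar>F y - F x\<bar> \<le> K * (y - x)"
    and lo: "(\<lambda>n. F (- real n)) \<longlonglongrightarrow> a" and hi: "(\<lambda>n. F (real n)) \<longlonglongrightarrow> b"
    and c: "a < c" "c < b"
  shows "\<exists>x. F x = c"
proof -
  have K: "0 \<le> K" using lip[of 0 1] by simp
  have "K-lipschitz_on UNIV F"
  proof (rule lipschitz_onI)
    fix x y show "dist (F x) (F y) \<le> K * dist x y" using lip[of x y] lip[of y x]
      by (cases "x \<le> y") (auto simp: dist_real_def abs_minus_commute[of "F x" "F y"] abs_minus_commute[of x y])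
  qed (rule K)
  then have cont: "continuous_on UNIV F" by (rule lipschitz_on_continuous_on)
  have "eventually (\<lambda>n. F (- real n) < c \<and> c < F (real n)) sequentially"
    using order_tendstoD(2)[OF lo c(1)] order_tendstoD(1)[OF hi c(2)] by eventually_elim auto
  then obtain n where "F (- real n) < c" "c < F (real n)" by (auto simp: eventually_sequentially)
  then show ?thesis
    using IVT'[of F "- real n" c "real n"] continuous_on_subset[OF cont] by auto
qed

lemma split_right:
  fixes B :: "real set"
  assumes B [measurable]: "B \<in> sets borel" and b: "len B = ennreal b" and t: "0 < t" "t < b"
  shows "\<exists>\<beta>. len (B \<inter> {\<beta>..}) = ennreal t"
proof -
  have fin: "len (B \<inter> X) \<noteq> \<infinity>" if "X \<in> sets borel" for X
  proof -
    have "len (B \<inter> X) \<le> len B" by (intro emeasure_mono) auto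
    then show ?thesis by (auto simp: b top_unique)
  qed
  define F where "F \<beta> = measure lborel (B \<inter> {- \<beta>..})" for \<beta>
  have "\<exists>x. F x = t"
  proof (rule lipschitz_ivt)
    fix x y :: real assume xy: "x \<le> y"
    have "measure lborel (B \<inter> {- y..}) = measure lborel ((B \<inter> {- y..<- x}) \<union> (B \<inter> {- x..}))"
      using xy by (intro arg_cong[where f = "measure lborel"]) auto
    also have "... = measure lborel (B \<inter> {- y..<- x}) + measure lborel (B \<inter> {- x..})" using fin by (intro measure_Union) auto
    finally have "F y - F x = measure lborel (B \<inter> {- y..<- x})" by (simp add: F_def)
    moreover have "measure lborel (B \<inter> {- y..<- x}) \<le> measure lborel {- y..<- x}"
      using xy by (intro measure_mono_fmeasurable) (auto simp: fmeasurable_def)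
    ultimately show "\<bar>F y - F x\<bar> \<le> 1 * (y - x)" using xy by simp
  next
    have "(\<lambda>n. measure lborel (B \<inter> {real n..})) \<longlonglongrightarrow> measure lborel (\<Inter>n. B \<inter> {real n..})"
      using fin by (intro Lim_measure_decseq) (auto simp: decseq_def)
    moreover have "(\<Inter>n. B \<inter> {real n..}) = {}"
    proof -
      have "\<exists>n. x < real n" for x :: real by (rule reals_Archimedean2)
      then show ?thesis by (auto simp: set_eq_iff) (metis not_less)
    qed
    ultimately show "(\<lambda>n. F (- real n)) \<longlonglongrightarrow> 0" by (simp add: F_def)
    have un: "(\<Union>n. B \<inter> {- real n..}) = B"
    proof -
      have "\<exists>n. - x \<le> real n" for x :: real by (rule real_arch_simple)
      then have "\<exists>n. - real n \<le> x" for x :: real by (metis minus_le_iff)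
      then show ?thesis by auto
    qed
    have "(\<lambda>n. measure lborel (B \<inter> {- real n..})) \<longlonglongrightarrow> measure lborel (\<Union>n. B \<inter> {- real n..})"
      by (intro Lim_measure_incseq) (use b un in \<open>auto simp: incseq_def simp del: UN_simps\<close>)
    then show "(\<lambda>n. F (real n)) \<longlonglongrightarrow> b" unfolding un using b t by (simp add: F_def measure_def)
  qed (use t in auto)
  then obtain x where x: "F x = t" ..
  have "len (B \<inter> {- x..}) = ennreal t" using x fin[of "{- x..}"] by (simp add: F_def emeasure_eq_ennreal_measure)
  then show ?thesis ..
qed

definition overlap :: "real set \<Rightarrow> real set \<Rightarrow> real \<Rightarrow> ennreal" where
  "overlap B C x = (LI y. ind B y * ind C (x + y))"

lemma overlap_measurable [measurable]:
  assumes [measurable]: "B \<in> sets borel" "C \<in> sets borel"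
  shows "overlap B C \<in> borel_measurable borel"
  unfolding overlap_def[abs_def] by measurable

lemma overlap_mass:
  assumes [measurable]: "B \<in> sets borel" "C \<in> sets borel"
  shows "(LI x. overlap B C x) = len B * len C"
proof -
  have "(LI x. overlap B C x)
      = (LI y. (LI x. ind B y * ind C (x + y)))" unfolding overlap_def by (rule lborel_pair.Fubini') measurable
  also have "... = (LI y. len C * ind B y)"
  proof (intro nn_integral_cong)
    fix y :: real
    have "(LI x. ind B y * ind C (x + y))
        = ind B y * (LI x. ind C (x + y))" by (rule nn_integral_cmult) measurable
    also have "(LI x. ind C (x + y)) = len C" using nn_integral_real_affine[of "ind C :: real \<Rightarrow> ennreal" 1 y] by (simp add: add.commute)
    finally show "(LI x. ind B y * ind C (x + y)) = len C * ind B y" by (simp add: mult.commute)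
  qed
  also have "... = len C * len B" by (simp add: nn_integral_cmult_indicator)
  finally show ?thesis by (simp only: mult.commute)
qed

lemma overlap_le:
  assumes [measurable]: "B \<in> sets borel" "C \<in> sets borel"
  shows "overlap B C x \<le> len B" "overlap B C x \<le> len C"
proof -
  have "overlap B C x \<le> (LI y. ind B y)" unfolding overlap_def by (intro nn_integral_mono) (auto split: split_indicator)
  then show "overlap B C x \<le> len B" by simp
  have "overlap B C x \<le> (LI y. ind C (x + y))" unfolding overlap_def by (intro nn_integral_mono) (auto split: split_indicator)
  also have "... = (LI y. ind C y)" using nn_integral_real_affine[of "ind C :: real \<Rightarrow> ennreal" 1 x] by simp
  finally show "overlap B C x \<le> len C" by simp
qed

text \<open>Let \<open>B1\<close> and \<open>C1\<close> be the right ends of measure \<open>t\<close>. At every translate, the overlap of \<open>B1\<close> with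
  \<open>C\<close> plus the overlap of the rest of \<open>B\<close> with \<open>C1\<close> is at most \<open>t\<close> and at most the full overlap. Its
  integral is \<open>t * c + (b - t) * t\<close>, which leaves \<open>(b - t) * (c - t)\<close> for the excess over \<open>t\<close>.\<close>
lemma pollard:
  assumes B [measurable]: "B \<in> sets borel" and C [measurable]: "C \<in> sets borel"
    and b: "len B = ennreal b" and c: "len C = ennreal c"
    and t: "0 < t" "t < b" "t < c"
  shows "(LI x. (overlap B C x - ennreal t)) \<le> ennreal ((b - t) * (c - t))"
proof -
  obtain \<beta> where \<beta>: "len (B \<inter> {\<beta>..}) = ennreal t" using split_right[OF B b] t by blast
  obtain \<gamma> where \<gamma>: "len (C \<inter> {\<gamma>..}) = ennreal t" using split_right[OF C c] t by blast
  have "ennreal b = len ((B \<inter> {\<beta>..}) \<union> (B \<inter> {..<\<beta>}))"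
    unfolding b[symmetric] by (intro arg_cong[where f = "len"]) auto
  also have "... = ennreal t + len (B \<inter> {..<\<beta>})" by (subst plus_emeasure[symmetric]) (auto simp: \<beta>)
  finally have B2: "len (B \<inter> {..<\<beta>}) = ennreal (b - t)"
    using t by (cases "len (B \<inter> {..<\<beta>})") (auto simp flip: ennreal_plus simp: ennreal_plus[symmetric])
  let ?p = "\<lambda>x. overlap (B \<inter> {\<beta>..}) C x + overlap (B \<inter> {..<\<beta>}) (C \<inter> {\<gamma>..}) x"
  have p1: "?p x \<le> overlap B C x" for x unfolding overlap_def
    by (subst nn_integral_add[symmetric]) (auto intro!: nn_integral_mono split: split_indicator)
  have p2: "?p x \<le> ennreal t" for x
  proof (cases "\<gamma> - \<beta> \<le> x")
    case True
    have "?p x \<le> overlap B (C \<inter> {\<gamma>..}) x" unfolding overlap_def using True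
      by (subst nn_integral_add[symmetric]) (auto intro!: nn_integral_mono split: split_indicator)
    also have "... \<le> ennreal t" using overlap_le(2)[of B "C \<inter> {\<gamma>..}" x] by (simp add: \<gamma>)
    finally show ?thesis .
  next
    case False
    have "?p x \<le> overlap (B \<inter> {\<beta>..}) C x" unfolding overlap_def using False
      by (subst nn_integral_add[symmetric]) (auto intro!: nn_integral_mono split: split_indicator)
    also have "... \<le> ennreal t" using overlap_le(1)[of "B \<inter> {\<beta>..}" C x] by (simp add: \<beta>)
    finally show ?thesis .
  qed
  have "ennreal (t * c + (b - t) * t) = (LI x. ?p x)" using t by (subst nn_integral_add) (auto simp: overlap_mass \<beta> \<gamma> B2 c ennreal_mult)
  also have "... \<le> (LI x. min (overlap B C x) (ennreal t))" using p1 p2 by (intro nn_integral_mono) auto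
  finally have M: "ennreal (t * c + (b - t) * t) \<le> (LI x. min (overlap B C x) (ennreal t))" .
  have "(LI x. (overlap B C x - ennreal t)) + (LI x. min (overlap B C x) (ennreal t))
      = (LI x. overlap B C x)"
  proof (subst nn_integral_add[symmetric], measurable, intro nn_integral_cong)
    fix x show "(overlap B C x - ennreal t) + min (overlap B C x) (ennreal t) = overlap B C x" by (cases "ennreal t \<le> overlap B C x")
         (auto simp: min_def add_diff_inverse_ennreal add.commute diff_eq_0_iff_ennreal intro: le_less_trans)
  qed
  also have "... = ennreal (b * c)" using t by (simp add: overlap_mass b c ennreal_mult)
  finally have "(LI x. (overlap B C x - ennreal t)) + ennreal (t * c + (b - t) * t) \<le> ennreal (b * c)" using M by (metis add_left_mono)
  then show ?thesis
  proof (cases "\<integral>\<^sup>+x. (overlap B C x - ennreal t) \<partial>lborel")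
    case (real r)
    assume "(LI x. (overlap B C x - ennreal t)) + ennreal (t * c + (b - t) * t) \<le> ennreal (b * c)"
    then have "ennreal (r + (t * c + (b - t) * t)) \<le> ennreal (b * c)" using real t by (subst ennreal_plus) auto
    then have "r + (t * c + (b - t) * t) \<le> b * c" using t by (subst (asm) ennreal_le_iff) auto
    then have "r \<le> (b - t) * (c - t)" by (simp add: algebra_simps)
    then show ?thesis using real by (simp add: ennreal_leI)
  qed (auto simp: top_unique)
qed

text \<open>For two intervals the bound of \<open>pollard\<close> is an equality, so the truncated integrals are ordered and
  \<open>domI_hinge\<close> applies.\<close>
lemma overlap_dominated:
  assumes B [measurable]: "B \<in> sets borel" and C [measurable]: "C \<in> sets borel"
    and b: "len B = ennreal b" "0 \<le> b" and c: "len C = ennreal c" "0 \<le> c"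
  shows "dominated (overlap B C) (nconv (ind (symint (ennreal b))) (ind (symint (ennreal c))))"
    (is "dominated _ ?h")
proof (rule domI_hinge)
  show "symdec ?h" by (intro symdec_nconv symdec_indicator_symint) simp
  fix t :: real assume "0 \<le> t"
  then consider "t = 0" | "0 < t" "t < b" "t < c" | "b \<le> t \<or> c \<le> t" by linarith
  then show "(LI x. (overlap B C x - ennreal t)) \<le> (LI x. (?h x - ennreal t))"
  proof cases
    case 1
    then show ?thesis by (simp add: overlap_mass nconv_mass b c)
  next
    case 2
    have "(LI x. (overlap B C x - ennreal t)) \<le> ennreal ((b - t) * (c - t))" using pollard[OF B C b(1) c(1)] 2 by simp
    also have "... = (LI x. nconv (ind (symint (ennreal (b - t)))) (ind (symint (ennreal (c - t)))) x)"
      using 2 by (subst nconv_mass) (auto simp: ennreal_mult)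
    also have "... \<le> (LI x. (?h x - ennreal t))"
    proof (intro nn_integral_mono)
      fix x
      have "min ((b - t) / 2) (x + (c - t) / 2) - max (- (b - t) / 2) (x - (c - t) / 2)
          = min (b / 2) (x + c / 2) - max (- b / 2) (x - c / 2) - t" by (auto simp: min_def max_def field_simps)
      then show "nconv (ind (symint (ennreal (b - t)))) (ind (symint (ennreal (c - t)))) x \<le> ?h x - ennreal t"
        using 2 b c by (simp add: nconv_indicators ennreal_minus)
    qed
    finally show ?thesis .
  next
    case 3
    have "overlap B C x \<le> ennreal t" for x using 3 overlap_le[OF B C, of x] b c by (auto intro: order.trans ennreal_leI)
    then have "overlap B C x - ennreal t = 0" for x using le_less_trans[of "overlap B C x" "ennreal t" \<top>] by (simp add: diff_eq_0_iff_ennreal)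
    then show ?thesis by simp
  qed
qed measurable

lemma smeared_dominated:
  assumes g [measurable]: "g \<in> borel_measurable borel" and k: "symdec k"
    and gfin: "(LI x. g x) < \<top>" and gk: "dominated g k"
    and C [measurable]: "C \<in> sets borel" and c: "len C = ennreal c" "0 \<le> c"
  shows "dominated (\<lambda>x. \<integral>\<^sup>+y. g y * ind C (x + y) \<partial>lborel) (nconv k (ind (symint (ennreal c))))"
  unfolding dominated_def
proof
  note [measurable] = symdecD(1)[OF k]
  let ?I = "ind (symint (ennreal c)) :: real \<Rightarrow> ennreal"
  fix A :: "real set" assume A [measurable]: "A \<in> sets borel"
  have swap: "(LI x. (LI y. u y * ind X (x + y)) * ind Y x)
      = (LI y. u y * overlap Y X y)"
    if [measurable]: "u \<in> borel_measurable borel" "X \<in> sets borel" "Y \<in> sets borel" for u X Y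
  proof -
    have "(LI x. (LI y. u y * ind X (x + y)) * ind Y x)
        = (LI x. (LI y. u y * (ind Y x * ind X (y + x))))" by (subst nn_integral_multc[symmetric], measurable) (simp add: mult_ac add.commute)
    also have "... = (LI y. (LI x. u y * (ind Y x * ind X (y + x))))" by (rule lborel_pair.Fubini') measurable
    also have "... = (LI y. u y * overlap Y X y)" unfolding overlap_def by (intro nn_integral_cong nn_integral_cmult) measurable
    finally show ?thesis .
  qed
  have I: "symdec ?I" by (rule symdec_indicator_symint)
  show "(LI x. (LI y. g y * ind C (x + y)) * ind A x)
    \<le> (LI x. nconv k ?I x * ind (symint (len A)) x)"
  proof (cases "len A")
    case top
    have "(LI x. (LI y. g y * ind C (x + y)) * ind A x)
        = (LI y. g y * overlap A C y)" by (rule swap) measurable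
    also have "... \<le> (LI y. g y * ennreal c)" using overlap_le(2)[OF A C] by (intro nn_integral_mono mult_left_mono) (auto simp: c)
    also have "... = (LI y. g y) * ennreal c" by (rule nn_integral_multc) measurable
    also have "... \<le> (LI y. k y) * ennreal c" by (intro mult_right_mono dom_mass gk) simp
    also have "... = (LI x. nconv k ?I x)" by (simp add: nconv_mass)
    finally show ?thesis by (simp add: top symint_top)
  next
    case (real a)
    let ?J = "ind (symint (ennreal a)) :: real \<Rightarrow> ennreal"
    have flip: "(LI y. k y * ?I (x + y)) = nconv k ?I x" for x
    proof -
      have "(LI y. k y * ?I (x + y)) = (LI y. k (0 - y) * ?I (x + (0 - y)))" using nn_integral_reflect[of "\<lambda>y. k y * ?I (x + y)" 0] by simp
      then show ?thesis by (simp add: nconv_def symdecD(4)[OF k])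
    qed
    have "(LI x. (LI y. g y * ind C (x + y)) * ind A x)
        = (LI y. g y * overlap A C y)" by (rule swap) measurable
    also have "... \<le> (LI y. k y * nconv ?J ?I y)"
      using real c by (intro hardy_littlewood overlap_dominated symdec_nconv symdec_indicator_symint k gfin gk) auto
    also have "... = (LI y. k y * overlap (symint (ennreal a)) (symint (ennreal c)) y)"
    proof (intro nn_integral_cong)
      fix y
      have "nconv ?J ?I y = nconv ?J ?I (- y)" by (rule symdecD(4)[symmetric], intro symdec_nconv symdec_indicator_symint) simp
      also have "... = overlap (symint (ennreal a)) (symint (ennreal c)) y" unfolding nconv_def overlap_def
      proof (intro nn_integral_cong)
        fix x
        have "?I (- y - x) = ?I (y + x)" using symdecD(4)[OF I, of "y + x"] by simp
        then show "?J x * ?I (- y - x) = ?J x * ?I (y + x)" by simp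
      qed
      finally show "k y * nconv ?J ?I y = k y * overlap (symint (ennreal a)) (symint (ennreal c)) y" by simp
    qed
    also have "... = (LI x. (LI y. k y * ?I (x + y)) * ?J x)" by (rule swap[symmetric]) measurable
    also have "... = (LI x. nconv k ?I x * ind (symint (len A)) x)" by (simp add: flip real)
    finally show ?thesis .
  qed
qed

text \<open>In this version of the one-dimensional Riesz inequality, majorants take the place of rearrangements.
  It is obtained by using \<open>hardy_littlewood\<close> twice, once to smear \<open>C\<close> with \<open>g\<close> and once against \<open>f\<close>.\<close>
theorem riesz_rearrangement:
  assumes f [measurable]: "f \<in> borel_measurable borel" and g [measurable]: "g \<in> borel_measurable borel"
    and h: "symdec h" and k: "symdec k"
    and fin: "(LI x. f x) < \<top>" "(LI x. g x) < \<top>" "(LI x. k x) < \<top>"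
    and fh: "dominated f h" and gk: "dominated g k" and C [measurable]: "C \<in> sets borel"
  shows "(LI x. (LI y. f x * g y * ind C (x + y)))
    \<le> (LI z. nconv h k z * ind (symint (len C)) z)"
proof -
  note [measurable] = symdecD(1)[OF h] symdecD(1)[OF k]
  show ?thesis
  proof (cases "len C")
    case top
    have "(LI x. (LI y. f x * g y * ind C (x + y)))
        \<le> (LI x. (LI y. f x * g y))" by (intro nn_integral_mono) (auto split: split_indicator)
    also have "... = (LI x. f x) * (LI x. g x)" by (simp add: nn_integral_cmult nn_integral_multc)
    also have "... \<le> (LI x. h x) * (LI x. k x)" by (intro mult_mono dom_mass fh gk) auto
    also have "... = (LI x. nconv h k x)" by (simp add: nconv_mass)
    finally show ?thesis by (simp add: top symint_top)
  next
    case (real c)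
    let ?I = "ind (symint (ennreal c)) :: real \<Rightarrow> ennreal"
    have "(LI x. (LI y. f x * g y * ind C (x + y)))
        = (LI x. f x * (LI y. g y * ind C (x + y)))" by (intro nn_integral_cong, subst nn_integral_cmult[symmetric]) (auto simp: mult.assoc)
    also have "... \<le> (LI x. h x * nconv k ?I x)"
      using real by (intro hardy_littlewood smeared_dominated symdec_nconv symdec_indicator_symint h k fin fh gk) auto
    also have "... = (LI x. (LI y. h x * k y * ?I (x + y)))"
    proof (intro nn_integral_cong)
      fix x
      have "nconv k ?I x = (LI y. k (0 - y) * ?I (x - (0 - y)))"
        unfolding nconv_def using nn_integral_reflect[of "\<lambda>y. k y * ?I (x - y)" 0] by simp
      also have "... = (LI y. k y * ?I (x + y))" by (simp add: symdecD(4)[OF k])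
      finally show "h x * nconv k ?I x = (LI y. h x * k y * ?I (x + y))" by (simp add: nn_integral_cmult[symmetric] mult.assoc)
    qed
    also have "... = (LI z. nconv h k z * ?I z)" by (rule nconv_double) measurable
    finally show ?thesis by (simp add: real)
  qed
qed

text \<open>A finite measure below \<open>h\<close> in this sense is absolutely continuous, so it has a density that is
  dominated by \<open>h\<close>, and Riesz rearrangement turns into a statement about sums of independent
  variables.\<close>
definition conc_le :: "real measure \<Rightarrow> (real \<Rightarrow> ennreal) \<Rightarrow> bool" where
  "conc_le \<mu> h \<longleftrightarrow> (\<forall>A\<in>sets borel. emeasure \<mu> A \<le> (LI x. h x * ind (symint (len A)) x))"

lemma conc_le_density:
  assumes sets: "sets \<mu> = sets borel" and fin: "emeasure \<mu> UNIV < \<top>" and c: "conc_le \<mu> h"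
  obtains f where "f \<in> borel_measurable borel" "\<mu> = density lborel f" "dominated f h"
    "(LI x. f x) < \<top>"
proof -
  have "absolutely_continuous lborel \<mu>" unfolding absolutely_continuous_def
  proof
    fix A :: "real set" assume "A \<in> null_sets lborel"
    then have A: "A \<in> sets borel" "len A = 0" by auto
    have "symint 0 = {}" by (auto simp: symint_def)
    then have "emeasure \<mu> A = 0" using c[unfolded conc_le_def, rule_format, OF A(1)] A by simp
    then show "A \<in> null_sets \<mu>" using A sets by (auto simp: null_sets_def)
  qed
  then obtain f where f [measurable]: "f \<in> borel_measurable borel" and d: "density lborel f = \<mu>"
    using sigma_finite_measure.Radon_Nikodym[OF sigma_finite_lborel, of \<mu>] sets by auto
  have em: "emeasure \<mu> A = (LI x. f x * ind A x)" if "A \<in> sets borel" for A using that by (simp add: d[symmetric] emeasure_density)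
  have "dominated f h" using c by (auto simp: dominated_def conc_le_def em)
  moreover have "(LI x. f x) < \<top>" using fin em[of UNIV] by simp
  ultimately show thesis using that f d by metis
qed

theorem conc_le_convolution:
  assumes sets [measurable_cong]: "sets \<mu> = sets borel" "sets \<nu> = sets borel"
    and fin: "emeasure \<mu> UNIV < \<top>" "emeasure \<nu> UNIV < \<top>" "(LI x. k x) < \<top>"
    and h: "symdec h" and k: "symdec k" and c: "conc_le \<mu> h" "conc_le \<nu> k"
    and C [measurable]: "C \<in> sets borel"
  shows "(\<integral>\<^sup>+x. (\<integral>\<^sup>+y. ind C (x + y) \<partial>\<nu>) \<partial>\<mu>)
    \<le> (LI z. nconv h k z * ind (symint (len C)) z)"
proof -
  obtain f where f [measurable]: "f \<in> borel_measurable borel" "\<mu> = density lborel f" "dominated f h"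
    "(LI x. f x) < \<top>" by (rule conc_le_density[OF sets(1) fin(1) c(1)])
  obtain g where g [measurable]: "g \<in> borel_measurable borel" "\<nu> = density lborel g" "dominated g k"
    "(LI x. g x) < \<top>" by (rule conc_le_density[OF sets(2) fin(2) c(2)])
  have "(\<integral>\<^sup>+x. (\<integral>\<^sup>+y. ind C (x + y) \<partial>\<nu>) \<partial>\<mu>)
      = (LI x. f x * (LI y. g y * ind C (x + y)))" unfolding f(2) g(2) by (simp add: nn_integral_density)
  also have "... = (LI x. (LI y. f x * g y * ind C (x + y)))"
    by (intro nn_integral_cong, subst nn_integral_cmult[symmetric]) (auto simp: mult.assoc)
  also have "... \<le> (LI z. nconv h k z * ind (symint (len C)) z)" by (intro riesz_rearrangement f g h k fin C)
  finally show ?thesis .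
qed

section \<open>The series rule for a branch\<close>

text \<open>Summing over the middle spin of two bonds of strengths \<open>x\<close> and \<open>y\<close> in series gives a bond of strength
  \<open>ser x y\<close>; all strengths include the factor \<open>\<beta>\<close>.\<close>
definition ser :: "real \<Rightarrow> real \<Rightarrow> real" where
  "ser x y = ln (cosh (x + y) / cosh (x - y)) / 2"

lemma ser_measurable [measurable]: "(\<lambda>(x, y). ser x y) \<in> borel_measurable (borel \<Otimes>\<^sub>M borel)"
proof -
  have "continuous_on UNIV (\<lambda>z. ser (fst z) (snd z))" unfolding ser_def by (intro continuous_intros) auto
  then have "(\<lambda>z. ser (fst z) (snd z)) \<in> borel_measurable borel" by (rule borel_measurable_continuous_onI)
  then show ?thesis by (simp add: borel_prod case_prod_beta)
qed

lemma ser_measurable' [measurable (raw)]: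
  assumes [measurable]: "f \<in> borel_measurable M" "g \<in> borel_measurable M"
  shows "(\<lambda>x. ser (f x) (g x)) \<in> borel_measurable M"
  using measurable_compose[OF measurable_Pair[OF assms] ser_measurable] by simp

lemma ser_commute: "ser x y = ser y x"
  using cosh_minus[of "x - y"] unfolding ser_def by (simp add: add.commute del: cosh_minus)

lemma ser_minus_right: "ser x (- y) = ser (- x) y"
proof -
  have "- x - y = - (x + y)" "- x + y = - (x - y)" by simp_all
  then have e: "cosh (- x - y) = cosh (x + y)" "cosh (- x + y) = cosh (x - y)" by (simp_all only: cosh_minus)
  show ?thesis unfolding ser_def e by simp
qed

lemma ser_deriv: "((\<lambda>x. ser x y) has_real_derivative (tanh (x + y) - tanh (x - y)) / 2) (at x)"
proof -
  have e: "ser x y = (ln (cosh (x + y)) - ln (cosh (x - y))) / 2" for x unfolding ser_def by (simp add: ln_div)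
  show ?thesis unfolding e
    by (auto intro!: derivative_eq_intros simp: tanh_def cosh_real_nonzero field_simps)
qed

text \<open>When \<open>y\<close> exceeds both \<open>R\<close> and \<open>\<bar>x\<bar> + L\<close>, the weaker bond passes through almost unchanged: the
  derivative in \<open>x\<close> is bounded below by a constant that tends to \<open>1\<close>. This is why a branch with one
  clearly dominant half does not concentrate the law.\<close>
lemma ser_deriv_ge:
  fixes x y L R :: real
  assumes R: "0 < R" "R \<le> y" and L: "0 < L" "\<bar>x\<bar> \<le> y - L"
  shows "tanh R / (1 + exp (- 2 * L)) \<le> (tanh (x + y) - tanh (x - y)) / 2"
proof -
  define Q where "Q = 2 * (cosh (x + y) * cosh (x - y))"
  have Q0: "0 < Q" by (simp add: Q_def)
  have y: "0 < y" using R by simp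
  have Q: "Q = cosh (2 * x) + cosh (2 * y)"
  proof -
    have "cosh (2 * x) = cosh ((x + y) + (x - y))" "cosh (2 * y) = cosh ((x + y) - (x - y))" by simp_all
    then show ?thesis unfolding Q_def cosh_add cosh_diff by simp
  qed
  have "cosh (2 * x) \<le> cosh (2 * y - 2 * L)"
  proof -
    have "cosh \<bar>2 * x\<bar> \<le> cosh (2 * y - 2 * L)" using L by (subst cosh_real_nonneg_le_iff) auto
    then show ?thesis by (metis cosh_real_abs)
  qed
  also have "... \<le> 1 + exp (- 2 * L) + exp (- 2 * L) * cosh (2 * y)"
  proof -
    have half: "(a + b) / 2 \<le> a / 2 + 1" if "b \<le> 2" for a b :: real using that by simp
    have "exp (- (2 * y - 2 * L)) \<le> 1" using L by simp
    then have "exp (- (2 * y - 2 * L)) \<le> 2" by (rule order.trans) simp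
    then have "cosh (2 * y - 2 * L) \<le> exp (2 * y - 2 * L) / 2 + 1" unfolding cosh_field_def by (rule half)
    also have "exp (2 * y - 2 * L) = exp (- 2 * L) * exp (2 * y)" by (simp flip: exp_add)
    also have "exp (- 2 * L) * exp (2 * y) / 2 + 1 \<le> exp (- 2 * L) * cosh (2 * y) + 1" by (simp add: cosh_field_def)
    finally show ?thesis using exp_ge_zero[of "- 2 * L"] by linarith
  qed
  finally have Qle: "Q \<le> 2 * (cosh y)\<^sup>2 * (1 + exp (- 2 * L))" unfolding Q cosh_double_cosh[of y] by (simp add: algebra_simps)
  have t: "0 \<le> tanh R" "tanh R \<le> tanh y" using R by simp_all
  have "tanh R * Q \<le> tanh y * (2 * (cosh y)\<^sup>2 * (1 + exp (- 2 * L)))" using t Qle Q0 y by (intro mult_mono) auto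
  also have "... = sinh (2 * y) * (1 + exp (- 2 * L))" unfolding sinh_double tanh_def by (simp add: power2_eq_square cosh_real_nonzero)
  finally have main: "tanh R * Q \<le> sinh (2 * y) * (1 + exp (- 2 * L))" .
  have "tanh (x + y) - tanh (x - y) = sinh ((x + y) - (x - y)) / (cosh (x + y) * cosh (x - y))"
    unfolding sinh_diff tanh_def by (simp add: field_simps cosh_real_nonzero)
  also have "... = 2 * (sinh (2 * y) / Q)" by (simp add: Q_def)
  finally have e: "(tanh (x + y) - tanh (x - y)) / 2 = sinh (2 * y) / Q" by simp
  have "0 < 1 + exp (- 2 * L)" by (simp add: add_pos_pos)
  then have "tanh R / (1 + exp (- 2 * L)) \<le> sinh (2 * y) / Q" using main Q0 by (simp add: pos_divide_le_eq pos_le_divide_eq)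
  then show ?thesis by (simp only: e)
qed

lemma expansive_preimage:
  fixes g :: "real \<Rightarrow> real"
  assumes g: "\<And>x. x \<in> {a..b} \<Longrightarrow> (g has_real_derivative g' x) (at x)"
    and cont: "continuous_on {a..b} g'" and c: "0 < c" "\<And>x. x \<in> {a..b} \<Longrightarrow> c \<le> g' x"
    and [measurable]: "g \<in> borel_measurable borel" "B \<in> sets borel"
  shows "ennreal c * len {x \<in> {a..b}. g x \<in> B} \<le> len B"
proof (cases "a < b")
  case True
  have "{x \<in> {a..b}. g x \<in> B} \<in> sets borel" by measurable
  then have "ennreal c * len {x \<in> {a..b}. g x \<in> B}
      = (LI x. ennreal c * ind {x \<in> {a..b}. g x \<in> B} x)" by (simp add: nn_integral_cmult_indicator)
  also have "... \<le> (LI x. ind B (g x) * ennreal (g' x) * ind {a..b} x)"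
    using c by (intro nn_integral_mono) (auto simp: ennreal_leI split: split_indicator)
  also have "... = (LI x. ind B x * ind {g a..g b} x)"
    using True c by (intro nn_integral_substitution_aux[symmetric] g cont) (auto intro: order.trans less_imp_le)
  also have "... \<le> (LI x. ind B x)" by (intro nn_integral_mono) (auto split: split_indicator)
  finally show ?thesis by simp
next
  case False
  then have "{x \<in> {a..b}. g x \<in> B} \<subseteq> {a}" by auto
  then have "len {x \<in> {a..b}. g x \<in> B} \<le> len {a}" by (intro emeasure_mono) auto
  then show ?thesis by simp
qed

lemma ser_preimage:
  assumes L: "0 < L" and R: "0 < R" "R < \<bar>y\<bar>" and B [measurable]: "B \<in> sets borel"
  shows "len {x. \<bar>x\<bar> < \<bar>y\<bar> - L \<and> ser x y \<in> B}
    \<le> ennreal ((1 + exp (- 2 * L)) / tanh R) * len B"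
proof -
  have pos: "len {x. \<bar>x\<bar> < y - L \<and> ser x y \<in> B}
      \<le> ennreal ((1 + exp (- 2 * L)) / tanh R) * len B" if y: "R < y" for y
  proof -
    define c where "c = tanh R / (1 + exp (- 2 * L))"
    have c: "0 < c" using R by (simp add: c_def add_pos_pos)
    let ?S = "{x \<in> {-(y - L)..y - L}. ser x y \<in> B}"
    have "ennreal c * len ?S \<le> len B"
    proof (rule expansive_preimage)
      fix x assume "x \<in> {-(y - L)..y - L}"
      then show "c \<le> (tanh (x + y) - tanh (x - y)) / 2" unfolding c_def using R y L by (intro ser_deriv_ge) auto
    qed (auto intro!: ser_deriv c continuous_intros)
    then have "ennreal (1 / c) * (ennreal c * len ?S) \<le> ennreal (1 / c) * len B" by (intro mult_left_mono) auto
    then have "len ?S \<le> ennreal (1 / c) * len B" using c by (simp add: mult.assoc[symmetric] ennreal_mult[symmetric])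
    moreover have "len {x. \<bar>x\<bar> < y - L \<and> ser x y \<in> B} \<le> len ?S"
    proof (intro emeasure_mono)
      have "?S \<in> sets borel" by measurable
      then show "?S \<in> sets lborel" by simp
    qed auto
    moreover have "1 / c = (1 + exp (- 2 * L)) / tanh R" by (simp add: c_def)
    ultimately show ?thesis by simp
  qed
  show ?thesis
  proof (cases "0 < y")
    case True
    then show ?thesis using pos[of y] R by simp
  next
    case False
    then have y: "\<bar>y\<bar> = - y" by simp
    let ?S = "{x. \<bar>x\<bar> < - y - L \<and> ser x (- y) \<in> B}"
    have [measurable]: "?S \<in> sets borel" by measurable
    have S: "{x. \<bar>x\<bar> < \<bar>y\<bar> - L \<and> ser x y \<in> B} = {x. - x \<in> ?S}" using ser_minus_right[of _ "-y"] by (auto simp: y)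
    have "len {x. \<bar>x\<bar> < \<bar>y\<bar> - L \<and> ser x y \<in> B} = (LI x. ind {x. - x \<in> ?S} x)" unfolding S by simp
    also have "... = (LI x. ind ?S (0 - x))" by (intro nn_integral_cong) (auto split: split_indicator)
    also have "... = (LI x. ind ?S x)" by (rule nn_integral_reflect) measurable
    also have "... = len ?S" by simp
    also have "... \<le> ennreal ((1 + exp (- 2 * L)) / tanh R) * len B" using pos[of "- y"] R y by simp
    finally show ?thesis .
  qed
qed


text \<open>Of the ordered pairs in \<open>T\<close> at most half have the first entry strictly smaller in modulus; for the
  lower set \<open>T\<close> the inner condition stays inside \<open>T\<close>.\<close>
lemma ranked_pairs_half:
  assumes sets [measurable_cong]: "sets G = sets borel" and "finite_measure G"
    and T [measurable]: "T \<in> sets borel" and down: "\<And>x y. y \<in> T \<Longrightarrow> \<bar>x\<bar> < \<bar>y\<bar> \<Longrightarrow> x \<in> T"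
  shows "2 * (\<integral>\<^sup>+y. emeasure G {x::real. \<bar>x\<bar> < \<bar>y\<bar>} * ind T y \<partial>G) \<le> (emeasure G T)\<^sup>2"
proof -
  interpret G: finite_measure G by fact
  interpret GG: pair_sigma_finite G G ..
  let ?f = "\<lambda>y x. ind T x * ind T y * ind {(x, y). \<bar>x\<bar> < \<bar>y\<bar>} (x, y) :: ennreal"
  have I: "(\<integral>\<^sup>+y. emeasure G {x. \<bar>x\<bar> < \<bar>y\<bar>} * ind T y \<partial>G) = (\<integral>\<^sup>+y. (\<integral>\<^sup>+x. ?f y x \<partial>G) \<partial>G)"
  proof (rule nn_integral_cong)
    fix y
    have "(\<integral>\<^sup>+x. ?f y x \<partial>G) = (\<integral>\<^sup>+x. ind T y * ind {x. \<bar>x\<bar> < \<bar>y\<bar>} x \<partial>G)"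
      using down by (intro nn_integral_cong) (auto split: split_indicator)
    also have "... = ind T y * emeasure G {x. \<bar>x\<bar> < \<bar>y\<bar>}" by (rule nn_integral_cmult_indicator) measurable
    finally show "emeasure G {x. \<bar>x\<bar> < \<bar>y\<bar>} * ind T y = (\<integral>\<^sup>+x. ?f y x \<partial>G)" by (simp only: mult.commute)
  qed
  have swap: "(\<integral>\<^sup>+y. (\<integral>\<^sup>+x. ?f y x \<partial>G) \<partial>G) = (\<integral>\<^sup>+x. (\<integral>\<^sup>+y. ?f y x \<partial>G) \<partial>G)"
    by (rule GG.Fubini') measurable
  have "2 * (\<integral>\<^sup>+y. (\<integral>\<^sup>+x. ?f y x \<partial>G) \<partial>G)
      = (\<integral>\<^sup>+y. (\<integral>\<^sup>+x. ?f y x \<partial>G) \<partial>G) + (\<integral>\<^sup>+y. (\<integral>\<^sup>+x. ?f x y \<partial>G) \<partial>G)"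
    using swap by (simp only: mult_2)
  also have "... = (\<integral>\<^sup>+y. (\<integral>\<^sup>+x. ?f y x + ?f x y \<partial>G) \<partial>G)" by (simp add: nn_integral_add)
  also have "... \<le> (\<integral>\<^sup>+y. (\<integral>\<^sup>+x. ind T x * ind T y \<partial>G) \<partial>G)"
    by (intro nn_integral_mono) (auto split: split_indicator)
  also have "... = (emeasure G T)\<^sup>2" by (simp add: nn_integral_multc nn_integral_cmult power2_eq_square)
  finally show ?thesis unfolding I .
qed

text \<open>The distribution function of the modulus is Lipschitz for a measure of bounded density, so it takes
  the value \<open>c\<close> at some point; below that point \<open>ranked_pairs_half\<close> is used, above it the
  minimum is \<open>c\<close>.\<close>
lemma ranked_pair_bound:
  fixes G :: "real measure"
  assumes sets [measurable_cong]: "sets G = sets borel" and p: "emeasure G UNIV = ennreal p" "0 \<le> p"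
    and r: "0 \<le> r" and conc: "\<And>A. A \<in> sets borel \<Longrightarrow> emeasure G A \<le> ennreal r * len A"
    and c: "0 \<le> c"
  shows "2 * (\<integral>\<^sup>+y. min (ennreal c) (emeasure G {x. \<bar>x\<bar> < \<bar>y\<bar>}) \<partial>G)
    \<le> ennreal (if c < p then 2 * c * p - c\<^sup>2 else p\<^sup>2)"
proof -
  have sp [simp]: "space G = UNIV" using sets_eq_imp_space_eq[OF sets] by simp
  interpret G: finite_measure G by (rule finite_measureI) (simp add: p)
  have mp: "measure G UNIV = p" using p by (simp add: measure_def)
  consider "p \<le> c" | "c = 0" "c < p" | "0 < c" "c < p" using c by linarith
  then show ?thesis
  proof cases
    case 1
    have "2 * (\<integral>\<^sup>+y. min (ennreal c) (emeasure G {x. \<bar>x\<bar> < \<bar>y\<bar>}) \<partial>G)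
        \<le> 2 * (\<integral>\<^sup>+y. emeasure G {x. \<bar>x\<bar> < \<bar>y\<bar>} * ind UNIV y \<partial>G)"
      by (intro mult_left_mono nn_integral_mono) auto
    also have "... \<le> (emeasure G UNIV)\<^sup>2" by (rule ranked_pairs_half[OF sets]) (auto intro: G.finite_measure_axioms)
    finally show ?thesis using 1 p by (simp add: ennreal_power)
  next
    case 2
    then show ?thesis by simp
  next
    case 3
    define F where "F t = measure G {x. \<bar>x\<bar> < t}" for t
    have "\<exists>t. F t = c"
    proof (rule lipschitz_ivt)
      fix x y :: real assume xy: "x \<le> y"
      have "{u. \<bar>u\<bar> < y} = {u. \<bar>u\<bar> < x} \<union> {u. x \<le> \<bar>u\<bar> \<and> \<bar>u\<bar> < y}" using xy by auto
      then have "F y = F x + measure G {u. x \<le> \<bar>u\<bar> \<and> \<bar>u\<bar> < y}"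
        unfolding F_def by (simp, intro G.finite_measure_Union) auto
      moreover have "measure G {u. x \<le> \<bar>u\<bar> \<and> \<bar>u\<bar> < y} \<le> 2 * r * (y - x)"
      proof -
        have "emeasure G {u. x \<le> \<bar>u\<bar> \<and> \<bar>u\<bar> < y} \<le> emeasure G ({-y..-x} \<union> {x..y})"
          by (intro emeasure_mono) (auto simp: abs_if split: if_splits)
        also have "... \<le> emeasure G {-y..-x} + emeasure G {x..y}" by (intro emeasure_subadditive) auto
        also have "... \<le> ennreal r * len {-y..-x} + ennreal r * len {x..y}" by (intro add_mono conc) auto
        also have "... = ennreal (2 * r * (y - x))" using xy r by (simp add: ennreal_mult[symmetric] ennreal_plus[symmetric] del: ennreal_plus)
        finally show ?thesis
          using xy r by (simp add: G.emeasure_eq_measure)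
      qed
      ultimately show "\<bar>F y - F x\<bar> \<le> 2 * r * (y - x)" by simp
    next
      have "F (- real n) = 0" for n
      proof -
        have "{x. \<bar>x\<bar> < - real n} = {}" by auto
        then show ?thesis by (simp add: F_def)
      qed
      then show "(\<lambda>n. F (- real n)) \<longlonglongrightarrow> 0" by simp
      have un: "(\<Union>n. {x. \<bar>x\<bar> < real n}) = UNIV" using reals_Archimedean2 by auto
      have "(\<lambda>n. measure G {x. \<bar>x\<bar> < real n}) \<longlonglongrightarrow> measure G (\<Union>n. {x. \<bar>x\<bar> < real n})"
        by (intro Lim_measure_incseq) (auto simp: incseq_def)
      then show "(\<lambda>n. F (real n)) \<longlonglongrightarrow> p" unfolding un mp by (simp add: F_def)
    qed (use 3 in auto)
    then obtain t where t: "measure G {x. \<bar>x\<bar> < t} = c" by (auto simp: F_def)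
    have far: "measure G {x. t \<le> \<bar>x\<bar>} = p - c"
    proof -
      have "measure G UNIV = measure G ({x. \<bar>x\<bar> < t} \<union> {x. t \<le> \<bar>x\<bar>})" by (intro arg_cong[where f = "measure G"]) auto
      also have "... = c + measure G {x. t \<le> \<bar>x\<bar>}" by (subst G.finite_measure_Union) (auto simp: t)
      finally show ?thesis by (simp add: mp)
    qed
    have "2 * (\<integral>\<^sup>+y. min (ennreal c) (emeasure G {x. \<bar>x\<bar> < \<bar>y\<bar>}) \<partial>G)
        \<le> 2 * (\<integral>\<^sup>+y. emeasure G {x. \<bar>x\<bar> < \<bar>y\<bar>} * ind {y. \<bar>y\<bar> < t} y
             + ennreal c * ind {y. t \<le> \<bar>y\<bar>} y \<partial>G)" by (intro mult_left_mono nn_integral_mono) (auto split: split_indicator)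
    also have "... = 2 * (\<integral>\<^sup>+y. emeasure G {x. \<bar>x\<bar> < \<bar>y\<bar>} * ind {y. \<bar>y\<bar> < t} y \<partial>G)
        + 2 * (ennreal c * emeasure G {y. t \<le> \<bar>y\<bar>})"
    proof (subst nn_integral_add)
      have "{p \<in> space (borel \<Otimes>\<^sub>M G). \<bar>snd p\<bar> < \<bar>fst p\<bar>} \<in> sets (borel \<Otimes>\<^sub>M G)" by measurable
      from G.measurable_emeasure_Pair[OF this]
      have "(\<lambda>y. emeasure G {x. \<bar>x\<bar> < \<bar>y\<bar>}) \<in> borel_measurable borel" by (simp add: space_pair_measure vimage_def)
      then show "(\<lambda>y. emeasure G {x. \<bar>x\<bar> < \<bar>y\<bar>} * ind {y. \<bar>y\<bar> < t} y) \<in> borel_measurable G" by measurable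
    qed (auto simp: nn_integral_cmult_indicator distrib_left)
    also have "... \<le> (emeasure G {y. \<bar>y\<bar> < t})\<^sup>2 + 2 * (ennreal c * emeasure G {y. t \<le> \<bar>y\<bar>})"
      by (intro add_right_mono ranked_pairs_half[OF sets]) (auto intro: G.finite_measure_axioms)
    also have "... = ennreal (c\<^sup>2 + 2 * (c * (p - c)))" using 3 by (simp add: G.emeasure_eq_measure t far ennreal_power ennreal_mult)
    also have "c\<^sup>2 + 2 * (c * (p - c)) = 2 * c * p - c\<^sup>2" by (simp add: power2_eq_square algebra_simps)
    finally show ?thesis using 3 by simp
  qed
qed

abbreviation tri :: "real \<Rightarrow> ennreal" where
  "tri x \<equiv> ennreal (p2 x)"

lemma p2_measurable [measurable]: "p2 \<in> borel_measurable borel"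
  unfolding p2_def[abs_def] by measurable

lemma symdec_tri: "symdec tri"
  unfolding symdec_def by (auto simp: p2_def intro!: ennreal_leI)

lemma tri_integral_symint:
  assumes c: "0 \<le> c" "c \<le> 1"
  shows "(LI x. tri x * ind (symint (ennreal c)) x) = ennreal (2 * c - c\<^sup>2)"
proof -
  have "(LI x. tri x * ind (symint (ennreal c)) x)
      = (LI y. (tri y * ind (symint (ennreal c)) y
          + tri (2 * 0 - y) * ind (symint (ennreal c)) (2 * 0 - y)) * ind {0<..} y)" by (rule nn_integral_fold) measurable
  also have "... = (LI y. ennreal (4 * (1 - 2 * y)) * ind {0..c / 2} y)"
  proof (intro nn_integral_cong_AE)
    show "AE y in lborel. (tri y * ind (symint (ennreal c)) y
          + tri (2 * 0 - y) * ind (symint (ennreal c)) (2 * 0 - y)) * ind {0<..} y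
        = ennreal (4 * (1 - 2 * y)) * ind {0..c / 2} y" using AE_lborel_singleton[of "0::real"] AE_lborel_singleton[of "c / 2"]
    proof eventually_elim
      fix y :: real assume "y \<noteq> 0" "y \<noteq> c / 2"
      then show "(tri y * ind (symint (ennreal c)) y
          + tri (2 * 0 - y) * ind (symint (ennreal c)) (2 * 0 - y)) * ind {0<..} y
        = ennreal (4 * (1 - 2 * y)) * ind {0..c / 2} y"
        using c by (auto simp: symint_ennreal p2_def ennreal_plus[symmetric] simp del: ennreal_plus split: split_indicator)
    qed
  qed
  also have "... = ennreal ((4 * (c / 2) - 4 * (c / 2)\<^sup>2) - (4 * 0 - 4 * 0\<^sup>2))"
    using c by (intro nn_integral_FTC_Icc[where F = "\<lambda>y. 4 * y - 4 * y\<^sup>2"]) (auto intro!: derivative_eq_intros)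
  also have "(4 * (c / 2) - 4 * (c / 2)\<^sup>2) - (4 * 0 - 4 * 0\<^sup>2) = 2 * c - c\<^sup>2" by (simp add: power2_eq_square)
  finally show ?thesis .
qed

lemma symint_1: "symint 1 = {- 1 / 2<..<1 / 2}"
  using symint_ennreal[of 1] by simp

lemma tri_mass: "(LI x. tri x) = 1"
proof -
  have "(LI x. tri x) = (LI x. tri x * ind (symint (ennreal 1)) x)" by (intro nn_integral_cong) (auto simp: symint_1 p2_def split: split_indicator)
  then show ?thesis using tri_integral_symint[of 1] by simp
qed

lemma tri_integral_symint_ge:
  assumes "0 \<le> c" "0 \<le> p" "p \<le> 1"
  shows "ennreal (if c < p then 2 * c * p - c\<^sup>2 else p\<^sup>2) \<le> (LI x. tri x * ind (symint (ennreal c)) x)"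
proof (cases "c \<le> 1")
  case True
  have "(if c < p then 2 * c * p - c\<^sup>2 else p\<^sup>2) \<le> 2 * c - c\<^sup>2"
  proof (cases "c < p")
    case True
    then show ?thesis using assms mult_left_mono[of p 1 "2 * c"] by simp
  next
    case False
    have "(1 - c)\<^sup>2 \<le> (1 - p)\<^sup>2" using False True by (intro power_mono) auto
    moreover have "p * p \<le> p * 1" using assms by (intro mult_left_mono) auto
    ultimately show ?thesis using False by (simp add: power2_eq_square algebra_simps)
  qed
  then show ?thesis using True assms by (simp add: tri_integral_symint ennreal_leI)
next
  case False
  have "(if c < p then 2 * c * p - c\<^sup>2 else p\<^sup>2) \<le> 1" using False assms by (simp add: power_le_one)
  then have "ennreal (if c < p then 2 * c * p - c\<^sup>2 else p\<^sup>2) \<le> ennreal 1" by (rule ennreal_leI)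
  also have "... = (LI x. tri x * ind (symint (ennreal 1)) x)" using tri_integral_symint[of 1] by simp
  also have "... \<le> (LI x. tri x * ind (symint (ennreal c)) x)"
    using False by (intro nn_integral_mono) (auto simp: symint_1 symint_ennreal split: split_indicator)
  finally show ?thesis .
qed

definition dominant_pair :: "real \<Rightarrow> real \<Rightarrow> real \<Rightarrow> real \<Rightarrow> bool" where
  "dominant_pair L R x y \<longleftrightarrow> \<bar>x\<bar> < \<bar>y\<bar> - L \<and> R < \<bar>y\<bar>"

lemma dominant_pair_measurable [measurable (raw)]:
  assumes [measurable]: "f \<in> borel_measurable M" "g \<in> borel_measurable M"
  shows "Measurable.pred M (\<lambda>x. dominant_pair L R (f x) (g x))"
  unfolding dominant_pair_def by measurable

text \<open>For fixed dominant half \<open>y\<close> the other half lies both in the preimage of \<open>B\<close>, whose length is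
  controlled by \<open>ser_preimage\<close>, and in \<open>\<bar>x\<bar> < \<bar>y\<bar>\<close>. The minimum of the two bounds, integrated over \<open>y\<close>,
  is at most what the triangular density gives to a centred interval.\<close>
lemma branch_concentration:
  fixes G :: "real measure"
  assumes sets [measurable_cong]: "sets G = sets borel" and p: "emeasure G UNIV \<le> 1"
    and r: "0 < r" and conc: "\<And>A. A \<in> sets borel \<Longrightarrow> emeasure G A \<le> ennreal r * len A"
    and L: "0 < L" and R: "0 < R" and s: "s = r * ((1 + exp (- 2 * L)) / tanh R)"
    and B [measurable]: "B \<in> sets borel"
  shows "(\<integral>\<^sup>+y. (\<integral>\<^sup>+x. (if (dominant_pair L R x y \<or> dominant_pair L R y x) \<and> s * ser x y \<in> B then 1 else 0) \<partial>G) \<partial>G)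
    \<le> (LI x. tri x * ind (symint (len B)) x)"
    (is "?lhs \<le> _")
proof -
  have sp [simp]: "space G = UNIV" using sets_eq_imp_space_eq[OF sets] by simp
  interpret G: finite_measure G by (rule finite_measureI) (use p in \<open>auto simp: top_unique\<close>)
  interpret GG: pair_sigma_finite G G ..
  define q where "q = measure G UNIV"
  have q: "emeasure G UNIV = ennreal q" "0 \<le> q" "q \<le> 1" using p by (auto simp: q_def G.emeasure_eq_measure)
  have "0 < 1 + exp (- 2 * L)" by (simp add: add_pos_pos)
  then have s0: "0 < s" using r R by (simp add: s)
  define B' where "B' = {z. s * z \<in> B}"
  have [measurable]: "B' \<in> sets borel" unfolding B'_def by measurable
  have scale: "len B = ennreal s * len B'"
  proof -
    have "len B = (LI x. ind B x)" by simp
    also have "... = ennreal s * (LI x. ind B (0 + s * x))" using s0 by (subst nn_integral_real_affine[where c = s and t = 0]) auto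
    also have "(LI x. ind B (0 + s * x)) = (LI x. ind B' x)" by (intro nn_integral_cong) (auto simp: B'_def split: split_indicator)
    finally show ?thesis by simp
  qed
  let ?d = "\<lambda>y x. (if dominant_pair L R x y \<and> ser x y \<in> B' then 1 else 0) :: ennreal"
  have dom: "(\<integral>\<^sup>+x. ?d y x \<partial>G) \<le> min (len B) (emeasure G {x. \<bar>x\<bar> < \<bar>y\<bar>})" for y
  proof (cases "R < \<bar>y\<bar>")
    case True
    let ?S = "{x. \<bar>x\<bar> < \<bar>y\<bar> - L \<and> ser x y \<in> B'}"
    have S [measurable]: "?S \<in> sets borel" by measurable
    have "(\<integral>\<^sup>+x. ?d y x \<partial>G) = (\<integral>\<^sup>+x. ind ?S x \<partial>G)"
      using True by (intro nn_integral_cong) (auto simp: dominant_pair_def split: split_indicator)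
    also have "... = emeasure G ?S" by simp
    finally have e: "(\<integral>\<^sup>+x. ?d y x \<partial>G) = emeasure G ?S" .
    have "emeasure G ?S \<le> ennreal r * len ?S" by (rule conc) measurable
    also have "... \<le> ennreal r * (ennreal ((1 + exp (- 2 * L)) / tanh R) * len B')" by (intro mult_left_mono ser_preimage L R True) auto
    also have "... = len B" using r R unfolding scale s by (simp add: mult.assoc[symmetric] ennreal_mult[symmetric] add_nonneg_nonneg)
    finally have "emeasure G ?S \<le> len B" .
    moreover have "emeasure G ?S \<le> emeasure G {x. \<bar>x\<bar> < \<bar>y\<bar>}" using L by (intro emeasure_mono) auto
    ultimately show ?thesis unfolding e by simp
  next
    case False
    then have "(\<integral>\<^sup>+x. ?d y x \<partial>G) = (\<integral>\<^sup>+x. 0 \<partial>G)"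
      by (intro nn_integral_cong) (auto simp: dominant_pair_def split: split_indicator)
    then show ?thesis by simp
  qed
  show ?thesis
  proof (cases "len B")
    case top
    have "?lhs \<le> (\<integral>\<^sup>+y. (\<integral>\<^sup>+x. 1 \<partial>G) \<partial>G)"
      by (intro nn_integral_mono) (auto split: split_indicator)
    also have "... = emeasure G UNIV * emeasure G UNIV" by simp
    also have "... \<le> 1 * 1" using p by (intro mult_mono) auto
    finally show ?thesis by (simp add: top symint_top tri_mass)
  next
    case (real c)
    have "?lhs \<le> (\<integral>\<^sup>+y. (\<integral>\<^sup>+x. ?d y x + ?d x y \<partial>G) \<partial>G)"
    proof (intro nn_integral_mono)
      fix x y :: real
      show "(if (dominant_pair L R x y \<or> dominant_pair L R y x) \<and> s * ser x y \<in> B then 1 else 0)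
          \<le> ?d y x + ?d x y" using ser_commute[of x y] by (auto simp: B'_def split: split_indicator)
    qed
    also have "... = (\<integral>\<^sup>+y. (\<integral>\<^sup>+x. ?d y x \<partial>G) + (\<integral>\<^sup>+x. ?d x y \<partial>G) \<partial>G)"
      by (intro nn_integral_cong nn_integral_add) measurable
    also have "... = (\<integral>\<^sup>+y. (\<integral>\<^sup>+x. ?d y x \<partial>G) \<partial>G) + (\<integral>\<^sup>+y. (\<integral>\<^sup>+x. ?d x y \<partial>G) \<partial>G)"
      by (rule nn_integral_add) measurable
    also have "(\<integral>\<^sup>+y. (\<integral>\<^sup>+x. ?d x y \<partial>G) \<partial>G) = (\<integral>\<^sup>+y. (\<integral>\<^sup>+x. ?d y x \<partial>G) \<partial>G)"
      by (rule GG.Fubini') measurable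
    also have "(\<integral>\<^sup>+y. (\<integral>\<^sup>+x. ?d y x \<partial>G) \<partial>G) + (\<integral>\<^sup>+y. (\<integral>\<^sup>+x. ?d y x \<partial>G) \<partial>G)
        = 2 * (\<integral>\<^sup>+y. (\<integral>\<^sup>+x. ?d y x \<partial>G) \<partial>G)" by (rule mult_2[symmetric])
    also have "... \<le> 2 * (\<integral>\<^sup>+y. min (ennreal c) (emeasure G {x. \<bar>x\<bar> < \<bar>y\<bar>}) \<partial>G)"
      using dom real by (intro mult_left_mono nn_integral_mono) auto
    also have "... \<le> ennreal (if c < q then 2 * c * q - c\<^sup>2 else q\<^sup>2)"
      using real r q by (intro ranked_pair_bound[OF sets _ _ _ conc]) auto
    also have "... \<le> (LI x. tri x * ind (symint (ennreal c)) x)" using real q by (intro tri_integral_symint_ge) auto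
    finally show ?thesis by (simp add: real)
  qed
qed


lemma abs_near_subset:
  "{x. \<bar>\<bar>x\<bar> - a\<bar> \<le> L} \<subseteq> {a - L..a + L} \<union> {- a - L..- a + L}" for a L :: real
  by (auto simp: abs_if split: if_splits)

type_synonym marked = "real \<times> bool"

abbreviation marked_space :: "marked measure" where
  "marked_space \<equiv> borel \<Otimes>\<^sub>M count_space UNIV"

abbreviation good_in :: "real set \<Rightarrow> marked set" where "good_in A \<equiv> {z. snd z \<and> fst z \<in> A}"

text \<open>The law of the real mark restricted to the event that the Boolean mark is true; it has total mass
  below \<open>1\<close> and is not renormalised.\<close>
definition good_part :: "marked measure \<Rightarrow> real measure" where
  "good_part M = distr (density M (\<lambda>z. ind {z. snd z} z)) borel fst"

locale marked_law =
  fixes M :: "marked measure"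
  assumes sets_M [measurable_cong]: "sets M = sets marked_space" and prob: "prob_space M"
begin

lemma sp [simp]: "space M = UNIV"
  using sets_eq_imp_space_eq[OF sets_M] by (simp add: space_pair_measure)

lemma fst_snd_measurable [measurable]: "fst \<in> M \<rightarrow>\<^sub>M borel" "snd \<in> M \<rightarrow>\<^sub>M count_space UNIV"
  unfolding measurable_cong_sets[OF sets_M refl] by measurable

lemma sets_good [measurable_cong]: "sets (good_part M) = sets borel"
  by (simp add: good_part_def)

lemma nn_integral_good:
  assumes [measurable]: "f \<in> borel_measurable borel"
  shows "(\<integral>\<^sup>+x. f x \<partial>good_part M) = (\<integral>\<^sup>+z. ind {z. snd z} z * f (fst z) \<partial>M)"
proof -
  have [measurable]: "fst \<in> density M (\<lambda>z. ind {z. snd z} z) \<rightarrow>\<^sub>M borel"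
    unfolding measurable_cong_sets[OF sets_density refl] by measurable
  have "(\<lambda>z. ind {z. snd z} z :: ennreal) \<in> borel_measurable M" by measurable
  then show ?thesis unfolding good_part_def
    by (subst nn_integral_distr) (auto simp: nn_integral_density)
qed

lemma emeasure_good:
  assumes [measurable]: "A \<in> sets borel"
  shows "emeasure (good_part M) A = emeasure M (good_in A)"
proof -
  have S: "(good_in A) \<in> sets M"
  proof -
    have "{z \<in> space M. snd z \<and> fst z \<in> A} \<in> sets M" by measurable
    then show ?thesis by simp
  qed
  have "emeasure (good_part M) A = (\<integral>\<^sup>+x. ind A x \<partial>good_part M)" by simp
  also have "... = (\<integral>\<^sup>+z. ind (good_in A) z \<partial>M)"
    by (subst nn_integral_good) (auto intro!: nn_integral_cong split: split_indicator)
  finally show ?thesis using S by simp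
qed

lemma mass_good: "emeasure (good_part M) UNIV \<le> 1"
  using prob by (simp add: emeasure_good prob_space.emeasure_le_1)

lemma bad_set: "{z. \<not> snd z} \<in> sets M"
proof -
  have "{z \<in> space M. \<not> snd z} \<in> sets M" by measurable
  then show ?thesis by simp
qed

end

definition branch_map :: "real \<Rightarrow> real \<Rightarrow> real \<Rightarrow> marked \<times> marked \<Rightarrow> marked" where
  "branch_map L R s = (\<lambda>(z, z'). (s * ser (fst z) (fst z'), snd z \<and> snd z' \<and>
     (dominant_pair L R (fst z) (fst z') \<or> dominant_pair L R (fst z') (fst z))))"

lemma branch_map_measurable [measurable]:
  "branch_map L R s \<in> marked_space \<Otimes>\<^sub>M marked_space \<rightarrow>\<^sub>M marked_space" unfolding branch_map_def by measurable

definition branch_law :: "real \<Rightarrow> real \<Rightarrow> real \<Rightarrow> marked measure \<Rightarrow> marked measure" where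
  "branch_law L R s M = distr (M \<Otimes>\<^sub>M M) marked_space (branch_map L R s)"

context marked_law begin

lemma branch_marked_law: "marked_law (branch_law L R s M)"
proof -
  interpret prob_space M by (rule prob)
  interpret P: pair_prob_space M M ..
  have "branch_map L R s \<in> M \<Otimes>\<^sub>M M \<rightarrow>\<^sub>M marked_space" by measurable
  from P.prob_space_distr[OF this] show ?thesis
    unfolding marked_law_def branch_law_def by simp
qed

lemma branch_law_conc:
  assumes r: "0 < r" and conc: "\<And>A. A \<in> sets borel \<Longrightarrow> emeasure M (good_in A) \<le> ennreal r * len A"
    and L: "0 < L" and R: "0 < R" and s: "s = r * ((1 + exp (- 2 * L)) / tanh R)"
  shows "conc_le (good_part (branch_law L R s M)) tri"
  unfolding conc_le_def
proof
  fix B :: "real set" assume B [measurable]: "B \<in> sets borel"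
  interpret prob_space M by (rule prob)
  interpret P: pair_prob_space M M ..
  interpret K: marked_law "branch_law L R s M" by (rule branch_marked_law)
  let ?G = "good_part M"
  let ?D = "\<lambda>y x. (if (dominant_pair L R x y \<or> dominant_pair L R y x) \<and> s * ser x y \<in> B then 1 else 0) :: ennreal"
  have bm: "branch_map L R s \<in> M \<Otimes>\<^sub>M M \<rightarrow>\<^sub>M marked_space" by measurable
  have fm: "(\<lambda>w. ind {z. snd z} w * ind B (fst w) :: ennreal) \<in> borel_measurable marked_space" by measurable
  have "emeasure (good_part (branch_law L R s M)) B = (\<integral>\<^sup>+w. ind {z. snd z} w * ind B (fst w) \<partial>branch_law L R s M)"
    using K.nn_integral_good[of "ind B"] by simp
  also have "... = (\<integral>\<^sup>+w. ind {z. snd z} (branch_map L R s w) * ind B (fst (branch_map L R s w)) \<partial>(M \<Otimes>\<^sub>M M))"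
    unfolding branch_law_def by (rule nn_integral_distr[OF bm]) (use fm in simp)
  also have "... = (\<integral>\<^sup>+z'. (\<integral>\<^sup>+z. ind {z. snd z} (branch_map L R s (z, z')) * ind B (fst (branch_map L R s (z, z'))) \<partial>M) \<partial>M)"
    by (rule P.nn_integral_snd[symmetric]) (rule measurable_compose[OF bm fm])
  also have "... = (\<integral>\<^sup>+z'. ind {z. snd z} z' * (\<integral>\<^sup>+z. ind {z. snd z} z * ?D (fst z') (fst z) \<partial>M) \<partial>M)"
  proof (rule nn_integral_cong)
    fix z'
    have "(\<integral>\<^sup>+z. ind {z. snd z} (branch_map L R s (z, z')) * ind B (fst (branch_map L R s (z, z'))) \<partial>M)
        = (\<integral>\<^sup>+z. ind {z. snd z} z' * (ind {z. snd z} z * ?D (fst z') (fst z)) \<partial>M)"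
      by (intro nn_integral_cong) (auto simp: branch_map_def split: split_indicator)
    also have "... = ind {z. snd z} z' * (\<integral>\<^sup>+z. ind {z. snd z} z * ?D (fst z') (fst z) \<partial>M)"
      by (rule nn_integral_cmult) measurable
    finally show "(\<integral>\<^sup>+z. ind {z. snd z} (branch_map L R s (z, z')) * ind B (fst (branch_map L R s (z, z'))) \<partial>M)
        = ind {z. snd z} z' * (\<integral>\<^sup>+z. ind {z. snd z} z * ?D (fst z') (fst z) \<partial>M)" .
  qed
  also have "... = (\<integral>\<^sup>+z'. ind {z. snd z} z' * (\<integral>\<^sup>+x. ?D (fst z') x \<partial>?G) \<partial>M)"
    by (subst nn_integral_good) auto
  also have "... = (\<integral>\<^sup>+y. (\<integral>\<^sup>+x. ?D y x \<partial>?G) \<partial>?G)"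
  proof (rule nn_integral_good[symmetric])
    interpret G: finite_measure ?G
      using mass_good sets_eq_imp_space_eq[OF sets_good] by (intro finite_measureI) (auto simp: top_unique)
    show "(\<lambda>y. \<integral>\<^sup>+x. ?D y x \<partial>?G) \<in> borel_measurable borel" by measurable
  qed
  also have "... \<le> (LI x. tri x * ind (symint (len B)) x)"
    by (rule branch_concentration[OF sets_good mass_good r _ L R s B]) (auto simp: emeasure_good conc)
  finally show "emeasure (good_part (branch_law L R s M)) B
    \<le> (LI x. tri x * ind (symint (len B)) x)" .
qed

text \<open>A branch is bad if one half is bad (twice \<open>w\<close>), if both moduli are at most \<open>R\<close>, or if the moduli
  differ by at most \<open>L\<close>; the last two events are bounded with the concentration of the good halves.\<close>
lemma branch_law_bad:
  assumes r: "0 \<le> r" and conc: "\<And>A. A \<in> sets borel \<Longrightarrow> emeasure M (good_in A) \<le> ennreal r * len A"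
    and w: "0 \<le> w" and wbad: "emeasure M {z. \<not> snd z} \<le> ennreal w"
    and L: "0 < L" and R: "0 < R"
  shows "emeasure (branch_law L R s M) {z. \<not> snd z} \<le> ennreal (2 * w + (2 * r * R)\<^sup>2 + 4 * r * L)"
proof -
  interpret prob_space M by (rule prob)
  interpret P: pair_prob_space M M ..
  interpret K: marked_law "branch_law L R s M" by (rule branch_marked_law)
  have bm: "branch_map L R s \<in> M \<Otimes>\<^sub>M M \<rightarrow>\<^sub>M marked_space" by measurable
  have spp [simp]: "space (M \<Otimes>\<^sub>M M) = UNIV" by (simp add: space_pair_measure)
  define bad where "bad z = (if snd z then 0 else 1 :: ennreal)" for z :: marked
  define small where "small z = (if snd z \<and> \<bar>fst z\<bar> \<le> R then 1 else 0 :: ennreal)" for z :: marked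
  define close where "close z z' = (if snd z \<and> \<bar>\<bar>fst z\<bar> - \<bar>fst z'\<bar>\<bar> \<le> L then 1 else 0 :: ennreal)" for z z' :: marked
  have [measurable]: "bad \<in> borel_measurable M" "small \<in> borel_measurable M"
    "(\<lambda>p. close (fst p) (snd p)) \<in> borel_measurable (M \<Otimes>\<^sub>M M)"
    unfolding bad_def[abs_def] small_def[abs_def] close_def[abs_def] by measurable
  let ?b1 = "\<lambda>p. bad (fst p)"
  let ?b2 = "\<lambda>p. bad (snd p)"
  let ?b3 = "\<lambda>p. small (fst p) * small (snd p)"
  let ?b4 = "\<lambda>p. close (fst p) (snd p)"
  have m1: "?b1 \<in> borel_measurable (M \<Otimes>\<^sub>M M)" "?b2 \<in> borel_measurable (M \<Otimes>\<^sub>M M)"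
    "?b3 \<in> borel_measurable (M \<Otimes>\<^sub>M M)" "?b4 \<in> borel_measurable (M \<Otimes>\<^sub>M M)" by measurable
  have good_set: "(good_in A) \<in> sets M" if [measurable]: "A \<in> sets borel" for A
  proof -
    have "{z \<in> space M. snd z \<and> fst z \<in> A} \<in> sets M" by measurable
    then show ?thesis by simp
  qed
  have int_bad: "(\<integral>\<^sup>+z. bad z \<partial>M) = emeasure M {z. \<not> snd z}"
  proof -
    have "(\<integral>\<^sup>+z. bad z \<partial>M) = (\<integral>\<^sup>+z. ind {z. \<not> snd z} z \<partial>M)"
      by (rule nn_integral_cong) (simp add: bad_def)
    then show ?thesis using bad_set by simp
  qed
  have int_small: "(\<integral>\<^sup>+z. small z \<partial>M) = emeasure M {z. snd z \<and> fst z \<in> {-R..R}}"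
  proof -
    have "(\<integral>\<^sup>+z. small z \<partial>M) = (\<integral>\<^sup>+z. ind {z. snd z \<and> fst z \<in> {-R..R}} z \<partial>M)"
    proof (rule nn_integral_cong)
      fix z show "small z = ind {z. snd z \<and> fst z \<in> {-R..R}} z"
        by (cases "snd z \<and> \<bar>fst z\<bar> \<le> R") (auto simp: small_def abs_le_iff)
    qed
    then show ?thesis using good_set[of "{-R..R}"] by simp
  qed
  have fm: "(\<lambda>w. ind {z. \<not> snd z} w :: ennreal) \<in> borel_measurable marked_space" by measurable
  have geometry: "(a \<le> R \<and> a' \<le> R) \<or> \<bar>a - a'\<bar> \<le> L"
    if "\<not> (a < a' - L \<and> R < a')" "\<not> (a' < a - L \<and> R < a)" for a a' :: real using that L by (cases "a \<le> a'") auto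
  have "emeasure (branch_law L R s M) {z. \<not> snd z} = (\<integral>\<^sup>+w. ind {z. \<not> snd z} w \<partial>branch_law L R s M)"
    using K.bad_set by simp
  also have "... = (\<integral>\<^sup>+w. ind {z. \<not> snd z} (branch_map L R s w) \<partial>(M \<Otimes>\<^sub>M M))"
    unfolding branch_law_def by (rule nn_integral_distr[OF bm]) (use fm in simp)
  also have "... \<le> (\<integral>\<^sup>+p. ((?b1 p + ?b2 p) + ?b3 p) + ?b4 p \<partial>(M \<Otimes>\<^sub>M M))"
  proof (rule nn_integral_mono)
    fix p :: "marked \<times> marked"
    obtain z z' where p: "p = (z, z')" by (cases p)
    show "ind {z. \<not> snd z} (branch_map L R s p) \<le> ((?b1 p + ?b2 p) + ?b3 p) + ?b4 p"
    proof (cases "snd (branch_map L R s p)")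
      case False
      then consider "\<not> snd z" | "\<not> snd z'"
        | "snd z" "snd z'" "\<bar>fst z\<bar> \<le> R" "\<bar>fst z'\<bar> \<le> R"
        | "snd z" "\<bar>\<bar>fst z\<bar> - \<bar>fst z'\<bar>\<bar> \<le> L"
        using geometry[of "\<bar>fst z\<bar>" "\<bar>fst z'\<bar>"] by (auto simp: branch_map_def dominant_pair_def p)
      then have "?b1 p = 1 \<or> ?b2 p = 1 \<or> ?b3 p = 1 \<or> ?b4 p = 1" by cases (auto simp: p bad_def small_def close_def)
      moreover have "ind {z. \<not> snd z} (branch_map L R s p) \<le> (1 :: ennreal)" by (auto split: split_indicator)
      ultimately show ?thesis by (auto intro: order.trans add_increasing add_increasing2)
    qed simp
  qed
  also have "... = (((\<integral>\<^sup>+p. ?b1 p \<partial>(M \<Otimes>\<^sub>M M)) + (\<integral>\<^sup>+p. ?b2 p \<partial>(M \<Otimes>\<^sub>M M))) + (\<integral>\<^sup>+p. ?b3 p \<partial>(M \<Otimes>\<^sub>M M)))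
      + (\<integral>\<^sup>+p. ?b4 p \<partial>(M \<Otimes>\<^sub>M M))" using m1 by (simp add: nn_integral_add)
  also have "(\<integral>\<^sup>+p. ?b1 p \<partial>(M \<Otimes>\<^sub>M M)) = emeasure M {z. \<not> snd z}"
    using m1 by (subst nn_integral_fst[symmetric]) (auto simp: emeasure_space_1[simplified] int_bad)
  also have "(\<integral>\<^sup>+p. ?b2 p \<partial>(M \<Otimes>\<^sub>M M)) = emeasure M {z. \<not> snd z}"
    using m1 by (subst nn_integral_fst[symmetric]) (auto simp: emeasure_space_1[simplified] int_bad)
  also have "(\<integral>\<^sup>+p. ?b3 p \<partial>(M \<Otimes>\<^sub>M M)) \<le> ennreal (2 * r * R) * ennreal (2 * r * R)"
  proof -
    have "(\<integral>\<^sup>+p. ?b3 p \<partial>(M \<Otimes>\<^sub>M M)) = emeasure M {z. snd z \<and> fst z \<in> {-R..R}} * emeasure M {z. snd z \<and> fst z \<in> {-R..R}}"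
      using m1 by (subst nn_integral_fst[symmetric]) (auto simp: nn_integral_cmult nn_integral_multc int_small)
    also have "... \<le> (ennreal r * len {-R..R}) * (ennreal r * len {-R..R})" by (intro mult_mono conc) auto
    also have "ennreal r * len {-R..R} = ennreal (2 * r * R)" using R r by (simp add: ennreal_mult[symmetric])
    finally show ?thesis .
  qed
  also have "(\<integral>\<^sup>+p. ?b4 p \<partial>(M \<Otimes>\<^sub>M M)) \<le> ennreal (4 * r * L)"
  proof -
    have "(\<integral>\<^sup>+p. ?b4 p \<partial>(M \<Otimes>\<^sub>M M)) = (\<integral>\<^sup>+z'. (\<integral>\<^sup>+z. close z z' \<partial>M) \<partial>M)"
      using m1(4) by (subst P.nn_integral_snd[symmetric]) auto
    also have "... \<le> (\<integral>\<^sup>+z'. ennreal (4 * r * L) \<partial>M)"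
    proof (rule nn_integral_mono)
      fix z' :: marked
      let ?a = "\<bar>fst z'\<bar>"
      let ?A = "{?a - L..?a + L} \<union> {- ?a - L..- ?a + L}"
      have "(\<integral>\<^sup>+z. close z z' \<partial>M) \<le> (\<integral>\<^sup>+z. ind {z. snd z \<and> fst z \<in> ?A} z \<partial>M)"
        using abs_near_subset[of ?a L] by (intro nn_integral_mono) (auto simp: close_def split: split_indicator)
      also have "... = emeasure M {z. snd z \<and> fst z \<in> ?A}" using good_set[of ?A] by simp
      also have "... \<le> ennreal r * len ?A" by (rule conc) simp
      also have "... \<le> ennreal r * (len {?a - L..?a + L} + len {- ?a - L..- ?a + L})" by (intro mult_left_mono emeasure_subadditive) auto
      also have "... = ennreal r * ennreal (4 * L)" using L by (simp add: ennreal_plus[symmetric] del: ennreal_plus)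
      also have "... = ennreal (4 * r * L)" using L r by (simp add: ennreal_mult[symmetric] mult_ac)
      finally show "(\<integral>\<^sup>+z. close z z' \<partial>M) \<le> ennreal (4 * r * L)" .
    qed
    also have "... = ennreal (4 * r * L)" by (simp add: emeasure_space_1[simplified])
    finally show ?thesis .
  qed
  finally have "emeasure (branch_law L R s M) {z. \<not> snd z}
      \<le> ((emeasure M {z. \<not> snd z} + emeasure M {z. \<not> snd z}) + ennreal (2 * r * R) * ennreal (2 * r * R)) + ennreal (4 * r * L)"
    by (simp add: add_mono)
  also have "... \<le> ((ennreal w + ennreal w) + ennreal (2 * r * R) * ennreal (2 * r * R)) + ennreal (4 * r * L)" by (intro add_mono wbad) auto
  also have "... = ennreal (2 * w + (2 * r * R)\<^sup>2 + 4 * r * L)"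
    using r w L R by (simp add: ennreal_mult[symmetric] ennreal_plus[symmetric] power2_eq_square del: ennreal_plus)
  finally show ?thesis .
qed

end

section \<open>Parallel branches\<close>

primrec tri_power :: "nat \<Rightarrow> real \<Rightarrow> ennreal" where
  "tri_power 0 = tri"
| "tri_power (Suc k) = nconv tri (tri_power k)"



lemma tri_power_props:
  "symdec (tri_power k)" "(LI x. tri_power k x) = 1"
proof (induction k)
  case 0
  show "symdec (tri_power 0)" "(LI x. tri_power 0 x) = 1" by (simp_all add: symdec_tri tri_mass)
next
  case (Suc k)
  note [measurable] = symdecD(1)[OF Suc(1)]
  show "symdec (tri_power (Suc k))" unfolding tri_power.simps by (rule symdec_nconv[OF symdec_tri Suc(1)]) (simp add: tri_mass)
  show "(LI x. tri_power (Suc k) x) = 1" unfolding tri_power.simps by (subst nconv_mass) (simp_all add: tri_mass Suc)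
qed

lemmas tri_power_measurable [measurable] = symdecD(1)[OF tri_power_props(1)]

lemma tri_power_eq:
  "(convolve p2 ^^ k) p2 \<in> borel_measurable borel \<and>
   (\<forall>x. 0 \<le> (convolve p2 ^^ k) p2 x \<and> (convolve p2 ^^ k) p2 x \<le> 2 \<and>
        tri_power k x = ennreal ((convolve p2 ^^ k) p2 x))"
proof (induction k)
  case 0
  have "(\<lambda>x. p2 x) \<in> borel_measurable borel" by measurable
  then show ?case by (auto simp: p2_def)
next
  case (Suc k)
  define F where "F = (convolve p2 ^^ k) p2"
  have F [measurable]: "F \<in> borel_measurable borel" and F0: "0 \<le> F x" and F2: "F x \<le> 2"
    and FT: "tri_power k x = ennreal (F x)" for x
    using Suc by (auto simp: F_def)
  have step: "(convolve p2 ^^ Suc k) p2 = convolve p2 F" by (simp add: F_def)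
  have p20: "0 \<le> p2 x" for x by (simp add: p2_def)
  have intp: "integrable lborel p2" by (rule integrableI_nonneg) (auto simp: p20 tri_mass)
  have eq: "tri_power (Suc k) x = ennreal (convolve p2 F x)" and nn: "0 \<le> convolve p2 F x" for x
  proof -
    have "integrable lborel (\<lambda>y. p2 y * F (x - y))"
    proof (rule Bochner_Integration.integrable_bound)
      show "integrable lborel (\<lambda>y. p2 y * 2)" using intp by simp
      show "AE y in lborel. norm (p2 y * F (x - y)) \<le> norm (p2 y * 2)" using F0 F2 p20 by (auto simp: abs_mult intro!: mult_left_mono)
    qed measurable
    then have "(LI y. ennreal (p2 y * F (x - y))) = ennreal (convolve p2 F x)"
      unfolding convolve_def by (rule nn_integral_eq_integral) (simp add: p20 F0)
    then show "tri_power (Suc k) x = ennreal (convolve p2 F x)" by (simp add: nconv_def FT p20 ennreal_mult F0)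
    show "0 \<le> convolve p2 F x" unfolding convolve_def by (rule integral_nonneg_AE) (simp add: p20 F0)
  qed
  have "convolve p2 F x \<le> 2" for x
  proof -
    have "ennreal (convolve p2 F x) \<le> (LI y. tri y * ennreal 2)" unfolding eq[symmetric] tri_power.simps nconv_def FT
      by (intro nn_integral_mono mult_left_mono ennreal_leI F2) auto
    also have "... = ennreal 2" by (subst nn_integral_multc) (auto simp: tri_mass)
    finally show ?thesis by (subst (asm) ennreal_le_iff) auto
  qed
  moreover have "convolve p2 F \<in> borel_measurable borel"
  proof -
    have "(\<lambda>x. enn2real (tri_power (Suc k) x)) \<in> borel_measurable borel" by measurable
    then show ?thesis by (simp only: eq nn enn2real_ennreal)
  qed
  ultimately show ?case unfolding step using eq nn by auto
qed

lemma kappa_tri_power: "1 \<le> g \<Longrightarrow> ennreal (kappa g) = tri_power (g - 1) 0"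
  and kappa_nonneg: "0 \<le> kappa g"
  using tri_power_eq[of "g - 1"] by (auto simp: kappa_def)

definition num_good :: "nat \<Rightarrow> (nat \<Rightarrow> marked) \<Rightarrow> nat" where
  "num_good j z = (\<Sum>i<j. of_bool (snd (z i)))"

definition total_sum :: "nat \<Rightarrow> (nat \<Rightarrow> marked) \<Rightarrow> real" where
  "total_sum j z = (\<Sum>i<j. fst (z i))"

context marked_law begin

abbreviation "branches j \<equiv> PiM {..<j} (\<lambda>_::nat. M)"

definition partial_law :: "nat \<Rightarrow> nat \<Rightarrow> real measure" where
  "partial_law j g = distr (density (branches j)
     (\<lambda>z. if num_good j z = g then 1 else 0)) borel (total_sum j)"


lemma total_sum_measurable: "total_sum j \<in> branches j \<rightarrow>\<^sub>M borel"
  unfolding total_sum_def[abs_def]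
proof (rule borel_measurable_sum)
  fix i assume "i \<in> {..<j}"
  then show "(\<lambda>z. fst (z i)) \<in> borel_measurable (branches j)" by measurable
qed

lemma count_measurable:
  "(\<lambda>z. if num_good j z = g then 1 else 0 :: ennreal) \<in> borel_measurable (branches j)"
proof -
  have "num_good j \<in> branches j \<rightarrow>\<^sub>M count_space UNIV" unfolding num_good_def[abs_def]
  proof (rule measurable_sum_nat)
    fix i assume "i \<in> {..<j}"
    then have "(\<lambda>z. snd (z i)) \<in> branches j \<rightarrow>\<^sub>M count_space UNIV" by measurable
    from measurable_compose[OF this, of of_bool "count_space UNIV"]
    show "(\<lambda>z. of_bool (snd (z i)) :: nat) \<in> branches j \<rightarrow>\<^sub>M count_space UNIV" by simp
  qed
  from measurable_compose[OF this, of "\<lambda>k. if k = g then 1 else 0 :: ennreal" borel]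
  show ?thesis by simp
qed

lemma sets_partial [measurable_cong]: "sets (partial_law j g) = sets borel"
  by (simp add: partial_law_def)

lemma space_partial [simp]: "space (partial_law j g) = UNIV"
  by (simp add: partial_law_def)

lemma nn_integral_partial:
  assumes f: "f \<in> borel_measurable borel"
  shows "(\<integral>\<^sup>+x. f x \<partial>partial_law j g) = (\<integral>\<^sup>+z. (if num_good j z = g then 1 else 0)
    * f (total_sum j z) \<partial>branches j)" unfolding partial_law_def
  using total_sum_measurable count_measurable f
  by (subst nn_integral_distr) (auto simp: measurable_cong_sets[OF sets_density refl] nn_integral_density)

lemma partial_mass: "emeasure (partial_law j g) A \<le> 1"
proof -
  interpret prob_space M by (rule prob)
  interpret P: prob_space "branches j" by (intro prob_space_PiM prob)
  have "emeasure (partial_law j g) A \<le> emeasure (partial_law j g) UNIV" by (intro emeasure_mono) (auto simp: sets_partial)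
  also have "... = (\<integral>\<^sup>+x. 1 \<partial>partial_law j g)" by simp
  also have "... = (\<integral>\<^sup>+z. (if num_good j z = g then 1 else 0) * 1 \<partial>branches j)" by (rule nn_integral_partial) simp
  also have "... \<le> (\<integral>\<^sup>+z. 1 \<partial>branches j)" by (intro nn_integral_mono) auto
  also have "... = 1" by (simp add: P.emeasure_space_1)
  finally show ?thesis .
qed

text \<open>Conditioning on the newest branch: if it is good it contributes one summand and one to the count of
  good branches, if it is bad its value is an arbitrary shift, which does not change lengths of sets.\<close>
lemma nn_integral_partial_Suc:
  assumes f [measurable]: "f \<in> borel_measurable borel"
  shows "(\<integral>\<^sup>+x. f x \<partial>partial_law (Suc j) g) =
    (\<integral>\<^sup>+y. (if snd y then if g = 0 then 0 else \<integral>\<^sup>+b. f (fst y + b) \<partial>partial_law j (g - 1)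
            else \<integral>\<^sup>+b. f (fst y + b) \<partial>partial_law j g) \<partial>M)"
proof -
  interpret prob_space M by (rule prob)
  interpret product_sigma_finite "\<lambda>_::nat. M" by unfold_locales
  let ?F = "\<lambda>j g z. (if num_good j z = g then 1 else 0) * f (total_sum j z) :: ennreal"
  have Fm: "?F j g \<in> borel_measurable (branches j)" for j g
    by (rule borel_measurable_times_ennreal[OF count_measurable measurable_compose[OF total_sum_measurable f]])
  have updc: "num_good (Suc j) (z(j := y)) = num_good j z + of_bool (snd y)"
    and updt: "total_sum (Suc j) (z(j := y)) = total_sum j z + fst y" for z y
  proof -
    have "(\<Sum>i<j. of_bool (snd ((z(j := y)) i)) :: nat) = (\<Sum>i<j. of_bool (snd (z i)))"
      "(\<Sum>i<j. fst ((z(j := y)) i)) = (\<Sum>i<j. fst (z i))" by (auto intro!: sum.cong)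
    then show "num_good (Suc j) (z(j := y)) = num_good j z + of_bool (snd y)"
      "total_sum (Suc j) (z(j := y)) = total_sum j z + fst y" unfolding num_good_def total_sum_def by (simp_all only: sum.lessThan_Suc fun_upd_same)
  qed
  have "(\<integral>\<^sup>+x. f x \<partial>partial_law (Suc j) g) = (\<integral>\<^sup>+z. ?F (Suc j) g z \<partial>branches (Suc j))"
    by (rule nn_integral_partial[OF f])
  also have "... = (\<integral>\<^sup>+y. (\<integral>\<^sup>+z. ?F (Suc j) g (z(j := y)) \<partial>branches j) \<partial>M)"
    unfolding lessThan_Suc using Fm[of "Suc j" g, unfolded lessThan_Suc]
    by (intro product_nn_integral_insert_rev) auto
  also have "... = (\<integral>\<^sup>+y. (if snd y then if g = 0 then 0 else \<integral>\<^sup>+b. f (fst y + b) \<partial>partial_law j (g - 1)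
            else \<integral>\<^sup>+b. f (fst y + b) \<partial>partial_law j g) \<partial>M)"
  proof (rule nn_integral_cong)
    fix y :: marked
    have e: "?F (Suc j) g (z(j := y)) = (if num_good j z + of_bool (snd y) = g then 1 else 0)
        * f (fst y + total_sum j z)" for z by (simp only: updc updt add.commute[of _ "fst y"])
    have p: "(\<integral>\<^sup>+b. f (fst y + b) \<partial>partial_law j g') = (\<integral>\<^sup>+z. (if num_good j z = g' then 1 else 0)
      * f (fst y + total_sum j z) \<partial>branches j)" for g' by (rule nn_integral_partial) measurable
    show "(\<integral>\<^sup>+z. ?F (Suc j) g (z(j := y)) \<partial>branches j)
        = (if snd y then if g = 0 then 0 else \<integral>\<^sup>+b. f (fst y + b) \<partial>partial_law j (g - 1)
            else \<integral>\<^sup>+b. f (fst y + b) \<partial>partial_law j g)" unfolding e p by (cases g; cases "snd y") simp_all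
  qed
  finally show ?thesis .
qed

lemma partial_law_0: "1 \<le> g \<Longrightarrow> emeasure (partial_law 0 g) A = 0"
proof -
  assume "1 \<le> g"
  then have "(\<integral>\<^sup>+x. 1 \<partial>partial_law 0 g) = 0" by (subst nn_integral_partial) (auto simp: num_good_def)
  then have "emeasure (partial_law 0 g) UNIV = 0" by simp
  moreover have "emeasure (partial_law 0 g) A \<le> emeasure (partial_law 0 g) UNIV" by (intro emeasure_mono) (auto simp: sets_partial)
  ultimately show ?thesis by simp
qed

lemma emeasure_shift:
  fixes B :: "real set"
  assumes [measurable]: "B \<in> sets borel"
  shows "{b. a + b \<in> B} \<in> sets borel" "len {b. a + b \<in> B} = len B"
proof -
  show S [measurable]: "{b. a + b \<in> B} \<in> sets borel" by measurable
  have "len B = (LI x. ind B x)" by simp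
  also have "... = (LI x. ind B (a + 1 * x))" by (subst nn_integral_real_affine[where c = 1 and t = a]) auto
  also have "... = (LI x. ind {b. a + b \<in> B} x)" by (intro nn_integral_cong) (auto split: split_indicator)
  finally show "len {b. a + b \<in> B} = len B" by simp
qed

text \<open>Induction on the number \<open>j\<close> of branches. A good branch convolves with the triangular density
  (\<open>conc_le_convolution\<close>), a bad one multiplies the mass by at most \<open>v\<close> and translates; Pascal's rule
  collects the binomial coefficients.\<close>
lemma partial_law_bounds:
  assumes v: "0 \<le> v" and bad: "emeasure M {z. \<not> snd z} \<le> ennreal v" and conc: "conc_le (good_part M) tri"
  shows "emeasure (partial_law j 0) UNIV \<le> ennreal (v ^ j) \<and>
    (\<forall>g\<ge>1. conc_le (partial_law j g) (\<lambda>x. ennreal (real (j choose g) * v ^ (j - g)) * tri_power (g - 1) x))"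
proof (induction j)
  case 0
  show ?case using partial_mass by (auto simp: conc_le_def partial_law_0)
next
  case (Suc j)
  interpret prob_space M by (rule prob)
  let ?c = "\<lambda>j g. real (j choose g) * v ^ (j - g)"
  have shift: "(\<integral>\<^sup>+b. ind B (a + b) \<partial>partial_law j g) = emeasure (partial_law j g) {b. a + b \<in> B}"
    if [measurable]: "B \<in> sets borel" for a B j g
  proof -
    have "(\<integral>\<^sup>+b. ind B (a + b) \<partial>partial_law j g) = (\<integral>\<^sup>+b. ind {b. a + b \<in> B} b \<partial>partial_law j g)"
      by (intro nn_integral_cong) (auto split: split_indicator)
    then show ?thesis using emeasure_shift(1)[OF that, of a] by (simp add: sets_partial)
  qed
  have badint: "(\<integral>\<^sup>+y. (if snd y then 0 else C) \<partial>M) \<le> ennreal v * C" for C :: ennreal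
  proof -
    have "(\<integral>\<^sup>+y. (if snd y then 0 else C) \<partial>M) = (\<integral>\<^sup>+y. C * ind {z. \<not> snd z} y \<partial>M)"
      by (intro nn_integral_cong) auto
    also have "... = C * emeasure M {z. \<not> snd z}" using bad_set by (simp add: nn_integral_cmult_indicator)
    also have "... \<le> C * ennreal v" using bad by (intro mult_left_mono) auto
    finally show ?thesis by (simp add: mult.commute)
  qed
  have "emeasure (partial_law (Suc j) 0) UNIV = (\<integral>\<^sup>+x. 1 \<partial>partial_law (Suc j) 0)" by simp
  also have "... = (\<integral>\<^sup>+y. (if snd y then 0 else emeasure (partial_law j 0) UNIV) \<partial>M)"
    by (subst nn_integral_partial_Suc) (auto intro!: nn_integral_cong)
  also have "... \<le> ennreal v * emeasure (partial_law j 0) UNIV" by (rule badint)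
  also have "... \<le> ennreal v * ennreal (v ^ j)" using Suc by (intro mult_left_mono) auto
  also have "... = ennreal (v ^ Suc j)" using v by (simp add: ennreal_mult)
  finally have none: "emeasure (partial_law (Suc j) 0) UNIV \<le> ennreal (v ^ Suc j)" .
  have "conc_le (partial_law (Suc j) g) (\<lambda>x. ennreal (?c (Suc j) g) * tri_power (g - 1) x)" if g: "1 \<le> g" for g unfolding conc_le_def
  proof
    fix B :: "real set" assume B [measurable]: "B \<in> sets borel"
    define Q where "Q = (LI x. tri_power (g - 1) x * ind (symint (len B)) x)"
    interpret G: finite_measure "good_part M" using mass_good sets_eq_imp_space_eq[OF sets_good] by (intro finite_measureI) (auto simp: top_unique)
    interpret N: finite_measure "partial_law j h" for h using partial_mass[of j h UNIV] by (intro finite_measureI) (auto simp: top_unique)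
    interpret GN: pair_sigma_finite "good_part M" "partial_law j h" for h ..
    have pull: "(LI x. ennreal C * tri_power h x * ind (symint (len B)) x)
        = ennreal C * (LI x. tri_power h x * ind (symint (len B)) x)" for C h by (subst nn_integral_cmult[symmetric]) (auto simp: mult.assoc)
    have good: "(\<integral>\<^sup>+y. (if snd y then \<integral>\<^sup>+b. ind B (fst y + b) \<partial>partial_law j (g - 1) else 0) \<partial>M)
        \<le> ennreal (?c j (g - 1)) * Q"
    proof -
      have "(\<integral>\<^sup>+y. (if snd y then \<integral>\<^sup>+b. ind B (fst y + b) \<partial>partial_law j (g - 1) else 0) \<partial>M)
          = (\<integral>\<^sup>+y. ind {z. snd z} y * (\<integral>\<^sup>+b. ind B (fst y + b) \<partial>partial_law j (g - 1)) \<partial>M)"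
        by (intro nn_integral_cong) auto
      also have "... = (\<integral>\<^sup>+a. (\<integral>\<^sup>+b. ind B (a + b) \<partial>partial_law j (g - 1)) \<partial>good_part M)"
        by (rule nn_integral_good[symmetric]) measurable
      also have "... \<le> ennreal (?c j (g - 1)) * Q"
      proof (cases "g = 1")
        case True
        have "(\<integral>\<^sup>+a. (\<integral>\<^sup>+b. ind B (a + b) \<partial>partial_law j (g - 1)) \<partial>good_part M)
            = (\<integral>\<^sup>+b. (\<integral>\<^sup>+a. ind B (a + b) \<partial>good_part M) \<partial>partial_law j (g - 1))"
          by (rule GN.Fubini'[symmetric]) measurable
        also have "... \<le> (\<integral>\<^sup>+b. Q \<partial>partial_law j (g - 1))"
        proof (rule nn_integral_mono)
          fix b
          have "(\<integral>\<^sup>+a. ind B (a + b) \<partial>good_part M) = (\<integral>\<^sup>+a. ind {a. b + a \<in> B} a \<partial>good_part M)"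
            by (intro nn_integral_cong) (auto simp: add.commute split: split_indicator)
          also have "... = emeasure (good_part M) {a. b + a \<in> B}" using emeasure_shift(1)[OF B, of b] by (simp add: sets_good)
          also have "... \<le> Q" using conc[unfolded conc_le_def, rule_format, OF emeasure_shift(1)[OF B, of b]] True
            by (simp add: emeasure_shift(2) Q_def)
          finally show "(\<integral>\<^sup>+a. ind B (a + b) \<partial>good_part M) \<le> Q" .
        qed
        also have "... = Q * emeasure (partial_law j 0) UNIV" using True by simp
        also have "... \<le> Q * ennreal (v ^ j)" using Suc by (intro mult_left_mono) auto
        finally show ?thesis using True by (simp add: mult.commute)
      next
        case False
        then have g2: "1 \<le> g - 1" "g - 1 = Suc (g - 1 - 1)" using g by auto
        let ?h = "\<lambda>x. ennreal (?c j (g - 1)) * tri_power (g - 1 - 1) x"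
        have h: "symdec ?h" using tri_power_props(1)[of "g - 1 - 1"] unfolding symdec_def
          by (auto intro!: mult_left_mono simp: ennreal_mult_less_top)
        have "(\<integral>\<^sup>+a. (\<integral>\<^sup>+b. ind B (a + b) \<partial>partial_law j (g - 1)) \<partial>good_part M)
            \<le> (LI z. nconv tri ?h z * ind (symint (len B)) z)"
        proof (rule conc_le_convolution[OF sets_good sets_partial _ _ _ symdec_tri h conc _ B])
          show "emeasure (good_part M) UNIV < \<top>" "emeasure (partial_law j (g - 1)) UNIV < \<top>"
            using mass_good partial_mass[of j "g - 1" UNIV] by (auto simp: le_less_trans)
          show "(LI x. ?h x) < \<top>" by (subst nn_integral_cmult) (auto simp: tri_power_props)
          show "conc_le (partial_law j (g - 1)) ?h" using Suc g2(1) by blast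
        qed
        also have "nconv tri ?h = (\<lambda>z. ennreal (?c j (g - 1)) * tri_power (g - 1) z)"
        proof
          fix z
          have "nconv tri ?h z = ennreal (?c j (g - 1)) * nconv tri (tri_power (g - 1 - 1)) z"
            unfolding nconv_def by (subst nn_integral_cmult[symmetric]) (auto simp: mult_ac)
          also have "nconv tri (tri_power (g - 1 - 1)) = tri_power (g - 1)" by (subst (2) g2(2)) simp
          finally show "nconv tri ?h z = ennreal (?c j (g - 1)) * tri_power (g - 1) z" .
        qed
        finally show ?thesis unfolding pull Q_def .
      qed
      finally show ?thesis .
    qed
    have badpart: "(\<integral>\<^sup>+y. (if snd y then 0 else \<integral>\<^sup>+b. ind B (fst y + b) \<partial>partial_law j g) \<partial>M)
        \<le> ennreal (v * ?c j g) * Q"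
    proof -
      have "(\<integral>\<^sup>+y. (if snd y then 0 else \<integral>\<^sup>+b. ind B (fst y + b) \<partial>partial_law j g) \<partial>M)
          \<le> (\<integral>\<^sup>+y. (if snd y then 0 else ennreal (?c j g) * Q) \<partial>M)"
      proof (rule nn_integral_mono)
        fix y :: marked
        have "(\<integral>\<^sup>+b. ind B (fst y + b) \<partial>partial_law j g) \<le> ennreal (?c j g) * Q"
        proof -
          have "conc_le (partial_law j g) (\<lambda>x. ennreal (?c j g) * tri_power (g - 1) x)" using Suc g by blast
          from this[unfolded conc_le_def, rule_format, OF emeasure_shift(1)[OF B, of "fst y"]]
          show ?thesis unfolding shift[OF B] Q_def pull[symmetric] emeasure_shift(2)[OF B] .
        qed
        then show "(if snd y then 0 else \<integral>\<^sup>+b. ind B (fst y + b) \<partial>partial_law j g)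
          \<le> (if snd y then 0 else ennreal (?c j g) * Q)" by simp
      qed
      also have "... \<le> ennreal v * (ennreal (?c j g) * Q)" by (rule badint)
      finally show ?thesis using v by (simp add: ennreal_mult mult.assoc)
    qed
    have "emeasure (partial_law (Suc j) g) B = (\<integral>\<^sup>+x. ind B x \<partial>partial_law (Suc j) g)" by (simp add: sets_partial)
    also have "... = (\<integral>\<^sup>+y. (if snd y then \<integral>\<^sup>+b. ind B (fst y + b) \<partial>partial_law j (g - 1) else 0)
        + (if snd y then 0 else \<integral>\<^sup>+b. ind B (fst y + b) \<partial>partial_law j g) \<partial>M)"
      using g by (subst nn_integral_partial_Suc) (auto intro!: nn_integral_cong)
    also have "... = (\<integral>\<^sup>+y. (if snd y then \<integral>\<^sup>+b. ind B (fst y + b) \<partial>partial_law j (g - 1) else 0) \<partial>M)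
        + (\<integral>\<^sup>+y. (if snd y then 0 else \<integral>\<^sup>+b. ind B (fst y + b) \<partial>partial_law j g) \<partial>M)"
      by (rule nn_integral_add) measurable
    also have "... \<le> ennreal (?c j (g - 1)) * Q + ennreal (v * ?c j g) * Q" by (intro add_mono good badpart)
    also have "... = ennreal (?c j (g - 1) + v * ?c j g) * Q" using v by (subst ennreal_plus) (auto simp: distrib_right)
    also have "?c j (g - 1) + v * ?c j g = ?c (Suc j) g"
    proof (cases "g \<le> j")
      case True
      obtain g' where g': "g = Suc g'" using g by (cases g) auto
      have "v * v ^ (j - g) = v ^ (j - g')" using True by (simp add: g' flip: power_Suc) (metis Suc_diff_Suc Suc_le_lessD)
      then show ?thesis by (simp add: g' algebra_simps)
    next
      case False
      then have "j choose g = 0" by (simp add: binomial_eq_0)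
      moreover have "Suc j choose g = j choose (g - 1)" using g False by (cases g) (auto simp: binomial_eq_0)
      moreover have "j - (g - 1) = Suc j - g" using g by simp
      ultimately show ?thesis by simp
    qed
    finally show "emeasure (partial_law (Suc j) g) B
      \<le> (LI x. ennreal (?c (Suc j) g) * tri_power (g - 1) x * ind (symint (len B)) x)" unfolding pull Q_def .
  qed
  with none show ?case by blast
qed

text \<open>Summation over the number \<open>g\<close> of good branches. A \<open>g\<close>-fold convolution is at most its value
  \<open>kappa g\<close> at the origin, so the bound for each \<open>g\<close> is a uniform density.\<close>
theorem branches_sum:
  assumes v: "0 \<le> v" and bad: "emeasure M {z. \<not> snd z} \<le> ennreal v" and conc: "conc_le (good_part M) tri"
    and B [measurable]: "B \<in> sets borel"
  shows "emeasure (branches n) {z \<in> space (branches n). (\<exists>i<n. snd (z i)) \<and> total_sum n z \<in> B}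
      \<le> ennreal (\<Sum>g = 1..n. real (n choose g) * kappa g * v ^ (n - g)) * len B"
    and "emeasure (branches n) {z \<in> space (branches n). \<forall>i<n. \<not> snd (z i)} \<le> ennreal (v ^ n)"
proof -
  define E where "E g A = {z \<in> space (branches n). num_good n z = g \<and> total_sum n z \<in> A}" for g A
  have E: "E g A \<in> sets (branches n) \<and> emeasure (branches n) (E g A) = emeasure (partial_law n g) A"
    if A: "A \<in> sets borel" for g A
  proof -
    let ?cnt = "\<lambda>z. if num_good n z = g then 1 else 0 :: ennreal"
    have eq: "E g A = (?cnt -` {1} \<inter> space (branches n)) \<inter> (total_sum n -` A \<inter> space (branches n))"
      unfolding E_def by (rule set_eqI) (simp only: mem_Collect_eq Int_iff vimage_eq singleton_iff, simp, blast)
    have S: "E g A \<in> sets (branches n)" unfolding eq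
      by (intro sets.Int measurable_sets[OF count_measurable] measurable_sets[OF total_sum_measurable] A) simp
    have "emeasure (partial_law n g) A = (\<integral>\<^sup>+x. ind A x \<partial>partial_law n g)" using A by (simp add: sets_partial)
    also have "... = (\<integral>\<^sup>+z. ind (E g A) z \<partial>branches n)"
      using A by (subst nn_integral_partial) (auto simp: E_def intro!: nn_integral_cong split: split_indicator)
    finally show ?thesis using S by simp
  qed
  note bounds = partial_law_bounds[OF v bad conc, of n]
  have "{z \<in> space (branches n). \<forall>i<n. \<not> snd (z i)} = E 0 UNIV" by (auto simp: E_def num_good_def)
  then show "emeasure (branches n) {z \<in> space (branches n). \<forall>i<n. \<not> snd (z i)} \<le> ennreal (v ^ n)"
    using E[of UNIV 0] bounds by simp
  have "{z \<in> space (branches n). (\<exists>i<n. snd (z i)) \<and> total_sum n z \<in> B} \<subseteq> (\<Union>g\<in>{1..n}. E g B)"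
  proof
    fix z assume z: "z \<in> {z \<in> space (branches n). (\<exists>i<n. snd (z i)) \<and> total_sum n z \<in> B}"
    define g where "g = num_good n z"
    have "g \<le> (\<Sum>i<n. 1)" unfolding g_def num_good_def by (intro sum_mono) auto
    moreover have "g \<noteq> 0" using z by (auto simp: g_def num_good_def)
    ultimately have "g \<in> {1..n}" by auto
    moreover have "z \<in> E g B" using z by (simp add: E_def g_def)
    ultimately show "z \<in> (\<Union>g\<in>{1..n}. E g B)" by blast
  qed
  then have "emeasure (branches n) {z \<in> space (branches n). (\<exists>i<n. snd (z i)) \<and> total_sum n z \<in> B}
      \<le> emeasure (branches n) (\<Union>g\<in>{1..n}. E g B)" using E B by (intro emeasure_mono sets.finite_UN) auto
  also have "... \<le> (\<Sum>g\<in>{1..n}. emeasure (branches n) (E g B))" using E B by (intro emeasure_subadditive_finite) auto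
  also have "... \<le> (\<Sum>g\<in>{1..n}. ennreal (real (n choose g) * kappa g * v ^ (n - g)) * len B)"
  proof (rule sum_mono)
    fix g assume g: "g \<in> {1..n}"
    let ?c = "ennreal (real (n choose g) * v ^ (n - g))"
    have "emeasure (branches n) (E g B) = emeasure (partial_law n g) B" using E B by simp
    also have "... \<le> (LI x. ?c * tri_power (g - 1) x * ind (symint (len B)) x)" using bounds g B by (auto simp: conc_le_def)
    also have "... \<le> (LI x. ?c * tri_power (g - 1) 0 * ind (symint (len B)) x)"
      by (intro nn_integral_mono mult_right_mono mult_left_mono symdecD(2)[OF tri_power_props(1)]) auto
    also have "... = ?c * tri_power (g - 1) 0 * len B" by (simp add: nn_integral_cmult_indicator)
    also have "?c * tri_power (g - 1) 0 = ennreal (real (n choose g) * kappa g * v ^ (n - g))"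
    proof -
      have "tri_power (g - 1) 0 = ennreal (kappa g)" using kappa_tri_power[of g] g by simp
      then show ?thesis using kappa_nonneg[of g] v
        by (simp only:) (simp add: ennreal_mult[symmetric] mult_ac)
    qed
    finally show "emeasure (branches n) (E g B) \<le> ennreal (real (n choose g) * kappa g * v ^ (n - g)) * len B" .
  qed
  also have "... = ennreal (\<Sum>g = 1..n. real (n choose g) * kappa g * v ^ (n - g)) * len B"
    using v kappa_nonneg by (simp add: sum_distrib_right[symmetric] sum_ennreal)
  finally show "emeasure (branches n) {z \<in> space (branches n). (\<exists>i<n. snd (z i)) \<and> total_sum n z \<in> B}
      \<le> ennreal (\<Sum>g = 1..n. real (n choose g) * kappa g * v ^ (n - g)) * len B" .
qed

end

section \<open>The constant for four branches\<close>

lemma nconv_assoc_at_0: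
  assumes f: "symdec f" and g: "symdec g" and h: "symdec h"
    and fin: "(LI x. f x) < \<top>"
  shows "nconv f (nconv g h) 0 = (LI z. nconv f g z * h z)"
proof -
  note [measurable] = symdecD(1)[OF f] symdecD(1)[OF g] symdecD(1)[OF h]
  have "nconv f (nconv g h) 0 = (LI x. (LI y. f x * g y * h (x + y)))" unfolding nconv_def
  proof (rule nn_integral_cong)
    fix x
    have "h (- x - y) = h (x + y)" for y using symdecD(4)[OF h, of "x + y"] by simp
    then show "f x * (LI y. g y * h (0 - x - y)) = (LI y. f x * g y * h (x + y))" by (simp add: nn_integral_cmult[symmetric] mult.assoc)
  qed
  also have "... = (LI z. nconv f g z * h z)" by (rule nconv_double) measurable
  finally show ?thesis .
qed

lemma poly_integral:
  fixes f :: "real \<Rightarrow> real"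
  assumes ab: "a \<le> b" and F: "\<And>x. (F has_real_derivative f x) (at x)" and f: "f \<in> borel_measurable borel"
    and nn: "\<And>x. a \<le> x \<Longrightarrow> x \<le> b \<Longrightarrow> 0 \<le> f x"
  shows "(LI x. ennreal (f x) * ind {a..b} x) = ennreal (F b - F a)" "0 \<le> F b - F a"
proof -
  show "(LI x. ennreal (f x) * ind {a..b} x) = ennreal (F b - F a)"
    using assms by (intro nn_integral_FTC_Icc) (auto intro: has_field_derivative_at_within)
  have "F a \<le> F b" by (rule DERIV_nonneg_imp_nondecreasing[OF ab]) (use F nn in blast)
  then show "0 \<le> F b - F a" by simp
qed

text \<open>The self-convolution of the triangular density on \<open>[0, 1]\<close>, a cubic spline. Integrating its square
  gives the value of the fourfold convolution at the origin.\<close>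
definition spline :: "real \<Rightarrow> real" where
  "spline x = (if x \<le> 1 / 2 then 4 / 3 - 8 * x\<^sup>2 + 8 * x ^ 3 else 8 / 3 * (1 - x) ^ 3)"

lemma tri_mult:
  assumes "- 1 / 2 \<le> y" "y \<le> 1 / 2" "- 1 / 2 \<le> z" "z \<le> 1 / 2"
  shows "tri y * tri z = ennreal ((2 - 4 * \<bar>y\<bar>) * (2 - 4 * \<bar>z\<bar>))"
proof -
  have "\<bar>y\<bar> \<le> 1 / 2" "\<bar>z\<bar> \<le> 1 / 2" using assms by (auto simp: abs_le_iff)
  then have "p2 y = 2 - 4 * \<bar>y\<bar>" "p2 z = 2 - 4 * \<bar>z\<bar>" "0 \<le> 2 - 4 * \<bar>y\<bar>" "0 \<le> 2 - 4 * \<bar>z\<bar>"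
    by (auto simp: p2_def max_def)
  then show ?thesis by (simp only: ennreal_mult)
qed

lemma tri_tri_le:
  assumes x: "0 \<le> x" "x \<le> 1"
  shows "nconv tri tri x \<le> ennreal (spline x)"
proof -
  have outside: "tri y * tri (x - y) = 0" if "y < x - 1 / 2 \<or> 1 / 2 < y" for y
  proof -
    have "p2 y = 0 \<or> p2 (x - y) = 0" using that by (auto simp: p2_def)
    then show ?thesis by auto
  qed
  let ?f2 = "\<lambda>y. (2 - 4 * y) * (2 - 4 * (x - y))"
  let ?F2 = "\<lambda>y. 2 * (2 - 4 * x) * y + 8 * x * y\<^sup>2 - 16 / 3 * y ^ 3"
  have D2: "(?F2 has_real_derivative ?f2 y) (at y)" for y by (auto intro!: derivative_eq_intros simp: power2_eq_square algebra_simps)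
  show ?thesis
  proof (cases "x \<le> 1 / 2")
    case True
    let ?f1 = "\<lambda>y. (2 + 4 * y) * (2 - 4 * (x - y))" and ?f3 = "\<lambda>y. (2 - 4 * y) * (2 + 4 * (x - y))"
    let ?F1 = "\<lambda>y. 2 * (2 - 4 * x) * y + (8 - 8 * x) * y\<^sup>2 + 16 / 3 * y ^ 3"
      and ?F3 = "\<lambda>y. 2 * (2 + 4 * x) * y - (8 + 8 * x) * y\<^sup>2 + 16 / 3 * y ^ 3"
    have D1: "(?F1 has_real_derivative ?f1 y) (at y)" and D3: "(?F3 has_real_derivative ?f3 y) (at y)" for y
      by (auto intro!: derivative_eq_intros simp: power2_eq_square algebra_simps)
    have I1: "(LI y. ennreal (?f1 y) * ind {x - 1 / 2..0} y) = ennreal (?F1 0 - ?F1 (x - 1 / 2))"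
      "0 \<le> ?F1 0 - ?F1 (x - 1 / 2)" by (rule poly_integral[OF _ D1]; use x True in \<open>auto intro!: mult_nonneg_nonneg\<close>)+
    have I2: "(LI y. ennreal (?f2 y) * ind {0..x} y) = ennreal (?F2 x - ?F2 0)"
      "0 \<le> ?F2 x - ?F2 0" by (rule poly_integral[OF _ D2]; use x True in \<open>auto intro!: mult_nonneg_nonneg\<close>)+
    have I3: "(LI y. ennreal (?f3 y) * ind {x..1 / 2} y) = ennreal (?F3 (1 / 2) - ?F3 x)"
      "0 \<le> ?F3 (1 / 2) - ?F3 x" by (rule poly_integral[OF _ D3]; use x True in \<open>auto intro!: mult_nonneg_nonneg\<close>)+
    have "nconv tri tri x \<le> (LI y. (ennreal (?f1 y) * ind {x - 1 / 2..0} y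
        + ennreal (?f2 y) * ind {0..x} y) + ennreal (?f3 y) * ind {x..1 / 2} y)" unfolding nconv_def
    proof (rule nn_integral_mono)
      fix y
      consider "y < x - 1 / 2 \<or> 1 / 2 < y" | "x - 1 / 2 \<le> y" "y \<le> 0" | "0 < y" "y \<le> x" | "x < y" "y \<le> 1 / 2" by linarith
      then show "tri y * tri (x - y) \<le> (ennreal (?f1 y) * ind {x - 1 / 2..0} y
        + ennreal (?f2 y) * ind {0..x} y) + ennreal (?f3 y) * ind {x..1 / 2} y"
      proof cases
        case 1
        then show ?thesis by (simp add: outside)
      next
        case 2
        then have "tri y * tri (x - y) = ennreal (?f1 y)" using x True by (subst tri_mult) auto
        then show ?thesis using 2 by (simp add: add_increasing2)
      next
        case 3
        then have "tri y * tri (x - y) = ennreal (?f2 y)" using x True by (subst tri_mult) auto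
        then show ?thesis using 3 by (simp add: add_increasing2)
      next
        case 4
        then have "tri y * tri (x - y) = ennreal (?f3 y)" using x True by (subst tri_mult) (auto simp: abs_if)
        then show ?thesis using 4 by (simp add: add_increasing)
      qed
    qed
    also have "... = (ennreal (?F1 0 - ?F1 (x - 1 / 2)) + ennreal (?F2 x - ?F2 0)) + ennreal (?F3 (1 / 2) - ?F3 x)"
      unfolding I1(1)[symmetric] I2(1)[symmetric] I3(1)[symmetric]
      by (subst nn_integral_add, measurable, subst nn_integral_add, measurable)
    also have "... = ennreal ((?F1 0 - ?F1 (x - 1 / 2)) + (?F2 x - ?F2 0) + (?F3 (1 / 2) - ?F3 x))"
      by (simp only: ennreal_plus[OF I1(2) I2(2), symmetric] ennreal_plus[OF add_nonneg_nonneg[OF I1(2) I2(2)] I3(2), symmetric])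
    also have "(?F1 0 - ?F1 (x - 1 / 2)) + (?F2 x - ?F2 0) + (?F3 (1 / 2) - ?F3 x) = spline x"
      using True by (simp add: spline_def power2_eq_square power3_eq_cube field_simps)
    finally show ?thesis .
  next
    case False
    have I2: "(LI y. ennreal (?f2 y) * ind {x - 1 / 2..1 / 2} y) = ennreal (?F2 (1 / 2) - ?F2 (x - 1 / 2))"
      by (rule poly_integral[OF _ D2]; use x False in \<open>auto intro!: mult_nonneg_nonneg\<close>)
    have "nconv tri tri x \<le> (LI y. ennreal (?f2 y) * ind {x - 1 / 2..1 / 2} y)" unfolding nconv_def
    proof (rule nn_integral_mono)
      fix y
      show "tri y * tri (x - y) \<le> ennreal (?f2 y) * ind {x - 1 / 2..1 / 2} y"
      proof (cases "x - 1 / 2 \<le> y \<and> y \<le> 1 / 2")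
        case True
        then have "tri y * tri (x - y) = ennreal (?f2 y)" using x False by (subst tri_mult) auto
        then show ?thesis using True by simp
      next
        case False
        then show ?thesis using outside[of y] by auto
      qed
    qed
    also have "... = ennreal (spline x)"
    proof -
      have "?F2 (1 / 2) - ?F2 (x - 1 / 2) = spline x" using False by (simp add: spline_def power2_eq_square power3_eq_cube field_simps)
      then show ?thesis by (simp only: I2)
    qed
    finally show ?thesis .
  qed
qed

lemma tri_tri_far:
  assumes "1 < x" shows "nconv tri tri x = 0"
proof -
  have z: "tri y * tri (x - y) = 0" for y
  proof -
    have "1 - 2 * \<bar>y\<bar> \<le> 0 \<or> 1 - 2 * \<bar>x - y\<bar> \<le> 0" using assms by (cases "0 \<le> y"; cases "0 \<le> x - y") auto
    then have "p2 y = 0 \<or> p2 (x - y) = 0" by (auto simp: p2_def)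
    then show ?thesis by auto
  qed
  show ?thesis unfolding nconv_def z by simp
qed

lemma tri_power_3_le: "tri_power 3 0 \<le> ennreal (302 / 315)"
proof -
  let ?q = "nconv tri tri"
  have q: "tri_power (Suc 0) = ?q" by simp
  have sq: "symdec ?q" using tri_power_props(1)[of "Suc 0"] by simp
  note [measurable] = symdecD(1)[OF sq]
  have "tri_power 3 0 = nconv tri (nconv tri ?q) 0" by (simp add: numeral_3_eq_3)
  also have "... = (LI z. ?q z * ?q z)" by (rule nconv_assoc_at_0[OF symdec_tri symdec_tri sq]) (simp add: tri_mass)
  also have "... = (LI z. (?q z * ?q z + ?q (2 * 0 - z) * ?q (2 * 0 - z)) * ind {0<..} z)" by (rule nn_integral_fold) measurable
  also have "... \<le> (LI z. ennreal (2 * (4 / 3 - 8 * z\<^sup>2 + 8 * z ^ 3)\<^sup>2) * ind {0..1 / 2} z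
      + ennreal (2 * (8 / 3 * (1 - z) ^ 3)\<^sup>2) * ind {1 / 2..1} z)"
  proof (rule nn_integral_mono)
    fix z :: real
    consider "z \<le> 0" | "0 < z" "z \<le> 1" | "1 < z" by linarith
    then show "(?q z * ?q z + ?q (2 * 0 - z) * ?q (2 * 0 - z)) * ind {0<..} z
      \<le> ennreal (2 * (4 / 3 - 8 * z\<^sup>2 + 8 * z ^ 3)\<^sup>2) * ind {0..1 / 2} z
      + ennreal (2 * (8 / 3 * (1 - z) ^ 3)\<^sup>2) * ind {1 / 2..1} z"
    proof cases
      case 2
      have "0 \<le> spline z"
      proof (cases "z \<le> 1 / 2")
        case True
        have "z * z \<le> 1 / 2 * (1 / 2)" using 2 True by (intro mult_mono) auto
        moreover have "0 \<le> z ^ 3" using 2 by simp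
        moreover have "z * z * (1 - z) \<le> 1 / 4 * (1 - z)" using 2 True \<open>z * z \<le> 1 / 2 * (1 / 2)\<close> by (intro mult_right_mono) auto
        moreover have "z * z * (1 - z) \<le> z * (1 / 4)"
        proof -
          have "z * (1 - z) \<le> 1 / 4" using zero_le_power2[of "z - 1 / 2"] by (simp add: power2_eq_square algebra_simps)
          then have "z * (z * (1 - z)) \<le> z * (1 / 4)" using 2 by (intro mult_left_mono) auto
          then show ?thesis by (simp add: mult.assoc)
        qed
        ultimately show ?thesis using True 2 by (simp add: spline_def power2_eq_square power3_eq_cube algebra_simps)
      next
        case False
        then show ?thesis using 2 by (simp add: spline_def)
      qed
      have "?q z * ?q z + ?q z * ?q z \<le> ennreal (spline z) * ennreal (spline z) + ennreal (spline z) * ennreal (spline z)"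
        using 2 by (intro add_mono mult_mono tri_tri_le) auto
      also have "... = ennreal (2 * (spline z)\<^sup>2)"
        using \<open>0 \<le> spline z\<close> by (simp add: ennreal_mult[symmetric] ennreal_plus[symmetric] power2_eq_square del: ennreal_plus)
      also have "... \<le> ennreal (2 * (4 / 3 - 8 * z\<^sup>2 + 8 * z ^ 3)\<^sup>2) * ind {0..1 / 2} z
        + ennreal (2 * (8 / 3 * (1 - z) ^ 3)\<^sup>2) * ind {1 / 2..1} z"
      proof (cases "z \<le> 1 / 2")
        case True
        then show ?thesis using 2 by (simp add: spline_def)
      next
        case False
        then show ?thesis using 2 by (simp add: spline_def)
      qed
      finally show ?thesis using 2 symdecD(4)[OF sq, of z] by simp
    next
      case 3
      then show ?thesis by (simp add: tri_tri_far symdecD(4)[OF sq])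
    qed simp
  qed
  also have "... = (LI z. ennreal (2 * (4 / 3 - 8 * z\<^sup>2 + 8 * z ^ 3)\<^sup>2) * ind {0..1 / 2} z)
      + (LI z. ennreal (2 * (8 / 3 * (1 - z) ^ 3)\<^sup>2) * ind {1 / 2..1} z)" by (rule nn_integral_add) measurable
  also have "... = ennreal (302 / 315)"
  proof -
    let ?F = "\<lambda>z::real. 32 / 9 * z - 128 / 9 * z ^ 3 + 32 / 3 * z ^ 4 + 128 / 5 * z ^ 5 - 128 / 3 * z ^ 6 + 128 / 7 * z ^ 7"
    let ?G = "\<lambda>z::real. - (128 / 63 * (1 - z) ^ 7)"
    have DF: "(?F has_real_derivative 2 * (4 / 3 - 8 * z\<^sup>2 + 8 * z ^ 3)\<^sup>2) (at z)" for z
    proof -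
      have "2 * (4 / 3 - 8 * z\<^sup>2 + 8 * z ^ 3)\<^sup>2
          = 32 / 9 - 128 / 3 * z\<^sup>2 + 128 / 3 * z ^ 3 + 128 * z ^ 4 - 256 * z ^ 5 + 128 * z ^ 6" by algebra
      then show ?thesis by (simp only:) ((rule derivative_eq_intros refl)+; simp)
    qed
    have DG: "(?G has_real_derivative 2 * (8 / 3 * (1 - z) ^ 3)\<^sup>2) (at z)" for z
    proof -
      have "2 * (8 / 3 * (1 - z) ^ 3)\<^sup>2 = 128 / 9 * (1 - z) ^ 6" by algebra
      then show ?thesis by (simp only:) ((rule derivative_eq_intros refl)+; simp)
    qed
    have 1: "(LI z. ennreal (2 * (4 / 3 - 8 * z\<^sup>2 + 8 * z ^ 3)\<^sup>2) * ind {0..1 / 2} z) = ennreal (?F (1 / 2) - ?F 0)"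
      by (rule poly_integral[OF _ DF]) auto
    have 2: "(LI z. ennreal (2 * (8 / 3 * (1 - z) ^ 3)\<^sup>2) * ind {1 / 2..1} z) = ennreal (?G 1 - ?G (1 / 2))"
      by (rule poly_integral[OF _ DG]) auto
    have a: "?F (1 / 2) - ?F 0 = 33 / 35" and b: "?G 1 - ?G (1 / 2) = 1 / 63" by (simp_all add: power_divide)
    show ?thesis unfolding 1 2 a b by (subst ennreal_plus[symmetric]) simp_all
  qed
  finally show ?thesis .
qed

text \<open>Further convolutions with a probability density cannot raise the supremum, so the fourfold value
  bounds all later ones. That it is below \<open>1\<close> makes the recursion for \<open>r\<close> a contraction.\<close>
lemma kappa_le:
  assumes "4 \<le> n" shows "kappa n \<le> 302 / 315"
proof -
  have "tri_power (3 + k) x \<le> ennreal (302 / 315)" for k x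
  proof (induction k arbitrary: x)
    case 0
    have "tri_power 3 x \<le> tri_power 3 0" by (rule symdecD(2)[OF tri_power_props(1)]) simp
    also note tri_power_3_le
    finally show ?case by simp
  next
    case (Suc k)
    have "tri_power (3 + Suc k) x \<le> (LI y. tri y * ennreal (302 / 315))"
    proof -
      have "tri_power (3 + Suc k) x = nconv tri (tri_power (3 + k)) x" by (simp only: add_Suc_right tri_power.simps)
      also have "... \<le> (LI y. tri y * ennreal (302 / 315))" unfolding nconv_def by (intro nn_integral_mono mult_left_mono Suc) simp
      finally show ?thesis .
    qed
    also have "... = ennreal (302 / 315)" by (subst nn_integral_multc) (auto simp: tri_mass)
    finally show ?case .
  qed
  note bound = this
  obtain k where k: "n = 4 + k" using assms le_Suc_ex by blast
  have "n - 1 = 3 + k" "1 \<le> n" by (simp_all add: k)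
  then have "ennreal (kappa n) = tri_power (3 + k) 0" using kappa_tri_power[of n] by (simp only:)
  then have "ennreal (kappa n) \<le> ennreal (302 / 315)" using bound by (simp only:)
  then show ?thesis by (rule ennreal_le_iff[THEN iffD1, rotated]) simp
qed

section \<open>Restriction of samples to sub-lattices\<close>

lemma emb_inj: "inj (emb i h)"
proof (rule injI)
  fix x y show "emb i h x = emb i h y \<Longrightarrow> x = y" by (cases x; cases y) (auto split: if_splits)
qed

lemma emb_eq_iff [simp]: "emb i h x = emb i h y \<longleftrightarrow> x = y"
  using emb_inj by (auto dest: injD)

lemma emb_two_points:
  assumes "emb i h x = emb i' h' x'" "emb i h y = emb i' h' y'" "x \<noteq> y"
  shows "i = i' \<and> h = h'"
proof (rule ccontr)
  assume ne: "\<not> (i = i' \<and> h = h')"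
  have "emb i h z = (if i = i' then Mid i else if h then PoleB else PoleA)" if "emb i h z = emb i' h' z'" for z z'
    using that ne by (cases z; cases z') (auto split: if_splits)
  from this[OF assms(1)] this[OF assms(2)] have "emb i h x = emb i h y" by simp
  with assms(3) show False by simp
qed

lemma edgesD:
  assumes "0 < n" "e \<in> edges n N"
  shows "\<exists>x y. x \<noteq> y \<and> e = {x, y} \<and> x \<in> verts n N \<and> y \<in> verts n N"
  using assms(2)
proof (induction N arbitrary: e)
  case 0
  then show ?case by auto
next
  case (Suc N)
  then obtain i h e' where e: "i < n" "e' \<in> edges n N" "e = emb i h ` e'" by auto
  obtain x y where xy: "x \<noteq> y" "e' = {x, y}" "x \<in> verts n N" "y \<in> verts n N" using Suc.IH[OF e(2)] by blast
  have "emb i h x \<in> verts n (Suc N)" "emb i h y \<in> verts n (Suc N)" using e(1) xy by auto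
  moreover have "e = {emb i h x, emb i h y}" "emb i h x \<noteq> emb i h y" using e xy by auto
  ultimately show ?case by blast
qed

lemma edges_subset: "0 < n \<Longrightarrow> e \<in> edges n N \<Longrightarrow> e \<subseteq> verts n N"
  using edgesD by blast

lemma emb_image_eq:
  assumes n: "0 < n" and e: "e \<in> edges n N" "e' \<in> edges n N" and eq: "emb i h ` e = emb i' h' ` e'"
  shows "i = i' \<and> h = h' \<and> e = e'"
proof -
  obtain x y where xy: "x \<noteq> y" "e = {x, y}" using edgesD[OF n e(1)] by blast
  have "emb i h x \<in> emb i' h' ` e'" "emb i h y \<in> emb i' h' ` e'" using xy by (auto simp: eq[symmetric])
  then obtain x' y' where "emb i h x = emb i' h' x'" "emb i h y = emb i' h' y'" by auto
  then have ih: "i = i' \<and> h = h'" using emb_two_points xy(1) by blast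
  then have "emb i h ` e = emb i h ` e'" using eq by simp
  then have "e = e'" using emb_inj by (simp add: inj_image_eq_iff)
  with ih show ?thesis by blast
qed

abbreviation halves :: "nat \<Rightarrow> (nat \<times> bool) set" where "halves n \<equiv> {..<n} \<times> UNIV"

definition emb_edge :: "(nat \<times> bool) \<times> edge \<Rightarrow> edge" where
  "emb_edge = (\<lambda>((i, h), e). emb i h ` e)"

lemma edges_Suc: "edges n (Suc N) = emb_edge ` (halves n \<times> edges n N)"
proof (intro set_eqI iffI)
  fix e assume "e \<in> edges n (Suc N)"
  then obtain i h e' where "i < n" "e' \<in> edges n N" "e = emb i h ` e'" by auto
  then have "((i, h), e') \<in> halves n \<times> edges n N" "e = emb_edge ((i, h), e')" by (simp_all add: emb_edge_def)
  then show "e \<in> emb_edge ` (halves n \<times> edges n N)" by (rule rev_image_eqI)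
next
  fix e assume "e \<in> emb_edge ` (halves n \<times> edges n N)"
  then obtain i h e' where "i < n" "e' \<in> edges n N" "e = emb i h ` e'" by (auto simp: emb_edge_def)
  then show "e \<in> edges n (Suc N)" by auto
qed

lemma emb_edge_inj: "0 < n \<Longrightarrow> inj_on emb_edge (halves n \<times> edges n N)"
proof (rule inj_onI)
  fix z z' assume "0 < n" and z: "z \<in> halves n \<times> edges n N" "z' \<in> halves n \<times> edges n N" "emb_edge z = emb_edge z'"
  obtain i h e i' h' e' where zz: "z = ((i, h), e)" "z' = ((i', h'), e')" by (metis prod.collapse)
  then have "i = i' \<and> h = h' \<and> e = e'" using z by (intro emb_image_eq[OF \<open>0 < n\<close>]) (auto simp: emb_edge_def)
  then show "z = z'" by (simp add: zz)
qed

lemma prod_edges_Suc: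
  fixes f :: "edge \<Rightarrow> real"
  assumes "0 < n"
  shows "(\<Prod>e\<in>edges n (Suc N). f e) = (\<Prod>i<n. (\<Prod>e\<in>edges n N. f (emb i False ` e)) * (\<Prod>e\<in>edges n N. f (emb i True ` e)))"
proof -
  have "(\<Prod>e\<in>edges n (Suc N). f e) = (\<Prod>(k, e)\<in>halves n \<times> edges n N. f (emb_edge (k, e)))"
    unfolding edges_Suc by (subst prod.reindex[OF emb_edge_inj[OF assms]]) (auto intro!: prod.cong)
  also have "... = (\<Prod>k\<in>halves n. \<Prod>e\<in>edges n N. f (emb_edge (k, e)))" by (rule prod.cartesian_product[symmetric])
  also have "... = (\<Prod>i<n. \<Prod>h\<in>UNIV. \<Prod>e\<in>edges n N. f (emb i h ` e))"
    by (subst prod.cartesian_product) (auto simp: emb_edge_def intro!: prod.cong)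
  finally show ?thesis by (simp add: UNIV_bool mult.commute)
qed

text \<open>Samples are restricted to labels that vanish off the edge set, so that they form a finite set and
  a sample of the large lattice is determined by its restrictions.\<close>
definition labels :: "nat \<Rightarrow> nat \<Rightarrow> (edge \<Rightarrow> bool) set" where
  "labels n N = {b. \<forall>e. e \<notin> edges n N \<longrightarrow> \<not> b e}"

definition samples :: "nat \<Rightarrow> nat \<Rightarrow> sample set" where
  "samples n N = configs n N \<times> configs n N \<times> labels n N"

lemma finite_configs: "finite (configs n N)"
  unfolding configs_def by (intro finite_PiE finite_verts) auto

lemma finite_labels: "finite (labels n N)"
proof -
  have "labels n N \<subseteq> (\<lambda>S e. e \<in> S) ` Pow (edges n N)"
  proof
    fix b assume "b \<in> labels n N"
    then have "b = (\<lambda>e. e \<in> {e. b e})" "{e. b e} \<in> Pow (edges n N)" by (auto simp: labels_def)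
    then show "b \<in> (\<lambda>S e. e \<in> S) ` Pow (edges n N)" by (rule image_eqI)
  qed
  then show ?thesis using finite_edges by (auto intro: finite_subset)
qed

lemma finite_samples: "finite (samples n N)"
  unfolding samples_def using finite_configs finite_labels by auto

type_synonym spins = "real \<times> real"

abbreviation pm :: "real set" where "pm \<equiv> {-1, 1}"
abbreviation pm2 :: "spins set" where "pm2 \<equiv> pm \<times> pm"

definition spin :: "vertex \<Rightarrow> sample \<Rightarrow> spins" where
  "spin x w = (fst w x, fst (snd w) x)"

definition poled :: "nat \<Rightarrow> nat \<Rightarrow> spins \<Rightarrow> spins \<Rightarrow> sample set" where
  "poled n N p p' = {w \<in> samples n N. spin PoleA w = p \<and> spin PoleB w = p'}"

lemma finite_poled: "finite (poled n N p p')"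
  unfolding poled_def using finite_samples by auto

definition sub_config :: "nat \<Rightarrow> nat \<Rightarrow> nat \<Rightarrow> bool \<Rightarrow> config \<Rightarrow> config" where
  "sub_config n N i h \<sigma> = (\<lambda>x\<in>verts n N. \<sigma> (emb i h x))"

definition sub_label :: "nat \<Rightarrow> nat \<Rightarrow> nat \<Rightarrow> bool \<Rightarrow> (edge \<Rightarrow> bool) \<Rightarrow> edge \<Rightarrow> bool" where
  "sub_label n N i h b = (\<lambda>e. e \<in> edges n N \<and> b (emb i h ` e))"

definition sub :: "nat \<Rightarrow> nat \<Rightarrow> nat \<Rightarrow> bool \<Rightarrow> sample \<Rightarrow> sample" where
  "sub n N i h = (\<lambda>(\<sigma>, \<tau>, b). (sub_config n N i h \<sigma>, sub_config n N i h \<tau>, sub_label n N i h b))"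

text \<open>Couplings of a half, read off through its embedding; \<open>sub\<close> does the same for samples.\<close>
definition subJ :: "nat \<Rightarrow> nat \<Rightarrow> nat \<Rightarrow> bool \<Rightarrow> (edge \<Rightarrow> real) \<Rightarrow> edge \<Rightarrow> real" where
  "subJ n N i h J = (\<lambda>e\<in>edges n N. J (emb i h ` e))"

lemma sub_config_in:
  assumes "i < n" "\<sigma> \<in> configs n (Suc N)"
  shows "sub_config n N i h \<sigma> \<in> configs n N"
  using assms unfolding configs_def sub_config_def by (auto simp: PiE_def Pi_def)

lemma sub_in: "i < n \<Longrightarrow> w \<in> samples n (Suc N) \<Longrightarrow> sub n N i h w \<in> samples n N"
  by (auto simp: samples_def sub_def sub_config_in labels_def sub_label_def)

lemma spin_sub: "x \<in> verts n N \<Longrightarrow> spin x (sub n N i h w) = spin (emb i h x) w"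
  by (cases w) (simp add: spin_def sub_def sub_config_def)

definition joined :: "nat \<Rightarrow> nat \<Rightarrow> spins \<Rightarrow> spins \<Rightarrow> (sample \<times> sample) set" where
  "joined n N p p' = {(w, w'). w \<in> samples n N \<and> w' \<in> samples n N \<and> spin PoleA w = p
     \<and> spin PoleB w = spin PoleA w' \<and> spin PoleB w' = p'}"

lemma finite_joined: "finite (joined n N p p')"
proof -
  have "joined n N p p' \<subseteq> samples n N \<times> samples n N" by (auto simp: joined_def)
  then show ?thesis by (rule finite_subset) (simp add: finite_samples)
qed

lemma spin_in: "0 < n \<Longrightarrow> w \<in> samples n N \<Longrightarrow> x \<in> verts n N \<Longrightarrow> spin x w \<in> pm2"
  by (auto simp: samples_def configs_def spin_def PiE_def Pi_def)

lemma verts_SucE: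
  assumes "x \<in> verts n (Suc N)"
  obtains i h y where "i < n" "y \<in> verts n N" "x = emb i h y" using assms by auto

definition split_sample :: "nat \<Rightarrow> nat \<Rightarrow> sample \<Rightarrow> nat \<Rightarrow> sample \<times> sample" where
  "split_sample n N w = (\<lambda>i\<in>{..<n}. (sub n N i False w, sub n N i True w))"

lemma split_sample_inj:
  assumes n: "0 < n"
  shows "inj_on (split_sample n N) (samples n (Suc N))"
proof (rule inj_onI)
  fix w w' assume w: "w \<in> samples n (Suc N)" "w' \<in> samples n (Suc N)" and eq: "split_sample n N w = split_sample n N w'"
  have subs: "sub n N i h w = sub n N i h w'" if "i < n" for i h using fun_cong[OF eq, of i] that by (cases h) (auto simp: split_sample_def)
  obtain \<sigma> \<tau> b \<sigma>' \<tau>' b' where o: "w = (\<sigma>, \<tau>, b)" "w' = (\<sigma>', \<tau>', b')" by (metis prod_cases3)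
  have spins: "spin x w = spin x w'" if x: "x \<in> verts n (Suc N)" for x
  proof -
    obtain i h y where y: "i < n" "y \<in> verts n N" "x = emb i h y" using verts_SucE[OF x] by blast
    have "spin x w = spin y (sub n N i h w)" using y spin_sub by simp
    also have "... = spin x w'" using y spin_sub subs[OF y(1)] by simp
    finally show ?thesis .
  qed
  have "\<sigma> = \<sigma>'"
  proof (rule PiE_ext[of _ "verts n (Suc N)" "\<lambda>_. pm"])
    show "\<sigma> \<in> verts n (Suc N) \<rightarrow>\<^sub>E pm" "\<sigma>' \<in> verts n (Suc N) \<rightarrow>\<^sub>E pm" using w o by (auto simp: samples_def configs_def)
  qed (use spins o in \<open>auto simp: spin_def\<close>)
  moreover have "\<tau> = \<tau>'"
  proof (rule PiE_ext[of _ "verts n (Suc N)" "\<lambda>_. pm"])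
    show "\<tau> \<in> verts n (Suc N) \<rightarrow>\<^sub>E pm" "\<tau>' \<in> verts n (Suc N) \<rightarrow>\<^sub>E pm" using w o by (auto simp: samples_def configs_def)
  qed (use spins o in \<open>auto simp: spin_def\<close>)
  moreover have "b = b'"
  proof
    fix e
    show "b e = b' e"
    proof (cases "e \<in> edges n (Suc N)")
      case True
      then obtain i h e' where e: "i < n" "e' \<in> edges n N" "e = emb i h ` e'" by auto
      have "sub_label n N i h b = sub_label n N i h b'" using subs[OF e(1), of h] o by (simp add: sub_def)
      from fun_cong[OF this, of e'] show ?thesis using e by (simp add: sub_label_def)
    next
      case False
      then show ?thesis using w o by (auto simp: samples_def labels_def)
    qed
  qed
  ultimately show "w = w'" using o by simp
qed

definition glue_config :: "nat \<Rightarrow> nat \<Rightarrow> (nat \<Rightarrow> bool \<Rightarrow> config) \<Rightarrow> config" where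
  "glue_config n N s = (\<lambda>x\<in>verts n (Suc N). case x of PoleA \<Rightarrow> s 0 False PoleA | PoleB \<Rightarrow> s 0 True PoleB
     | Mid i \<Rightarrow> s i False PoleB | Sub i h y \<Rightarrow> s i h y)"

lemma glue_config:
  assumes n: "0 < n" and s: "\<And>i h. i < n \<Longrightarrow> s i h \<in> configs n N"
    and A: "\<And>i. i < n \<Longrightarrow> s i False PoleA = s 0 False PoleA" and B: "\<And>i. i < n \<Longrightarrow> s i True PoleB = s 0 True PoleB"
    and M: "\<And>i. i < n \<Longrightarrow> s i False PoleB = s i True PoleA"
  shows "glue_config n N s \<in> configs n (Suc N)" "i < n \<Longrightarrow> sub_config n N i h (glue_config n N s) = s i h"
proof -
  have val: "glue_config n N s (emb i h y) = s i h y" if "i < n" "y \<in> verts n N" for i h y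
  proof -
    have "emb i h y \<in> verts n (Suc N)" using that by auto
    then show ?thesis using that A[of i] B[of i] M[of i] unfolding glue_config_def
      by (cases y; cases h) auto
  qed
  have range: "s i h y \<in> pm" if "i < n" "y \<in> verts n N" for i h y using s[OF that(1), of h] that(2) by (auto simp: configs_def PiE_def Pi_def)
  show "glue_config n N s \<in> configs n (Suc N)" unfolding configs_def
  proof (rule PiE_I)
    fix x assume "x \<in> verts n (Suc N)"
    then obtain i h y where "i < n" "y \<in> verts n N" "x = emb i h y" by (rule verts_SucE)
    then show "glue_config n N s x \<in> pm" using val range by simp
  qed (simp add: glue_config_def)
  assume i: "i < n"
  show "sub_config n N i h (glue_config n N s) = s i h"
  proof (rule PiE_ext[of _ "verts n N" "\<lambda>_. UNIV"])
    show "s i h \<in> verts n N \<rightarrow>\<^sub>E UNIV" using s[OF i, of h] by (auto simp: configs_def PiE_def)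
  qed (auto simp: sub_config_def val[OF i])
qed

lemma split_sample_bij:
  assumes n: "0 < n"
  shows "bij_betw (split_sample n N) (poled n (Suc N) p p') ({..<n} \<rightarrow>\<^sub>E joined n N p p')"
  unfolding bij_betw_def
proof
  show "inj_on (split_sample n N) (poled n (Suc N) p p')" by (rule inj_on_subset[OF split_sample_inj[OF n]]) (auto simp: poled_def)
  note poles = poles_in_verts[OF n]
  show "split_sample n N ` poled n (Suc N) p p' = ({..<n} \<rightarrow>\<^sub>E joined n N p p')"
  proof (intro equalityI subsetI)
    fix g assume "g \<in> split_sample n N ` poled n (Suc N) p p'"
    then obtain w where w: "w \<in> poled n (Suc N) p p'" "g = split_sample n N w" by blast
    then show "g \<in> {..<n} \<rightarrow>\<^sub>E joined n N p p'" using poles by (auto simp: split_sample_def joined_def poled_def sub_in spin_sub)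
  next
    fix g assume g: "g \<in> {..<n} \<rightarrow>\<^sub>E joined n N p p'"
    define hf where "hf i h = (if h then snd (g i) else fst (g i))" for i h
    define s where "s i h = fst (hf i h)" for i h
    define t where "t i h = fst (snd (hf i h))" for i h
    define l where "l i h = snd (snd (hf i h))" for i h
    have hf: "hf i h = (s i h, t i h, l i h)" for i h by (simp add: s_def t_def l_def)
    have gi: "g i = (hf i False, hf i True)" for i by (simp add: hf_def)
    have J: "(hf i False, hf i True) \<in> joined n N p p'" if "i < n" for i using g that by (auto simp flip: gi simp: PiE_def Pi_def)
    have S: "hf i h \<in> samples n N" if "i < n" for i h using J[OF that] by (cases h) (auto simp: joined_def)
    have sc: "s i h \<in> configs n N" "t i h \<in> configs n N" "l i h \<in> labels n N" if "i < n" for i h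
      using S[OF that, of h] by (auto simp: hf samples_def)
    have poleA: "s i False PoleA = fst p" "t i False PoleA = snd p"
      and poleB: "s i True PoleB = fst p'" "t i True PoleB = snd p'"
      and mid: "s i False PoleB = s i True PoleA" "t i False PoleB = t i True PoleA" if "i < n" for i
      using J[OF that] by (auto simp: joined_def spin_def hf)
    define \<sigma> where "\<sigma> = glue_config n N s"
    define \<tau> where "\<tau> = glue_config n N t"
    define b where "b e = (\<exists>i<n. \<exists>h. \<exists>e'\<in>edges n N. e = emb i h ` e' \<and> l i h e')" for e
    have gs: "\<sigma> \<in> configs n (Suc N)" "\<And>i h. i < n \<Longrightarrow> sub_config n N i h \<sigma> = s i h"
      unfolding \<sigma>_def using glue_config[of n s N] n sc poleA poleB mid by auto
    have gt: "\<tau> \<in> configs n (Suc N)" "\<And>i h. i < n \<Longrightarrow> sub_config n N i h \<tau> = t i h"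
      unfolding \<tau>_def using glue_config[of n t N] n sc poleA poleB mid by auto
    have gb: "sub_label n N i h b = l i h" if i: "i < n" for i h
    proof
      fix e
      show "sub_label n N i h b e = l i h e"
      proof (cases "e \<in> edges n N")
        case True
        then have "b (emb i h ` e) \<longleftrightarrow> l i h e" unfolding b_def using i emb_image_eq[OF n True] by blast
        then show ?thesis using True by (simp add: sub_label_def)
      next
        case False
        then show ?thesis using sc(3)[OF i, of h] by (auto simp: sub_label_def labels_def)
      qed
    qed
    have bl: "b \<in> labels n (Suc N)" by (auto simp: labels_def b_def)
    define w where "w = (\<sigma>, \<tau>, b)"
    have sub: "sub n N i h w = hf i h" if "i < n" for i h using that by (simp add: w_def sub_def gs gt gb hf)
    have w: "w \<in> samples n (Suc N)" using gs gt bl by (simp add: w_def samples_def)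
    have "spin PoleA w = spin PoleA (sub n N 0 False w)" "spin PoleB w = spin PoleB (sub n N 0 True w)" using poles by (simp_all add: spin_sub)
    then have "w \<in> poled n (Suc N) p p'" using w poleA[OF n] poleB[OF n] n by (simp add: poled_def sub) (simp add: hf spin_def)
    moreover have "split_sample n N w = g"
    proof
      fix i show "split_sample n N w i = g i" using g by (cases "i < n") (auto simp: split_sample_def sub gi PiE_def extensional_def)
    qed
    ultimately show "g \<in> split_sample n N ` poled n (Suc N) p p'" by blast
  qed
qed

text \<open>With the spins of both poles given, a sample consists of independent choices for the branches, each
  a pair of samples of the halves that agree at the midpoint. Hence sums of products factorise.\<close>
theorem sum_poled_Suc:
  fixes H :: "nat \<Rightarrow> sample \<Rightarrow> sample \<Rightarrow> real"
  assumes n: "0 < n"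
  shows "(\<Sum>w\<in>poled n (Suc N) p p'. \<Prod>i<n. H i (sub n N i False w) (sub n N i True w))
    = (\<Prod>i<n. \<Sum>(w, w')\<in>joined n N p p'. H i w w')"
proof -
  have "(\<Prod>i<n. \<Sum>(w, w')\<in>joined n N p p'. H i w w')
      = (\<Sum>g\<in>{..<n} \<rightarrow>\<^sub>E joined n N p p'. \<Prod>i<n. (case g i of (w, w') \<Rightarrow> H i w w'))"
    by (rule prod_sum_PiE) (auto simp: finite_joined)
  also have "... = (\<Sum>w\<in>poled n (Suc N) p p'. \<Prod>i<n. (case split_sample n N w i of (w, w') \<Rightarrow> H i w w'))"
    by (rule sum.reindex_bij_betw[OF split_sample_bij[OF n], symmetric])
  finally show ?thesis by (simp add: split_sample_def)
qed

lemma sum_joined: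
  fixes K :: "sample \<Rightarrow> sample \<Rightarrow> real"
  assumes n: "0 < n"
  shows "(\<Sum>(w, w')\<in>joined n N p p'. K w w')
    = (\<Sum>m\<in>pm2. \<Sum>w\<in>poled n N p m. \<Sum>w'\<in>poled n N m p'. K w w')"
proof -
  have "joined n N p p' = (\<Union>m\<in>pm2. poled n N p m \<times> poled n N m p')"
    using spin_in[OF n _ poles_in_verts(1)[OF n]] by (fastforce simp: joined_def poled_def)
  then have "(\<Sum>(w, w')\<in>joined n N p p'. K w w') = (\<Sum>m\<in>pm2. \<Sum>(w, w')\<in>poled n N p m \<times> poled n N m p'. K w w')"
    by (simp only:) (rule sum.UNION_disjoint, auto simp: finite_poled, auto simp: poled_def)
  then show ?thesis by (simp add: sum.cartesian_product)
qed

section \<open>Decimation for two replicas with blue bonds\<close>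

text \<open>The joint weight that one edge contributes to the two Gibbs weights and to the conditional law of
  its blue label.\<close>
definition edge_weight :: "real \<Rightarrow> real \<Rightarrow> real \<Rightarrow> real \<Rightarrow> bool \<Rightarrow> real" where
  "edge_weight \<beta> j u v l = exp (\<beta> * (j * u)) * exp (\<beta> * (j * v)) *
     (let p = (if j * u > 0 \<and> j * v > 0 then 1 - exp (- 4 * \<beta> * \<bar>j\<bar>) else 0) in if l then p else 1 - p)"

definition weight :: "nat \<Rightarrow> nat \<Rightarrow> real \<Rightarrow> (edge \<Rightarrow> real) \<Rightarrow> sample \<Rightarrow> real" where
  "weight n N \<beta> J w = (\<Prod>e\<in>edges n N. edge_weight \<beta> (J e) (bond (fst w) e) (bond (fst (snd w)) e) (snd (snd w) e))"

text \<open>The effective coupling between the poles: series rule in each branch, addition over parallel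
  branches.\<close>
primrec eff :: "nat \<Rightarrow> real \<Rightarrow> nat \<Rightarrow> (edge \<Rightarrow> real) \<Rightarrow> real" where
  "eff n \<beta> 0 J = \<beta> * J {PoleA, PoleB}"
| "eff n \<beta> (Suc N) J = (\<Sum>i<n. ser (eff n \<beta> N (subJ n N i False J)) (eff n \<beta> N (subJ n N i True J)))"

definition ip :: "spins \<Rightarrow> spins \<Rightarrow> real" where
  "ip p p' = fst p * fst p' + snd p * snd p'"

definition ov :: "vertex \<Rightarrow> sample \<Rightarrow> real" where
  "ov x w = fst (spin x w) * snd (spin x w)"

definition series_const :: "real \<Rightarrow> real \<Rightarrow> real" where
  "series_const x y = 2 * sqrt (cosh (x + y) * cosh (x - y))"

lemma series_const_pos: "0 < series_const x y"
  by (simp add: series_const_def)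

lemma exp_ser: "series_const x y * exp (ser x y) = 2 * cosh (x + y)" "series_const x y * exp (- ser x y) = 2 * cosh (x - y)"
proof -
  have pos: "0 < cosh (x + y)" "0 < cosh (x - y)" by simp_all
  have s: "ser x y = ln (sqrt (cosh (x + y) / cosh (x - y)))" unfolding ser_def using pos by (simp add: ln_sqrt)
  have e: "exp (ser x y) = sqrt (cosh (x + y)) / sqrt (cosh (x - y))" unfolding s using pos by (subst exp_ln) (auto simp: real_sqrt_divide)
  have e': "exp (- ser x y) = sqrt (cosh (x - y)) / sqrt (cosh (x + y))" using pos by (simp add: exp_minus e field_simps)
  show "series_const x y * exp (ser x y) = 2 * cosh (x + y)" unfolding e series_const_def using pos by (simp add: real_sqrt_mult)
  show "series_const x y * exp (- ser x y) = 2 * cosh (x - y)" unfolding e' series_const_def using pos by (simp add: real_sqrt_mult)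
qed

lemma decimate_spin:
  assumes "a \<in> pm" "b \<in> pm"
  shows "exp (x * a + y * b) + exp (- (x * a + y * b)) = series_const x y * exp (ser x y * (a * b))"
proof -
  have c: "exp (z) + exp (- z) = 2 * cosh z" for z :: real by (simp add: cosh_field_def)
  have m: "cosh (- x - y) = cosh (x + y)" "cosh (- x + y) = cosh (x - y)"
    using cosh_minus[of "x + y"] cosh_minus[of "x - y"] by (simp_all only: minus_add_distrib minus_diff_eq diff_conv_add_uminus add.commute minus_minus)
  show ?thesis unfolding c using assms exp_ser[of x y] m by auto
qed

lemma sum_spin_pairs:
  fixes F :: "spins \<Rightarrow> real"
  assumes "q \<in> pm"
  shows "(\<Sum>m\<in>pm2. F m) = F (1, q) + F (1, - q) + F (-1, q) + F (-1, - q)"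
  using assms by (auto simp: sum.cartesian_product[symmetric])

lemma decimate_pair:
  assumes "p \<in> pm2" "p' \<in> pm2"
  shows "(\<Sum>m\<in>pm2. exp (x * ip p m) * exp (y * ip m p')) = (series_const x y)\<^sup>2 * exp (ser x y * ip p p')"
proof -
  obtain a a' b b' where p: "p = (a, a')" "p' = (b, b')" by (metis prod.collapse)
  let ?f = "x * a + y * b" and ?g = "x * a' + y * b'"
  have "(\<Sum>m\<in>pm2. exp (x * ip p m) * exp (y * ip m p')) = (exp ?f + exp (- ?f)) * (exp ?g + exp (- ?g))"
    unfolding sum_spin_pairs[of 1, simplified] p ip_def by (simp add: algebra_simps flip: exp_add)
  also have "... = (series_const x y)\<^sup>2 * exp (ser x y * ip p p')"
    using assms p by (subst (1 2) decimate_spin) (auto simp: ip_def p power2_eq_square algebra_simps exp_add)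
  finally show ?thesis .
qed

locale lattice =
  fixes n :: nat and \<beta> :: real
  assumes n: "0 < n" and \<beta>: "0 \<le> \<beta>"
begin

abbreviation "X \<equiv> eff n \<beta>"
abbreviation "W N J \<equiv> weight n N \<beta> J"
abbreviation "gw N J \<equiv> gibbs_weight n N \<beta> J"
abbreviation "sJ \<equiv> subJ n"

lemma edge_weight_nonneg: "0 \<le> edge_weight \<beta> j u v l"
  using \<beta> by (auto simp: edge_weight_def Let_def)

lemma edge_weight_sum: "edge_weight \<beta> j u v True + edge_weight \<beta> j u v False = exp (\<beta> * (j * u)) * exp (\<beta> * (j * v))"
  by (auto simp: edge_weight_def Let_def algebra_simps)

lemma weight_nonneg: "0 \<le> W N J w"
  unfolding weight_def by (intro prod_nonneg) (auto intro: edge_weight_nonneg)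

lemma bond_sub:
  assumes "e \<in> edges n N"
  shows "bond (sub_config n N i h \<sigma>) e = bond \<sigma> (emb i h ` e)"
proof -
  have "bond \<sigma> (emb i h ` e) = (\<Prod>x\<in>e. \<sigma> (emb i h x))"
    unfolding bond_def by (rule prod.reindex_cong[of "emb i h"]) (auto intro: inj_onI)
  also have "... = bond (sub_config n N i h \<sigma>) e"
    unfolding bond_def using edges_subset[OF n assms] by (intro prod.cong) (auto simp: sub_config_def)
  finally show ?thesis ..
qed

lemma weight_sub:
  "W N (sJ N i h J) (sub n N i h w) = (\<Prod>e\<in>edges n N. edge_weight \<beta> (J (emb i h ` e))
     (bond (fst w) (emb i h ` e)) (bond (fst (snd w)) (emb i h ` e)) (snd (snd w) (emb i h ` e)))" unfolding weight_def
  by (intro prod.cong refl) (cases w, simp add: sub_def subJ_def bond_sub sub_label_def)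

lemma weight_Suc: "W (Suc N) J w =
   (\<Prod>i<n. W N (sJ N i False J) (sub n N i False w) * W N (sJ N i True J) (sub n N i True w))"
  unfolding weight_sub by (subst weight_def) (rule prod_edges_Suc[OF n])

definition psum :: "nat \<Rightarrow> (edge \<Rightarrow> real) \<Rightarrow> spins \<Rightarrow> spins \<Rightarrow> (sample \<Rightarrow> real) \<Rightarrow> real" where
  "psum N J p p' F = (\<Sum>w\<in>poled n N p p'. W N J w * F w)"

definition bsum :: "nat \<Rightarrow> (edge \<Rightarrow> real) \<Rightarrow> (edge \<Rightarrow> real) \<Rightarrow> spins \<Rightarrow> spins \<Rightarrow> (sample \<Rightarrow> sample \<Rightarrow> real) \<Rightarrow> real" where
  "bsum N J J' p p' K = (\<Sum>m\<in>pm2. \<Sum>w\<in>poled n N p m. \<Sum>w'\<in>poled n N m p'.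
     W N J w * W N J' w' * K w w')"

lemma psum_Suc:
  "psum (Suc N) J p p' (\<lambda>w. \<Prod>i<n. K i (sub n N i False w) (sub n N i True w))
    = (\<Prod>i<n. bsum N (sJ N i False J) (sJ N i True J) p p' (K i))"
proof -
  have "psum (Suc N) J p p' (\<lambda>w. \<Prod>i<n. K i (sub n N i False w) (sub n N i True w))
      = (\<Sum>w\<in>poled n (Suc N) p p'. \<Prod>i<n. (\<lambda>w w'. W N (sJ N i False J) w *
          W N (sJ N i True J) w' * K i w w') (sub n N i False w) (sub n N i True w))" unfolding psum_def weight_Suc by (simp add: prod.distrib)
  also have "... = (\<Prod>i<n. bsum N (sJ N i False J) (sJ N i True J) p p' (K i))"
    unfolding bsum_def by (subst sum_poled_Suc[OF n]) (simp add: sum_joined[OF n])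
  finally show ?thesis .
qed

lemma bsum_mult:
  "bsum N J J' p p' (\<lambda>w w'. A w * B w') = (\<Sum>m\<in>pm2. psum N J p m A * psum N J' m p' B)"
  unfolding bsum_def psum_def by (simp add: sum_product mult_ac)

definition base_config :: "real \<Rightarrow> real \<Rightarrow> config" where
  "base_config a b = (\<lambda>x\<in>{PoleA, PoleB}. if x = PoleA then a else b)"

definition base_sample :: "spins \<Rightarrow> spins \<Rightarrow> bool \<Rightarrow> sample" where
  "base_sample p p' l = (base_config (fst p) (fst p'), base_config (snd p) (snd p'), \<lambda>e. e = {PoleA, PoleB} \<and> l)"

lemma config_0_eq: "\<sigma> \<in> configs n 0 \<Longrightarrow> \<sigma> = base_config (\<sigma> PoleA) (\<sigma> PoleB)"
  by (rule PiE_ext[of _ "{PoleA, PoleB}" "\<lambda>_. UNIV"]) (auto simp: configs_def base_config_def PiE_def)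

lemma poled_0:
  assumes "p \<in> pm2" "p' \<in> pm2"
  shows "poled n 0 p p' = base_sample p p' ` UNIV"
proof (intro equalityI subsetI)
  fix w assume w: "w \<in> poled n 0 p p'"
  obtain \<sigma> \<tau> b where o: "w = (\<sigma>, \<tau>, b)" by (metis prod_cases3)
  have "\<sigma> = base_config (\<sigma> PoleA) (\<sigma> PoleB)" "\<tau> = base_config (\<tau> PoleA) (\<tau> PoleB)"
    using w o config_0_eq by (auto simp: poled_def samples_def)
  moreover have "\<sigma> PoleA = fst p" "\<tau> PoleA = snd p" "\<sigma> PoleB = fst p'" "\<tau> PoleB = snd p'"
    using w o by (auto simp: poled_def spin_def)
  moreover have "b = (\<lambda>e. e = {PoleA, PoleB} \<and> b {PoleA, PoleB})"
  proof
    fix e show "b e = (e = {PoleA, PoleB} \<and> b {PoleA, PoleB})"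
      using w o by (cases "e = {PoleA, PoleB}") (auto simp: poled_def samples_def labels_def)
  qed
  ultimately have "w = base_sample p p' (b {PoleA, PoleB})" by (simp add: o base_sample_def)
  then show "w \<in> base_sample p p' ` UNIV" by blast
next
  fix w assume "w \<in> base_sample p p' ` UNIV"
  then obtain l where "w = base_sample p p' l" by blast
  then show "w \<in> poled n 0 p p'" using assms by (auto simp: poled_def samples_def configs_def base_sample_def base_config_def labels_def spin_def)
qed

lemma psum_0:
  assumes "p \<in> pm2" "p' \<in> pm2"
  shows "psum 0 J p p' F = edge_weight \<beta> (J {PoleA, PoleB}) (fst p * fst p') (snd p * snd p') True * F (base_sample p p' True)
    + edge_weight \<beta> (J {PoleA, PoleB}) (fst p * fst p') (snd p * snd p') False * F (base_sample p p' False)"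
proof -
  have w: "W 0 J (base_sample p p' l) = edge_weight \<beta> (J {PoleA, PoleB}) (fst p * fst p') (snd p * snd p') l" for l
    by (simp add: weight_def base_sample_def bond_def base_config_def)
  have "base_sample p p' True \<noteq> base_sample p p' False" by (auto simp: base_sample_def fun_eq_iff)
  then show ?thesis unfolding psum_def poled_0[OF assms] by (simp add: UNIV_bool w)
qed

text \<open>Exact decimation: the total weight with given pole spins depends on them only through the effective
  coupling, with a prefactor that is common to all pole spins and cancels in conditional expectations.\<close>
lemma psum_one: "\<exists>C>0. \<forall>p\<in>pm2. \<forall>p'\<in>pm2. psum N J p p' (\<lambda>_. 1) = C * exp (X N J * ip p p')"
proof (induction N arbitrary: J)
  case 0
  have "psum 0 J p p' (\<lambda>_. 1) = 1 * exp (X 0 J * ip p p')" if "p \<in> pm2" "p' \<in> pm2" for p p'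
    using edge_weight_sum by (simp add: psum_0[OF that] ip_def algebra_simps exp_add)
  then show ?case by (intro exI[of _ 1]) auto
next
  case (Suc N)
  have "\<exists>C>0. \<forall>p\<in>pm2. \<forall>p'\<in>pm2. bsum N (sJ N i False J) (sJ N i True J) p p' (\<lambda>_ _. 1)
      = C * exp (ser (X N (sJ N i False J)) (X N (sJ N i True J)) * ip p p')" for i
  proof -
    let ?x = "X N (sJ N i False J)" and ?y = "X N (sJ N i True J)"
    obtain C where C: "C > 0" "\<And>p p'. p \<in> pm2 \<Longrightarrow> p' \<in> pm2 \<Longrightarrow> psum N (sJ N i False J) p p' (\<lambda>_. 1) = C * exp (?x * ip p p')"
      using Suc by metis
    obtain C' where C': "C' > 0" "\<And>p p'. p \<in> pm2 \<Longrightarrow> p' \<in> pm2 \<Longrightarrow> psum N (sJ N i True J) p p' (\<lambda>_. 1) = C' * exp (?y * ip p p')"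
      using Suc by metis
    have "bsum N (sJ N i False J) (sJ N i True J) p p' (\<lambda>_ _. 1) = (C * C' * (series_const ?x ?y)\<^sup>2) * exp (ser ?x ?y * ip p p')"
      if p: "p \<in> pm2" "p' \<in> pm2" for p p'
    proof -
      have "bsum N (sJ N i False J) (sJ N i True J) p p' (\<lambda>_ _. 1) = (\<Sum>m\<in>pm2. C * C' * (exp (?x * ip p m) * exp (?y * ip m p')))"
        using bsum_mult[of N "sJ N i False J" "sJ N i True J" p p' "\<lambda>_. 1" "\<lambda>_. 1"]
        by (simp only: mult_1) (intro sum.cong refl, simp only: C(2)[OF p(1)] C'(2)[OF _ p(2)] mult_ac)
      also have "... = C * C' * (\<Sum>m\<in>pm2. exp (?x * ip p m) * exp (?y * ip m p'))" by (rule sum_distrib_left[symmetric])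
      finally show ?thesis unfolding decimate_pair[OF p] by (simp only: mult.assoc)
    qed
    moreover have "0 < C * C' * (series_const ?x ?y)\<^sup>2" using C(1) C'(1) series_const_pos[of ?x ?y] by simp
    ultimately show ?thesis by metis
  qed
  then obtain c where c: "\<And>i. c i > 0" "\<And>i p p'. p \<in> pm2 \<Longrightarrow> p' \<in> pm2 \<Longrightarrow>
      bsum N (sJ N i False J) (sJ N i True J) p p' (\<lambda>_ _. 1)
      = c i * exp (ser (X N (sJ N i False J)) (X N (sJ N i True J)) * ip p p')" by metis
  have "psum (Suc N) J p p' (\<lambda>_. 1) = (\<Prod>i<n. c i) * exp (X (Suc N) J * ip p p')" if "p \<in> pm2" "p' \<in> pm2" for p p'
    using psum_Suc[of N J p p' "\<lambda>_ _ _. 1"] c(2)[OF that] by (simp add: prod.distrib exp_sum sum_distrib_right)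
  moreover have "0 < (\<Prod>i<n. c i)" using c(1) by (intro prod_pos) auto
  ultimately show ?case by blast
qed

lemma psum_one_pos: "p \<in> pm2 \<Longrightarrow> p' \<in> pm2 \<Longrightarrow> 0 < psum N J p p' (\<lambda>_. 1)"
  using psum_one[of N J] by (metis exp_gt_zero mult_pos_pos)

text \<open>Conditional expectation of the two-replica system given the spins of both poles.\<close>
definition cex :: "nat \<Rightarrow> (edge \<Rightarrow> real) \<Rightarrow> spins \<Rightarrow> spins \<Rightarrow> (sample \<Rightarrow> real) \<Rightarrow> real" where
  "cex N J p p' F = psum N J p p' F / psum N J p p' (\<lambda>_. 1)"

lemma psum_cex:
  assumes "p \<in> pm2" "p' \<in> pm2"
  shows "psum N J p p' F = psum N J p p' (\<lambda>_. 1) * cex N J p p' F"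
  using psum_one_pos[OF assms, of N J] by (simp add: cex_def)

lemma psum_mono:
  assumes "\<And>w. w \<in> poled n N p p' \<Longrightarrow> W N J w \<noteq> 0 \<Longrightarrow> F w \<le> G w"
  shows "psum N J p p' F \<le> psum N J p p' G"
  unfolding psum_def
proof (rule sum_mono)
  fix w assume "w \<in> poled n N p p'"
  then show "W N J w * F w \<le> W N J w * G w" using assms[of w] weight_nonneg[of N J w] by (cases "W N J w = 0") (auto intro: mult_left_mono)
qed

lemma cex_mono:
  assumes p: "p \<in> pm2" "p' \<in> pm2"
    and "\<And>w. w \<in> poled n N p p' \<Longrightarrow> W N J w \<noteq> 0 \<Longrightarrow> F w \<le> G w"
  shows "cex N J p p' F \<le> cex N J p p' G"
  unfolding cex_def using psum_mono[OF assms(3)] psum_one_pos[OF p, of N J] by (simp add: divide_right_mono)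

lemma cex_one: "p \<in> pm2 \<Longrightarrow> p' \<in> pm2 \<Longrightarrow> cex N J p p' (\<lambda>_. 1) = 1"
  using psum_one_pos[of p p' N J] by (simp add: cex_def)

lemma psum_add: "psum N J p p' (\<lambda>w. F w + G w) = psum N J p p' F + psum N J p p' G"
  by (simp add: psum_def sum.distrib distrib_left)

lemma cex_add: "cex N J p p' (\<lambda>w. F w + G w) = cex N J p p' F + cex N J p p' G"
  by (simp add: cex_def psum_add add_divide_distrib)

lemma psum_cmult: "psum N J p p' (\<lambda>w. c * F w) = c * psum N J p p' F"
  by (simp add: psum_def sum_distrib_left mult_ac)

lemma cex_cmult: "cex N J p p' (\<lambda>w. c * F w) = c * cex N J p p' F"
  by (simp add: cex_def psum_cmult)

lemma cex_bounds:
  assumes p: "p \<in> pm2" "p' \<in> pm2" and F: "\<And>w. 0 \<le> F w" "\<And>w. F w \<le> 1"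
  shows "0 \<le> cex N J p p' F" "cex N J p p' F \<le> 1"
proof -
  have "cex N J p p' (\<lambda>_. 0 * 1) \<le> cex N J p p' F" by (rule cex_mono[OF p]) (simp add: F)
  then show "0 \<le> cex N J p p' F" by (simp add: cex_def psum_def)
  have "cex N J p p' F \<le> cex N J p p' (\<lambda>_. 1)" by (rule cex_mono[OF p]) (simp add: F)
  then show "cex N J p p' F \<le> 1" by (simp add: cex_one[OF p])
qed

lemma bsum_one_pos:
  assumes "p \<in> pm2" "p' \<in> pm2"
  shows "0 < bsum N J J' p p' (\<lambda>_ _. 1)"
proof -
  have "bsum N J J' p p' (\<lambda>_ _. 1) = (\<Sum>m\<in>pm2. psum N J p m (\<lambda>_. 1) * psum N J' m p' (\<lambda>_. 1))"
    using bsum_mult[of N J J' p p' "\<lambda>_. 1" "\<lambda>_. 1"] by simp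
  also have "0 < ..." using assms by (intro sum_pos) (auto intro!: mult_pos_pos psum_one_pos simp del: insert_iff)
  finally show ?thesis .
qed

lemma cex_branches:
  assumes "p \<in> pm2" "p' \<in> pm2"
  shows "cex (Suc N) J p p' (\<lambda>w. \<Prod>i<n. K i (sub n N i False w) (sub n N i True w))
    = (\<Prod>i<n. bsum N (sJ N i False J) (sJ N i True J) p p' (K i)
          / bsum N (sJ N i False J) (sJ N i True J) p p' (\<lambda>_ _. 1))"
  unfolding cex_def psum_Suc using psum_Suc[of N J p p' "\<lambda>_ _ _. 1"] by (simp add: prod_dividef)

lemma cex_one_branch:
  assumes p: "p \<in> pm2" "p' \<in> pm2" and j: "j < n"
  shows "cex (Suc N) J p p' (\<lambda>w. K (sub n N j False w) (sub n N j True w))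
    = bsum N (sJ N j False J) (sJ N j True J) p p' K
          / bsum N (sJ N j False J) (sJ N j True J) p p' (\<lambda>_ _. 1)"
proof -
  let ?K = "\<lambda>i. if i = j then K else (\<lambda>_ _. 1)"
  have "(\<Prod>i<n. ?K i (sub n N i False w) (sub n N i True w)) = K (sub n N j False w) (sub n N j True w)" for w
  proof -
    have "(\<Prod>i<n. ?K i (sub n N i False w) (sub n N i True w)) = (\<Prod>i<n. if i = j then K (sub n N i False w) (sub n N i True w) else 1)"
      by (intro prod.cong) auto
    then show ?thesis using j by (simp add: prod.delta)
  qed
  then have "cex (Suc N) J p p' (\<lambda>w. K (sub n N j False w) (sub n N j True w))
      = (\<Prod>i<n. bsum N (sJ N i False J) (sJ N i True J) p p' (?K i)
          / bsum N (sJ N i False J) (sJ N i True J) p p' (\<lambda>_ _. 1))" using cex_branches[OF p, of N J ?K] by simp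
  also have "... = (\<Prod>i<n. if i = j then bsum N (sJ N j False J) (sJ N j True J) p p' K
          / bsum N (sJ N j False J) (sJ N j True J) p p' (\<lambda>_ _. 1) else 1)"
    using bsum_one_pos[OF p, of N] by (intro prod.cong refl) (auto simp: less_imp_neq[THEN not_sym])
  finally show ?thesis using j by (simp add: prod.delta)
qed

text \<open>Pole spins with overlap \<open>q\<close> are gauged to \<open>(a, q a)\<close> and \<open>(b, q b)\<close>; the midpoint then has spins
  \<open>(\<mu>, q \<nu>)\<close> with weight \<open>exp ((u + v) * (\<mu> + \<nu>))\<close>, and \<open>\<mu> = \<nu>\<close> means that its overlap is again \<open>q\<close>.\<close>
lemma bsum_ratio:
  assumes q: "q \<in> pm" "a \<in> pm" "b \<in> pm" and u: "u = X N J * a" and v: "v = X N J' * b"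
  shows "bsum N J J' (a, q * a) (b, q * b) (\<lambda>w w'. A w * B w') / bsum N J J' (a, q * a) (b, q * b) (\<lambda>_ _. 1)
    = (\<Sum>\<mu>\<in>pm. \<Sum>\<nu>\<in>pm. exp ((u + v) * (\<mu> + \<nu>)) * (cex N J (a, q * a) (\<mu>, q * \<nu>) A * cex N J' (\<mu>, q * \<nu>) (b, q * b) B))
      / (4 * (cosh (u + v))\<^sup>2)"
proof -
  let ?p = "(a, q * a)" and ?p' = "(b, q * b)"
  have p: "?p \<in> pm2" "?p' \<in> pm2" using q by auto
  have m: "(\<mu>, q * \<nu>) \<in> pm2" if "\<mu> \<in> pm" "\<nu> \<in> pm" for \<mu> \<nu> using that q by auto
  have qq: "q * q = 1" using q by auto
  obtain C where C: "C > 0" "\<And>p p'. p \<in> pm2 \<Longrightarrow> p' \<in> pm2 \<Longrightarrow> psum N J p p' (\<lambda>_. 1) = C * exp (X N J * ip p p')"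
    using psum_one by metis
  obtain C' where C': "C' > 0" "\<And>p p'. p \<in> pm2 \<Longrightarrow> p' \<in> pm2 \<Longrightarrow> psum N J' p p' (\<lambda>_. 1) = C' * exp (X N J' * ip p p')"
    using psum_one by metis
  have reindex: "(\<Sum>m\<in>pm2. F m) = (\<Sum>\<mu>\<in>pm. \<Sum>\<nu>\<in>pm. F (\<mu>, q * \<nu>))" for F :: "spins \<Rightarrow> real"
    using q by (auto simp: sum_spin_pairs[OF q(1)])
  have ipm: "ip ?p (\<mu>, q * \<nu>) = a * (\<mu> + \<nu>)" "ip (\<mu>, q * \<nu>) ?p' = b * (\<mu> + \<nu>)" for \<mu> \<nu>
    using q(1) by (auto simp: ip_def algebra_simps)
  have gen: "bsum N J J' ?p ?p' (\<lambda>w w'. A w * B w')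
      = C * C' * (\<Sum>\<mu>\<in>pm. \<Sum>\<nu>\<in>pm. exp ((u + v) * (\<mu> + \<nu>)) * (cex N J ?p (\<mu>, q * \<nu>) A * cex N J' (\<mu>, q * \<nu>) ?p' B))" for A B
  proof -
    have "bsum N J J' ?p ?p' (\<lambda>w w'. A w * B w') = (\<Sum>\<mu>\<in>pm. \<Sum>\<nu>\<in>pm. psum N J ?p (\<mu>, q * \<nu>) A * psum N J' (\<mu>, q * \<nu>) ?p' B)"
      unfolding bsum_mult by (rule reindex)
    also have "... = (\<Sum>\<mu>\<in>pm. \<Sum>\<nu>\<in>pm. C * C' * (exp ((u + v) * (\<mu> + \<nu>)) * (cex N J ?p (\<mu>, q * \<nu>) A * cex N J' (\<mu>, q * \<nu>) ?p' B)))"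
    proof (intro sum.cong refl)
      fix \<mu> \<nu> assume mn: "\<mu> \<in> pm" "\<nu> \<in> pm"
      have e: "exp ((u + v) * (\<mu> + \<nu>)) = exp (X N J * (a * (\<mu> + \<nu>))) * exp (X N J' * (b * (\<mu> + \<nu>)))"
        unfolding u v by (simp add: algebra_simps flip: exp_add)
      have fA: "psum N J ?p (\<mu>, q * \<nu>) A = C * exp (X N J * (a * (\<mu> + \<nu>))) * cex N J ?p (\<mu>, q * \<nu>) A"
        unfolding psum_cex[OF p(1) m[OF mn], of N J A] C(2)[OF p(1) m[OF mn]] ipm ..
      have fB: "psum N J' (\<mu>, q * \<nu>) ?p' B = C' * exp (X N J' * (b * (\<mu> + \<nu>))) * cex N J' (\<mu>, q * \<nu>) ?p' B"
        unfolding psum_cex[OF m[OF mn] p(2), of N J' B] C'(2)[OF m[OF mn] p(2)] ipm ..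
      show "psum N J ?p (\<mu>, q * \<nu>) A * psum N J' (\<mu>, q * \<nu>) ?p' B
        = C * C' * (exp ((u + v) * (\<mu> + \<nu>)) * (cex N J ?p (\<mu>, q * \<nu>) A * cex N J' (\<mu>, q * \<nu>) ?p' B))"
        unfolding fA fB e by (simp only: mult_ac)
    qed
    finally show ?thesis by (simp only: sum_distrib_left)
  qed
  have "bsum N J J' ?p ?p' (\<lambda>_ _. 1) = C * C' * (\<Sum>\<mu>\<in>pm. \<Sum>\<nu>\<in>pm. exp ((u + v) * (\<mu> + \<nu>)))"
  proof -
    have "(\<Sum>\<mu>\<in>pm. \<Sum>\<nu>\<in>pm. exp ((u + v) * (\<mu> + \<nu>)) * (cex N J ?p (\<mu>, q * \<nu>) (\<lambda>_. 1) * cex N J' (\<mu>, q * \<nu>) ?p' (\<lambda>_. 1)))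
        = (\<Sum>\<mu>\<in>pm. \<Sum>\<nu>\<in>pm. exp ((u + v) * (\<mu> + \<nu>)))"
    proof (intro sum.cong refl)
      fix \<mu> \<nu> assume mn: "\<mu> \<in> pm" "\<nu> \<in> pm"
      show "exp ((u + v) * (\<mu> + \<nu>)) * (cex N J ?p (\<mu>, q * \<nu>) (\<lambda>_. 1) * cex N J' (\<mu>, q * \<nu>) ?p' (\<lambda>_. 1))
        = exp ((u + v) * (\<mu> + \<nu>))" by (simp only: cex_one[OF p(1) m[OF mn]] cex_one[OF m[OF mn] p(2)] mult_1_right)
    qed
    then show ?thesis using gen[of "\<lambda>_. 1" "\<lambda>_. 1"] by (simp only: mult_1)
  qed
  also have "(\<Sum>\<mu>\<in>pm. \<Sum>\<nu>\<in>pm. exp ((u + v) * (\<mu> + \<nu>))) = 4 * (cosh (u + v))\<^sup>2"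
    by (simp add: cosh_field_def power2_eq_square algebra_simps flip: exp_add)
  finally have one: "bsum N J J' ?p ?p' (\<lambda>_ _. 1) = C * C' * (4 * (cosh (u + v))\<^sup>2)" .
  show ?thesis unfolding gen one using C(1) C'(1) by simp
qed

end

section \<open>Blue clusters and connection probabilities\<close>

lemma cluster_refl: "x \<in> cluster n N b x"
  by (simp add: cluster_def)

lemma cluster_sym: "y \<in> cluster n N b x \<Longrightarrow> x \<in> cluster n N b y"
proof -
  let ?r = "{(y, z). {y, z} \<in> edges n N \<and> b {y, z}}"
  assume "y \<in> cluster n N b x"
  then have "(x, y) \<in> ?r\<^sup>*" by (simp add: cluster_def)
  then have "(y, x) \<in> (?r\<inverse>)\<^sup>*" by (rule rtrancl_converseI)
  moreover have "?r\<inverse> = ?r" by (auto simp: insert_commute)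
  ultimately show ?thesis by (simp add: cluster_def)
qed

lemma cluster_trans: "y \<in> cluster n N b x \<Longrightarrow> z \<in> cluster n N b y \<Longrightarrow> z \<in> cluster n N b x"
  unfolding cluster_def by (auto intro: rtrancl_trans)

lemma cluster_eq: "y \<in> cluster n N b x \<Longrightarrow> cluster n N b y = cluster n N b x"
  using cluster_trans cluster_sym by blast

lemma cluster_subset:
  assumes "0 < n" "x \<in> verts n N" shows "cluster n N b x \<subseteq> verts n N"
proof
  fix y assume "y \<in> cluster n N b x"
  then have "(x, y) \<in> {(y, z). {y, z} \<in> edges n N \<and> b {y, z}}\<^sup>*" by (simp add: cluster_def)
  then show "y \<in> verts n N"
  proof (induction rule: rtrancl_induct)
    case base show ?case by (rule assms(2))
  next
    case (step y z)
    then have "{y, z} \<in> edges n N" by auto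
    then show ?case using edges_subset[OF assms(1)] by blast
  qed
qed

lemma cluster_emb:
  assumes "i < n" and "y \<in> cluster n N (sub_label n N i h b) x"
  shows "emb i h y \<in> cluster n (Suc N) b (emb i h x)"
proof -
  have "(x, y) \<in> {(y, z). {y, z} \<in> edges n N \<and> sub_label n N i h b {y, z}}\<^sup>*" using assms(2) by (simp add: cluster_def)
  then have "(emb i h x, emb i h y) \<in> {(y, z). {y, z} \<in> edges n (Suc N) \<and> b {y, z}}\<^sup>*"
  proof (induction rule: rtrancl_induct)
    case (step y z)
    then have e: "{y, z} \<in> edges n N" "b (emb i h ` {y, z})" by (auto simp: sub_label_def)
    have "emb i h ` {y, z} \<in> edges n (Suc N)" unfolding edges.simps using e(1) assms(1) by blast
    then have "(emb i h y, emb i h z) \<in> {(y, z). {y, z} \<in> edges n (Suc N) \<and> b {y, z}}" using e(2) by simp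
    with step.IH show ?case by (rule rtrancl_into_rtrancl)
  qed simp
  then show ?thesis by (simp add: cluster_def)
qed

text \<open>A vertex is reached through a chain of midpoints, one per generation. The loss of the chain sums \<open>g\<close>,
  evaluated at the effective couplings of the two halves next to each of these midpoints.\<close>
fun loss :: "(real \<Rightarrow> real \<Rightarrow> real) \<Rightarrow> nat \<Rightarrow> real \<Rightarrow> nat \<Rightarrow> (edge \<Rightarrow> real) \<Rightarrow> vertex \<Rightarrow> real" where
  "loss g n \<beta> (Suc N) J (Mid i) = g (eff n \<beta> N (subJ n N i False J)) (eff n \<beta> N (subJ n N i True J))"
| "loss g n \<beta> (Suc N) J (Sub i h y) = g (eff n \<beta> N (subJ n N i False J)) (eff n \<beta> N (subJ n N i True J))
     + loss g n \<beta> N (subJ n N i h J) y"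
| "loss g n \<beta> N J x = 0"

definition sech2 :: "real \<Rightarrow> real" where "sech2 x = 1 / (cosh x)\<^sup>2"

text \<open>Symmetric in the signs of both arguments, so that it does not depend on the gauge of the poles.\<close>
definition blue_loss :: "real \<Rightarrow> real \<Rightarrow> real" where
  "blue_loss u v = (sech2 (u + v) + sech2 (u - v)) / 2"

definition site_loss :: "real \<Rightarrow> real \<Rightarrow> real" where
  "site_loss u v = min (1 / 2) (blue_loss u v)"

lemma sech2_bounds: "0 < sech2 x" "sech2 x \<le> 1" "sech2 (- x) = sech2 x"
proof -
  have "1 \<le> (cosh x)\<^sup>2" using cosh_real_ge_1[of x] by (rule one_le_power)
  then show "sech2 x \<le> 1" by (simp add: sech2_def)
qed (simp_all add: sech2_def)

lemma blue_loss_sign: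
  assumes "a \<in> pm" "b \<in> pm" shows "blue_loss (x * a) (y * b) = blue_loss x y"
proof -
  have "sech2 (- x - y) = sech2 (x + y)" "sech2 (- x + y) = sech2 (x - y)" using sech2_bounds(3)[of "x + y"] sech2_bounds(3)[of "x - y"] by simp_all
  then show ?thesis using assms unfolding blue_loss_def by auto
qed

lemma site_loss_ge: "sech2 (u + v) / 2 \<le> site_loss u v"
  using sech2_bounds(1)[of "u - v"] sech2_bounds(2)[of "u + v"] by (simp add: site_loss_def blue_loss_def)

lemma blue_loss_ge:
  "(1 + exp (- 2 * (\<bar>u\<bar> + \<bar>v\<bar>))) / (2 * (cosh (u + v))\<^sup>2) \<le> blue_loss u v"
proof -
  define S where "S = \<bar>u\<bar> + \<bar>v\<bar>"
  have "exp (- S) * cosh (u - v) \<le> 1"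
  proof -
    have "cosh \<bar>u - v\<bar> \<le> cosh S" unfolding S_def by (subst cosh_real_nonneg_le_iff) auto
    then have "cosh (u - v) \<le> cosh S" by (metis cosh_real_abs)
    then have "exp (- S) * cosh (u - v) \<le> exp (- S) * cosh S" by simp
    also have "... = (1 + exp (- S) * exp (- S)) / 2" by (simp add: cosh_field_def distrib_left flip: exp_add)
    also have "... \<le> 1" using mult_mono[of "exp (- S)" 1 "exp (- S)" 1] by (simp add: S_def)
    finally show ?thesis .
  qed
  then have "(exp (- S) * cosh (u - v))\<^sup>2 \<le> 1" by (simp add: power_le_one)
  also have "1 \<le> (cosh (u + v))\<^sup>2" using sech2_bounds(2)[of "u + v"] by (simp add: sech2_def)
  also have "(exp (- S) * cosh (u - v))\<^sup>2 = exp (- 2 * S) * (cosh (u - v))\<^sup>2" by (simp add: power_mult_distrib flip: exp_double)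
  finally have "exp (- 2 * S) / (cosh (u + v))\<^sup>2 \<le> 1 / (cosh (u - v))\<^sup>2" by (simp add: field_simps)
  note le = this
  have split: "(1 + E) / (2 * C) = (1 / C + E / C) / 2" for C E :: real by (simp add: add_divide_distrib)
  show ?thesis
    unfolding blue_loss_def sech2_def S_def[symmetric] split
    by (intro divide_right_mono add_left_mono le) simp
qed

context lattice begin

definition nc :: "nat \<Rightarrow> sample \<Rightarrow> real" where
  "nc N w = of_bool (PoleB \<notin> cluster n N (snd (snd w)) PoleA)"

lemma nc_bounds: "0 \<le> nc N w" "nc N w \<le> 1" by (simp_all add: nc_def)

lemma blue_ok:
  assumes w: "W N J w \<noteq> 0" and s: "w \<in> samples n N" and c: "y \<in> cluster n N (snd (snd w)) x"
  shows "ov y w = ov x w"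
proof -
  have "(x, y) \<in> {(y, z). {y, z} \<in> edges n N \<and> snd (snd w) {y, z}}\<^sup>*" using c by (simp add: cluster_def)
  then show ?thesis
  proof (induction rule: rtrancl_induct)
    case (step y z)
    then have e: "{y, z} \<in> edges n N" "snd (snd w) {y, z}" by auto
    have "edge_weight \<beta> (J {y, z}) (bond (fst w) {y, z}) (bond (fst (snd w)) {y, z}) True \<noteq> 0"
      using w e finite_edges unfolding weight_def by auto
    then have "0 < J {y, z} * bond (fst w) {y, z} \<and> 0 < J {y, z} * bond (fst (snd w)) {y, z}"
      by (auto simp: edge_weight_def Let_def split: if_splits)
    then have b: "0 < bond (fst w) {y, z} * bond (fst (snd w)) {y, z}" by (auto simp: zero_less_mult_iff)
    obtain y' z' where "{y, z} = {y', z'}" "y' \<noteq> z'" using edgesD[OF n e(1)] by blast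
    then have "y \<noteq> z" by auto
    then have b': "0 < ov y w * ov z w" using b by (simp add: bond_def ov_def spin_def mult_ac)
    have "y \<in> verts n N" "z \<in> verts n N" using edges_subset[OF n e(1)] by auto
    then have "spin y w \<in> pm2" "spin z w \<in> pm2" using spin_in[OF n s] by auto
    then have "ov y w \<in> pm" "ov z w \<in> pm" by (auto simp: ov_def)
    then have "ov y w = ov z w" using b' by auto
    then show ?case using step.IH by simp
  qed simp
qed

text \<open>The connection bound \<open>1 - exp (- 4 * max 0 (x * s))\<close> is reproduced by the series rule: summed over the
  midpoint, the products of the bounds of the two halves give at least the bound for \<open>ser u v\<close>.\<close>
lemma connection_series:
  assumes "0 < ser u v"
  shows "4 * (cosh (u + v))\<^sup>2 * (1 - exp (- 4 * ser u v))
    \<le> (\<Sum>\<mu>\<in>pm. exp ((u + v) * (\<mu> + \<mu>)) * ((1 - exp (- 4 * max 0 (u * \<mu>))) * (1 - exp (- 4 * max 0 (v * \<mu>)))))"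
proof -
  have pos: "0 < cosh (u + v)" "0 < cosh (u - v)" by simp_all
  have "exp (- 2 * ser u v) = cosh (u - v) / cosh (u + v)"
  proof -
    have "exp (- 2 * ser u v) = exp (- ser u v) / exp (ser u v)" by (simp flip: exp_diff)
    also have "... = (series_const u v * exp (- ser u v)) / (series_const u v * exp (ser u v))" using series_const_pos[of u v] by simp
    finally show ?thesis unfolding exp_ser by simp
  qed
  note e2 = this
  have "exp (- 4 * ser u v) = (exp (- 2 * ser u v))\<^sup>2" by (simp flip: exp_double)
  also have "... = (cosh (u - v))\<^sup>2 / (cosh (u + v))\<^sup>2" unfolding e2 by (rule power_divide)
  finally have e4: "exp (- 4 * ser u v) = (cosh (u - v))\<^sup>2 / (cosh (u + v))\<^sup>2" .
  have "4 * (cosh (u + v))\<^sup>2 * (1 - exp (- 4 * ser u v)) = 4 * ((cosh (u + v))\<^sup>2 - (cosh (u - v))\<^sup>2)"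
    unfolding e4 using pos by (simp add: right_diff_distrib)
  also have "4 * ((cosh (u + v))\<^sup>2 - (cosh (u - v))\<^sup>2) = 4 * (sinh (2 * u) * sinh (2 * v))"
  proof -
    have "(cosh (u + v))\<^sup>2 - (cosh (u - v))\<^sup>2 = (cosh (u + v) + cosh (u - v)) * (cosh (u + v) - cosh (u - v))"
      by (simp add: power2_eq_square algebra_simps)
    then show ?thesis by (simp add: cosh_add cosh_diff sinh_double)
  qed
  finally have lhs: "4 * (cosh (u + v))\<^sup>2 * (1 - exp (- 4 * ser u v)) = 4 * (sinh (2 * u) * sinh (2 * v))" .
  have "exp (- 2 * ser u v) < 1" using assms by simp
  then have "cosh (u - v) < cosh (u + v)" unfolding e2 using pos by (simp add: divide_less_eq)
  then have "0 < sinh u * sinh v" by (simp add: cosh_add cosh_diff)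
  then have uv: "(0 < u \<and> 0 < v) \<or> (u < 0 \<and> v < 0)" by (auto simp: zero_less_mult_iff)
  have exp_sinh: "exp ((x + y) * 2) * ((1 - exp (- 4 * x)) * (1 - exp (- 4 * y))) = 4 * (sinh (2 * x) * sinh (2 * y))" for x y :: real
  proof -
    have s: "exp (2 * z) * (1 - exp (- 4 * z)) = 2 * sinh (2 * z)" for z :: real by (simp add: sinh_field_def algebra_simps flip: exp_add)
    have "exp ((x + y) * 2) = exp (2 * x) * exp (2 * y)" by (simp add: algebra_simps flip: exp_add)
    then have "exp ((x + y) * 2) * ((1 - exp (- 4 * x)) * (1 - exp (- 4 * y)))
        = (exp (2 * x) * (1 - exp (- 4 * x))) * (exp (2 * y) * (1 - exp (- 4 * y)))" by simp
    then show ?thesis unfolding s by simp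
  qed
  from uv show ?thesis
  proof
    assume "0 < u \<and> 0 < v"
    then show ?thesis unfolding lhs using exp_sinh[of u v] by (simp add: max_def algebra_simps)
  next
    assume "u < 0 \<and> v < 0"
    then show ?thesis unfolding lhs using exp_sinh[of "- u" "- v"] by (simp add: max_def algebra_simps)
  qed
qed

lemma ser_mult_signs: "a \<in> pm \<Longrightarrow> b \<in> pm \<Longrightarrow> ser (x * a) (y * b) = ser x y * (a * b)"
proof -
  have "ser (- x) y = - ser x y" for x y
  proof -
    have e: "cosh (- x + y) = cosh (x - y)" "cosh (- x - y) = cosh (x + y)"
      using cosh_minus[of "x + y"] cosh_minus[of "x - y"] by (simp_all only: minus_add_distrib minus_diff_eq diff_conv_add_uminus add.commute minus_minus)
    have l: "ln (cosh c / cosh d) = ln (cosh c) - ln (cosh d)" for c d :: real by (simp add: ln_div)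
    show ?thesis unfolding ser_def e l by (simp add: diff_divide_distrib)
  qed
  moreover have "ser x (- y) = ser (- x) y" for x y by (rule ser_minus_right)
  moreover assume "a \<in> pm" "b \<in> pm"
  ultimately show ?thesis by auto
qed

text \<open>Induction over generations. For a single edge this is the definition of a blue bond; in series
  \<open>connection_series\<close> applies; for parallel branches the poles are disconnected only if every branch
  is disconnected, the branches are conditionally independent and the exponents of the bounds add up.
  The function \<open>max 0\<close> is subadditive.\<close>
lemma cex_nc:
  assumes "q \<in> pm" "a \<in> pm" "b \<in> pm"
  shows "cex N J (a, q * a) (b, q * b) (nc N) \<le> exp (- 4 * max 0 (X N J * (a * b)))"
  using assms
proof (induction N arbitrary: J a b q)
  case 0
  let ?p = "(a, q * a)" and ?p' = "(b, q * b)" and ?j = "J {PoleA, PoleB}" and ?s = "a * b"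
  have p: "?p \<in> pm2" "?p' \<in> pm2" using 0 by auto
  have s: "fst ?p * fst ?p' = ?s" "snd ?p * snd ?p' = ?s" using 0(1) by auto
  have nct: "nc 0 (base_sample ?p ?p' True) = 0"
  proof -
    have "(PoleA, PoleB) \<in> {(y, z). {y, z} \<in> edges n 0 \<and> snd (snd (base_sample ?p ?p' True)) {y, z}}" by (simp add: base_sample_def)
    then have "PoleB \<in> cluster n 0 (snd (snd (base_sample ?p ?p' True))) PoleA" unfolding cluster_def by blast
    then show ?thesis by (simp add: nc_def)
  qed
  have ncf: "nc 0 (base_sample ?p ?p' False) = 1"
  proof -
    have "snd (snd (base_sample ?p ?p' False)) = (\<lambda>_. False)" by (simp add: base_sample_def)
    then show ?thesis by (simp add: nc_def cluster_def)
  qed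
  let ?P = "if 0 < ?j * ?s then 1 - exp (- 4 * \<beta> * \<bar>?j\<bar>) else 0"
  have "cex 0 J ?p ?p' (nc 0) = 1 - ?P" unfolding cex_def psum_0[OF p] s nct ncf
    using edge_weight_sum[of ?j ?s ?s] by (simp add: edge_weight_def Let_def)
  also have "... = exp (- 4 * max 0 (X 0 J * ?s))"
  proof (cases "0 < ?j * ?s")
    case True
    then have "?j * ?s = \<bar>?j\<bar>" using 0 by auto
    then have "X 0 J * ?s = \<beta> * \<bar>?j\<bar>" by (simp only: eff.simps mult.assoc)
    then have "max 0 (X 0 J * ?s) = \<beta> * \<bar>?j\<bar>" using \<beta> by (simp only:) (simp add: max_def)
    then show ?thesis using True by (simp only: if_True) simp
  next
    case False
    then have "?j * ?s \<le> 0" by linarith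
    with \<beta> have "\<beta> * (?j * ?s) \<le> 0" by (rule mult_nonneg_nonpos)
    then have "max 0 (X 0 J * ?s) = 0" by (simp only: eff.simps mult.assoc max.absorb1)
    then show ?thesis using False by (simp only: if_False) simp
  qed
  finally show ?case by simp
next
  case (Suc N)
  let ?p = "(a, q * a)" and ?p' = "(b, q * b)"
  have p: "?p \<in> pm2" "?p' \<in> pm2" using Suc by auto
  let ?Y = "\<lambda>i. ser (X N (sJ N i False J)) (X N (sJ N i True J))"
  let ?J0 = "\<lambda>i. sJ N i False J" and ?J1 = "\<lambda>i. sJ N i True J"
  have "cex (Suc N) J ?p ?p' (nc (Suc N))
      \<le> cex (Suc N) J ?p ?p' (\<lambda>w. \<Prod>i<n. 1 - (1 - nc N (sub n N i False w)) * (1 - nc N (sub n N i True w)))"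
  proof (rule cex_mono[OF p])
    fix w
    show "nc (Suc N) w \<le> (\<Prod>i<n. 1 - (1 - nc N (sub n N i False w)) * (1 - nc N (sub n N i True w)))"
    proof (cases "\<exists>i<n. nc N (sub n N i False w) = 0 \<and> nc N (sub n N i True w) = 0")
      case True
      then obtain i where i: "i < n" "nc N (sub n N i False w) = 0" "nc N (sub n N i True w) = 0" by blast
      have "emb i h PoleB \<in> cluster n (Suc N) (snd (snd w)) (emb i h PoleA)" for h
      proof (rule cluster_emb[OF i(1)])
        show "PoleB \<in> cluster n N (sub_label n N i h (snd (snd w))) PoleA" using i(2,3) by (cases h; cases w) (auto simp: nc_def sub_def)
      qed
      from this[of False] this[of True] have "PoleB \<in> cluster n (Suc N) (snd (snd w)) PoleA" using cluster_trans by simp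
      then have "nc (Suc N) w = 0" by (simp add: nc_def)
      moreover have "0 \<le> (\<Prod>i<n. 1 - (1 - nc N (sub n N i False w)) * (1 - nc N (sub n N i True w)))"
        by (intro prod_nonneg) (auto simp: nc_def)
      ultimately show ?thesis by simp
    next
      case False
      then have "(\<Prod>i<n. 1 - (1 - nc N (sub n N i False w)) * (1 - nc N (sub n N i True w))) = 1"
        by (intro prod.neutral) (auto simp: nc_def split: if_splits)
      then show ?thesis by (simp add: nc_bounds)
    qed
  qed
  also have "... = (\<Prod>i<n. bsum N (?J0 i) (?J1 i) ?p ?p' (\<lambda>w w'. 1 - (1 - nc N w) * (1 - nc N w'))
      / bsum N (?J0 i) (?J1 i) ?p ?p' (\<lambda>_ _. 1))" by (rule cex_branches[OF p, of N J "\<lambda>_ w w'. 1 - (1 - nc N w) * (1 - nc N w')"])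
  also have "... \<le> (\<Prod>i<n. exp (- 4 * max 0 (?Y i * (a * b))))"
  proof (rule prod_mono, rule conjI)
    fix i assume "i \<in> {..<n}"
    let ?u = "X N (?J0 i) * a" and ?v = "X N (?J1 i) * b"
    let ?K = "\<lambda>w w'. (1 - nc N w) * (1 - nc N w')"
    have sgl: "cex N J (\<mu>, q * \<nu>) (\<mu>', q * \<nu>') (\<lambda>w. 1 - nc N w) = 1 - cex N J (\<mu>, q * \<nu>) (\<mu>', q * \<nu>') (nc N)"
      if "\<mu> \<in> pm" "\<nu> \<in> pm" "\<mu>' \<in> pm" "\<nu>' \<in> pm" for J \<mu> \<nu> \<mu>' \<nu>'
    proof -
      have "(\<mu>, q * \<nu>) \<in> pm2" "(\<mu>', q * \<nu>') \<in> pm2" using that Suc.prems(1) by auto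
      then have "cex N J (\<mu>, q * \<nu>) (\<mu>', q * \<nu>') (\<lambda>w. 1 + (-1) * nc N w)
          = 1 + (-1) * cex N J (\<mu>, q * \<nu>) (\<mu>', q * \<nu>') (nc N)" unfolding cex_add cex_cmult by (simp only: cex_one)
      then show ?thesis by simp
    qed
    have c0: "0 \<le> cex N J (\<mu>, q * \<nu>) (\<mu>', q * \<nu>') (\<lambda>w. 1 - nc N w)"
      if "\<mu> \<in> pm" "\<nu> \<in> pm" "\<mu>' \<in> pm" "\<nu>' \<in> pm" for J \<mu> \<nu> \<mu>' \<nu>'
    proof (rule cex_bounds)
      show "(\<mu>, q * \<nu>) \<in> pm2" "(\<mu>', q * \<nu>') \<in> pm2" using that Suc.prems(1) by auto
    qed (auto simp: nc_def)
    have neg: "bsum N (?J0 i) (?J1 i) ?p ?p' (\<lambda>w w'. 1 - ?K w w')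
        = bsum N (?J0 i) (?J1 i) ?p ?p' (\<lambda>_ _. 1) - bsum N (?J0 i) (?J1 i) ?p ?p' ?K"
      unfolding bsum_def sum_subtractf[symmetric] by (intro sum.cong refl) (simp only: right_diff_distrib)
    have pos: "0 < bsum N (?J0 i) (?J1 i) ?p ?p' (\<lambda>_ _. 1)" by (rule bsum_one_pos[OF p])
    have "0 \<le> bsum N (?J0 i) (?J1 i) ?p ?p' (\<lambda>w w'. 1 - ?K w w')"
      unfolding bsum_def by (intro sum_nonneg mult_nonneg_nonneg weight_nonneg) (auto simp: nc_def)
    then show "0 \<le> bsum N (?J0 i) (?J1 i) ?p ?p' (\<lambda>w w'. 1 - ?K w w') / bsum N (?J0 i) (?J1 i) ?p ?p' (\<lambda>_ _. 1)" using pos by simp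
    have le_quot: "y \<le> T / X" if "0 < X" "X * y \<le> T" for X y T :: real using that by (simp add: pos_le_divide_eq mult.commute)
    have Y: "?Y i * (a * b) = ser ?u ?v" using Suc.prems by (simp add: ser_mult_signs)
    define avg where "avg = bsum N (?J0 i) (?J1 i) ?p ?p' ?K / bsum N (?J0 i) (?J1 i) ?p ?p' (\<lambda>_ _. 1)"
    have avg: "avg = (\<Sum>\<mu>\<in>pm. \<Sum>\<nu>\<in>pm. exp ((?u + ?v) * (\<mu> + \<nu>)) * (cex N (?J0 i) ?p (\<mu>, q * \<nu>) (\<lambda>w. 1 - nc N w)
        * cex N (?J1 i) (\<mu>, q * \<nu>) ?p' (\<lambda>w. 1 - nc N w))) / (4 * (cosh (?u + ?v))\<^sup>2)"
      unfolding avg_def by (rule bsum_ratio[OF Suc.prems refl refl])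
    have "1 - exp (- 4 * max 0 (ser ?u ?v)) \<le> avg"
    proof (cases "0 < ser ?u ?v")
      case False
      have "0 \<le> avg" unfolding avg
        by (intro divide_nonneg_nonneg sum_nonneg mult_nonneg_nonneg exp_ge_zero c0 Suc.prems) simp_all
      then show ?thesis using False by (simp add: max_def)
    next
      case True
      have "4 * (cosh (?u + ?v))\<^sup>2 * (1 - exp (- 4 * ser ?u ?v))
          \<le> (\<Sum>\<mu>\<in>pm. exp ((?u + ?v) * (\<mu> + \<mu>)) * ((1 - exp (- 4 * max 0 (?u * \<mu>))) * (1 - exp (- 4 * max 0 (?v * \<mu>)))))"
        by (rule connection_series[OF True])
      also have "... \<le> (\<Sum>\<mu>\<in>pm. exp ((?u + ?v) * (\<mu> + \<mu>)) * (cex N (?J0 i) ?p (\<mu>, q * \<mu>) (\<lambda>w. 1 - nc N w)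
        * cex N (?J1 i) (\<mu>, q * \<mu>) ?p' (\<lambda>w. 1 - nc N w)))"
      proof (intro sum_mono mult_left_mono mult_mono)
        fix \<mu> assume m: "\<mu> \<in> pm"
        have ih: "cex N (?J0 i) ?p (\<mu>, q * \<mu>) (nc N) \<le> exp (- 4 * max 0 (?u * \<mu>))"
          using Suc.IH[OF Suc.prems(1) Suc.prems(2) m, of "?J0 i"] by (simp only: mult.assoc)
        show "1 - exp (- 4 * max 0 (?u * \<mu>)) \<le> cex N (?J0 i) ?p (\<mu>, q * \<mu>) (\<lambda>w. 1 - nc N w)"
          unfolding sgl[OF Suc.prems(2) Suc.prems(2) m m] using ih by (rule diff_left_mono)
        have ih: "cex N (?J1 i) (\<mu>, q * \<mu>) ?p' (nc N) \<le> exp (- 4 * max 0 (?v * \<mu>))"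
          using Suc.IH[OF Suc.prems(1) m Suc.prems(3), of "?J1 i"] by (simp only: mult.assoc mult.commute[of \<mu> b])
        show "1 - exp (- 4 * max 0 (?v * \<mu>)) \<le> cex N (?J1 i) (\<mu>, q * \<mu>) ?p' (\<lambda>w. 1 - nc N w)"
          unfolding sgl[OF m m Suc.prems(3) Suc.prems(3)] using ih by (rule diff_left_mono)
        show "0 \<le> cex N (?J0 i) ?p (\<mu>, q * \<mu>) (\<lambda>w. 1 - nc N w)" by (intro c0 m Suc.prems)
        show "0 \<le> 1 - exp (- 4 * max 0 (?v * \<mu>))" by simp
        show "0 \<le> exp ((?u + ?v) * (\<mu> + \<mu>))" by simp
      qed
      also have "... \<le> (\<Sum>\<mu>\<in>pm. \<Sum>\<nu>\<in>pm. exp ((?u + ?v) * (\<mu> + \<nu>)) * (cex N (?J0 i) ?p (\<mu>, q * \<nu>) (\<lambda>w. 1 - nc N w)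
        * cex N (?J1 i) (\<mu>, q * \<nu>) ?p' (\<lambda>w. 1 - nc N w)))"
      proof (rule sum_mono)
        fix \<mu> assume m: "\<mu> \<in> pm"
        show "exp ((?u + ?v) * (\<mu> + \<mu>)) * (cex N (?J0 i) ?p (\<mu>, q * \<mu>) (\<lambda>w. 1 - nc N w)
          * cex N (?J1 i) (\<mu>, q * \<mu>) ?p' (\<lambda>w. 1 - nc N w))
          \<le> (\<Sum>\<nu>\<in>pm. exp ((?u + ?v) * (\<mu> + \<nu>)) * (cex N (?J0 i) ?p (\<mu>, q * \<nu>) (\<lambda>w. 1 - nc N w)
          * cex N (?J1 i) (\<mu>, q * \<nu>) ?p' (\<lambda>w. 1 - nc N w)))"
        proof (rule member_le_sum[OF m, where f = "\<lambda>\<nu>. exp ((?u + ?v) * (\<mu> + \<nu>)) * (cex N (?J0 i) ?p (\<mu>, q * \<nu>) (\<lambda>w. 1 - nc N w)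
          * cex N (?J1 i) (\<mu>, q * \<nu>) ?p' (\<lambda>w. 1 - nc N w))"])
          fix \<nu> assume "\<nu> \<in> pm - {\<mu>}"
          then have "\<nu> \<in> pm" by blast
          then show "0 \<le> exp ((?u + ?v) * (\<mu> + \<nu>)) * (cex N (?J0 i) ?p (\<mu>, q * \<nu>) (\<lambda>w. 1 - nc N w)
            * cex N (?J1 i) (\<mu>, q * \<nu>) ?p' (\<lambda>w. 1 - nc N w))" by (intro mult_nonneg_nonneg exp_ge_zero c0 m Suc.prems)
        qed simp
      qed
      finally have "1 - exp (- 4 * ser ?u ?v) \<le> avg" unfolding avg by (rule le_quot[rotated]) simp
      then show ?thesis using True by (simp add: max_def)
    qed
    then show "bsum N (?J0 i) (?J1 i) ?p ?p' (\<lambda>w w'. 1 - ?K w w') / bsum N (?J0 i) (?J1 i) ?p ?p' (\<lambda>_ _. 1)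
      \<le> exp (- 4 * max 0 (?Y i * (a * b)))" unfolding neg Y using pos by (simp add: avg_def diff_divide_distrib)
  qed
  also have "... = exp (- 4 * (\<Sum>i<n. max 0 (?Y i * (a * b))))" by (simp add: exp_sum[symmetric] sum_distrib_left)
  also have "... \<le> exp (- 4 * max 0 (X (Suc N) J * (a * b)))"
  proof -
    have "(\<Sum>i<n. ?Y i * (a * b)) \<le> (\<Sum>i<n. max 0 (?Y i * (a * b)))" by (intro sum_mono) simp
    moreover have "0 \<le> (\<Sum>i<n. max 0 (?Y i * (a * b)))" by (intro sum_nonneg) simp
    ultimately have "max 0 (X (Suc N) J * (a * b)) \<le> (\<Sum>i<n. max 0 (?Y i * (a * b)))" by (simp add: sum_distrib_right)
    then show ?thesis by simp
  qed
  finally show ?case .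
qed

end

section \<open>Losses along chains of midpoints\<close>

definition site_bad :: "vertex \<Rightarrow> sample \<Rightarrow> bool" where
  "site_bad x w \<longleftrightarrow> ov x w \<noteq> ov PoleA w"

definition blue_bad :: "nat \<Rightarrow> nat \<Rightarrow> vertex \<Rightarrow> sample \<Rightarrow> bool" where
  "blue_bad n N x w \<longleftrightarrow> x \<notin> cluster n N (snd (snd w)) PoleA \<and> x \<notin> cluster n N (snd (snd w)) PoleB"

abbreviation qsign :: "spins \<Rightarrow> real" where "qsign p \<equiv> fst p * snd p"

lemma sum_pm: "(\<Sum>\<mu>\<in>pm. f \<mu>) = f 1 + (f (-1) :: real)"
  by simp

lemma same_sign_pair:
  assumes "p \<in> pm2" "p' \<in> pm2" "qsign p = qsign p'"
  obtains q a b where "q \<in> pm" "a \<in> pm" "b \<in> pm" "p = (a, q * a)" "p' = (b, q * b)"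
proof
  show "qsign p \<in> pm" "fst p \<in> pm" "fst p' \<in> pm" using assms by auto
  show "p = (fst p, qsign p * fst p)" using assms(1) by auto
  show "p' = (fst p', qsign p * fst p')" unfolding assms(3) using assms(2) by auto
qed

context lattice begin

text \<open>The sum over the midpoint is split by its overlap: the aligned terms carry a factor
  \<open>exp (2 * (u + v) * \<mu>)\<close>, the misaligned ones have factor \<open>1\<close>.\<close>
lemma branch_split:
  assumes q: "q \<in> pm" "a \<in> pm" "b \<in> pm" and i: "i < n"
    and u: "u = X N (sJ N i False J) * a" and v: "v = X N (sJ N i True J) * b"
  shows "cex (Suc N) J (a, q * a) (b, q * b) (\<lambda>w. A (sub n N i False w) * B (sub n N i True w))
    = (\<Sum>\<mu>\<in>pm. exp (2 * ((u + v) * \<mu>)) *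
         (cex N (sJ N i False J) (a, q * a) (\<mu>, q * \<mu>) A * cex N (sJ N i True J) (\<mu>, q * \<mu>) (b, q * b) B)
       + cex N (sJ N i False J) (a, q * a) (\<mu>, q * (- \<mu>)) A * cex N (sJ N i True J) (\<mu>, q * (- \<mu>)) (b, q * b) B)
      / (4 * (cosh (u + v))\<^sup>2)"
proof -
  have p: "(a, q * a) \<in> pm2" "(b, q * b) \<in> pm2" using q by auto
  define T where "T \<mu> \<nu> = cex N (sJ N i False J) (a, q * a) (\<mu>, q * \<nu>) A * cex N (sJ N i True J) (\<mu>, q * \<nu>) (b, q * b) B" for \<mu> \<nu>
  have "cex (Suc N) J (a, q * a) (b, q * b) (\<lambda>w. A (sub n N i False w) * B (sub n N i True w))
      = (\<Sum>\<mu>\<in>pm. \<Sum>\<nu>\<in>pm. exp ((u + v) * (\<mu> + \<nu>)) * T \<mu> \<nu>) / (4 * (cosh (u + v))\<^sup>2)"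
    unfolding cex_one_branch[OF p i, of N J "\<lambda>w w'. A w * B w'"] T_def by (rule bsum_ratio[OF q u v])
  also have "(\<Sum>\<mu>\<in>pm. \<Sum>\<nu>\<in>pm. exp ((u + v) * (\<mu> + \<nu>)) * T \<mu> \<nu>)
      = (\<Sum>\<mu>\<in>pm. exp (2 * ((u + v) * \<mu>)) * T \<mu> \<mu> + T \<mu> (- \<mu>))" by (simp add: algebra_simps)
  finally show ?thesis unfolding T_def .
qed

lemma cex_cong:
  assumes "\<And>w. w \<in> poled n N p p' \<Longrightarrow> F w = G w"
  shows "cex N J p p' F = cex N J p p' G"
  unfolding cex_def psum_def using assms by (intro arg_cong2[where f = "(/)"] sum.cong) auto

lemma cex_zero: "cex N J p p' (\<lambda>_. 0) = 0"
  by (simp add: cex_def psum_def)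

lemma exp_sum_le: "exp (2 * f) + exp (- 2 * f) \<le> 4 * (cosh f)\<^sup>2" for f :: real
  by (simp add: cosh_field_def power2_eq_square algebra_simps flip: exp_add)

text \<open>Only misaligned midpoints count, and they have total weight \<open>2\<close> out of \<open>4 * (cosh (u + v))\<^sup>2\<close>.\<close>
lemma site_mid:
  assumes i: "i < n" and p: "p \<in> pm2" "p' \<in> pm2" "qsign p = qsign p'"
  shows "cex (Suc N) J p p' (\<lambda>w. of_bool (site_bad (Mid i) w))
    \<le> site_loss (X N (sJ N i False J)) (X N (sJ N i True J))"
proof -
  obtain q a b where q: "q \<in> pm" "a \<in> pm" "b \<in> pm" and pp: "p = (a, q * a)" "p' = (b, q * b)" using same_sign_pair[OF p] by blast
  let ?x = "X N (sJ N i False J)" and ?y = "X N (sJ N i True J)"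
  define u where "u = ?x * a" define v where "v = ?y * b"
  let ?A = "\<lambda>w. of_bool (ov PoleB w \<noteq> q) :: real"
  have sp: "(\<mu>, q * \<nu>) \<in> pm2" if "\<mu> \<in> pm" "\<nu> \<in> pm" for \<mu> \<nu> using that q by auto
  have ovp: "ov PoleA w = q" if "w \<in> poled n (Suc N) p p'" for w using that q by (auto simp: poled_def ov_def pp)
  have "cex (Suc N) J p p' (\<lambda>w. of_bool (site_bad (Mid i) w)) = cex (Suc N) J p p' (\<lambda>w. ?A (sub n N i False w) * 1)"
  proof (rule cex_cong)
    fix w assume w: "w \<in> poled n (Suc N) p p'"
    have "ov PoleB (sub n N i False w) = ov (Mid i) w" using spin_sub[OF poles_in_verts(2)[OF n], of N i False w] by (simp add: ov_def)
    then show "of_bool (site_bad (Mid i) w) = ?A (sub n N i False w) * 1" using ovp[OF w] by (simp add: site_bad_def)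
  qed
  also have "... = (\<Sum>\<mu>\<in>pm. exp (2 * ((u + v) * \<mu>)) *
         (cex N (sJ N i False J) p (\<mu>, q * \<mu>) ?A * cex N (sJ N i True J) (\<mu>, q * \<mu>) p' (\<lambda>_. 1))
       + cex N (sJ N i False J) p (\<mu>, q * (- \<mu>)) ?A * cex N (sJ N i True J) (\<mu>, q * (- \<mu>)) p' (\<lambda>_. 1))
      / (4 * (cosh (u + v))\<^sup>2)" unfolding pp by (rule branch_split[OF q i u_def v_def, where B = "\<lambda>_. 1"])
  also have "... \<le> (\<Sum>\<mu>\<in>pm. 1) / (4 * (cosh (u + v))\<^sup>2)"
  proof (intro divide_right_mono sum_mono)
    fix \<mu> assume m: "\<mu> \<in> pm" then have m': "- \<mu> \<in> pm" by auto
    have "cex N (sJ N i False J) p (\<mu>, q * \<mu>) ?A = cex N (sJ N i False J) p (\<mu>, q * \<mu>) (\<lambda>_. 0)"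
      using m by (intro cex_cong) (auto simp: poled_def ov_def)
    then have z: "cex N (sJ N i False J) p (\<mu>, q * \<mu>) ?A = 0" by (simp only: cex_zero)
    have o: "cex N (sJ N i True J) (\<mu>, q * (- \<mu>)) p' (\<lambda>_. 1) = 1" by (rule cex_one[OF sp[OF m m'] p(2)])
    have "cex N (sJ N i False J) p (\<mu>, q * (- \<mu>)) ?A \<le> 1" by (rule cex_bounds(2)[OF p(1) sp[OF m m']]) auto
    then show "exp (2 * ((u + v) * \<mu>)) *
         (cex N (sJ N i False J) p (\<mu>, q * \<mu>) ?A * cex N (sJ N i True J) (\<mu>, q * \<mu>) p' (\<lambda>_. 1))
       + cex N (sJ N i False J) p (\<mu>, q * (- \<mu>)) ?A * cex N (sJ N i True J) (\<mu>, q * (- \<mu>)) p' (\<lambda>_. 1) \<le> 1"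
      unfolding z o by (simp only: mult_zero_left mult_zero_right add_0 mult_1_right)
  qed simp
  also have "... = sech2 (u + v) / 2" by (simp add: sech2_def)
  also have "... \<le> site_loss u v" by (rule site_loss_ge)
  also have "... = site_loss ?x ?y" unfolding site_loss_def u_def v_def by (simp only: blue_loss_sign[OF q(2,3)])
  finally show ?thesis .
qed

text \<open>If the midpoint is connected to neither pole, both halves are disconnected; aligned midpoints are
  then bounded with \<open>cex_nc\<close> and misaligned ones trivially.\<close>
lemma blue_mid:
  assumes i: "i < n" and p: "p \<in> pm2" "p' \<in> pm2" "qsign p = qsign p'"
  shows "cex (Suc N) J p p' (\<lambda>w. of_bool (blue_bad n (Suc N) (Mid i) w))
    \<le> blue_loss (X N (sJ N i False J)) (X N (sJ N i True J))"
proof -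
  obtain q a b where q: "q \<in> pm" "a \<in> pm" "b \<in> pm" and pp: "p = (a, q * a)" "p' = (b, q * b)" using same_sign_pair[OF p] by blast
  let ?x = "X N (sJ N i False J)" and ?y = "X N (sJ N i True J)"
  define u where "u = ?x * a" define v where "v = ?y * b"
  have sp: "(\<mu>, q * \<nu>) \<in> pm2" if "\<mu> \<in> pm" "\<nu> \<in> pm" for \<mu> \<nu> using that q by auto
  have "cex (Suc N) J p p' (\<lambda>w. of_bool (blue_bad n (Suc N) (Mid i) w))
      \<le> cex (Suc N) J p p' (\<lambda>w. nc N (sub n N i False w) * nc N (sub n N i True w))"
  proof (rule cex_mono[OF p(1,2)])
    fix w :: sample
    obtain \<sigma> \<tau> l where o: "w = (\<sigma>, \<tau>, l)" by (metis prod_cases3)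
    have "Mid i \<in> cluster n (Suc N) l PoleA" if "PoleB \<in> cluster n N (sub_label n N i False l) PoleA" using cluster_emb[OF i that] by simp
    moreover have "Mid i \<in> cluster n (Suc N) l PoleB" if "PoleB \<in> cluster n N (sub_label n N i True l) PoleA"
      using cluster_emb[OF i that] cluster_sym by simp
    ultimately show "of_bool (blue_bad n (Suc N) (Mid i) w) \<le> nc N (sub n N i False w) * nc N (sub n N i True w)"
      by (auto simp: o blue_bad_def nc_def sub_def)
  qed
  also have "... = (\<Sum>\<mu>\<in>pm. exp (2 * ((u + v) * \<mu>)) *
         (cex N (sJ N i False J) p (\<mu>, q * \<mu>) (nc N) * cex N (sJ N i True J) (\<mu>, q * \<mu>) p' (nc N))
       + cex N (sJ N i False J) p (\<mu>, q * (- \<mu>)) (nc N) * cex N (sJ N i True J) (\<mu>, q * (- \<mu>)) p' (nc N))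
      / (4 * (cosh (u + v))\<^sup>2)" unfolding pp by (rule branch_split[OF q i u_def v_def])
  also have "... \<le> (\<Sum>\<mu>\<in>pm. exp (- 2 * (\<bar>u\<bar> + \<bar>v\<bar>)) + 1) / (4 * (cosh (u + v))\<^sup>2)"
  proof (intro divide_right_mono sum_mono add_mono)
    fix \<mu> assume m: "\<mu> \<in> pm" then have m': "- \<mu> \<in> pm" by auto
    have "cex N (sJ N i False J) p (\<mu>, q * \<mu>) (nc N) \<le> exp (- 4 * max 0 (u * \<mu>))"
      unfolding pp u_def using cex_nc[OF q(1,2) m, of N "sJ N i False J"] by (simp only: mult.assoc)
    moreover have "cex N (sJ N i True J) (\<mu>, q * \<mu>) p' (nc N) \<le> exp (- 4 * max 0 (v * \<mu>))"
      unfolding pp v_def using cex_nc[OF q(1) m q(3), of N "sJ N i True J"] by (simp only: mult.assoc mult.commute[of \<mu> b])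
    ultimately have "cex N (sJ N i False J) p (\<mu>, q * \<mu>) (nc N) * cex N (sJ N i True J) (\<mu>, q * \<mu>) p' (nc N)
        \<le> exp (- 4 * max 0 (u * \<mu>)) * exp (- 4 * max 0 (v * \<mu>))"
      using cex_bounds(1)[OF sp[OF m m] p(2), of "nc N" N "sJ N i True J"] nc_bounds by (intro mult_mono) auto
    then have "exp (2 * ((u + v) * \<mu>)) * (cex N (sJ N i False J) p (\<mu>, q * \<mu>) (nc N) * cex N (sJ N i True J) (\<mu>, q * \<mu>) p' (nc N))
        \<le> exp (2 * ((u + v) * \<mu>)) * (exp (- 4 * max 0 (u * \<mu>)) * exp (- 4 * max 0 (v * \<mu>)))" by (intro mult_left_mono) auto
    also have "... = exp ((2 * (u * \<mu>) - 4 * max 0 (u * \<mu>)) + (2 * (v * \<mu>) - 4 * max 0 (v * \<mu>)))"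
      by (simp add: algebra_simps flip: exp_add)
    also have "(2 * (u * \<mu>) - 4 * max 0 (u * \<mu>)) + (2 * (v * \<mu>) - 4 * max 0 (v * \<mu>)) = - 2 * (\<bar>u\<bar> + \<bar>v\<bar>)"
      using m by (auto simp: max_def)
    finally show "exp (2 * ((u + v) * \<mu>)) * (cex N (sJ N i False J) p (\<mu>, q * \<mu>) (nc N) * cex N (sJ N i True J) (\<mu>, q * \<mu>) p' (nc N))
        \<le> exp (- 2 * (\<bar>u\<bar> + \<bar>v\<bar>))" .
    have "cex N (sJ N i False J) p (\<mu>, q * (- \<mu>)) (nc N) * cex N (sJ N i True J) (\<mu>, q * (- \<mu>)) p' (nc N) \<le> 1 * 1"
      by (intro mult_mono cex_bounds p sp m m' nc_bounds) simp
    then show "cex N (sJ N i False J) p (\<mu>, q * (- \<mu>)) (nc N) * cex N (sJ N i True J) (\<mu>, q * (- \<mu>)) p' (nc N) \<le> 1" by simp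
  qed simp
  also have "... = (1 + exp (- 2 * (\<bar>u\<bar> + \<bar>v\<bar>))) / (2 * (cosh (u + v))\<^sup>2)"
  proof -
    have "(E + 1 + (E + 1)) / (4 * C) = (1 + E) / (2 * C)" for E C :: real by (cases "C = 0") (simp_all add: field_simps)
    then show ?thesis unfolding sum_pm .
  qed
  also have "... \<le> blue_loss u v" by (rule blue_loss_ge)
  also have "... = blue_loss ?x ?y" unfolding u_def v_def by (rule blue_loss_sign[OF q(2,3)])
  finally show ?thesis .
qed

text \<open>A deeper vertex is bad only if the first midpoint of its chain is bad, or that midpoint has the common
  overlap of the poles and the vertex is bad inside its half, whose poles then again have equal
  overlaps. So the statement is proved for all pole spins with equal overlaps at once.\<close>
lemma loss_bound:
  assumes mid: "\<And>N J i p p'. i < n \<Longrightarrow> p \<in> pm2 \<Longrightarrow> p' \<in> pm2 \<Longrightarrow> qsign p = qsign p' \<Longrightarrow>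
      cex (Suc N) J p p' (\<lambda>w. of_bool (bad (Suc N) (Mid i) w))
      \<le> g (X N (sJ N i False J)) (X N (sJ N i True J))"
    and step: "\<And>N J w i h y. i < n \<Longrightarrow> y \<in> verts n N - {PoleA, PoleB} \<Longrightarrow> w \<in> samples n (Suc N) \<Longrightarrow>
      W (Suc N) J w \<noteq> 0 \<Longrightarrow> ov PoleA w = ov PoleB w \<Longrightarrow> bad (Suc N) (Sub i h y) w \<Longrightarrow>
      bad (Suc N) (Mid i) w \<or> (ov (Mid i) w = ov PoleA w \<and> bad N y (sub n N i h w))"
    and x: "x \<in> verts n N - {PoleA, PoleB}" and p: "p \<in> pm2" "p' \<in> pm2" "qsign p = qsign p'"
  shows "cex N J p p' (\<lambda>w. of_bool (bad N x w)) \<le> loss g n \<beta> N J x"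
  using x p
proof (induction N arbitrary: J x p p')
  case 0
  then show ?case by simp
next
  case (Suc N)
  note p = Suc.prems(2-4)
  consider i where "i < n" "x = Mid i" | i h y where "i < n" "y \<in> verts n N - {PoleA, PoleB}" "x = Sub i h y"
    using Suc.prems(1) unfolding inner_verts_Suc[OF n] by auto
  then show ?case
  proof cases
    case 1
    then show ?thesis using mid[OF 1(1) p] by simp
  next
    case 2
    obtain q a b where q: "q \<in> pm" "a \<in> pm" "b \<in> pm" and pp: "p = (a, q * a)" "p' = (b, q * b)" using same_sign_pair[OF p] by blast
    define u where "u = X N (sJ N i False J) * a"
    define v where "v = X N (sJ N i True J) * b"
    have sp: "(\<mu>, q * \<nu>) \<in> pm2" if "\<mu> \<in> pm" "\<nu> \<in> pm" for \<mu> \<nu> using that q by auto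
    have qs: "qsign (\<mu>, q * \<mu>) = q" if "\<mu> \<in> pm" for \<mu> using that by auto
    let ?l = "loss g n \<beta> N (sJ N i h J) y"
    define K where "K pole w = (of_bool (ov pole w = q \<and> bad N y w) :: real)" for pole w
    define A where "A = (if h then (\<lambda>_. 1) else K PoleB)"
    define B where "B = (if h then K PoleA else (\<lambda>_. 1))"
    have l0: "0 \<le> ?l"
    proof -
      have "0 \<le> cex N (sJ N i h J) (1, q * 1) (1, q * 1) (\<lambda>w. of_bool (bad N y w))" by (intro cex_bounds sp) auto
      also have "... \<le> ?l" using sp[of 1 1] by (intro Suc.IH 2(2)) auto
      finally show ?thesis .
    qed
    have AB01: "0 \<le> A w" "A w \<le> 1" "0 \<le> B w" "B w \<le> 1" for w by (auto simp: A_def B_def K_def)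
    have ovq: "ov PoleA w = q" "ov PoleB w = q" if "w \<in> poled n (Suc N) p p'" for w using that q by (auto simp: poled_def ov_def pp)
    have "cex (Suc N) J p p' (\<lambda>w. of_bool (bad (Suc N) x w))
        \<le> cex (Suc N) J p p' (\<lambda>w. of_bool (bad (Suc N) (Mid i) w) + A (sub n N i False w) * B (sub n N i True w))"
    proof (rule cex_mono[OF p(1,2)])
      fix w assume w: "w \<in> poled n (Suc N) p p'" "W (Suc N) J w \<noteq> 0"
      have mids: "ov PoleB (sub n N i False w) = ov (Mid i) w" "ov PoleA (sub n N i True w) = ov (Mid i) w"
        using spin_sub[OF poles_in_verts(2)[OF n], of N i False w] spin_sub[OF poles_in_verts(1)[OF n], of N i True w]
        by (simp_all add: ov_def)
      have AB: "A (sub n N i False w) * B (sub n N i True w) = of_bool (ov (Mid i) w = q \<and> bad N y (sub n N i h w))"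
        by (cases h) (simp_all add: A_def B_def K_def mids)
      have "bad (Suc N) x w \<Longrightarrow> bad (Suc N) (Mid i) w \<or> (ov (Mid i) w = q \<and> bad N y (sub n N i h w))"
        using step[OF 2(1,2) _ w(2), of h] w(1) ovq[OF w(1)] 2(3) by (simp add: poled_def)
      then show "of_bool (bad (Suc N) x w) \<le> of_bool (bad (Suc N) (Mid i) w) + A (sub n N i False w) * B (sub n N i True w)" unfolding AB by auto
    qed
    also have "... = cex (Suc N) J p p' (\<lambda>w. of_bool (bad (Suc N) (Mid i) w))
        + cex (Suc N) J p p' (\<lambda>w. A (sub n N i False w) * B (sub n N i True w))" by (rule cex_add)
    also have "cex (Suc N) J p p' (\<lambda>w. A (sub n N i False w) * B (sub n N i True w)) \<le> ?l"
    proof -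
      define T where "T \<mu> \<nu> = cex N (sJ N i False J) p (\<mu>, q * \<nu>) A * cex N (sJ N i True J) (\<mu>, q * \<nu>) p' B" for \<mu> \<nu>
      have aligned: "T \<mu> \<mu> \<le> ?l" if m: "\<mu> \<in> pm" for \<mu>
      proof (cases h)
        case True
        have "cex N (sJ N i True J) (\<mu>, q * \<mu>) p' B \<le> cex N (sJ N i True J) (\<mu>, q * \<mu>) p' (\<lambda>w. of_bool (bad N y w))"
          by (rule cex_mono[OF sp[OF m m] p(2)]) (auto simp: B_def K_def True)
        also have "... \<le> ?l"
        proof -
          have "qsign (\<mu>, q * \<mu>) = qsign p'" using qs[OF m] qs[OF q(3)] by (simp only: pp(2))
          then show ?thesis using Suc.IH[OF 2(2) sp[OF m m] p(2), of "sJ N i h J"] True by (simp only:)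
        qed
        finally show ?thesis
          unfolding T_def using True cex_one[OF p(1) sp[OF m m], of N "sJ N i False J"] by (simp add: A_def)
      next
        case False
        have "cex N (sJ N i False J) p (\<mu>, q * \<mu>) A \<le> cex N (sJ N i False J) p (\<mu>, q * \<mu>) (\<lambda>w. of_bool (bad N y w))"
          by (rule cex_mono[OF p(1) sp[OF m m]]) (auto simp: A_def K_def False)
        also have "... \<le> ?l"
        proof -
          have "qsign p = qsign (\<mu>, q * \<mu>)" using qs[OF m] qs[OF q(2)] by (simp only: pp(1))
          then show ?thesis using Suc.IH[OF 2(2) p(1) sp[OF m m], of "sJ N i h J"] False by (simp only:)
        qed
        finally show ?thesis
          unfolding T_def using False cex_one[OF sp[OF m m] p(2), of N "sJ N i True J"] by (simp add: B_def)
      qed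
      have misaligned: "T \<mu> (- \<mu>) = 0" if m: "\<mu> \<in> pm" for \<mu>
      proof (cases h)
        case True
        have "cex N (sJ N i True J) (\<mu>, q * (- \<mu>)) p' B = cex N (sJ N i True J) (\<mu>, q * (- \<mu>)) p' (\<lambda>_. 0)"
          using m q(1) True by (intro cex_cong) (auto simp: poled_def ov_def B_def K_def)
        then show ?thesis by (simp add: T_def cex_zero)
      next
        case False
        have "cex N (sJ N i False J) p (\<mu>, q * (- \<mu>)) A = cex N (sJ N i False J) p (\<mu>, q * (- \<mu>)) (\<lambda>_. 0)"
          using m q(1) False by (intro cex_cong) (auto simp: poled_def ov_def A_def K_def)
        then show ?thesis by (simp add: T_def cex_zero)
      qed
      have "cex (Suc N) J p p' (\<lambda>w. A (sub n N i False w) * B (sub n N i True w))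
          = (\<Sum>\<mu>\<in>pm. exp (2 * ((u + v) * \<mu>)) * T \<mu> \<mu> + T \<mu> (- \<mu>)) / (4 * (cosh (u + v))\<^sup>2)"
        unfolding T_def pp by (rule branch_split[OF q 2(1) u_def v_def])
      also have "... \<le> (\<Sum>\<mu>\<in>pm. exp (2 * ((u + v) * \<mu>)) * ?l + 0) / (4 * (cosh (u + v))\<^sup>2)"
        using aligned misaligned by (intro divide_right_mono sum_mono add_mono mult_left_mono) auto
      also have "... = ?l * (exp (2 * (u + v)) + exp (- 2 * (u + v))) / (4 * (cosh (u + v))\<^sup>2)"
        unfolding sum_pm by (simp add: algebra_simps)
      also have "... \<le> ?l * (4 * (cosh (u + v))\<^sup>2) / (4 * (cosh (u + v))\<^sup>2)"
        by (intro divide_right_mono mult_left_mono exp_sum_le l0) simp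
      also have "... = ?l" by simp
      finally show ?thesis .
    qed
    also have "cex (Suc N) J p p' (\<lambda>w. of_bool (bad (Suc N) (Mid i) w))
        \<le> g (X N (sJ N i False J)) (X N (sJ N i True J))" by (rule mid[OF 2(1) p])
    finally show ?thesis using 2(3) by simp
  qed
qed

lemma site_chain:
  assumes "x \<in> verts n N - {PoleA, PoleB}" "p \<in> pm2" "p' \<in> pm2" "qsign p = qsign p'"
  shows "cex N J p p' (\<lambda>w. of_bool (site_bad x w)) \<le> loss site_loss n \<beta> N J x"
proof (rule loss_bound[where bad = "\<lambda>_. site_bad", OF site_mid _ assms], assumption+)
  fix N J i h y and w :: sample
  assume y: "y \<in> verts n N - {PoleA, PoleB}" and eq: "ov PoleA w = ov PoleB w" and bad: "site_bad (Sub i h y) w"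
  have "emb i h y = Sub i h y" using y by (cases y) auto
  then have "ov y (sub n N i h w) = ov (Sub i h y) w" using spin_sub[of y n N i h w] y by (simp add: ov_def)
  moreover have "ov PoleA (sub n N i h w) = (if h then ov (Mid i) w else ov PoleA w)"
    using spin_sub[OF poles_in_verts(1)[OF n], of N i h w] by (simp add: ov_def)
  ultimately show "site_bad (Mid i) w \<or> ov (Mid i) w = ov PoleA w \<and> site_bad y (sub n N i h w)" using bad by (auto simp: site_bad_def)
qed

lemma blue_chain:
  assumes "x \<in> verts n N - {PoleA, PoleB}" "p \<in> pm2" "p' \<in> pm2" "qsign p = qsign p'"
  shows "cex N J p p' (\<lambda>w. of_bool (blue_bad n N x w)) \<le> loss blue_loss n \<beta> N J x"
proof (rule loss_bound[where bad = "blue_bad n", OF blue_mid _ assms], assumption+)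
  fix N J i h y and w :: sample
  assume i: "i < n" and y: "y \<in> verts n N - {PoleA, PoleB}" and w: "w \<in> samples n (Suc N)" "W (Suc N) J w \<noteq> 0"
    and eq: "ov PoleA w = ov PoleB w" and bad: "blue_bad n (Suc N) (Sub i h y) w"
  obtain \<sigma> \<tau> l where o: "w = (\<sigma>, \<tau>, l)" by (metis prod_cases3)
  let ?C = "cluster n (Suc N) l"
  have e: "emb i h y = Sub i h y" using y by (cases y) auto
  show "blue_bad n (Suc N) (Mid i) w \<or> ov (Mid i) w = ov PoleA w \<and> blue_bad n N y (sub n N i h w)"
  proof (rule disjCI)
    assume "\<not> (ov (Mid i) w = ov PoleA w \<and> blue_bad n N y (sub n N i h w))"
    moreover have "ov (Mid i) w = ov PoleA w \<and> blue_bad n N y (sub n N i h w)" if m: "\<not> blue_bad n (Suc N) (Mid i) w"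
    proof
      have M: "Mid i \<in> ?C PoleA \<or> Mid i \<in> ?C PoleB" using m by (auto simp: blue_bad_def o)
      then show "ov (Mid i) w = ov PoleA w" using blue_ok[OF w(2,1)] eq by (auto simp: o)
      have poles: "?C (emb i h pole) = ?C PoleA \<or> ?C (emb i h pole) = ?C PoleB" if "pole \<in> {PoleA, PoleB}" for pole
        using that M cluster_eq by (cases h) auto
      have "y \<notin> cluster n N (sub_label n N i h l) pole" if pole: "pole \<in> {PoleA, PoleB}" for pole
      proof
        assume "y \<in> cluster n N (sub_label n N i h l) pole"
        from cluster_emb[OF i this] have "Sub i h y \<in> ?C (emb i h pole)" by (simp add: e)
        then show False using poles[OF pole] bad by (auto simp: blue_bad_def o)
      qed
      then show "blue_bad n N y (sub n N i h w)" by (simp add: blue_bad_def o sub_def)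
    qed
    ultimately show "blue_bad n (Suc N) (Mid i) w" by blast
  qed
qed

section \<open>Free poles\<close>

definition tot :: "nat \<Rightarrow> (edge \<Rightarrow> real) \<Rightarrow> (sample \<Rightarrow> real) \<Rightarrow> real" where
  "tot N J F = (\<Sum>w\<in>samples n N. W N J w * F w)"

definition ens :: "nat \<Rightarrow> (edge \<Rightarrow> real) \<Rightarrow> (sample \<Rightarrow> real) \<Rightarrow> real" where
  "ens N J F = tot N J F / tot N J (\<lambda>_. 1)"

lemma tot_psum: "tot N J F = (\<Sum>p\<in>pm2. \<Sum>p'\<in>pm2. psum N J p p' F)"
proof -
  let ?g = "\<lambda>w. (spin PoleA w, spin PoleB w)"
  have sub: "?g ` samples n N \<subseteq> pm2 \<times> pm2"
    using spin_in[OF n _ poles_in_verts(1)[OF n]] spin_in[OF n _ poles_in_verts(2)[OF n]] by blast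
  have "tot N J F = (\<Sum>y\<in>pm2 \<times> pm2. \<Sum>w\<in>{w \<in> samples n N. ?g w = y}. W N J w * F w)"
    unfolding tot_def by (rule sum.group[OF finite_samples _ sub, symmetric]) simp
  also have "... = (\<Sum>(p, p')\<in>pm2 \<times> pm2. psum N J p p' F)"
  proof (rule sum.cong[OF refl])
    fix y assume "y \<in> pm2 \<times> pm2"
    obtain p p' where y: "y = (p, p')" by (rule prod.exhaust)
    have "{w \<in> samples n N. ?g w = (p, p')} = poled n N p p'" by (simp add: poled_def)
    then show "(\<Sum>w\<in>{w \<in> samples n N. ?g w = y}. W N J w * F w) = (case y of (p, p') \<Rightarrow> psum N J p p' F)"
      by (simp only: y psum_def prod.case)
  qed
  finally show ?thesis by (simp only: sum.cartesian_product)
qed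

lemma sum_qsign: "(\<Sum>p\<in>pm2. f (qsign p)) = 2 * f 1 + 2 * (f (-1) :: real)"
proof -
  have "(1::real) \<in> pm" by simp
  note e = sum_spin_pairs[OF this, of "\<lambda>p. f (qsign p)"]
  show ?thesis unfolding e by simp
qed

lemma sum_signs:
  "(\<Sum>p\<in>pm2. \<Sum>p'\<in>pm2. if qsign p = qsign p' then c else d) = 8 * c + 8 * (d :: real)"
proof -
  have "(\<Sum>p'\<in>pm2. if s = qsign p' then c else d) = 2 * (if s = 1 then c else d) + 2 * (if s = -1 then c else d)" for s
    by (rule sum_qsign[of "\<lambda>s'. if s = s' then c else d"])
  then have "(\<Sum>p\<in>pm2. \<Sum>p'\<in>pm2. if qsign p = qsign p' then c else d)
      = (\<Sum>p\<in>pm2. 2 * (if qsign p = 1 then c else d) + 2 * (if qsign p = -1 then c else d))" by (simp only:)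
  also have "... = 2 * (2 * c + 2 * d) + 2 * (2 * d + 2 * c)"
    by (subst sum_qsign[of "\<lambda>s. 2 * (if s = 1 then c else d) + 2 * (if s = -1 then c else d)"]) simp
  finally show ?thesis by simp
qed

lemma tot_one: "\<exists>C>0. (\<forall>p\<in>pm2. \<forall>p'\<in>pm2. psum N J p p' (\<lambda>_. 1) = C * exp (X N J * ip p p'))
    \<and> tot N J (\<lambda>_. 1) = C * (16 * (cosh (X N J))\<^sup>2)"
proof -
  obtain C where C: "C > 0" "\<And>p p'. p \<in> pm2 \<Longrightarrow> p' \<in> pm2 \<Longrightarrow> psum N J p p' (\<lambda>_. 1) = C * exp (X N J * ip p p')"
    using psum_one by metis
  have "tot N J (\<lambda>_. 1) = (\<Sum>p\<in>pm2. \<Sum>p'\<in>pm2. C * exp (X N J * ip p p'))" unfolding tot_psum by (intro sum.cong refl C(2))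
  also have "... = C * (\<Sum>p\<in>pm2. \<Sum>p'\<in>pm2. exp (X N J * ip p p'))" by (simp only: sum_distrib_left)
  also have "(\<Sum>p\<in>pm2. \<Sum>p'\<in>pm2. exp (X N J * ip p p')) = 16 * (cosh (X N J))\<^sup>2"
    unfolding sum_spin_pairs[of 1, simplified] ip_def
    by (simp add: cosh_field_def power2_eq_square algebra_simps flip: exp_add)
  finally show ?thesis using C by blast
qed

lemma tot_one_pos: "0 < tot N J (\<lambda>_. 1)"
  using tot_one[of N J] by (auto intro!: mult_pos_pos)

lemma tot_mono:
  assumes "\<And>w. w \<in> samples n N \<Longrightarrow> W N J w \<noteq> 0 \<Longrightarrow> F w \<le> G w"
  shows "tot N J F \<le> tot N J G"
  unfolding tot_def
proof (rule sum_mono)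
  fix w assume "w \<in> samples n N"
  then show "W N J w * F w \<le> W N J w * G w" using assms[of w] weight_nonneg[of N J w] by (cases "W N J w = 0") (auto intro: mult_left_mono)
qed

lemma ens_mono:
  assumes "\<And>w. w \<in> samples n N \<Longrightarrow> W N J w \<noteq> 0 \<Longrightarrow> F w \<le> G w"
  shows "ens N J F \<le> ens N J G"
  unfolding ens_def using tot_mono[OF assms] tot_one_pos[of N J] by (simp add: divide_right_mono)

lemma ens_add: "ens N J (\<lambda>w. F w + G w) = ens N J F + ens N J G"
  by (simp add: ens_def tot_def sum.distrib distrib_left add_divide_distrib)

lemma ens_cmult: "ens N J (\<lambda>w. c * F w) = c * ens N J F"
  by (simp add: ens_def tot_def sum_distrib_left mult_ac)

lemma ens_const: "ens N J (\<lambda>_. c) = c"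
  using ens_cmult[of N J c "\<lambda>_. 1"] tot_one_pos[of N J] by (simp add: ens_def)

lemma ens_sum: "ens N J (\<lambda>w. \<Sum>i\<in>I. F i w) = (\<Sum>i\<in>I. ens N J (F i))"
proof (induction I rule: infinite_finite_induct)
  case (insert x I)
  then show ?case by (simp add: ens_add)
qed (simp_all add: ens_const)

lemma ip_sign:
  assumes "p \<in> pm2" "p' \<in> pm2"
  shows "ip p p' = (if qsign p = qsign p' then 2 * (fst p * fst p') else 0)"
  using assms by (auto simp: ip_def)

text \<open>Of the sixteen pole configurations eight have equal overlaps. For those \<open>cex_nc\<close> turns the weight
  \<open>exp (2 * X * s)\<close> into at most \<open>exp (- 2 * \<bar>X\<bar>)\<close>, the other eight have weight \<open>1\<close>, and
  \<open>(1 + exp (- 2 * x)) / (2 * (cosh x)\<^sup>2) = 1 - tanh x\<close>.\<close>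
theorem ens_disconnected: "ens N J (nc N) \<le> 1 - tanh \<bar>X N J\<bar>"
proof -
  let ?X = "X N J"
  obtain C where C: "C > 0" "\<And>p p'. p \<in> pm2 \<Longrightarrow> p' \<in> pm2 \<Longrightarrow> psum N J p p' (\<lambda>_. 1) = C * exp (?X * ip p p')"
      "tot N J (\<lambda>_. 1) = C * (16 * (cosh ?X)\<^sup>2)" using tot_one[of N J] by metis
  have "psum N J p p' (nc N) \<le> C * (if qsign p = qsign p' then exp (- 2 * \<bar>?X\<bar>) else 1)"
    if p: "p \<in> pm2" "p' \<in> pm2" for p p'
  proof (cases "qsign p = qsign p'")
    case True
    then obtain q a b where q: "q \<in> pm" "a \<in> pm" "b \<in> pm" and pp: "p = (a, q * a)" "p' = (b, q * b)" using same_sign_pair[OF p] by blast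
    have "psum N J p p' (nc N) = C * exp (?X * (2 * (a * b))) * cex N J p p' (nc N)"
      unfolding psum_cex[OF p, of N J "nc N"] C(2)[OF p] ip_sign[OF p] using True by (simp add: pp)
    also have "... \<le> C * exp (?X * (2 * (a * b))) * exp (- 4 * max 0 (?X * (a * b)))"
      unfolding pp using C(1) by (intro mult_left_mono cex_nc[OF q]) auto
    also have "... = C * exp (2 * (?X * (a * b)) - 4 * max 0 (?X * (a * b)))"
    proof -
      have "exp (x * (2 * s)) * exp (- 4 * m) = exp (2 * (x * s) - 4 * m)" for x s m :: real by (simp add: mult.left_commute flip: exp_add)
      then show ?thesis by (simp only: mult.assoc)
    qed
    also have "2 * (?X * (a * b)) - 4 * max 0 (?X * (a * b)) = - 2 * \<bar>?X\<bar>"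
    proof -
      have "2 * (x * s) - 4 * max 0 (x * s) = - 2 * \<bar>x\<bar>" if "s \<in> pm" for x s :: real using that by auto
      moreover have "a * b \<in> pm" using q by auto
      ultimately show ?thesis by blast
    qed
    finally show ?thesis unfolding if_P[OF True] .
  next
    case False
    have "psum N J p p' (nc N) = C * cex N J p p' (nc N)" unfolding psum_cex[OF p, of N J "nc N"] C(2)[OF p] ip_sign[OF p] using False by simp
    also have "... \<le> C * 1" using C(1) nc_bounds by (intro mult_left_mono cex_bounds p) auto
    finally show ?thesis using False by simp
  qed
  then have "tot N J (nc N) \<le> (\<Sum>p\<in>pm2. \<Sum>p'\<in>pm2. C * (if qsign p = qsign p' then exp (- 2 * \<bar>?X\<bar>) else 1))"
    unfolding tot_psum by (intro sum_mono)
  also have "... = C * (8 * exp (- 2 * \<bar>?X\<bar>) + 8 * 1)" by (simp only: sum_distrib_left[symmetric] sum_signs)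
  finally have "ens N J (nc N) \<le> C * (8 * exp (- 2 * \<bar>?X\<bar>) + 8 * 1) / (C * (16 * (cosh ?X)\<^sup>2))"
    unfolding ens_def C(3) using C(1) by (intro divide_right_mono) auto
  also have "... = (1 + exp (- 2 * \<bar>?X\<bar>)) / (2 * (cosh \<bar>?X\<bar>)\<^sup>2)"
  proof -
    have "C * (8 * E + 8 * 1) / (C * (16 * D)) = (1 + E) / (2 * D)" for E D :: real using C(1) by (cases "D = 0") (simp_all add: field_simps)
    then show ?thesis by (simp only: cosh_real_abs)
  qed
  also have "1 + exp (- 2 * \<bar>?X\<bar>) = 2 * exp (- \<bar>?X\<bar>) * cosh \<bar>?X\<bar>"
  proof -
    have "1 + exp (- 2 * x) = 2 * exp (- x) * cosh x" for x :: real
    proof -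
      have a: "exp (- x) * exp x = 1" and b: "exp (- 2 * x) = exp (- x) * exp (- x)" by (simp_all flip: exp_add)
      have "2 * E * ((Y + E) / 2) = E * Y + E * E" for E Y :: real by (simp add: field_simps)
      then show ?thesis unfolding cosh_field_def b by (simp only: a)
    qed
    then show ?thesis .
  qed
  also have "2 * exp (- \<bar>?X\<bar>) * cosh \<bar>?X\<bar> / (2 * (cosh \<bar>?X\<bar>)\<^sup>2) = 1 - tanh \<bar>?X\<bar>"
  proof -
    have "2 * exp (- x) * cosh x / (2 * (cosh x)\<^sup>2) = 1 - tanh x" for x :: real
    proof -
      have c: "cosh x \<noteq> 0" using cosh_real_pos[of x] by linarith
      have "exp (- x) = cosh x - sinh x" by (simp add: cosh_minus_sinh)
      then show ?thesis using c by (simp add: power2_eq_square tanh_def diff_divide_distrib)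
    qed
    then show ?thesis .
  qed
  finally show ?thesis .
qed

theorem ens_poles_differ: "ens N J (\<lambda>w. of_bool (ov PoleA w \<noteq> ov PoleB w)) = sech2 (X N J) / 2"
proof -
  let ?X = "X N J" and ?F = "\<lambda>w. of_bool (ov PoleA w \<noteq> ov PoleB w) :: real"
  obtain C where C: "C > 0" "\<And>p p'. p \<in> pm2 \<Longrightarrow> p' \<in> pm2 \<Longrightarrow> psum N J p p' (\<lambda>_. 1) = C * exp (?X * ip p p')"
      "tot N J (\<lambda>_. 1) = C * (16 * (cosh ?X)\<^sup>2)" using tot_one[of N J] by metis
  have "psum N J p p' ?F = C * (if qsign p = qsign p' then 0 else 1)"
    if p: "p \<in> pm2" "p' \<in> pm2" for p p'
  proof -
    have "psum N J p p' ?F = (\<Sum>w\<in>poled n N p p'. W N J w * of_bool (qsign p \<noteq> qsign p'))"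
      unfolding psum_def by (intro sum.cong) (auto simp: poled_def ov_def)
    also have "... = psum N J p p' (\<lambda>_. 1) * of_bool (qsign p \<noteq> qsign p')" unfolding psum_def by (simp add: sum_distrib_right)
    finally show ?thesis unfolding C(2)[OF p] ip_sign[OF p] by simp
  qed
  then have "tot N J ?F = (\<Sum>p\<in>pm2. \<Sum>p'\<in>pm2. C * (if qsign p = qsign p' then 0 else 1))" unfolding tot_psum by (intro sum.cong refl)
  also have "... = C * (8 * 0 + 8 * 1)" by (simp only: sum_distrib_left[symmetric] sum_signs)
  finally show ?thesis unfolding ens_def C(3) sech2_def using C(1) by simp
qed

theorem ens_chain:
  assumes "\<And>p p'. p \<in> pm2 \<Longrightarrow> p' \<in> pm2 \<Longrightarrow> qsign p = qsign p' \<Longrightarrow> cex N J p p' (\<lambda>w. of_bool (P w)) \<le> c"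
  shows "ens N J (\<lambda>w. of_bool (ov PoleA w = ov PoleB w \<and> P w)) \<le> c"
proof -
  let ?F = "\<lambda>w. of_bool (ov PoleA w = ov PoleB w \<and> P w) :: real"
  have "0 \<le> cex N J (1, 1) (1, 1) (\<lambda>w. of_bool (P w))" by (intro cex_bounds) auto
  also have "... \<le> c" by (intro assms) auto
  finally have c: "0 \<le> c" .
  have "psum N J p p' ?F \<le> c * psum N J p p' (\<lambda>_. 1)" if p: "p \<in> pm2" "p' \<in> pm2" for p p'
  proof (cases "qsign p = qsign p'")
    case True
    have "psum N J p p' ?F \<le> psum N J p p' (\<lambda>w. of_bool (P w))" by (rule psum_mono) auto
    also have "... = psum N J p p' (\<lambda>_. 1) * cex N J p p' (\<lambda>w. of_bool (P w))" by (rule psum_cex[OF p])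
    also have "... \<le> psum N J p p' (\<lambda>_. 1) * c" using psum_one_pos[OF p, of N J] by (intro mult_left_mono assms p True) auto
    finally show ?thesis by (simp add: mult.commute)
  next
    case False
    have "psum N J p p' ?F = (\<Sum>w\<in>poled n N p p'. 0)" unfolding psum_def using False by (intro sum.cong) (auto simp: poled_def ov_def)
    then show ?thesis using c psum_one_pos[OF p, of N J] by simp
  qed
  then have "tot N J ?F \<le> (\<Sum>p\<in>pm2. \<Sum>p'\<in>pm2. c * psum N J p p' (\<lambda>_. 1))" unfolding tot_psum by (intro sum_mono)
  also have "... = c * tot N J (\<lambda>_. 1)" unfolding tot_psum by (simp only: sum_distrib_left)
  finally show ?thesis unfolding ens_def using tot_one_pos[of N J] by (simp add: divide_le_eq)
qed

end

section \<open>Random couplings and the recursion\<close>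

text \<open>The event on which the effective coupling is spread out: some branch has two good halves, one of
  which clearly dominates the other.\<close>
primrec good :: "(nat \<Rightarrow> real) \<Rightarrow> (nat \<Rightarrow> real) \<Rightarrow> nat \<Rightarrow> real \<Rightarrow> nat \<Rightarrow> (edge \<Rightarrow> real) \<Rightarrow> bool" where
  "good L R n \<beta> 0 J = True"
| "good L R n \<beta> (Suc N) J = (\<exists>i\<in>{..<n}. good L R n \<beta> N (subJ n N i False J) \<and> good L R n \<beta> N (subJ n N i True J) \<and>
     (dominant_pair (L N) (R N) (eff n \<beta> N (subJ n N i False J)) (eff n \<beta> N (subJ n N i True J)) \<or>
      dominant_pair (L N) (R N) (eff n \<beta> N (subJ n N i True J)) (eff n \<beta> N (subJ n N i False J))))"

locale couplings = lattice n \<beta> for n \<beta> +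
  fixes \<nu> :: "real measure" and L R :: "nat \<Rightarrow> real"
  assumes prob_\<nu>: "prob_space \<nu>" and sets_\<nu>: "sets \<nu> = sets borel"
begin

abbreviation Q :: "nat \<Rightarrow> (edge \<Rightarrow> real) measure" where "Q N \<equiv> coupling_law n N \<nu>"

lemma prob_Q: "prob_space (Q N)"
  unfolding coupling_law_def by (intro prob_space_PiM prob_\<nu>)

lemma coupling_measurable:
  assumes "e \<in> edges n N" shows "(\<lambda>J. J e) \<in> borel_measurable (Q N)"
proof -
  have "(\<lambda>J. J e) \<in> Q N \<rightarrow>\<^sub>M \<nu>" unfolding coupling_law_def using assms by (rule measurable_component_singleton)
  then show ?thesis unfolding measurable_cong_sets[OF refl sets_\<nu>] .
qed

lemma subJ_measurable:
  assumes "i < n" shows "sJ N i h \<in> Q (Suc N) \<rightarrow>\<^sub>M Q N"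
proof -
  have "emb i h ` e \<in> edges n (Suc N)" if "e \<in> edges n N" for e using assms that by auto
  then have "(\<lambda>J. \<lambda>e\<in>edges n N. J (emb i h ` e)) \<in> PiM (edges n (Suc N)) (\<lambda>_. \<nu>) \<rightarrow>\<^sub>M PiM (edges n N) (\<lambda>_. \<nu>)"
    by (intro measurable_restrict measurable_component_singleton)
  then show ?thesis unfolding coupling_law_def by (simp only: subJ_def[abs_def])
qed

lemma eff_measurable: "X N \<in> borel_measurable (Q N)"
proof (induction N)
  case 0
  have [measurable]: "(\<lambda>J. J {PoleA, PoleB}) \<in> borel_measurable (Q 0)" by (rule coupling_measurable) simp
  have "(\<lambda>J. \<beta> * J {PoleA, PoleB}) \<in> borel_measurable (Q 0)" by measurable
  then show ?case by (simp add: eff.simps[abs_def] cong: measurable_cong)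
next
  case (Suc N)
  have [measurable]: "(\<lambda>J. X N (sJ N i h J)) \<in> borel_measurable (Q (Suc N))" if "i < n" for i h
    using measurable_compose[OF subJ_measurable[OF that] Suc] .
  have "(\<lambda>J. \<Sum>i<n. ser (X N (sJ N i False J)) (X N (sJ N i True J))) \<in> borel_measurable (Q (Suc N))"
    by (rule borel_measurable_sum) simp
  then show ?case by (simp cong: measurable_cong)
qed

lemma good_measurable: "Measurable.pred (Q N) (good L R n \<beta> N)"
proof (induction N)
  case 0
  then show ?case by simp
next
  case (Suc N)
  have e [measurable]: "(\<lambda>J. X N (sJ N i h J)) \<in> borel_measurable (Q (Suc N))" if "i < n" for i h
    using measurable_compose[OF subJ_measurable[OF that] eff_measurable] .
  have g [measurable]: "Measurable.pred (Q (Suc N)) (\<lambda>J. good L R n \<beta> N (sJ N i h J))" if "i < n" for i h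
    using measurable_compose[OF subJ_measurable[OF that] Suc] .
  show ?case
    unfolding good.simps by (rule pred_intros_finite(4)) (auto intro!: e g measurable pred_intros_logic dominant_pair_measurable)
qed

text \<open>The effective coupling with its good event. Keeping both in one law allows the good event to be
  carried through the recursion without conditioning.\<close>
definition mark :: "nat \<Rightarrow> (edge \<Rightarrow> real) \<Rightarrow> marked" where
  "mark N J = (X N J, good L R n \<beta> N J)"

definition law :: "nat \<Rightarrow> marked measure" where
  "law N = distr (Q N) marked_space (mark N)"

lemma mark_measurable: "mark N \<in> Q N \<rightarrow>\<^sub>M marked_space"
  unfolding mark_def[abs_def] using eff_measurable good_measurable by measurable

lemma law_marked: "marked_law (law N)"
proof -
  interpret prob_space "Q N" by (rule prob_Q)
  show ?thesis unfolding marked_law_def law_def using prob_space_distr[OF mark_measurable] by simp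
qed

lemma distr_subJ:
  assumes "i < n" shows "distr (Q (Suc N)) (Q N) (sJ N i h) = Q N"
proof -
  have "inj_on ((`) (emb i h)) (edges n N)" using emb_inj by (simp add: inj_on_def inj_image_eq_iff)
  moreover have "(`) (emb i h) \<in> edges n N \<rightarrow> edges n (Suc N)" using assms by auto
  ultimately have "distr (PiM (edges n (Suc N)) (\<lambda>_. \<nu>)) (PiM (edges n N) (\<lambda>_. \<nu>)) (\<lambda>J. \<lambda>e\<in>edges n N. J (emb i h ` e))
      = PiM (edges n N) (\<lambda>_. \<nu>)" by (rule distr_PiM_reindex[where M = "\<lambda>_. \<nu>", OF prob_\<nu>])
  then show ?thesis unfolding coupling_law_def by (simp only: subJ_def[abs_def])
qed

lemma edges_ne: "edges n N \<noteq> {}"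
  using n by (induction N) (auto simp: lessThan_empty_iff)

lemma indep_couplings: "prob_space.indep_vars (Q N) (\<lambda>_. \<nu>) (\<lambda>e J. J e) (edges n N)"
proof -
  interpret prob_space "Q N" by (rule prob_Q)
  have rv: "(\<lambda>J. J e) \<in> Q N \<rightarrow>\<^sub>M \<nu>" if "e \<in> edges n N" for e
    unfolding coupling_law_def using that by (rule measurable_component_singleton)
  have "distr (Q N) (PiM (edges n N) (\<lambda>_. \<nu>)) (\<lambda>J. \<lambda>e\<in>edges n N. J e) = distr (Q N) (Q N) (\<lambda>J. J)"
    unfolding coupling_law_def
    by (rule distr_cong) (auto simp: space_PiM PiE_def extensional_restrict)
  also have "... = PiM (edges n N) (\<lambda>_. \<nu>)" by (simp add: coupling_law_def)
  also have "... = PiM (edges n N) (\<lambda>e. distr (Q N) \<nu> (\<lambda>J. J e))"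
    unfolding coupling_law_def by (rule PiM_cong) (auto simp: distr_PiM_component[where M = "\<lambda>_. \<nu>", OF prob_\<nu>])
  finally show ?thesis using indep_vars_iff_distr_eq_PiM'[of "edges n N" "\<lambda>e J. J e" "\<lambda>_. \<nu>", OF edges_ne rv] by blast
qed

text \<open>The halves use disjoint sets of edges.\<close>
lemma indep_halves:
  assumes f: "inj_on f I" "f ` I \<subseteq> halves n"
  shows "prob_space.indep_vars (Q (Suc N)) (\<lambda>_. Q N) (\<lambda>k. sJ N (fst (f k)) (snd (f k))) I"
proof -
  interpret prob_space "Q (Suc N)" by (rule prob_Q)
  let ?K = "\<lambda>k. (`) (emb (fst (f k)) (snd (f k))) ` edges n N"
  have "indep_vars (\<lambda>k. PiM (?K k) (\<lambda>_. \<nu>)) (\<lambda>k J. restrict (\<lambda>e. J e) (?K k)) I"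
  proof (rule indep_vars_restrict[OF indep_couplings])
    show "?K k \<subseteq> edges n (Suc N)" if "k \<in> I" for k
    proof -
      have "fst (f k) < n" using f(2) that by (auto simp: image_subset_iff mem_Times_iff)
      then show ?thesis by auto
    qed
    show "disjoint_family_on ?K I" unfolding disjoint_family_on_def
    proof (intro ballI impI)
      fix k k' assume k: "k \<in> I" "k' \<in> I" "k \<noteq> k'"
      then have ne: "f k \<noteq> f k'" using f(1) by (auto dest: inj_onD)
      show "?K k \<inter> ?K k' = {}"
      proof (rule ccontr)
        assume "?K k \<inter> ?K k' \<noteq> {}"
        then obtain e e' where "e \<in> edges n N" "e' \<in> edges n N"
          "emb (fst (f k)) (snd (f k)) ` e = emb (fst (f k')) (snd (f k')) ` e'" by blast
        from emb_image_eq[OF n this] ne show False by (auto simp: prod_eq_iff)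
      qed
    qed
  qed
  then have "indep_vars (\<lambda>_. Q N) (\<lambda>k J. (\<lambda>J. \<lambda>e\<in>edges n N. J (emb (fst (f k)) (snd (f k)) ` e)) (restrict (\<lambda>e. J e) (?K k))) I"
  proof (rule indep_vars_compose2)
    fix k
    show "(\<lambda>J. \<lambda>e\<in>edges n N. J (emb (fst (f k)) (snd (f k)) ` e)) \<in> PiM (?K k) (\<lambda>_. \<nu>) \<rightarrow>\<^sub>M Q N"
      unfolding coupling_law_def by (intro measurable_restrict measurable_component_singleton) auto
  qed
  moreover have "(\<lambda>J. \<lambda>e\<in>edges n N. J (emb i h ` e)) (restrict (\<lambda>e. J e) ((`) (emb i h) ` edges n N)) = sJ N i h J" for i h and J :: "edge \<Rightarrow> real"
    by (auto simp: subJ_def fun_eq_iff)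
  ultimately show ?thesis by (simp only:)
qed

lemma distr_halves:
  assumes "i < n"
  shows "distr (Q (Suc N)) (Q N \<Otimes>\<^sub>M Q N) (\<lambda>J. (sJ N i False J, sJ N i True J)) = Q N \<Otimes>\<^sub>M Q N"
proof -
  interpret prob_space "Q (Suc N)" by (rule prob_Q)
  let ?f = "\<lambda>b. (i, \<not> b)"
  have "indep_vars (\<lambda>_. Q N) (\<lambda>b. sJ N (fst (?f b)) (snd (?f b))) UNIV" using assms by (intro indep_halves) (auto simp: inj_on_def)
  moreover have "(\<lambda>b. sJ N (fst (?f b)) (snd (?f b))) = case_bool (sJ N i False) (sJ N i True)" by (auto simp: fun_eq_iff split: bool.split)
  moreover have "(\<lambda>_. Q N) = case_bool (Q N) (Q N)" by (auto simp: fun_eq_iff split: bool.split)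
  ultimately have "indep_var (Q N) (sJ N i False) (Q N) (sJ N i True)" by (simp only: indep_var_def)
  then show ?thesis
    unfolding indep_var_distribution_eq distr_subJ[OF assms] by simp
qed

definition branch_mark :: "real \<Rightarrow> nat \<Rightarrow> (edge \<Rightarrow> real) \<Rightarrow> nat \<Rightarrow> marked" where
  "branch_mark s N J i = branch_map (L N) (R N) s (mark N (sJ N i False J), mark N (sJ N i True J))"

lemma mark_subJ_measurable: "i < n \<Longrightarrow> (\<lambda>J. mark N (sJ N i h J)) \<in> Q (Suc N) \<rightarrow>\<^sub>M marked_space"
  by (rule measurable_compose[OF subJ_measurable mark_measurable])

lemma distr_mark_pair:
  assumes "i < n"
  shows "distr (Q (Suc N)) (marked_space \<Otimes>\<^sub>M marked_space) (\<lambda>J. (mark N (sJ N i False J), mark N (sJ N i True J)))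
    = law N \<Otimes>\<^sub>M law N"
proof -
  interpret marked_law "law N" by (rule law_marked)
  interpret prob_space "law N" by (rule prob)
  have sf: "sigma_finite_measure (distr (Q N) marked_space (mark N))" using sigma_finite_measure_axioms by (simp add: law_def)
  have mm: "(\<lambda>(x, y). (mark N x, mark N y)) \<in> Q N \<Otimes>\<^sub>M Q N \<rightarrow>\<^sub>M marked_space \<Otimes>\<^sub>M marked_space"
    using mark_measurable[of N] by measurable
  have "law N \<Otimes>\<^sub>M law N = distr (Q N \<Otimes>\<^sub>M Q N) (marked_space \<Otimes>\<^sub>M marked_space) (\<lambda>(x, y). (mark N x, mark N y))"
    unfolding law_def by (rule pair_measure_distr[OF mark_measurable mark_measurable sf])
  also have "... = distr (distr (Q (Suc N)) (Q N \<Otimes>\<^sub>M Q N) (\<lambda>J. (sJ N i False J, sJ N i True J)))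
      (marked_space \<Otimes>\<^sub>M marked_space) (\<lambda>(x, y). (mark N x, mark N y))" by (simp only: distr_halves[OF assms])
  also have "... = distr (Q (Suc N)) (marked_space \<Otimes>\<^sub>M marked_space)
      ((\<lambda>(x, y). (mark N x, mark N y)) \<circ> (\<lambda>J. (sJ N i False J, sJ N i True J)))"
    using subJ_measurable[OF assms] by (intro distr_distr mm measurable_Pair)
  finally show ?thesis by (simp add: comp_def)
qed

lemma distr_branch_mark:
  assumes "i < n"
  shows "distr (Q (Suc N)) marked_space (\<lambda>J. branch_mark s N J i) = branch_law (L N) (R N) s (law N)"
proof -
  have m: "(\<lambda>J. (mark N (sJ N i False J), mark N (sJ N i True J))) \<in> Q (Suc N) \<rightarrow>\<^sub>M marked_space \<Otimes>\<^sub>M marked_space"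
    using mark_subJ_measurable[OF assms] by (intro measurable_Pair)
  show ?thesis
    unfolding branch_law_def distr_mark_pair[OF assms, symmetric]
    by (subst distr_distr[OF branch_map_measurable m]) (simp add: branch_mark_def comp_def)
qed

lemma distr_branches:
  "distr (Q (Suc N)) (PiM {..<n} (\<lambda>_. marked_space)) (\<lambda>J. \<lambda>i\<in>{..<n}. branch_mark s N J i)
    = PiM {..<n} (\<lambda>_. branch_law (L N) (R N) s (law N))"
proof -
  interpret prob_space "Q (Suc N)" by (rule prob_Q)
  let ?K = "\<lambda>i::nat. {i} \<times> (UNIV :: bool set)"
  have rv: "(\<lambda>J. branch_mark s N J i) \<in> Q (Suc N) \<rightarrow>\<^sub>M marked_space" if "i \<in> {..<n}" for i
    using that mark_subJ_measurable[of i N] unfolding branch_mark_def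
    by (intro measurable_compose[OF _ branch_map_measurable] measurable_Pair) auto
  have "indep_vars (\<lambda>i. PiM (?K i) (\<lambda>_. Q N)) (\<lambda>i J. \<lambda>k\<in>?K i. sJ N (fst k) (snd k) J) {..<n}"
    by (rule indep_vars_restrict[OF indep_halves[where f = "\<lambda>k. k" and I = "halves n"]]) (auto simp: disjoint_family_on_def)
  then have "indep_vars (\<lambda>_. marked_space) (\<lambda>i J. (\<lambda>f. branch_map (L N) (R N) s (mark N (f (i, False)), mark N (f (i, True))))
      (\<lambda>k\<in>?K i. sJ N (fst k) (snd k) J)) {..<n}"
  proof (rule indep_vars_compose2)
    fix i
    have "(\<lambda>f. mark N (f (i, h))) \<in> PiM (?K i) (\<lambda>_. Q N) \<rightarrow>\<^sub>M marked_space" for h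
    proof -
      have "(\<lambda>f. f (i, h)) \<in> PiM (?K i) (\<lambda>_. Q N) \<rightarrow>\<^sub>M Q N" by (rule measurable_component_singleton) simp
      from measurable_compose[OF this mark_measurable] show ?thesis .
    qed
    then show "(\<lambda>f. branch_map (L N) (R N) s (mark N (f (i, False)), mark N (f (i, True)))) \<in> PiM (?K i) (\<lambda>_. Q N) \<rightarrow>\<^sub>M marked_space"
      by (intro measurable_compose[OF _ branch_map_measurable] measurable_Pair)
  qed
  then have "indep_vars (\<lambda>_. marked_space) (\<lambda>i J. branch_mark s N J i) {..<n}" by (simp add: branch_mark_def)
  then have "distr (Q (Suc N)) (PiM {..<n} (\<lambda>_. marked_space)) (\<lambda>J. \<lambda>i\<in>{..<n}. branch_mark s N J i)
      = PiM {..<n} (\<lambda>i. distr (Q (Suc N)) marked_space (\<lambda>J. branch_mark s N J i))"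
    using indep_vars_iff_distr_eq_PiM'[of "{..<n}" "\<lambda>i J. branch_mark s N J i" "\<lambda>_. marked_space"] rv n by auto
  also have "... = PiM {..<n} (\<lambda>_. branch_law (L N) (R N) s (law N))" by (rule PiM_cong) (auto simp: distr_branch_mark)
  finally show ?thesis .
qed

definition conc :: "nat \<Rightarrow> real \<Rightarrow> bool" where
  "conc N r \<longleftrightarrow> (\<forall>A\<in>sets borel. emeasure (law N) (good_in A) \<le> ennreal r * len A)"

definition bad :: "nat \<Rightarrow> real \<Rightarrow> bool" where
  "bad N w \<longleftrightarrow> emeasure (law N) {z. \<not> snd z} \<le> ennreal w"

text \<open>The branch variables are rescaled by \<open>s\<close> so that their concentration is bounded by the triangular
  density without parameters; the scale reappears in the preimage.\<close>
lemma law_Suc: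
  fixes N :: nat
  assumes s: "0 < s"
  defines "B \<equiv> PiM {..<n} (\<lambda>_. branch_law (L N) (R N) s (law N))"
  shows "A \<in> sets borel \<Longrightarrow> emeasure (law (Suc N)) (good_in A)
      = emeasure B {z \<in> space B. (\<exists>i<n. snd (z i)) \<and> total_sum n z \<in> (\<lambda>x. x / s) -` A}"
    and "emeasure (law (Suc N)) {z. \<not> snd z} = emeasure B {z \<in> space B. \<forall>i<n. \<not> snd (z i)}"
proof -
  interpret M: marked_law "law (Suc N)" by (rule law_marked)
  interpret N: marked_law "law N" by (rule law_marked)
  interpret K: marked_law "branch_law (L N) (R N) s (law N)" by (rule N.branch_marked_law)
  let ?h = "\<lambda>J. \<lambda>i\<in>{..<n}. branch_mark s N J i"
  have h: "?h \<in> Q (Suc N) \<rightarrow>\<^sub>M PiM {..<n} (\<lambda>_. marked_space)"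
  proof (rule measurable_restrict)
    fix i assume "i \<in> {..<n}"
    then show "(\<lambda>J. branch_mark s N J i) \<in> Q (Suc N) \<rightarrow>\<^sub>M marked_space"
      using mark_subJ_measurable[of i N] unfolding branch_mark_def
      by (intro measurable_compose[OF _ branch_map_measurable] measurable_Pair) auto
  qed
  have setsB: "sets B = sets (PiM {..<n} (\<lambda>_. marked_space))" unfolding B_def by (intro sets_PiM_cong refl K.sets_M)
  have B: "B = distr (Q (Suc N)) (PiM {..<n} (\<lambda>_. marked_space)) ?h" unfolding B_def by (rule distr_branches[symmetric])
  have g: "(\<exists>i<n. snd (branch_mark s N J i)) = snd (mark (Suc N) J)" for J by (auto simp: mark_def branch_mark_def branch_map_def)
  have t: "total_sum n (?h J) = s * fst (mark (Suc N) J)" for J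
    unfolding total_sum_def mark_def branch_mark_def branch_map_def by (simp add: sum_distrib_left)
  have comp [measurable]: "(\<lambda>z. z i) \<in> B \<rightarrow>\<^sub>M marked_space" if "i < n" for i
    unfolding measurable_cong_sets[OF setsB refl] by (rule measurable_component_singleton) (simp add: that)
  have spB: "space B = space (PiM {..<n} (\<lambda>_. marked_space))" by (rule sets_eq_imp_space_eq[OF setsB])
  have tm: "total_sum n \<in> borel_measurable B" unfolding total_sum_def[abs_def] by (rule borel_measurable_sum) simp
  have gm: "Measurable.pred B (\<lambda>z. \<exists>i<n. snd (z i))"
  proof -
    have "Measurable.pred B (\<lambda>z. \<exists>i\<in>{..<n}. snd (z i))" by (rule pred_intros_finite(4)) auto
    then show ?thesis by (simp add: Bex_def)
  qed
  {
    assume A [measurable]: "A \<in> sets borel"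
    have [measurable]: "(\<lambda>x. x / s) -` A \<in> sets borel" using measurable_sets[of "\<lambda>x. x / s" borel borel A] by simp
    have E: "{z \<in> space B. (\<exists>i<n. snd (z i)) \<and> total_sum n z \<in> (\<lambda>x. x / s) -` A} \<in> sets B" using gm tm by measurable
    have S: "(good_in A) \<in> sets marked_space"
    proof -
      have "{z \<in> space (marked_space). snd z \<and> fst z \<in> A} \<in> sets marked_space" by measurable
      then show ?thesis by (simp add: space_pair_measure)
    qed
    have "emeasure B {z \<in> space B. (\<exists>i<n. snd (z i)) \<and> total_sum n z \<in> (\<lambda>x. x / s) -` A}
        = emeasure (Q (Suc N)) (?h -` {z \<in> space B. (\<exists>i<n. snd (z i)) \<and> total_sum n z \<in> (\<lambda>x. x / s) -` A} \<inter> space (Q (Suc N)))"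
      unfolding spB by (subst (1) B) (rule emeasure_distr[OF h E[unfolded setsB spB]])
    also have "?h -` {z \<in> space B. (\<exists>i<n. snd (z i)) \<and> total_sum n z \<in> (\<lambda>x. x / s) -` A} \<inter> space (Q (Suc N))
        = mark (Suc N) -` (good_in A) \<inter> space (Q (Suc N))" using s g t measurable_space[OF h] unfolding spB by auto (metis g)
    also have "emeasure (Q (Suc N)) ... = emeasure (law (Suc N)) (good_in A)"
      unfolding law_def by (rule emeasure_distr[OF mark_measurable S, symmetric])
    finally show "emeasure (law (Suc N)) (good_in A)
      = emeasure B {z \<in> space B. (\<exists>i<n. snd (z i)) \<and> total_sum n z \<in> (\<lambda>x. x / s) -` A}" ..
  }
  have E: "{z \<in> space B. \<forall>i<n. \<not> snd (z i)} \<in> sets B"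
  proof -
    have "{z \<in> space B. \<not> (\<exists>i<n. snd (z i))} \<in> sets B" using gm by measurable
    then show ?thesis by simp
  qed
  have S: "{z. \<not> snd z} \<in> sets marked_space" using M.bad_set M.sets_M by simp
  have "emeasure B {z \<in> space B. \<forall>i<n. \<not> snd (z i)}
      = emeasure (Q (Suc N)) (?h -` {z \<in> space B. \<forall>i<n. \<not> snd (z i)} \<inter> space (Q (Suc N)))"
    unfolding spB by (subst (1) B) (rule emeasure_distr[OF h E[unfolded setsB spB]])
  also have "?h -` {z \<in> space B. \<forall>i<n. \<not> snd (z i)} \<inter> space (Q (Suc N))
      = mark (Suc N) -` {z. \<not> snd z} \<inter> space (Q (Suc N))" using g[symmetric] measurable_space[OF h] unfolding spB by auto
  also have "emeasure (Q (Suc N)) ... = emeasure (law (Suc N)) {z. \<not> snd z}"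
    unfolding law_def by (rule emeasure_distr[OF mark_measurable S, symmetric])
  finally show "emeasure (law (Suc N)) {z. \<not> snd z} = emeasure B {z \<in> space B. \<forall>i<n. \<not> snd (z i)}" ..
qed

theorem recursion:
  fixes N :: nat
  assumes r: "0 < r" "conc N r" and w: "0 \<le> w" "bad N w" and LR: "0 < L N" "0 < R N"
  defines "v \<equiv> 2 * w + (2 * r * R N)\<^sup>2 + 4 * r * L N"
  shows "conc (Suc N) (r * ((1 + exp (- 2 * L N)) / tanh (R N) * (\<Sum>g = 1..n. real (n choose g) * kappa g * v ^ (n - g))))"
    and "bad (Suc N) (v ^ n)"
proof -
  define s where "s = r * ((1 + exp (- 2 * L N)) / tanh (R N))"
  have s: "0 < s" unfolding s_def using r(1) LR(2) by (intro mult_pos_pos divide_pos_pos) (auto simp: add_pos_pos)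
  interpret N: marked_law "law N" by (rule law_marked)
  interpret K: marked_law "branch_law (L N) (R N) s (law N)" by (rule N.branch_marked_law)
  have c: "conc_le (good_part (branch_law (L N) (R N) s (law N))) tri"
    using r(2) by (intro N.branch_law_conc[OF r(1) _ LR s_def]) (auto simp: conc_def)
  have b: "emeasure (branch_law (L N) (R N) s (law N)) {z. \<not> snd z} \<le> ennreal v"
    unfolding v_def using r w by (intro N.branch_law_bad LR) (auto simp: conc_def bad_def)
  have v: "0 \<le> v" unfolding v_def using r w LR by simp
  let ?G = "\<Sum>g = 1..n. real (n choose g) * kappa g * v ^ (n - g)"
  have G: "0 \<le> ?G" using v kappa_nonneg by (intro sum_nonneg mult_nonneg_nonneg) auto
  show "bad (Suc N) (v ^ n)" unfolding bad_def law_Suc(2)[OF s] by (rule K.branches_sum(2)[OF v b c, of "{}"]) simp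
  have "emeasure (law (Suc N)) (good_in A) \<le> ennreal (s * ?G) * len A"
    if A [measurable]: "A \<in> sets borel" for A
  proof -
    have m: "(\<lambda>x. x / s) -` A \<in> sets borel" using measurable_sets[of "\<lambda>x. x / s" borel borel A] by simp
    have "len ((\<lambda>x. x / s) -` A) = ennreal s * len A"
    proof -
      have "len A = emeasure (density (distr lborel borel (\<lambda>x. 0 + (1/s) *\<^sub>R x)) (\<lambda>_. ennreal \<bar>1/s\<bar> ^ DIM(real))) A"
        using lborel_real_affine[of "1/s" 0] s by simp
      also have "... = ennreal (1/s) * len ((\<lambda>x. x / s) -` A)" using s by (simp add: emeasure_density_const emeasure_distr)
      finally show ?thesis using s by (simp add: mult.assoc[symmetric] ennreal_mult[symmetric])
    qed
    then have "emeasure (law (Suc N)) (good_in A) \<le> ennreal ?G * (ennreal s * len A)"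
      unfolding law_Suc(1)[OF s A] using K.branches_sum(1)[OF v b c m] by simp
    also have "... = ennreal (s * ?G) * len A" using s G by (simp add: ennreal_mult mult_ac)
    finally show ?thesis .
  qed
  then show "conc (Suc N) (r * ((1 + exp (- 2 * L N)) / tanh (R N) * ?G))" unfolding conc_def s_def by (simp only: mult.assoc) auto
qed

end

section \<open>Expected losses\<close>

lemma sech2_measurable [measurable]: "sech2 \<in> borel_measurable borel"
  unfolding sech2_def[abs_def] by (intro borel_measurable_continuous_onI continuous_intros) auto

lemma even_integral:
  fixes f F :: "real \<Rightarrow> real"
  assumes f [measurable]: "f \<in> borel_measurable borel" and even: "\<And>x. f (- x) = f x"
    and D: "\<And>x. 0 \<le> x \<Longrightarrow> (F has_real_derivative f x) (at x)" and nn: "\<And>x. 0 \<le> x \<Longrightarrow> 0 \<le> f x"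
    and lim: "(F \<longlongrightarrow> T) at_top"
  shows "(LI x. ennreal (f x)) = 2 * ennreal (T - F 0)"
proof -
  have "(LI x. ennreal (f x)) = (LI y. (ennreal (f y) + ennreal (f (2 * 0 - y))) * ind {0<..} y)" by (rule nn_integral_fold) measurable
  also have "... = (LI y. 2 * (ennreal (f y) * ind {0..} y))"
    using even by (intro nn_integral_cong_AE eventually_mono[OF AE_lborel_singleton[of 0]])
      (auto split: split_indicator simp: mult_2)
  also have "... = 2 * (LI y. ennreal (f y) * ind {0..} y)" by (rule nn_integral_cmult) measurable
  also have "(LI y. ennreal (f y) * ind {0..} y) = ennreal (T - F 0)" by (rule nn_integral_FTC_atLeast[OF f D nn lim])
  finally show ?thesis .
qed

lemma sech2_integral: "(LI x. ennreal (sech2 x)) = 2"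
proof -
  have D: "(tanh has_real_derivative sech2 x) (at x)" for x :: real
  proof -
    have c: "cosh x \<noteq> 0" using cosh_real_pos[of x] by linarith
    have "1 - (tanh x)\<^sup>2 = sech2 x"
    proof -
      have "1 - (a / b)\<^sup>2 = (b\<^sup>2 - a\<^sup>2) / b\<^sup>2" if "b \<noteq> 0" for a b :: real
        using that by (simp add: power_divide diff_divide_distrib)
      from this[OF c, of "sinh x"] show ?thesis by (simp add: tanh_def sech2_def hyperbolic_pythagoras)
    qed
    then show ?thesis using has_field_derivative_tanh[OF c DERIV_ident] by simp
  qed
  have "(LI x. ennreal (sech2 x)) = 2 * ennreal (1 - tanh 0)" using sech2_bounds by (intro even_integral D tanh_real_at_top) (auto intro: less_imp_le)
  then show ?thesis by simp
qed

lemma tanh_defect_integral: "(LI x. ennreal (1 - tanh \<bar>x\<bar>)) = ennreal (2 * ln 2)"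
proof -
  let ?F = "\<lambda>x::real. - ln (1 + exp (- 2 * x))"
  have m: "(\<lambda>x::real. 1 - tanh \<bar>x\<bar>) \<in> borel_measurable borel"
  proof (intro borel_measurable_continuous_onI continuous_intros)
    show "cosh \<bar>x\<bar> \<noteq> 0" for x :: real using cosh_real_pos[of "\<bar>x\<bar>"] by linarith
  qed
  have D: "(?F has_real_derivative 1 - tanh \<bar>x\<bar>) (at x)" if "0 \<le> x" for x
  proof -
    have e: "exp (- 2 * x) = exp (- x) / exp x" by (simp flip: exp_diff)
    have "1 - tanh x = 2 * exp (- 2 * x) / (1 + exp (- 2 * x))"
    proof -
      have "1 - (X - E) / (X + E) = 2 * (E / X) / (1 + E / X)" if "0 < X" "0 < E" for X E :: real using that by (simp add: field_simps)
      from this[of "exp x" "exp (- x)"] show ?thesis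
        unfolding e tanh_altdef by simp
    qed
    moreover have "(?F has_real_derivative 2 * exp (- 2 * x) / (1 + exp (- 2 * x))) (at x)"
    proof -
      have "0 < 1 + exp (- 2 * x)" by (simp add: add_pos_pos)
      then show ?thesis by (auto intro!: derivative_eq_intros)
    qed
    ultimately show ?thesis using that by simp
  qed
  have "((\<lambda>x::real. - ln (1 + exp (- 2 * x))) \<longlongrightarrow> - ln (1 + 0)) at_top"
    by (intro tendsto_intros filterlim_compose[OF exp_at_bot]
              filterlim_tendsto_neg_mult_at_bot[OF tendsto_const] filterlim_ident) auto
  then have lim: "(?F \<longlongrightarrow> 0) at_top" by simp
  have "(LI x. ennreal (1 - tanh \<bar>x\<bar>)) = 2 * ennreal (0 - ?F 0)"
    using tanh_real_lt_1 by (intro even_integral m D lim) (auto intro: less_imp_le)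
  also have "... = ennreal (2 * ln 2)" by (simp add: ennreal_mult)
  finally show ?thesis .
qed

lemma blue_loss_measurable [measurable (raw)]:
  assumes [measurable]: "f \<in> borel_measurable M" "g \<in> borel_measurable M"
  shows "(\<lambda>x. blue_loss (f x) (g x)) \<in> borel_measurable M"
  unfolding blue_loss_def by measurable

lemma site_loss_measurable [measurable (raw)]:
  assumes [measurable]: "f \<in> borel_measurable M" "g \<in> borel_measurable M"
  shows "(\<lambda>x. site_loss (f x) (g x)) \<in> borel_measurable M"
  unfolding site_loss_def by measurable

lemma blue_loss_bounds: "0 \<le> blue_loss x y" "blue_loss x y \<le> 1" "blue_loss x y = blue_loss y x"
proof -
  have s: "0 < sech2 (x + y)" "0 < sech2 (x - y)" "sech2 (x + y) \<le> 1" "sech2 (x - y) \<le> 1" by (rule sech2_bounds)+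
  show "0 \<le> blue_loss x y" unfolding blue_loss_def using s by simp
  show "blue_loss x y \<le> 1" unfolding blue_loss_def using s by simp
  show "blue_loss x y = blue_loss y x" using sech2_bounds(3)[of "x - y"] by (simp add: blue_loss_def add.commute)
qed

lemma site_loss_bounds: "0 \<le> site_loss x y" "site_loss x y \<le> 1 / 2" "site_loss x y \<le> blue_loss x y"
  using blue_loss_bounds(1)[of x y] by (auto simp: site_loss_def)

lemma blue_loss_integral: "(LI x. ennreal (blue_loss x y)) = 2"
proof -
  have t: "(LI x. ennreal (sech2 (x + c))) = 2" for c
  proof -
    have "(LI x. ennreal (sech2 x)) = ennreal \<bar>1\<bar> * (LI x. ennreal (sech2 (c + 1 * x)))" by (rule nn_integral_real_affine) auto
    then show ?thesis by (simp add: sech2_integral add.commute)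
  qed
  have "(LI x. ennreal (blue_loss x y))
      = (LI x. ennreal (1 / 2) * ennreal (sech2 (x + y)) + ennreal (1 / 2) * ennreal (sech2 (x + - y)))"
  proof (rule nn_integral_cong)
    fix x
    have h: "ennreal (1 / 2) * ennreal (sech2 c) = ennreal (sech2 c / 2)" for c using sech2_bounds(1)[of c] by (subst ennreal_mult[symmetric]) auto
    show "ennreal (blue_loss x y) = ennreal (1 / 2) * ennreal (sech2 (x + y)) + ennreal (1 / 2) * ennreal (sech2 (x + - y))"
      unfolding h blue_loss_def using sech2_bounds(1)[of "x + y"] sech2_bounds(1)[of "x - y"]
      by (subst ennreal_plus[symmetric]) (auto simp: add_divide_distrib)
  qed
  also have "... = (LI x. ennreal (1 / 2) * ennreal (sech2 (x + y))) + (LI x. ennreal (1 / 2) * ennreal (sech2 (x + - y)))"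
    by (rule nn_integral_add) measurable
  also have "... = ennreal (1 / 2) * 2 + ennreal (1 / 2) * 2"
  proof -
    have "(LI x. ennreal (1 / 2) * ennreal (sech2 (x + c))) = ennreal (1 / 2) * 2" for c
      unfolding t[of c, symmetric] by (rule nn_integral_cmult) measurable
    then show ?thesis by (simp only:)
  qed
  also have "... = ennreal (1 / 2) * ennreal 2 + ennreal (1 / 2) * ennreal 2" by simp
  also have "... = 2" by (simp only: ennreal_mult[symmetric] ennreal_plus[symmetric]) simp
  finally show ?thesis .
qed

context marked_law begin

lemma nn_integral_good_le:
  assumes conc: "\<And>A. A \<in> sets borel \<Longrightarrow> emeasure M (good_in A) \<le> ennreal r * len A"
    and f [measurable]: "f \<in> borel_measurable borel"
  shows "(\<integral>\<^sup>+z. ind {z. snd z} z * f (fst z) \<partial>M) \<le> ennreal r * (LI x. f x)"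
proof -
  have "good_part M \<le> density lborel (\<lambda>_. ennreal r)"
    using conc by (subst le_measure) (auto simp: sets_good emeasure_good emeasure_density_const)
  then have "(\<integral>\<^sup>+x. f x \<partial>good_part M) \<le> (\<integral>\<^sup>+x. f x \<partial>density lborel (\<lambda>_. ennreal r))"
    by (intro nn_integral_mono_measure) (auto simp: sets_good)
  also have "... = ennreal r * (LI x. f x)" by (simp add: nn_integral_density nn_integral_cmult)
  finally show ?thesis by (simp add: nn_integral_good)
qed

lemma single_bound:
  assumes conc: "\<And>A. A \<in> sets borel \<Longrightarrow> emeasure M (good_in A) \<le> ennreal r * len A"
    and r: "0 \<le> r" and wbad: "emeasure M {z. \<not> snd z} \<le> ennreal w" and w: "0 \<le> w"
    and f [measurable]: "f \<in> borel_measurable borel" and le: "\<And>x. f x \<le> g x" "\<And>x. f x \<le> b" and b: "0 \<le> b"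
    and g [measurable]: "g \<in> borel_measurable borel" and I: "(LI x. ennreal (g x)) = ennreal I" "0 \<le> I"
  shows "(\<integral>\<^sup>+z. ennreal (f (fst z)) \<partial>M) \<le> ennreal (b * w + r * I)"
proof -
  have "(\<integral>\<^sup>+z. ennreal (f (fst z)) \<partial>M)
      \<le> (\<integral>\<^sup>+z. ind {z. snd z} z * ennreal (g (fst z)) + ennreal b * ind {z. \<not> snd z} z \<partial>M)"
    using le by (intro nn_integral_mono) (auto split: split_indicator intro!: ennreal_leI)
  also have "... = (\<integral>\<^sup>+z. ind {z. snd z} z * ennreal (g (fst z)) \<partial>M) + ennreal b * emeasure M {z. \<not> snd z}"
    using bad_set by (subst nn_integral_add) (auto simp: nn_integral_cmult_indicator)
  also have "... \<le> ennreal r * ennreal I + ennreal b * ennreal w"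
    using nn_integral_good_le[OF conc, of "\<lambda>x. ennreal (g x)"] wbad I by (intro add_mono mult_left_mono) auto
  also have "... = ennreal (b * w + r * I)"
    using r w b I by (simp add: ennreal_mult[symmetric] ennreal_plus[symmetric] add.commute del: ennreal_plus)
  finally show ?thesis .
qed

lemma pair_site_bound:
  assumes conc: "\<And>A. A \<in> sets borel \<Longrightarrow> emeasure M (good_in A) \<le> ennreal r * len A"
    and r: "0 \<le> r" and wbad: "emeasure M {z. \<not> snd z} \<le> ennreal w" and w: "0 \<le> w"
  shows "(\<integral>\<^sup>+p. ennreal (site_loss (fst (fst p)) (fst (snd p))) \<partial>(M \<Otimes>\<^sub>M M)) \<le> ennreal (w / 2 + 2 * r)"
proof -
  interpret prob_space M by (rule prob)
  interpret P: pair_prob_space M M ..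
  have "(\<integral>\<^sup>+p. ennreal (site_loss (fst (fst p)) (fst (snd p))) \<partial>(M \<Otimes>\<^sub>M M))
      = (\<integral>\<^sup>+z'. (\<integral>\<^sup>+z. ennreal (site_loss (fst z) (fst z')) \<partial>M) \<partial>M)"
    by (subst P.nn_integral_snd[symmetric]) auto
  also have "... \<le> (\<integral>\<^sup>+z'. ennreal (w / 2 + 2 * r) \<partial>M)"
  proof (rule nn_integral_mono)
    fix z'
    have "(\<integral>\<^sup>+z. ennreal (site_loss (fst z) (fst z')) \<partial>M) \<le> ennreal (1 / 2 * w + r * 2)"
      by (rule single_bound[OF conc r wbad w _ site_loss_bounds(3) site_loss_bounds(2)])
        (auto simp: blue_loss_integral)
    then show "(\<integral>\<^sup>+z. ennreal (site_loss (fst z) (fst z')) \<partial>M) \<le> ennreal (w / 2 + 2 * r)" by (simp add: mult.commute)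
  qed
  also have "... = ennreal (w / 2 + 2 * r)" using emeasure_space_1 by simp
  finally show ?thesis .
qed

text \<open>The plane is split by the mark of the first half. A good first half has density at most \<open>r\<close>, and
  every section of \<open>blue_loss\<close> has integral \<open>2\<close>; on a bad first half the same is done for the second.\<close>
lemma pair_blue_bound:
  assumes conc: "\<And>A. A \<in> sets borel \<Longrightarrow> emeasure M (good_in A) \<le> ennreal r * len A"
    and r: "0 \<le> r" and wbad: "emeasure M {z. \<not> snd z} \<le> ennreal w" and w: "0 \<le> w"
  shows "(\<integral>\<^sup>+p. ennreal (blue_loss (fst (fst p)) (fst (snd p))) \<partial>(M \<Otimes>\<^sub>M M)) \<le> ennreal (2 * r + w * (w + 2 * r))"
proof -
  interpret prob_space M by (rule prob)
  interpret P: pair_prob_space M M ..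
  note [measurable] = bad_set
  have section_le: "(\<integral>\<^sup>+z. ennreal (blue_loss (fst z) y) \<partial>M) \<le> ennreal (w + 2 * r)" for y
  proof -
    have "(\<integral>\<^sup>+z. ennreal (blue_loss (fst z) y) \<partial>M) \<le> ennreal (1 * w + r * 2)"
      by (rule single_bound[OF conc r wbad w _ order_refl blue_loss_bounds(2)]) (auto simp: blue_loss_integral)
    then show ?thesis by (simp add: mult.commute)
  qed
  have "(\<integral>\<^sup>+p. ennreal (blue_loss (fst (fst p)) (fst (snd p))) \<partial>(M \<Otimes>\<^sub>M M))
      = (\<integral>\<^sup>+p. ind {z. snd z} (fst p) * ennreal (blue_loss (fst (fst p)) (fst (snd p)))
          + ind {z. \<not> snd z} (fst p) * ennreal (blue_loss (fst (fst p)) (fst (snd p))) \<partial>(M \<Otimes>\<^sub>M M))"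
    by (intro nn_integral_cong) (auto split: split_indicator)
  also have "... = (\<integral>\<^sup>+p. ind {z. snd z} (fst p) * ennreal (blue_loss (fst (fst p)) (fst (snd p))) \<partial>(M \<Otimes>\<^sub>M M))
      + (\<integral>\<^sup>+p. ind {z. \<not> snd z} (fst p) * ennreal (blue_loss (fst (fst p)) (fst (snd p))) \<partial>(M \<Otimes>\<^sub>M M))"
    by (rule nn_integral_add) measurable
  also have "... \<le> ennreal (2 * r) + ennreal (w * (w + 2 * r))"
  proof (rule add_mono)
    have "(\<integral>\<^sup>+p. ind {z. snd z} (fst p) * ennreal (blue_loss (fst (fst p)) (fst (snd p))) \<partial>(M \<Otimes>\<^sub>M M))
        = (\<integral>\<^sup>+z'. (\<integral>\<^sup>+z. ind {z. snd z} z * ennreal (blue_loss (fst z) (fst z')) \<partial>M) \<partial>M)"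
      by (subst P.nn_integral_snd[symmetric]) auto
    also have "... \<le> (\<integral>\<^sup>+z'. ennreal r * 2 \<partial>M)"
    proof (rule nn_integral_mono)
      fix z'
      have "(\<integral>\<^sup>+z. ind {z. snd z} z * ennreal (blue_loss (fst z) (fst z')) \<partial>M)
          \<le> ennreal r * (LI x. ennreal (blue_loss x (fst z')))"
        by (rule nn_integral_good_le[OF conc, where f = "\<lambda>x. ennreal (blue_loss x (fst z'))"]) auto
      then show "(\<integral>\<^sup>+z. ind {z. snd z} z * ennreal (blue_loss (fst z) (fst z')) \<partial>M) \<le> ennreal r * 2"
        by (simp only: blue_loss_integral)
    qed
    also have "... = ennreal r * ennreal 2" using emeasure_space_1 by simp
    also have "... = ennreal (2 * r)" using r by (simp only: ennreal_mult[symmetric] mult.commute)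
    finally show "(\<integral>\<^sup>+p. ind {z. snd z} (fst p) * ennreal (blue_loss (fst (fst p)) (fst (snd p))) \<partial>(M \<Otimes>\<^sub>M M)) \<le> ennreal (2 * r)" .
  next
    have "(\<integral>\<^sup>+p. ind {z. \<not> snd z} (fst p) * ennreal (blue_loss (fst (fst p)) (fst (snd p))) \<partial>(M \<Otimes>\<^sub>M M))
        = (\<integral>\<^sup>+z. (\<integral>\<^sup>+z'. ind {z. \<not> snd z} z * ennreal (blue_loss (fst z) (fst z')) \<partial>M) \<partial>M)"
      by (subst nn_integral_fst[symmetric]) auto
    also have "... \<le> (\<integral>\<^sup>+z. ennreal (w + 2 * r) * ind {z. \<not> snd z} z \<partial>M)"
    proof (rule nn_integral_mono)
      fix z
      have "(\<integral>\<^sup>+z'. ind {z. \<not> snd z} z * ennreal (blue_loss (fst z) (fst z')) \<partial>M)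
          = ind {z. \<not> snd z} z * (\<integral>\<^sup>+z'. ennreal (blue_loss (fst z') (fst z)) \<partial>M)"
        using blue_loss_bounds(3) by (subst nn_integral_cmult[symmetric]) auto
      also have "... \<le> ind {z. \<not> snd z} z * ennreal (w + 2 * r)" by (intro mult_left_mono section_le) simp
      finally show "(\<integral>\<^sup>+z'. ind {z. \<not> snd z} z * ennreal (blue_loss (fst z) (fst z')) \<partial>M)
          \<le> ennreal (w + 2 * r) * ind {z. \<not> snd z} z" by (simp only: mult.commute)
    qed
    also have "... = ennreal (w + 2 * r) * emeasure M {z. \<not> snd z}" by (rule nn_integral_cmult_indicator[OF bad_set])
    also have "... \<le> ennreal (w + 2 * r) * ennreal w" by (intro mult_left_mono wbad) simp
    also have "... = ennreal (w * (w + 2 * r))" using w r by (subst ennreal_mult[symmetric]) (auto simp: mult.commute)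
    finally show "(\<integral>\<^sup>+p. ind {z. \<not> snd z} (fst p) * ennreal (blue_loss (fst (fst p)) (fst (snd p))) \<partial>(M \<Otimes>\<^sub>M M))
        \<le> ennreal (w * (w + 2 * r))" .
  qed
  also have "... = ennreal (2 * r + w * (w + 2 * r))" using r w by (subst ennreal_plus[symmetric]) auto
  finally show ?thesis .
qed

end

lemma blue_bound_le_abar:
  assumes "0 \<le> r" "0 \<le> w" "w \<le> 1"
  shows "2 * r + w * (w + 2 * r) \<le> abar r w"
proof -
  have "w * r \<le> 3 / 4 * w + r\<^sup>2 / 2"
  proof -
    have "0 \<le> (1 - w) * r\<^sup>2 + w * ((r - 1)\<^sup>2 + 1 / 2)" using assms by (intro add_nonneg_nonneg mult_nonneg_nonneg) auto
    then show ?thesis by (simp add: power2_eq_square algebra_simps)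
  qed
  moreover have "1 / 2 \<le> ln (2::real)" using ln2_ge_two_thirds by linarith
  then have "1 * r \<le> 2 * ln 2 * r" by (intro mult_right_mono assms(1)) linarith
  ultimately show ?thesis unfolding abar_def by (simp add: power2_eq_square algebra_simps)
qed

context couplings begin

lemma loss_nonneg:
  assumes "\<And>x y. 0 \<le> g x y" shows "0 \<le> loss g n \<beta> N J x"
proof (induction N arbitrary: J x)
  case (Suc N)
  then show ?case using assms by (cases x) auto
qed simp

lemma pair_fun_measurable:
  assumes "(\<lambda>(x, y). g x y) \<in> borel_measurable (borel \<Otimes>\<^sub>M borel)" "f \<in> borel_measurable M" "h \<in> borel_measurable M"
  shows "(\<lambda>x. g (f x) (h x)) \<in> borel_measurable M"
  using measurable_compose[OF measurable_Pair[OF assms(2,3)] assms(1)] by simp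

lemma loss_measurable:
  assumes g: "(\<lambda>(x, y). g x y) \<in> borel_measurable (borel \<Otimes>\<^sub>M borel)"
    and x: "x \<in> verts n N - {PoleA, PoleB}"
  shows "(\<lambda>J. loss g n \<beta> N J x) \<in> borel_measurable (Q N)"
  using x
proof (induction N arbitrary: x)
  case 0
  then show ?case by simp
next
  case (Suc N)
  have e: "(\<lambda>J. X N (sJ N i h J)) \<in> borel_measurable (Q (Suc N))" if "i < n" for i h
    using measurable_compose[OF subJ_measurable[OF that] eff_measurable] .
  have m: "(\<lambda>J. g (X N (sJ N i False J)) (X N (sJ N i True J))) \<in> borel_measurable (Q (Suc N))" if "i < n" for i
    by (intro pair_fun_measurable[OF g] e that)
  consider i where "i < n" "x = Mid i" | i h y where "i < n" "y \<in> verts n N - {PoleA, PoleB}" "x = Sub i h y"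
    using Suc.prems unfolding inner_verts_Suc[OF n] by auto
  then show ?case
  proof cases
    case 1
    then show ?thesis using m by simp
  next
    case 2
    have "(\<lambda>J. loss g n \<beta> N (sJ N i h J) y) \<in> borel_measurable (Q (Suc N))"
      using measurable_compose[OF subJ_measurable[OF 2(1)] Suc.IH[OF 2(2)]] .
    then show ?thesis using m[OF 2(1)] 2(3) by simp
  qed
qed

lemma nn_integral_eff:
  assumes "f \<in> borel_measurable borel"
  shows "(\<integral>\<^sup>+J. f (X N J) \<partial>Q N) = (\<integral>\<^sup>+z. f (fst z) \<partial>law N)"
proof -
  have "(\<lambda>z. f (fst z)) \<in> borel_measurable marked_space" using assms by measurable
  then show ?thesis unfolding law_def by (subst nn_integral_distr[OF mark_measurable]) (auto simp: mark_def)
qed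

lemma nn_integral_eff_pair:
  assumes i: "i < n" and g: "(\<lambda>(x, y). g x y) \<in> borel_measurable (borel \<Otimes>\<^sub>M borel)"
  shows "(\<integral>\<^sup>+J. ennreal (g (X N (sJ N i False J)) (X N (sJ N i True J))) \<partial>Q (Suc N))
    = (\<integral>\<^sup>+p. ennreal (g (fst (fst p)) (fst (snd p))) \<partial>(law N \<Otimes>\<^sub>M law N))"
proof -
  have m: "(\<lambda>p. ennreal (g (fst (fst p)) (fst (snd p)))) \<in> borel_measurable (marked_space \<Otimes>\<^sub>M marked_space)"
    by (intro measurable_compose[OF _ measurable_ennreal] pair_fun_measurable[OF g]) auto
  have p: "(\<lambda>J. (mark N (sJ N i False J), mark N (sJ N i True J))) \<in> Q (Suc N) \<rightarrow>\<^sub>M marked_space \<Otimes>\<^sub>M marked_space"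
    using mark_subJ_measurable[OF i] by (intro measurable_Pair)
  show ?thesis
    unfolding distr_mark_pair[OF i, symmetric] by (subst nn_integral_distr[OF p]) (auto simp: mark_def m)
qed

lemma verts_mono: "m \<le> N \<Longrightarrow> verts n m \<subseteq> verts n N"
proof (rule lift_Suc_mono_le[of "verts n"])
  show "verts n k \<subseteq> verts n (Suc k)" for k
  proof (induction k)
    case 0
    then show ?case using poles_in_verts[OF n, of 1] by auto
  next
    case (Suc k)
    have "(\<Union>i<n. \<Union>h. emb i h ` verts n k) \<subseteq> (\<Union>i<n. \<Union>h. emb i h ` verts n (Suc k))"
      by (intro UN_mono image_mono Suc order_refl)
    then show ?case by (simp only: verts.simps(2)[symmetric])
  qed
qed

text \<open>For a vertex of the skeleton \<open>verts n m\<close> the chain has at most \<open>m\<close> midpoints, so only the last \<open>m\<close>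
  generations contribute.\<close>
lemma loss_expectation:
  assumes g: "(\<lambda>(x, y). g x y) \<in> borel_measurable (borel \<Otimes>\<^sub>M borel)"
    and g0: "\<And>x y. 0 \<le> g x y" and a0: "\<And>k. 0 \<le> a k"
    and a: "\<And>k. (\<integral>\<^sup>+p. ennreal (g (fst (fst p)) (fst (snd p))) \<partial>(law k \<Otimes>\<^sub>M law k)) \<le> ennreal (a k)"
    and x: "x \<in> verts n m - {PoleA, PoleB}" and m: "m \<le> N"
  shows "(\<integral>\<^sup>+J. ennreal (loss g n \<beta> N J x) \<partial>Q N) \<le> ennreal (\<Sum>k\<in>{N - m..<N}. a k)"
  using x m
proof (induction N arbitrary: m x)
  case 0
  then show ?case by simp
next
  case (Suc N)
  then obtain m' where m': "m = Suc m'" by (cases m) auto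
  have step: "(\<integral>\<^sup>+J. ennreal (g (X N (sJ N i False J)) (X N (sJ N i True J))) \<partial>Q (Suc N)) \<le> ennreal (a N)"
    if "i < n" for i unfolding nn_integral_eff_pair[OF that g] by (rule a)
  have e: "(\<lambda>J. X N (sJ N i h J)) \<in> borel_measurable (Q (Suc N))" if "i < n" for i h
    using measurable_compose[OF subJ_measurable[OF that] eff_measurable] .
  have gm: "(\<lambda>J. g (X N (sJ N i False J)) (X N (sJ N i True J))) \<in> borel_measurable (Q (Suc N))" if "i < n" for i
    by (intro pair_fun_measurable[OF g] e that)
  have S: "(\<Sum>k\<in>{Suc N - m..<Suc N}. a k) = a N + (\<Sum>k\<in>{N - m'..<N}. a k)" using m' by (simp add: sum.atLeastLessThan_Suc add.commute)
  have S0: "0 \<le> (\<Sum>k\<in>{N - m'..<N}. a k)" by (intro sum_nonneg a0)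
  consider i where "i < n" "x = Mid i" | i h y where "i < n" "y \<in> verts n m' - {PoleA, PoleB}" "x = Sub i h y"
    using Suc.prems(1) unfolding m' inner_verts_Suc[OF n] by auto
  then show ?case
  proof cases
    case 1
    have "(\<integral>\<^sup>+J. ennreal (loss g n \<beta> (Suc N) J x) \<partial>Q (Suc N)) \<le> ennreal (a N)" using step[OF 1(1)] 1(2) by simp
    also have "... \<le> ennreal (\<Sum>k\<in>{Suc N - m..<Suc N}. a k)" unfolding S using S0 by (intro ennreal_leI) simp
    finally show ?thesis .
  next
    case 2
    have y: "y \<in> verts n N - {PoleA, PoleB}" using 2(2) verts_mono[of m' N] Suc.prems(2) m' by auto
    have lm: "(\<lambda>J. loss g n \<beta> N J y) \<in> borel_measurable (Q N)" by (rule loss_measurable[OF g y])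
    have l0: "0 \<le> loss g n \<beta> N J y" for J by (rule loss_nonneg[OF g0])
    have "(\<integral>\<^sup>+J. ennreal (loss g n \<beta> (Suc N) J x) \<partial>Q (Suc N))
        = (\<integral>\<^sup>+J. ennreal (g (X N (sJ N i False J)) (X N (sJ N i True J)))
            + ennreal (loss g n \<beta> N (sJ N i h J) y) \<partial>Q (Suc N))" using 2(3) l0 g0 by (intro nn_integral_cong) (simp flip: ennreal_plus)
    also have "... = (\<integral>\<^sup>+J. ennreal (g (X N (sJ N i False J)) (X N (sJ N i True J))) \<partial>Q (Suc N))
            + (\<integral>\<^sup>+J. ennreal (loss g n \<beta> N (sJ N i h J) y) \<partial>Q (Suc N))"
      by (intro nn_integral_add measurable_compose[OF _ measurable_ennreal] gm 2(1)
        measurable_compose[OF subJ_measurable[OF 2(1)] lm])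
    also have "(\<integral>\<^sup>+J. ennreal (loss g n \<beta> N (sJ N i h J) y) \<partial>Q (Suc N)) = (\<integral>\<^sup>+J. ennreal (loss g n \<beta> N J y) \<partial>Q N)"
      by (subst (2) distr_subJ[OF 2(1), symmetric], subst nn_integral_distr[OF subJ_measurable[OF 2(1)]])
        (auto intro: measurable_compose[OF lm measurable_ennreal])
    also have "(\<integral>\<^sup>+J. ennreal (g (X N (sJ N i False J)) (X N (sJ N i True J))) \<partial>Q (Suc N)) + ...
        \<le> ennreal (a N) + ennreal (\<Sum>k\<in>{N - m'..<N}. a k)" using Suc.prems(2) m' by (intro add_mono step 2(1) Suc.IH 2(2)) simp
    also have "... = ennreal (\<Sum>k\<in>{Suc N - m..<Suc N}. a k)" unfolding S using a0 S0 by (simp flip: ennreal_plus)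
    finally show ?thesis .
  qed
qed

end

section \<open>Certificates control the recursion\<close>

text \<open>The certificate divides \<open>r\<close> by \<open>1 - w\<close>, as one does when conditioning on the good event. Working with
  unnormalised measures gives the sharper expression on the left.\<close>
lemma varpi_ge:
  assumes "0 \<le> r" "0 \<le> w" "w < 1" "0 < L" "0 < R"
  shows "0 \<le> 2 * w + (2 * r * R)\<^sup>2 + 4 * r * L" "2 * w + (2 * r * R)\<^sup>2 + 4 * r * L \<le> varpi r w L R"
proof -
  show "0 \<le> 2 * w + (2 * r * R)\<^sup>2 + 4 * r * L" using assms by simp
  have "r * (1 - w) \<le> r * 1" using assms by (intro mult_left_mono) auto
  then have \<rho>: "r \<le> r / (1 - w)" using assms by (simp add: pos_le_divide_eq)
  then have "2 * r * R \<le> 2 * (r / (1 - w)) * R" "0 \<le> 2 * r * R" "4 * r * L \<le> 4 * (r / (1 - w)) * L"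
    using assms by (auto intro!: mult_right_mono mult_left_mono simp del: times_divide_eq_right times_divide_eq_left)
  then show "2 * w + (2 * r * R)\<^sup>2 + 4 * r * L \<le> varpi r w L R" unfolding varpi_def Let_def by (intro add_mono power_mono) auto
qed

text \<open>In the tail \<open>r\<close> shrinks by a factor \<open>s\<close> and \<open>w\<close> by \<open>s\<^sup>2\<close>, and every term of \<open>varpi\<close> is then at most
  \<open>s\<close> times its previous value. So the inequalities of the tail step, imposed at one depth, persist at all later
  depths.\<close>
lemma varpi_scale:
  assumes s: "0 \<le> s" "s \<le> 1" and r: "0 \<le> r" and A: "0 \<le> A" "A * r\<^sup>2 < 1" and LR: "0 < L" "0 < R"
  shows "varpi (r * s) (A * r\<^sup>2 * s\<^sup>2) L R \<le> s * varpi r (A * r\<^sup>2) L R"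
proof -
  define w where "w = A * r\<^sup>2"
  have w: "0 \<le> w" "w < 1" using A r by (auto simp: w_def)
  have s2: "s\<^sup>2 \<le> s" using s by (simp add: power2_eq_square mult_left_le)
  define \<rho> where "\<rho> = r / (1 - w)"
  define \<rho>' where "\<rho>' = r * s / (1 - w * s\<^sup>2)"
  have \<rho>0: "0 \<le> \<rho>" using r w by (simp add: \<rho>_def)
  have ws: "w * s\<^sup>2 \<le> w * 1" using w s s2 by (intro mult_left_mono) auto
  have "\<rho>' \<le> r * s / (1 - w)" unfolding \<rho>'_def using ws w r s by (intro divide_left_mono mult_pos_pos mult_nonneg_nonneg) auto
  then have \<rho>': "0 \<le> \<rho>'" "\<rho>' \<le> s * \<rho>" using ws w r s by (auto simp: \<rho>'_def \<rho>_def mult.commute)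
  have "(2 * \<rho>' * R)\<^sup>2 \<le> (2 * (s * \<rho>) * R)\<^sup>2" using \<rho>' LR by (intro power_mono mult_right_mono mult_left_mono) auto
  also have "... = s\<^sup>2 * (2 * \<rho> * R)\<^sup>2" by (simp add: power_mult_distrib)
  also have "... \<le> s * (2 * \<rho> * R)\<^sup>2" using s2 by (rule mult_right_mono) simp
  finally have 1: "(2 * \<rho>' * R)\<^sup>2 \<le> s * (2 * \<rho> * R)\<^sup>2" .
  have 2: "2 * (w * s\<^sup>2) \<le> s * (2 * w)" using mult_left_mono[OF s2 w(1)] by (simp add: mult_ac)
  have "4 * \<rho>' * L \<le> 4 * (s * \<rho>) * L" using \<rho>'(2) LR by (intro mult_right_mono mult_left_mono) auto
  then have 3: "4 * \<rho>' * L \<le> s * (4 * \<rho> * L)" by (simp add: mult_ac)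
  have "2 * (w * s\<^sup>2) + (2 * \<rho>' * R)\<^sup>2 + 4 * \<rho>' * L \<le> s * (2 * w) + s * (2 * \<rho> * R)\<^sup>2 + s * (4 * \<rho> * L)"
    using 1 2 3 by linarith
  then show ?thesis
    unfolding varpi_def Let_def w_def[symmetric] \<rho>_def[symmetric] \<rho>'_def[symmetric] by (simp only: distrib_left)
qed

lemma Gam_ge:
  assumes "0 \<le> v" "v \<le> varpi r w L R" "0 < R"
  shows "(1 + exp (- 2 * L)) / tanh R * (\<Sum>g = 1..n. real (n choose g) * kappa g * v ^ (n - g)) \<le> Gam n r w L R"
  unfolding Gam_def using assms kappa_nonneg
  by (intro mult_left_mono sum_mono power_mono divide_nonneg_nonneg mult_nonneg_nonneg) (auto intro: add_nonneg_nonneg)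

definition Lseq :: "certificate \<Rightarrow> nat \<Rightarrow> real" where
  "Lseq c k = (if k < depth c then cL c k else tailL c)"

definition Rseq :: "certificate \<Rightarrow> nat \<Rightarrow> real" where
  "Rseq c k = (if k < depth c then cR c k else tailR c)"

locale certified =
  fixes n :: nat and \<beta> :: real and \<nu> :: "real measure" and c :: certificate and \<phi> :: real
  assumes n2: "2 \<le> n" and \<phi>: "0 < \<phi>" and cert: "is_certificate n \<phi> \<beta> c" and density: "law_with_density_le \<phi> \<nu>"
begin

lemma \<beta>0: "0 < \<beta>" using cert by (simp add: is_certificate_def Let_def)

sublocale couplings n \<beta> \<nu> "Lseq c" "Rseq c"
proof (intro couplings.intro lattice.intro couplings_axioms.intro)
  show "0 < n" using n2 by simp
  show "0 \<le> \<beta>" using \<beta>0 by simp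
  show "prob_space \<nu>" "sets \<nu> = sets borel" using density by (auto simp: law_with_density_le_def)
qed

lemma conc_mono: "conc N r \<Longrightarrow> r \<le> r' \<Longrightarrow> conc N r'"
  unfolding conc_def by (meson ennreal_leI mult_right_mono order_trans zero_le)

lemma bad_mono: "bad N w \<Longrightarrow> w \<le> w' \<Longrightarrow> bad N w'"
  unfolding bad_def by (meson ennreal_leI order_trans)

text \<open>If the density bound were not positive, the good event would be null, contradicting \<open>w < 1\<close>.\<close>
lemma conc_pos:
  assumes "conc N r" "bad N w" "w < 1"
  shows "0 < r"
proof (rule ccontr)
  assume "\<not> 0 < r"
  then have r: "ennreal r = 0" by (simp add: ennreal_neg)
  interpret M: marked_law "law N" by (rule law_marked)
  interpret prob_space "law N" by (rule M.prob)
  have good: "emeasure (law N) {z. snd z} = 0" using assms(1) r unfolding conc_def by (auto dest!: bspec[of _ _ UNIV])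
  have g: "{z. snd z} \<in> sets (law N)"
  proof -
    have "{z \<in> space (law N). snd z} \<in> sets (law N)" by measurable
    then show ?thesis by simp
  qed
  have "1 = emeasure (law N) ({z. snd z} \<union> {z. \<not> snd z})"
  proof -
    have "{z. snd z} \<union> {z. \<not> snd z} = space (law N)" by auto
    then show ?thesis using emeasure_space_1 by simp
  qed
  also have "... \<le> emeasure (law N) {z. snd z} + emeasure (law N) {z. \<not> snd z}" by (rule emeasure_subadditive[OF g M.bad_set])
  also have "... \<le> ennreal w" using good assms(2) by (simp add: bad_def)
  finally have "1 \<le> w" by (simp add: ennreal_1[symmetric] del: ennreal_1) (metis assms(3) ennreal_le_iff2 ennreal_1 less_le_not_le not_one_le_zero)
  with assms(3) show False by simp
qed

lemma recursion_le:
  assumes c: "conc N r" "bad N w" "0 \<le> w" "w < 1" and LR: "0 < Lseq c N" "0 < Rseq c N"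
    and V: "2 * w + (2 * r * Rseq c N)\<^sup>2 + 4 * r * Lseq c N \<le> V" "V \<le> varpi r' w' (Lseq c N) (Rseq c N)"
  shows "conc (Suc N) (r * Gam n r' w' (Lseq c N) (Rseq c N))" "bad (Suc N) (V ^ n)"
proof -
  have r: "0 < r" by (rule conc_pos[OF c(1,2,4)])
  let ?v = "2 * w + (2 * r * Rseq c N)\<^sup>2 + 4 * r * Lseq c N"
  have v: "0 \<le> ?v" using c r LR by simp
  show "conc (Suc N) (r * Gam n r' w' (Lseq c N) (Rseq c N))"
    using V v r LR by (intro conc_mono[OF recursion(1)[OF r c(1) c(3,2) LR]] mult_left_mono Gam_ge) auto
  show "bad (Suc N) (V ^ n)" using v V by (intro bad_mono[OF recursion(2)[OF r c(1) c(3,2) LR]] power_mono) auto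
qed

lemma base: "conc 0 (cr c 0)" "bad 0 0"
proof -
  obtain f where f [measurable]: "f \<in> borel_measurable borel" and \<nu>: "\<nu> = density lborel f" and f\<phi>: "\<And>x. f x \<le> ennreal \<phi>"
    using density by (auto simp: law_with_density_le_def)
  let ?e = "{PoleA, PoleB}"
  have J: "distr (Q 0) \<nu> (\<lambda>J. J ?e) = \<nu>"
    unfolding coupling_law_def by (rule distr_PiM_component[where M = "\<lambda>_. \<nu>", OF prob_\<nu>]) simp
  have Jm: "(\<lambda>J. J ?e) \<in> Q 0 \<rightarrow>\<^sub>M \<nu>" unfolding coupling_law_def by (rule measurable_component_singleton) simp
  have "emeasure (law 0) (good_in A) \<le> ennreal (cr c 0) * len A" if A [measurable]: "A \<in> sets borel" for A
  proof -
    let ?B = "(\<lambda>x. \<beta> * x) -` A"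
    have B [measurable]: "?B \<in> sets borel" using measurable_sets[of "\<lambda>x. \<beta> * x" borel borel A] by simp
    have S: "(good_in A) \<in> sets marked_space"
    proof -
      have "{z \<in> space marked_space. snd z \<and> fst z \<in> A} \<in> sets marked_space" by measurable
      then show ?thesis by (simp add: space_pair_measure)
    qed
    have "emeasure (law 0) (good_in A) = emeasure (Q 0) (mark 0 -` (good_in A) \<inter> space (Q 0))"
      unfolding law_def by (rule emeasure_distr[OF mark_measurable S])
    also have "mark 0 -` (good_in A) \<inter> space (Q 0) = (\<lambda>J. J ?e) -` ?B \<inter> space (Q 0)" by (auto simp: mark_def)
    also have "emeasure (Q 0) ... = emeasure \<nu> ?B" using emeasure_distr[OF Jm, of ?B] B sets_\<nu> J by simp
    also have "... = (LI x. f x * ind ?B x)" unfolding \<nu> by (rule emeasure_density) auto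
    also have "... \<le> (LI x. ennreal \<phi> * ind ?B x)" by (intro nn_integral_mono mult_right_mono f\<phi>) simp
    also have "... = ennreal \<phi> * len ?B" by (simp add: nn_integral_cmult_indicator)
    also have "len ?B = ennreal (1 / \<beta>) * len A"
    proof -
      have "len A = emeasure (density (distr lborel borel (\<lambda>x. 0 + \<beta> *\<^sub>R x)) (\<lambda>_. ennreal \<bar>\<beta>\<bar> ^ DIM(real))) A"
        using lborel_real_affine[of \<beta> 0] \<beta>0 by simp
      also have "... = ennreal \<beta> * len ?B" using \<beta>0 by (simp add: emeasure_density_const emeasure_distr)
      finally show ?thesis using \<beta>0 by (simp add: mult.assoc[symmetric] ennreal_mult[symmetric])
    qed
    also have "ennreal \<phi> * (ennreal (1 / \<beta>) * len A) = ennreal (\<phi> / \<beta>) * len A"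
      using \<phi> \<beta>0 by (simp add: mult.assoc[symmetric] ennreal_mult[symmetric])
    also have "... \<le> ennreal (cr c 0) * len A" using cert by (intro mult_right_mono ennreal_leI) (auto simp: is_certificate_def Let_def)
    finally show ?thesis .
  qed
  then show "conc 0 (cr c 0)" by (simp add: conc_def)
  have S: "{z::marked. \<not> snd z} \<in> sets marked_space"
  proof -
    interpret M: marked_law "law 0" by (rule law_marked)
    show ?thesis using M.bad_set M.sets_M by simp
  qed
  have "emeasure (law 0) {z. \<not> snd z} = emeasure (Q 0) (mark 0 -` {z. \<not> snd z} \<inter> space (Q 0))"
    unfolding law_def by (rule emeasure_distr[OF mark_measurable S])
  also have "mark 0 -` {z. \<not> snd z} \<inter> space (Q 0) = {}" by (auto simp: mark_def)
  finally show "bad 0 0" by (simp add: bad_def)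
qed

lemma head_bounds: "k \<le> depth c \<Longrightarrow> conc k (cr c k) \<and> bad k (cw c k) \<and> 0 \<le> cw c k \<and> cw c k < 1"
proof (induction k)
  case 0
  have "cw c 0 = 0" using cert by (simp add: is_certificate_def Let_def)
  then show ?case using base by simp
next
  case (Suc k)
  then have k: "k < depth c" by simp
  have IH: "conc k (cr c k)" "bad k (cw c k)" "0 \<le> cw c k" "cw c k < 1" using Suc by auto
  have LR: "0 < Lseq c k" "0 < Rseq c k" using cert k by (auto simp: is_certificate_def Let_def Lseq_def Rseq_def)
  have r: "0 < cr c k" by (rule conc_pos[OF IH(1,2,4)])
  note v = varpi_ge[OF less_imp_le[OF r] IH(3,4) LR]
  have step: "cr c k * Gam n (cr c k) (cw c k) (Lseq c k) (Rseq c k) \<le> cr c (Suc k)"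
    "varpi (cr c k) (cw c k) (Lseq c k) (Rseq c k) ^ n \<le> cw c (Suc k)" using cert k by (auto simp: is_certificate_def Let_def Lseq_def Rseq_def)
  have "0 \<le> varpi (cr c k) (cw c k) (Lseq c k) (Rseq c k) ^ n" using v by simp
  moreover have "cw c (Suc k) < 1" using cert Suc.prems by (auto simp: is_certificate_def Let_def)
  ultimately show ?case
    using conc_mono[OF recursion_le(1)[OF IH LR v(2) order_refl] step(1)]
      bad_mono[OF recursion_le(2)[OF IH LR v(2) order_refl] step(2)] step(2) by simp
qed

lemma tail_bounds:
  defines "r \<equiv> cr c (depth c)" and "\<gamma> \<equiv> tail\<gamma> c" and "A \<equiv> tailA c"
  shows "conc (j + depth c) (r * \<gamma> ^ j) \<and> bad (j + depth c) (A * r\<^sup>2 * (\<gamma> ^ j)\<^sup>2)"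
proof -
  let ?K = "depth c" and ?L = "tailL c" and ?R = "tailR c"
  have r: "0 < r" unfolding r_def using conc_pos head_bounds[of ?K] by blast
  have T: "0 < A" "0 < \<gamma>" "\<gamma> < 1" "0 < ?L" "0 < ?R" "cw c ?K \<le> A * r\<^sup>2" "A * r\<^sup>2 < 1"
    "Gam n r (A * r\<^sup>2) ?L ?R \<le> \<gamma>" "varpi r (A * r\<^sup>2) ?L ?R ^ n \<le> A * \<gamma>\<^sup>2 * r\<^sup>2"
    using cert by (auto simp: is_certificate_def Let_def r_def \<gamma>_def A_def)
  show ?thesis
  proof (induction j)
    case 0
    then show ?case using head_bounds[of ?K] bad_mono[OF _ T(6)] by (simp add: r_def)
  next
    case (Suc j)
    define s where "s = \<gamma> ^ j"
    have s: "0 \<le> s" "s \<le> 1" using T(2,3) by (auto simp: s_def power_le_one)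
    have s2: "s\<^sup>2 \<le> 1" using s by (simp add: power_le_one)
    let ?N = "j + ?K" and ?w = "A * r\<^sup>2 * s\<^sup>2" and ?V = "s * varpi r (A * r\<^sup>2) ?L ?R"
    have LR: "0 < Lseq c ?N" "0 < Rseq c ?N" and [simp]: "Lseq c ?N = ?L" "Rseq c ?N = ?R" using T by (auto simp: Lseq_def Rseq_def)
    have w0: "0 \<le> ?w" using T(1) by simp
    have "?w \<le> A * r\<^sup>2 * 1" using T(1) s2 by (intro mult_left_mono) auto
    then have w1: "?w < 1" using T(7) by simp
    have cb: "conc ?N (r * s)" "bad ?N ?w" using Suc by (auto simp: s_def)
    have rs: "0 \<le> r * s" using r s by simp
    have v0: "0 \<le> varpi r (A * r\<^sup>2) ?L ?R"
    proof -
      have "0 \<le> A * r\<^sup>2" using T(1) by simp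
      from varpi_ge[OF less_imp_le[OF r] this T(7,4,5)] show ?thesis by linarith
    qed
    have V: "2 * ?w + (2 * (r * s) * Rseq c ?N)\<^sup>2 + 4 * (r * s) * Lseq c ?N \<le> ?V"
      using order_trans[OF varpi_ge(2)[OF rs w0 w1 T(4,5)] varpi_scale[OF s less_imp_le[OF r] less_imp_le[OF T(1)] T(7,4,5)]] by simp
    have V': "?V \<le> varpi r (A * r\<^sup>2) (Lseq c ?N) (Rseq c ?N)" using s v0 by (simp add: mult_left_le_one_le)
    have "conc (Suc ?N) (r * s * Gam n r (A * r\<^sup>2) ?L ?R)" using recursion_le(1)[OF cb w0 w1 LR V V'] by simp
    then have 1: "conc (Suc ?N) (r * s * \<gamma>)" by (rule conc_mono) (intro mult_left_mono T(8) rs)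
    have "?V ^ n \<le> A * r\<^sup>2 * (s * \<gamma>)\<^sup>2"
    proof -
      have "s ^ n \<le> s\<^sup>2" using s n2 by (rule power_decreasing[rotated])
      then have "?V ^ n \<le> s\<^sup>2 * varpi r (A * r\<^sup>2) ?L ?R ^ n" unfolding power_mult_distrib using v0 by (intro mult_right_mono) auto
      also have "... \<le> s\<^sup>2 * (A * \<gamma>\<^sup>2 * r\<^sup>2)" by (intro mult_left_mono T(9)) simp
      finally show ?thesis by (simp add: power_mult_distrib mult_ac)
    qed
    then have 2: "bad (Suc ?N) (A * r\<^sup>2 * (s * \<gamma>)\<^sup>2)" by (rule bad_mono[OF recursion_le(2)[OF cb w0 w1 LR V V']])
    show ?case using 1 2 by (simp add: s_def mult.assoc mult.commute[of "\<gamma> ^ j"])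
  qed
qed

text \<open>At \<open>depth c\<close> the value of \<open>w\<close> is replaced by the larger one from the tail, which only weakens the
  bound.\<close>
theorem sequence_bounds:
  "conc N (rseq c N)" "bad N (wseq c N)" "0 < rseq c N" "0 \<le> wseq c N" "wseq c N < 1"
proof -
  have "conc N (rseq c N) \<and> bad N (wseq c N) \<and> 0 \<le> wseq c N \<and> wseq c N < 1"
  proof (cases "N < depth c")
    case True
    then show ?thesis using head_bounds[of N] by (simp add: rseq_def wseq_def)
  next
    case False
    then obtain j where N: "N = j + depth c" using le_Suc_ex[of "depth c" N] by (auto simp: add.commute)
    let ?w = "tailA c * (cr c (depth c))\<^sup>2"
    have T: "0 < tailA c" "0 < tail\<gamma> c" "tail\<gamma> c < 1" "?w < 1" using cert by (auto simp: is_certificate_def Let_def)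
    have "(tail\<gamma> c ^ j)\<^sup>2 \<le> 1" using T by (simp add: power_le_one)
    then have "?w * (tail\<gamma> c ^ j)\<^sup>2 \<le> ?w * 1" using T(1) by (intro mult_left_mono) auto
    then have "?w * (tail\<gamma> c ^ j)\<^sup>2 < 1" using T(4) by linarith
    then show ?thesis unfolding N rseq_tail wseq_tail using tail_bounds[of j] T(1) by simp
  qed
  then show s: "conc N (rseq c N)" "bad N (wseq c N)" "0 \<le> wseq c N" "wseq c N < 1" by auto
  show "0 < rseq c N" by (rule conc_pos[OF s(1,2,4)])
qed

lemma law_conc: "A \<in> sets borel \<Longrightarrow> emeasure (law N) (good_in A) \<le> ennreal (rseq c N) * len A"
  using sequence_bounds(1)[of N] by (simp add: conc_def)

lemma law_bad: "emeasure (law N) {z. \<not> snd z} \<le> ennreal (wseq c N)"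
  using sequence_bounds(2)[of N] by (simp add: bad_def)

theorem expected_sech2: "(\<integral>\<^sup>+J. ennreal (sech2 (X N J)) \<partial>Q N) \<le> ennreal (wseq c N + 2 * rseq c N)"
proof -
  interpret M: marked_law "law N" by (rule law_marked)
  have "(\<integral>\<^sup>+z. ennreal (sech2 (fst z)) \<partial>law N) \<le> ennreal (1 * wseq c N + rseq c N * 2)"
    by (rule M.single_bound[OF law_conc less_imp_le[OF sequence_bounds(3)] law_bad sequence_bounds(4) _ order_refl sech2_bounds(2)])
      (auto simp: sech2_integral)
  then show ?thesis by (subst nn_integral_eff) (auto simp: mult.commute)
qed

lemma tanh_defect_bounds: "0 \<le> 1 - tanh \<bar>x\<bar>" "1 - tanh \<bar>x\<bar> \<le> (1::real)"
  using tanh_real_lt_1[of "\<bar>x\<bar>"] by simp_all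

lemma tanh_defect_measurable [measurable]: "(\<lambda>x::real. 1 - tanh \<bar>x\<bar>) \<in> borel_measurable borel"
proof (intro borel_measurable_continuous_onI continuous_intros)
  show "cosh \<bar>x\<bar> \<noteq> 0" for x :: real using cosh_real_pos[of "\<bar>x\<bar>"] by linarith
qed

theorem expected_tanh_defect:
  "(\<integral>\<^sup>+J. ennreal (1 - tanh \<bar>X N J\<bar>) \<partial>Q N) \<le> ennreal (wseq c N + 2 * ln 2 * rseq c N)"
proof -
  interpret M: marked_law "law N" by (rule law_marked)
  have "(\<integral>\<^sup>+z. ennreal (1 - tanh \<bar>fst z\<bar>) \<partial>law N) \<le> ennreal (1 * wseq c N + rseq c N * (2 * ln 2))"
    by (rule M.single_bound[OF law_conc less_imp_le[OF sequence_bounds(3)] law_bad sequence_bounds(4) tanh_defect_measurable order_refl tanh_defect_bounds(2)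
          _ tanh_defect_measurable tanh_defect_integral]) auto
  moreover have "(\<integral>\<^sup>+J. ennreal (1 - tanh \<bar>X N J\<bar>) \<partial>Q N) = (\<integral>\<^sup>+z. ennreal (1 - tanh \<bar>fst z\<bar>) \<partial>law N)"
    by (rule nn_integral_eff) (rule measurable_compose[OF tanh_defect_measurable measurable_ennreal])
  ultimately show ?thesis by (simp only: mult_1 mult.commute)
qed

theorem expected_site_loss:
  assumes "x \<in> verts n m - {PoleA, PoleB}" "m \<le> N"
  shows "(\<integral>\<^sup>+J. ennreal (loss site_loss n \<beta> N J x) \<partial>Q N) \<le> ennreal (\<Sum>k\<in>{N - m..<N}. 1/2 * wseq c k + 2 * rseq c k)"
proof (rule loss_expectation[OF _ site_loss_bounds(1) _ _ assms])
  show "(\<lambda>(x, y). site_loss x y) \<in> borel_measurable (borel \<Otimes>\<^sub>M borel)" by measurable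
  fix k
  interpret M: marked_law "law k" by (rule law_marked)
  show "0 \<le> 1/2 * wseq c k + 2 * rseq c k" using sequence_bounds(3,4)[of k] by simp
  show "(\<integral>\<^sup>+p. ennreal (site_loss (fst (fst p)) (fst (snd p))) \<partial>(law k \<Otimes>\<^sub>M law k)) \<le> ennreal (1/2 * wseq c k + 2 * rseq c k)"
    using M.pair_site_bound[OF law_conc less_imp_le[OF sequence_bounds(3)] law_bad sequence_bounds(4)] by simp
qed

theorem expected_blue_loss:
  assumes "x \<in> verts n m - {PoleA, PoleB}" "m \<le> N"
  shows "(\<integral>\<^sup>+J. ennreal (loss blue_loss n \<beta> N J x) \<partial>Q N) \<le> ennreal (\<Sum>k\<in>{N - m..<N}. abar (rseq c k) (wseq c k))"
proof (rule loss_expectation[OF _ blue_loss_bounds(1) _ _ assms])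
  show "(\<lambda>(x, y). blue_loss x y) \<in> borel_measurable (borel \<Otimes>\<^sub>M borel)" by measurable
  fix k
  interpret M: marked_law "law k" by (rule law_marked)
  note s = sequence_bounds(3,4,5)[of k]
  show "0 \<le> abar (rseq c k) (wseq c k)" unfolding abar_def using s by (intro add_nonneg_nonneg mult_nonneg_nonneg) auto
  have "(\<integral>\<^sup>+p. ennreal (blue_loss (fst (fst p)) (fst (snd p))) \<partial>(law k \<Otimes>\<^sub>M law k))
      \<le> ennreal (2 * rseq c k + wseq c k * (wseq c k + 2 * rseq c k))" by (rule M.pair_blue_bound[OF law_conc less_imp_le[OF s(1)] law_bad s(2)])
  also have "... \<le> ennreal (abar (rseq c k) (wseq c k))" using s by (intro ennreal_leI blue_bound_le_abar) auto
  finally show "(\<integral>\<^sup>+p. ennreal (blue_loss (fst (fst p)) (fst (snd p))) \<partial>(law k \<Otimes>\<^sub>M law k)) \<le> ennreal (abar (rseq c k) (wseq c k))" .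
qed

end

context lattice begin

section \<open>Gibbs measures as weighted sums\<close>

lemma gibbs_weight_prod: "gw N J \<sigma> = (\<Prod>e\<in>edges n N. exp (\<beta> * (J e * bond \<sigma> e)))"
  by (simp add: gibbs_weight_def sum_distrib_left exp_sum finite_edges)

lemma gibbs_weight_pos: "0 < gw N J \<sigma>"
  by (simp add: gibbs_weight_def)

lemma blue_prob_bounds: "0 \<le> blue_prob \<beta> J \<sigma> \<tau> e" "blue_prob \<beta> J \<sigma> \<tau> e \<le> 1"
  using \<beta> by (auto simp: blue_prob_def)

abbreviation label_pmf :: "nat \<Rightarrow> (edge \<Rightarrow> real) \<Rightarrow> config \<Rightarrow> config \<Rightarrow> (edge \<Rightarrow> bool) pmf" where
  "label_pmf N J \<sigma> \<tau> \<equiv> Pi_pmf (edges n N) False (\<lambda>e. bernoulli_pmf (blue_prob \<beta> J \<sigma> \<tau> e))"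

lemma pmf_label_weight:
  assumes "b \<in> labels n N"
  shows "W N J (\<sigma>, \<tau>, b) = gw N J \<sigma> * gw N J \<tau> * pmf (label_pmf N J \<sigma> \<tau>) b"
proof -
  have "pmf (label_pmf N J \<sigma> \<tau>) b = (\<Prod>e\<in>edges n N. pmf (bernoulli_pmf (blue_prob \<beta> J \<sigma> \<tau> e)) (b e))"
    using assms by (subst pmf_Pi[OF finite_edges]) (auto simp: labels_def)
  also have "... = (\<Prod>e\<in>edges n N. if b e then blue_prob \<beta> J \<sigma> \<tau> e else 1 - blue_prob \<beta> J \<sigma> \<tau> e)"
    using blue_prob_bounds by (intro prod.cong) auto
  finally show ?thesis
    unfolding gibbs_weight_prod weight_def by (simp only: prod.distrib[symmetric])
      (intro prod.cong refl, simp add: edge_weight_def blue_prob_def Let_def)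
qed

lemma set_label_pmf: "set_pmf (label_pmf N J \<sigma> \<tau>) \<subseteq> labels n N"
  using set_Pi_pmf_subset[OF finite_edges] by (fastforce simp: labels_def)

lemma sum_labels: "(\<Sum>b\<in>labels n N. W N J (\<sigma>, \<tau>, b)) = gw N J \<sigma> * gw N J \<tau>"
proof -
  have "(\<Sum>b\<in>labels n N. W N J (\<sigma>, \<tau>, b))
      = gw N J \<sigma> * gw N J \<tau> * (\<Sum>b\<in>labels n N. pmf (label_pmf N J \<sigma> \<tau>) b)"
    by (simp add: pmf_label_weight sum_distrib_left)
  then show ?thesis using sum_pmf_eq_1[OF finite_labels set_label_pmf] by simp
qed

definition gsum :: "nat \<Rightarrow> (edge \<Rightarrow> real) \<Rightarrow> config set \<Rightarrow> (config \<Rightarrow> real) \<Rightarrow> real" where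
  "gsum N J D f = (\<Sum>\<sigma>\<in>D. gw N J \<sigma> * f \<sigma>)"

lemma sum_replicas:
  "(\<Sum>w\<in>D \<times> D \<times> labels n N. W N J w * (f (fst w) * f (fst (snd w)))) = (gsum N J D f)\<^sup>2"
proof -
  have "(\<Sum>w\<in>D \<times> D \<times> labels n N. W N J w * (f (fst w) * f (fst (snd w))))
      = (\<Sum>\<sigma>\<in>D. \<Sum>\<tau>\<in>D. \<Sum>b\<in>labels n N. W N J (\<sigma>, \<tau>, b) * (f \<sigma> * f \<tau>))"
    by (simp add: sum.cartesian_product case_prod_beta)
  also have "... = (\<Sum>\<sigma>\<in>D. \<Sum>\<tau>\<in>D. (gw N J \<sigma> * f \<sigma>) * (gw N J \<tau> * f \<tau>))"
  proof (intro sum.cong refl)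
    fix \<sigma> \<tau>
    have "(\<Sum>b\<in>labels n N. W N J (\<sigma>, \<tau>, b) * (f \<sigma> * f \<tau>))
        = gw N J \<sigma> * gw N J \<tau> * (f \<sigma> * f \<tau>)" unfolding sum_distrib_right[symmetric] sum_labels ..
    then show "(\<Sum>b\<in>labels n N. W N J (\<sigma>, \<tau>, b) * (f \<sigma> * f \<tau>))
        = gw N J \<sigma> * f \<sigma> * (gw N J \<tau> * f \<tau>)" by (simp only: mult_ac)
  qed
  finally show ?thesis by (simp add: gsum_def power2_eq_square sum_product)
qed

abbreviation Z :: "nat \<Rightarrow> (edge \<Rightarrow> real) \<Rightarrow> real" where "Z N J \<equiv> gsum N J (configs n N) (\<lambda>_. 1)"

lemma gsum_one_pos: "D \<subseteq> configs n N \<Longrightarrow> D \<noteq> {} \<Longrightarrow> 0 < gsum N J D (\<lambda>_. 1)"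
  unfolding gsum_def using finite_subset[OF _ finite_configs] gibbs_weight_pos by (intro sum_pos) auto

lemma configs_ne: "configs n N \<noteq> {}"
  by (auto simp: configs_def PiE_eq_empty_iff)

lemma pmf_gibbs': "\<sigma> \<in> configs n N \<Longrightarrow> pmf (gibbs n N \<beta> J) \<sigma> = gw N J \<sigma> / Z N J"
  by (simp add: pmf_gibbs gsum_def)

lemma set_gibbs: "set_pmf (gibbs n N \<beta> J) \<subseteq> configs n N"
  by (auto simp: set_pmf_iff pmf_gibbs split: if_splits)

lemma gibbs_mean: "measure_pmf.expectation (gibbs n N \<beta> J) f = gsum N J (configs n N) f / Z N J"
proof -
  have "measure_pmf.expectation (gibbs n N \<beta> J) f = (\<Sum>\<sigma>\<in>configs n N. f \<sigma> * pmf (gibbs n N \<beta> J) \<sigma>)"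
    using set_gibbs by (intro integral_measure_pmf_real finite_configs) auto
  also have "... = (\<Sum>\<sigma>\<in>configs n N. gw N J \<sigma> * f \<sigma> / Z N J)" by (intro sum.cong refl) (simp add: pmf_gibbs')
  finally show ?thesis by (simp add: gsum_def sum_divide_distrib)
qed

definition pinned :: "nat \<Rightarrow> real \<Rightarrow> real \<Rightarrow> config set" where
  "pinned N a b = {\<sigma> \<in> configs n N. \<sigma> PoleA = a \<and> \<sigma> PoleB = b}"

lemma pinned_ne:
  assumes "a \<in> pm" "b \<in> pm" shows "pinned N a b \<noteq> {}"
proof -
  let ?\<sigma> = "\<lambda>x\<in>verts n N. if x = PoleA then a else if x = PoleB then b else 1"
  have "?\<sigma> \<in> pinned N a b" using assms poles_in_verts[OF n, of N] by (auto simp: pinned_def configs_def)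
  then show ?thesis by blast
qed

lemma fixed_mean:
  assumes "a \<in> pm" "b \<in> pm"
  shows "measure_pmf.expectation (gibbs_fixed n N \<beta> a b J) f = gsum N J (pinned N a b) f / gsum N J (pinned N a b) (\<lambda>_. 1)"
proof -
  let ?S = "{\<sigma>. \<sigma> PoleA = a \<and> \<sigma> PoleB = b}" and ?D = "pinned N a b"
  have D: "?D \<subseteq> configs n N" "finite ?D" using finite_configs by (auto simp: pinned_def)
  have Z: "0 < Z N J" by (rule gsum_one_pos[OF order_refl configs_ne])
  have pos: "0 < pmf (gibbs n N \<beta> J) \<sigma>" if "\<sigma> \<in> configs n N" for \<sigma>
    using that Z gibbs_weight_pos by (simp add: pmf_gibbs')
  obtain \<sigma>0 where "\<sigma>0 \<in> ?D" using pinned_ne[OF assms] by blast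
  have ne: "set_pmf (gibbs n N \<beta> J) \<inter> ?S \<noteq> {}"   proof -
    have "\<sigma>0 \<in> configs n N" "\<sigma>0 \<in> ?S" using \<open>\<sigma>0 \<in> ?D\<close> by (auto simp: pinned_def)
    then have "\<sigma>0 \<in> set_pmf (gibbs n N \<beta> J) \<inter> ?S" using pos[of \<sigma>0] by (simp add: set_pmf_iff)
    then show ?thesis by blast
  qed
  have "measure_pmf.prob (gibbs n N \<beta> J) ?S = measure_pmf.prob (gibbs n N \<beta> J) ?D"
    by (intro measure_prob_cong_0) (auto simp: pinned_def pmf_gibbs)
  also have "... = (\<Sum>\<sigma>\<in>?D. pmf (gibbs n N \<beta> J) \<sigma>)" by (rule measure_measure_pmf_finite[OF D(2)])
  also have "... = gsum N J ?D (\<lambda>_. 1) / Z N J"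
    using D unfolding gsum_def[of N J ?D] sum_divide_distrib by (intro sum.cong refl) (auto simp: pmf_gibbs')
  finally have m: "measure_pmf.prob (gibbs n N \<beta> J) ?S = gsum N J ?D (\<lambda>_. 1) / Z N J" .
  have "measure_pmf.expectation (gibbs_fixed n N \<beta> a b J) f = (\<Sum>\<sigma>\<in>?D. f \<sigma> * pmf (gibbs_fixed n N \<beta> a b J) \<sigma>)"
    unfolding gibbs_fixed_def using set_gibbs[of N J]
    by (intro integral_measure_pmf_real D) (auto simp: set_cond_pmf[OF ne] pinned_def)
  also have "... = (\<Sum>\<sigma>\<in>?D. gw N J \<sigma> * f \<sigma> / gsum N J ?D (\<lambda>_. 1))" unfolding gibbs_fixed_def using D Z
    by (intro sum.cong refl) (auto simp: pmf_cond[OF ne] m pmf_gibbs' pinned_def)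
  finally show ?thesis by (simp add: gsum_def[of N J ?D f] sum_divide_distrib)
qed

text \<open>The square of a mean is a mean over two independent replicas; the blue labels sum out.\<close>
theorem fixed_mean_sq:
  assumes "a \<in> pm" "b \<in> pm"
  shows "(measure_pmf.expectation (gibbs_fixed n N \<beta> a b J) (\<lambda>\<sigma>. \<sigma> x))\<^sup>2 = cex N J (a, a) (b, b) (ov x)"
proof -
  have "poled n N (a, a) (b, b) = pinned N a b \<times> pinned N a b \<times> labels n N" by (auto simp: poled_def samples_def pinned_def spin_def)
  then have "psum N J (a, a) (b, b) (ov x) = (gsum N J (pinned N a b) (\<lambda>\<sigma>. \<sigma> x))\<^sup>2"
    "psum N J (a, a) (b, b) (\<lambda>_. 1) = (gsum N J (pinned N a b) (\<lambda>_. 1))\<^sup>2"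
    using sum_replicas[where f = "\<lambda>\<sigma>. \<sigma> x"] sum_replicas[where f = "\<lambda>_. 1"]
    by (simp_all add: psum_def ov_def spin_def)
  then show ?thesis unfolding fixed_mean[OF assms] cex_def by (simp add: power_divide)
qed

theorem free_mean_sq:
  "(measure_pmf.expectation (gibbs n N \<beta> J) (\<lambda>\<sigma>. \<sigma> PoleA * \<sigma> PoleB))\<^sup>2 = ens N J (\<lambda>w. ov PoleA w * ov PoleB w)"
proof -
  have "tot N J (\<lambda>w. ov PoleA w * ov PoleB w) = (gsum N J (configs n N) (\<lambda>\<sigma>. \<sigma> PoleA * \<sigma> PoleB))\<^sup>2"
    unfolding tot_def samples_def sum_replicas[symmetric] by (intro sum.cong refl) (simp add: ov_def spin_def mult_ac)
  moreover have "tot N J (\<lambda>_. 1) = (Z N J)\<^sup>2" using sum_replicas[where f = "\<lambda>_. 1"] by (simp add: tot_def samples_def)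
  ultimately show ?thesis unfolding gibbs_mean ens_def by (simp add: power_divide)
qed

lemma pmf_sample:
  "pmf (sample_pmf n N \<beta> J) (\<sigma>, \<tau>, b) = pmf (label_pmf N J \<sigma> \<tau>) b * (pmf (gibbs n N \<beta> J) \<sigma> * pmf (gibbs n N \<beta> J) \<tau>)"
proof -
  let ?K = "\<lambda>z. pmf (case z of (\<sigma>', \<tau>') \<Rightarrow> map_pmf (\<lambda>b. (\<sigma>', \<tau>', b)) (label_pmf N J \<sigma>' \<tau>')) (\<sigma>, \<tau>, b)"
  have "pmf (sample_pmf n N \<beta> J) (\<sigma>, \<tau>, b)
      = measure_pmf.expectation (pair_pmf (gibbs n N \<beta> J) (gibbs n N \<beta> J)) ?K" unfolding sample_pmf_def by (simp add: pmf_bind)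
  also have "... = (\<Sum>z\<in>{(\<sigma>, \<tau>)}. ?K z * pmf (pair_pmf (gibbs n N \<beta> J) (gibbs n N \<beta> J)) z)"
  proof (rule integral_measure_pmf_real)
    fix z assume "?K z \<noteq> 0"
    then have "(\<sigma>, \<tau>, b) \<in> set_pmf (case z of (\<sigma>', \<tau>') \<Rightarrow> map_pmf (\<lambda>b. (\<sigma>', \<tau>', b)) (label_pmf N J \<sigma>' \<tau>'))"
      by (simp add: set_pmf_iff)
    then show "z \<in> {(\<sigma>, \<tau>)}" by (cases z) auto
  qed simp
  also have "... = ?K (\<sigma>, \<tau>) * (pmf (gibbs n N \<beta> J) \<sigma> * pmf (gibbs n N \<beta> J) \<tau>)" by (simp add: pmf_pair)
  also have "?K (\<sigma>, \<tau>) = pmf (label_pmf N J \<sigma> \<tau>) b"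
    using pmf_map_inj'[of "\<lambda>b. (\<sigma>, \<tau>, b)" "label_pmf N J \<sigma> \<tau>" b] by (simp add: inj_on_def)
  finally show ?thesis .
qed

theorem sample_expectation: "measure_pmf.expectation (sample_pmf n N \<beta> J) F = ens N J F"
proof -
  have out: "pmf (sample_pmf n N \<beta> J) w = 0" if "w \<notin> samples n N" for w
  proof -
    obtain \<sigma> \<tau> b where o: "w = (\<sigma>, \<tau>, b)" by (metis prod_cases3)
    have "pmf (label_pmf N J \<sigma> \<tau>) b = 0" if "b \<notin> labels n N"
      using that set_label_pmf[of N J \<sigma> \<tau>] by (meson set_pmf_iff subsetD)
    then show ?thesis using that unfolding o pmf_sample by (auto simp: samples_def pmf_gibbs)
  qed
  have e: "measure_pmf.expectation (sample_pmf n N \<beta> J) F = tot N J F / (Z N J)\<^sup>2" for F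
  proof -
    have "measure_pmf.expectation (sample_pmf n N \<beta> J) F = (\<Sum>w\<in>samples n N. F w * pmf (sample_pmf n N \<beta> J) w)"
      using out by (intro integral_measure_pmf_real finite_samples) (auto simp: set_pmf_iff)
    also have "... = (\<Sum>w\<in>samples n N. W N J w * F w / (Z N J)\<^sup>2)"
    proof (rule sum.cong[OF refl])
      fix w assume w: "w \<in> samples n N"
      obtain \<sigma> \<tau> b where o: "w = (\<sigma>, \<tau>, b)" by (metis prod_cases3)
      have "\<sigma> \<in> configs n N" "\<tau> \<in> configs n N" "b \<in> labels n N" using w by (auto simp: o samples_def)
      then show "F w * pmf (sample_pmf n N \<beta> J) w = W N J w * F w / (Z N J)\<^sup>2"
        unfolding o pmf_sample pmf_label_weight[OF \<open>b \<in> labels n N\<close>] by (simp add: pmf_gibbs' power2_eq_square)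
    qed
    finally show ?thesis by (simp add: tot_def sum_divide_distrib)
  qed
  have "tot N J (\<lambda>_. 1) / (Z N J)\<^sup>2 = 1" unfolding e[symmetric] by simp
  then have "(Z N J)\<^sup>2 = tot N J (\<lambda>_. 1)" by simp
  then show ?thesis unfolding e ens_def by simp
qed

lemma sample_prob: "measure_pmf.prob (sample_pmf n N \<beta> J) {w. P w} = ens N J (\<lambda>w. of_bool (P w))"
proof -
  have "measure_pmf.prob (sample_pmf n N \<beta> J) {w. P w} = measure_pmf.expectation (sample_pmf n N \<beta> J) (ind {w. P w})" by simp
  also have "... = ens N J (ind {w. P w})" by (rule sample_expectation)
  also have "ind {w. P w} = (\<lambda>w. of_bool (P w) :: real)" by (auto simp: indicator_def of_bool_def)
  finally show ?thesis .
qed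

end

context couplings begin

lemma weight_measurable: "(\<lambda>J. W N J w) \<in> borel_measurable (Q N)"
  unfolding weight_def
proof (rule borel_measurable_prod)
  fix e assume e: "e \<in> edges n N"
  have "(\<lambda>j. edge_weight \<beta> j u v l) \<in> borel_measurable borel" for u v l unfolding edge_weight_def Let_def by measurable
  then show "(\<lambda>J. edge_weight \<beta> (J e) (bond (fst w) e) (bond (fst (snd w)) e) (snd (snd w) e)) \<in> borel_measurable (Q N)"
    by (rule measurable_compose[OF coupling_measurable[OF e]])
qed

lemma ens_measurable: "(\<lambda>J. ens N J F) \<in> borel_measurable (Q N)"
  unfolding ens_def tot_def using weight_measurable
  by (intro borel_measurable_divide borel_measurable_sum borel_measurable_times) auto

lemma cex_measurable: "(\<lambda>J. cex N J p p' F) \<in> borel_measurable (Q N)"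
  unfolding cex_def psum_def using weight_measurable
  by (intro borel_measurable_divide borel_measurable_sum borel_measurable_times) auto

lemma gsum_measurable: "(\<lambda>J. gsum N J D f) \<in> borel_measurable (Q N)"
proof -
  have e: "(\<lambda>J. J e * c) \<in> borel_measurable (Q N)" if "e \<in> edges n N" for e c using coupling_measurable[OF that] by measurable
  have "(\<lambda>J. gw N J \<sigma>) \<in> borel_measurable (Q N)" for \<sigma> unfolding gibbs_weight_def
    by (intro measurable_compose[OF _ borel_measurable_exp] borel_measurable_times borel_measurable_sum e) auto
  then show ?thesis unfolding gsum_def by (intro borel_measurable_sum borel_measurable_times) auto
qed

definition flip :: "nat \<Rightarrow> vertex \<Rightarrow> (edge \<Rightarrow> real) \<Rightarrow> edge \<Rightarrow> real" where
  "flip N x J = (\<lambda>e\<in>edges n N. if x \<in> e then - J e else J e)"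

lemma distr_flip:
  assumes sym: "symmetric_law \<nu>"
  shows "distr (Q N) (Q N) (flip N x) = Q N"
proof -
  interpret prob_space "Q N" by (rule prob_Q)
  let ?f = "\<lambda>e (j::real). if x \<in> e then - j else j"
  have fm: "?f e \<in> \<nu> \<rightarrow>\<^sub>M \<nu>" for e unfolding measurable_cong_sets[OF sets_\<nu> sets_\<nu>] by measurable
  have cm: "(\<lambda>J. J e) \<in> Q N \<rightarrow>\<^sub>M \<nu>" if "e \<in> edges n N" for e
    unfolding coupling_law_def using that by (rule measurable_component_singleton)
  have f\<nu>: "distr \<nu> \<nu> (?f e) = \<nu>" for e
  proof (cases "x \<in> e")
    case True
    then have "distr \<nu> \<nu> (?f e) = distr \<nu> borel uminus" using sets_\<nu> by (intro distr_cong) auto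
    then show ?thesis using sym by (simp add: symmetric_law_def)
  next
    case False
    then show ?thesis by simp
  qed
  have "indep_vars (\<lambda>_. \<nu>) (\<lambda>e J. ?f e (J e)) (edges n N)" by (rule indep_vars_compose2[OF indep_couplings]) (rule fm)
  then have "distr (Q N) (PiM (edges n N) (\<lambda>_. \<nu>)) (\<lambda>J. \<lambda>e\<in>edges n N. ?f e (J e))
      = PiM (edges n N) (\<lambda>e. distr (Q N) \<nu> (\<lambda>J. ?f e (J e)))"
    using indep_vars_iff_distr_eq_PiM'[of "edges n N" "\<lambda>e J. ?f e (J e)" "\<lambda>_. \<nu>", OF edges_ne measurable_compose[OF cm fm]] by blast
  also have "... = PiM (edges n N) (\<lambda>_. \<nu>)"
  proof (rule PiM_cong[OF refl])
    fix e assume e: "e \<in> edges n N"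
    have "distr (Q N) \<nu> (\<lambda>J. ?f e (J e)) = distr (distr (Q N) \<nu> (\<lambda>J. J e)) \<nu> (?f e)"
      by (subst distr_distr[OF fm cm[OF e]]) (simp add: comp_def)
    also have "distr (Q N) \<nu> (\<lambda>J. J e) = \<nu>"
      unfolding coupling_law_def by (rule distr_PiM_component[where M = "\<lambda>_. \<nu>", OF prob_\<nu> e])
    finally show "distr (Q N) \<nu> (\<lambda>J. ?f e (J e)) = \<nu>" using f\<nu> by simp
  qed
  finally show ?thesis unfolding coupling_law_def by (simp only: flip_def[abs_def])
qed

text \<open>Flipping the spin at an inner vertex together with the couplings of its edges is a symmetry of the
  fixed-pole measure, and it changes the sign of the magnetisation there.\<close>
lemma gsum_flip:
  assumes x: "x \<noteq> PoleA" "x \<noteq> PoleB" "x \<in> verts n N"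
  shows "gsum N (flip N x J) (pinned N a b) f = gsum N J (pinned N a b) (\<lambda>\<sigma>. f (\<sigma>(x := - \<sigma> x)))"
proof -
  let ?h = "\<lambda>\<sigma>::config. \<sigma>(x := - \<sigma> x)"
  have h: "?h \<sigma> \<in> pinned N a b" if "\<sigma> \<in> pinned N a b" for \<sigma>
    using that x by (auto simp: pinned_def configs_def PiE_def Pi_def extensional_def)
  have hh: "?h (?h \<sigma>) = \<sigma>" for \<sigma> by auto
  have w: "gw N (flip N x J) (?h \<sigma>) = gw N J \<sigma>" for \<sigma>
  proof -
    have "flip N x J e * bond (?h \<sigma>) e = J e * bond \<sigma> e" if e: "e \<in> edges n N" for e
    proof -
      obtain y z where yz: "y \<noteq> z" "e = {y, z}" using edgesD[OF n e] by blast
      have "bond (?h \<sigma>) e = (if x \<in> e then - bond \<sigma> e else bond \<sigma> e)" using yz by (auto simp: bond_def)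
      then show ?thesis using e by (simp add: flip_def)
    qed
    then show ?thesis by (simp add: gibbs_weight_def)
  qed
  have "gsum N (flip N x J) (pinned N a b) f = (\<Sum>\<sigma>\<in>pinned N a b. gw N (flip N x J) (?h \<sigma>) * f (?h \<sigma>))"
    unfolding gsum_def by (rule sum.reindex_bij_witness[of _ ?h ?h]) (simp_all only: hh h)
  then show ?thesis unfolding w gsum_def .
qed

theorem fixed_mean_symmetric:
  assumes sym: "symmetric_law \<nu>" and ab: "a \<in> pm" "b \<in> pm" and x: "x \<in> verts n N - {PoleA, PoleB}"
  shows "(\<integral>J. measure_pmf.expectation (gibbs_fixed n N \<beta> a b J) (\<lambda>\<sigma>. \<sigma> x) \<partial>Q N) = 0"
proof -
  let ?m = "\<lambda>J. measure_pmf.expectation (gibbs_fixed n N \<beta> a b J) (\<lambda>\<sigma>. \<sigma> x)"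
  have m: "?m \<in> borel_measurable (Q N)" unfolding fixed_mean[OF ab] by (intro borel_measurable_divide gsum_measurable)
  have fl: "?m (flip N x J) = - ?m J" for J
  proof -
    have "gsum N (flip N x J) (pinned N a b) (\<lambda>\<sigma>. \<sigma> x) = - gsum N J (pinned N a b) (\<lambda>\<sigma>. \<sigma> x)"
      using x by (subst gsum_flip) (auto simp: gsum_def sum_negf)
    moreover have "gsum N (flip N x J) (pinned N a b) (\<lambda>_. 1) = gsum N J (pinned N a b) (\<lambda>_. 1)" using x by (subst gsum_flip) auto
    ultimately show ?thesis unfolding fixed_mean[OF ab] by simp
  qed
  have fm: "flip N x \<in> Q N \<rightarrow>\<^sub>M Q N"
  proof -
    have "(\<lambda>J. \<lambda>e\<in>edges n N. if x \<in> e then - J e else J e) \<in> Q N \<rightarrow>\<^sub>M PiM (edges n N) (\<lambda>_. \<nu>)"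
    proof (rule measurable_restrict)
      fix e assume "e \<in> edges n N"
      from coupling_measurable[OF this] have "(\<lambda>J. if x \<in> e then - J e else J e) \<in> borel_measurable (Q N)" by measurable
      then show "(\<lambda>J. if x \<in> e then - J e else J e) \<in> Q N \<rightarrow>\<^sub>M \<nu>" unfolding measurable_cong_sets[OF refl sets_\<nu>] .
    qed
    then show ?thesis by (simp only: flip_def[abs_def] coupling_law_def)
  qed
  have "(\<integral>J. ?m J \<partial>Q N) = (\<integral>J. ?m J \<partial>distr (Q N) (Q N) (flip N x))" by (simp only: distr_flip[OF sym])
  also have "... = (\<integral>J. ?m (flip N x J) \<partial>Q N)" by (rule integral_distr[OF fm m])
  also have "... = - (\<integral>J. ?m J \<partial>Q N)" unfolding fl by simp
  finally show ?thesis by simp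
qed

end

section \<open>Ordering on the lattice\<close>

lemma cluster_disjoint:
  assumes "z \<in> cluster n N b x" "z \<in> cluster n N b y" shows "cluster n N b x = cluster n N b y"
  using assms cluster_eq by metis

lemma inner_count_power:
  assumes n: "0 < n" and "m \<le> N"
  shows "(2 * n) ^ m * inner_count n (N - m) \<le> inner_count n N"
  using assms(2)
proof (induction m arbitrary: N)
  case (Suc m)
  then obtain N' where N': "N = Suc N'" "m \<le> N'" by (cases N) auto
  have "(2 * n) ^ Suc m * inner_count n (N - Suc m) = 2 * n * ((2 * n) ^ m * inner_count n (N' - m))" by (simp add: N')
  also have "... \<le> 2 * n * inner_count n N'" by (intro mult_left_mono Suc.IH N'(2)) simp
  also have "... \<le> inner_count n N" unfolding N'(1) inner_count_rec(2)[OF n] by (simp add: algebra_simps)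
  finally show ?case .
qed simp

text \<open>A cluster that avoids the skeleton \<open>verts n m\<close> cannot leave the interior of one of the sub-lattices of
  generation \<open>N - m\<close>, because every path out of such an interior passes through a skeleton vertex.\<close>
lemma cluster_card_le:
  assumes n: "0 < n" and "m \<le> N" "x \<in> verts n N" "cluster n N b x \<inter> verts n m = {}"
  shows "card (cluster n N b x) \<le> inner_count n (N - m)"
  using assms(2-)
proof (induction m arbitrary: N x b)
  case 0
  then have "cluster n N b x \<subseteq> verts n N - {PoleA, PoleB}" using cluster_subset[OF n] by auto
  then show ?case unfolding inner_count_def using finite_verts by (simp add: card_mono)
next
  case (Suc m)
  then obtain N' where N': "N = Suc N'" "m \<le> N'" by (cases N) auto
  obtain i h y where y: "i < n" "y \<in> verts n N'" "x = emb i h y" using Suc.prems(2) N' by auto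
  let ?C = "cluster n N b x" and ?C' = "cluster n N' (sub_label n N' i h b) y"
  have skel: "PoleA \<in> verts n (Suc m)" "PoleB \<in> verts n (Suc m)" by (rule poles_in_verts[OF n])+
  have mids: "Mid j \<in> verts n (Suc m)" if "j < n" for j
  proof -
    have "Mid j \<in> verts n (Suc m) - {PoleA, PoleB}" unfolding inner_verts_Suc[OF n] using that by blast
    then show ?thesis by blast
  qed
  have sub: "?C \<subseteq> emb i h ` ?C'"
  proof
    fix z assume "z \<in> ?C"
    then have "(x, z) \<in> {(y, z). {y, z} \<in> edges n N \<and> b {y, z}}\<^sup>*" by (simp add: cluster_def)
    then show "z \<in> emb i h ` ?C'"
    proof (induction rule: rtrancl_induct)
      case base
      show ?case using y(3) cluster_refl by blast
    next
      case (step z w)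
      obtain z' where z': "z' \<in> ?C'" "z = emb i h z'" using step.IH by blast
      have zC: "z \<in> ?C" using step.hyps(1) by (simp add: cluster_def)
      have e: "{z, w} \<in> edges n (Suc N')" "b {z, w}" using step.hyps(2) N' by auto
      then obtain i' h' e' where e': "i' < n" "e' \<in> edges n N'" "{z, w} = emb i' h' ` e'" by auto
      have "z \<noteq> PoleA" "z \<noteq> PoleB" "z \<noteq> Mid i" "z \<noteq> Mid i'"        using zC Suc.prems(3) skel mids[OF y(1)] mids[OF e'(1)] by blast+
      moreover obtain z'' where z'': "z'' \<in> e'" "z = emb i' h' z''" using e'(3) by blast
      ultimately have ih: "i' = i" "h' = h" using z'(2) by (cases z'; cases z''; auto split: if_splits)+
      obtain w' where w': "w' \<in> e'" "w = emb i h w'" using e'(3) ih by blast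
      have "emb i h ` {z', w'} = emb i h ` e'" using e'(3) ih z'(2) w'(2) by simp
      then have ee: "{z', w'} = e'" using emb_inj by (simp only: inj_image_eq_iff)
      have "sub_label n N' i h b {z', w'}" using ee e'(2) e(2) e'(3) ih by (simp add: sub_label_def)
      then have "(z', w') \<in> {(y, z). {y, z} \<in> edges n N' \<and> sub_label n N' i h b {y, z}}\<^sup>*" using ee e'(2) by blast
      then have "w' \<in> cluster n N' (sub_label n N' i h b) z'" by (simp add: cluster_def)
      with z'(1) have "w' \<in> ?C'" by (rule cluster_trans)
      then show ?case using w'(2) by blast
    qed
  qed
  have "?C' \<inter> verts n m = {}"
  proof (rule ccontr)
    assume "?C' \<inter> verts n m \<noteq> {}"
    then obtain v where v: "v \<in> ?C'" "v \<in> verts n m" by blast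
    have "emb i h v \<in> ?C" using cluster_emb[OF y(1) v(1)] by (simp add: y(3) N'(1))
    moreover have "emb i h v \<in> verts n (Suc m)" using v(2) y(1) by auto
    ultimately show False using Suc.prems(3) by blast
  qed
  then have "card ?C' \<le> inner_count n (N' - m)" by (intro Suc.IH N'(2) y(2))
  moreover have "finite ?C'" using cluster_subset[OF n y(2)] finite_verts by (rule finite_subset)
  then have "card ?C \<le> card ?C'" using sub card_mono[OF finite_imageI sub] card_image_le order_trans by blast
  ultimately show ?case by (simp add: N'(1))
qed

context couplings begin

abbreviation EE :: "nat \<Rightarrow> (sample \<Rightarrow> real) \<Rightarrow> real" where "EE N F \<equiv> (\<integral>J. ens N J F \<partial>Q N)"

lemma joint_expectation_ens: "joint_expectation n N \<beta> \<nu> F = EE N F"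
  by (simp add: joint_expectation_def sample_expectation)

lemma joint_prob_ens: "joint_prob n N \<beta> \<nu> P = EE N (\<lambda>w. of_bool (P w))"
  by (simp add: joint_prob_def sample_prob)

lemma bounded_integrable:
  assumes "f \<in> borel_measurable (Q N)" "\<And>J. \<bar>f J\<bar> \<le> (B::real)"
  shows "integrable (Q N) f"
proof -
  interpret prob_space "Q N" by (rule prob_Q)
  show ?thesis by (rule integrable_const_bound[of _ B]) (use assms in auto)
qed

lemma ens_integrable: "integrable (Q N) (\<lambda>J. ens N J F)"
proof (rule bounded_integrable[OF ens_measurable])
  fix J
  let ?B = "\<Sum>w\<in>samples n N. \<bar>F w\<bar>"
  have "\<bar>F w\<bar> \<le> ?B" if "w \<in> samples n N" for w using that finite_samples by (intro member_le_sum) auto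
  then have "ens N J F \<le> ens N J (\<lambda>_. ?B)" "ens N J (\<lambda>_. - ?B) \<le> ens N J F" by (intro ens_mono; fastforce simp: abs_le_iff)+
  then show "\<bar>ens N J F\<bar> \<le> ?B" unfolding ens_const by linarith
qed

lemma EE_const: "EE N (\<lambda>_. a) = a"
proof -
  interpret prob_space "Q N" by (rule prob_Q)
  show ?thesis by (simp add: ens_const prob_space)
qed

lemma EE_mono:
  assumes "\<And>J w. w \<in> samples n N \<Longrightarrow> W N J w \<noteq> 0 \<Longrightarrow> F w \<le> G w"
  shows "EE N F \<le> EE N G"
  by (intro integral_mono ens_integrable ens_mono assms)

lemma EE_add: "EE N (\<lambda>w. F w + G w) = EE N F + EE N G"
  unfolding ens_add by (intro Bochner_Integration.integral_add ens_integrable)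

lemma EE_cmult: "EE N (\<lambda>w. a * F w) = a * EE N F"
  unfolding ens_cmult by simp

lemma EE_sum: "EE N (\<lambda>w. \<Sum>x\<in>V. F x w) = (\<Sum>x\<in>V. EE N (F x))"
  unfolding ens_sum by (intro Bochner_Integration.integral_sum ens_integrable)

lemma EE_affine: "EE N (\<lambda>w. a + s * F w) = a + s * EE N F"
  by (simp only: EE_add EE_cmult EE_const)

lemma nn_expectation_le:
  assumes f: "f \<in> borel_measurable (Q N)" and "\<And>J. 0 \<le> f J" and le: "(\<integral>\<^sup>+J. ennreal (f J) \<partial>Q N) \<le> ennreal a" and a: "0 \<le> a"
  shows "integrable (Q N) f" "(\<integral>J. f J \<partial>Q N) \<le> a"
proof -
  show i: "integrable (Q N) f" using assms le_less_trans[OF le ennreal_less_top] by (intro integrableI_nonneg) auto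
  have "ennreal (\<integral>J. f J \<partial>Q N) = (\<integral>\<^sup>+J. ennreal (f J) \<partial>Q N)"
    using assms by (intro nn_integral_eq_integral[symmetric] i) auto
  then have "ennreal (\<integral>J. f J \<partial>Q N) \<le> ennreal a" using le by (simp only:)
  then show "(\<integral>J. f J \<partial>Q N) \<le> a" unfolding ennreal_le_iff[OF a] .
qed

lemma EE_le:
  assumes "\<And>J. ens N J F \<le> f J" "f \<in> borel_measurable (Q N)" "\<And>J. 0 \<le> f J"
    "(\<integral>\<^sup>+J. ennreal (f J) \<partial>Q N) \<le> ennreal a" "0 \<le> a"
  shows "EE N F \<le> a"
proof -
  have "EE N F \<le> (\<integral>J. f J \<partial>Q N)" by (intro integral_mono ens_integrable nn_expectation_le(1)[OF assms(2-5)] assms(1))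
  also have "... \<le> a" by (rule nn_expectation_le(2)[OF assms(2-5)])
  finally show ?thesis .
qed

lemma ov_pm: "w \<in> samples n N \<Longrightarrow> x \<in> verts n N \<Longrightarrow> ov x w \<in> pm"
  using spin_in[OF n, of w N x] by (auto simp: ov_def)

text \<open>The event that the poles are connected but \<open>x\<close> is not in their cluster. It forces equal overlaps at
  the poles, so the chain bounds apply to it.\<close>
definition miss :: "nat \<Rightarrow> vertex \<Rightarrow> sample \<Rightarrow> real" where
  "miss N x w = of_bool (PoleB \<in> cluster n N (snd (snd w)) PoleA \<and> x \<notin> cluster n N (snd (snd w)) PoleA)"

lemma miss_poles: "miss N PoleA w = 0" "miss N PoleB w = 0"
  by (auto simp: miss_def cluster_refl)

lemma miss_le:
  assumes "w \<in> samples n N" "W N J w \<noteq> 0"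
  shows "miss N x w \<le> of_bool (ov PoleA w = ov PoleB w \<and> blue_bad n N x w)"
proof (cases "PoleB \<in> cluster n N (snd (snd w)) PoleA")
  case True
  then have "ov PoleB w = ov PoleA w" "cluster n N (snd (snd w)) PoleB = cluster n N (snd (snd w)) PoleA"
    using blue_ok[OF assms(2,1)] cluster_eq by blast+
  then show ?thesis by (auto simp: miss_def blue_bad_def)
qed (simp add: miss_def)

lemma count_missing:
  assumes "PoleB \<in> cluster n N (snd (snd w)) PoleA"
  shows "(\<Sum>x\<in>verts n N. miss N x w) = real (card (verts n N)) - real (card (cluster n N (snd (snd w)) PoleA))"
proof -
  let ?C = "cluster n N (snd (snd w)) PoleA"
  have C: "?C \<subseteq> verts n N" by (rule cluster_subset[OF n poles_in_verts(1)[OF n]])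
  have "(\<Sum>x\<in>verts n N. miss N x w) = (\<Sum>x\<in>verts n N. if x \<in> verts n N - ?C then 1 else 0)"
    using assms by (intro sum.cong) (auto simp: miss_def)
  also have "... = (\<Sum>x\<in>verts n N \<inter> (verts n N - ?C). 1)" by (rule sum.inter_restrict[OF finite_verts, symmetric])
  also have "verts n N \<inter> (verts n N - ?C) = verts n N - ?C" by blast
  also have "(\<Sum>x\<in>verts n N - ?C. 1 :: real) = real (card (verts n N - ?C))" by simp
  also have "... = real (card (verts n N)) - real (card ?C)"
    using C finite_verts finite_subset[OF C finite_verts] card_mono[OF finite_verts C] by (simp add: card_Diff_subset of_nat_diff)
  finally show ?thesis .
qed

lemma card_verts_pos: "0 < card (verts n N)"
  using poles_in_verts(1)[OF n] finite_verts by (auto simp: card_gt_0_iff)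

end

context certified begin

lemma wr_le_S: "wseq c N + 2 * rseq c N \<le> S_const c"
  unfolding S_const_def by (intro cSUP_upper certificate_bdd[OF cert]) simp

lemma wr_le_P: "wseq c N + 2 * ln 2 * rseq c N \<le> P_const c"
  unfolding P_const_def using certificate_bdd[OF cert, of "2 * ln 2"] by (intro cSUP_upper) auto

lemma abar_nonneg: "0 \<le> abar (rseq c k) (wseq c k)"
  unfolding abar_def using sequence_bounds(3,4)[of k] by (intro add_nonneg_nonneg mult_nonneg_nonneg) auto

lemma site_term_nonneg: "0 \<le> 1/2 * wseq c k + 2 * rseq c k"
  using sequence_bounds(3,4)[of k] by simp

lemma partial_ell_s: "(\<Sum>k\<in>{0..<N}. 1/2 * wseq c k + 2 * rseq c k) \<le> ell_s c"
  unfolding ell_s_def using site_term_nonneg by (intro sum_le_suminf certificate_summable[OF cert]) auto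

lemma partial_ell_b: "(\<Sum>k\<in>{0..<N}. abar (rseq c k) (wseq c k)) \<le> ell_b c"
  unfolding ell_b_def using abar_nonneg by (intro sum_le_suminf certificate_summable[OF cert]) auto

lemma constants_nonneg: "0 \<le> ell_s c" "0 \<le> ell_b c" "0 \<le> S_const c" "0 \<le> P_const c"
proof -
  show "0 \<le> ell_s c" "0 \<le> ell_b c" using partial_ell_s[of 0] partial_ell_b[of 0] by simp_all
  show "0 \<le> S_const c" using wr_le_S[of 0] sequence_bounds(3,4)[of 0] by linarith
  have "0 \<le> wseq c 0 + 2 * ln 2 * rseq c 0" using sequence_bounds(3,4)[of 0] by simp
  then show "0 \<le> P_const c" using wr_le_P[of 0] by linarith
qed

lemma disconnected_le: "EE N (nc N) \<le> wseq c N + 2 * ln 2 * rseq c N"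
proof (rule EE_le[OF ens_disconnected])
  show "(\<lambda>J. 1 - tanh \<bar>X N J\<bar>) \<in> borel_measurable (Q N)" by (rule measurable_compose[OF eff_measurable tanh_defect_measurable])
  show "0 \<le> wseq c N + 2 * ln 2 * rseq c N" using sequence_bounds(3,4)[of N] by simp
qed (rule tanh_defect_bounds expected_tanh_defect)+

lemma poles_differ_le: "EE N (\<lambda>w. of_bool (ov PoleA w \<noteq> ov PoleB w)) \<le> (wseq c N + 2 * rseq c N) / 2"
proof -
  have m: "(\<lambda>J. sech2 (X N J)) \<in> borel_measurable (Q N)" by (rule measurable_compose[OF eff_measurable sech2_measurable])
  have "(\<integral>J. sech2 (X N J) \<partial>Q N) \<le> wseq c N + 2 * rseq c N" using sech2_bounds(1) sequence_bounds(3,4)[of N]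
    by (intro nn_expectation_le(2)[OF m _ expected_sech2]) (auto intro: less_imp_le)
  then show ?thesis unfolding ens_poles_differ by simp
qed

lemma site_bad_le:
  assumes "x \<in> verts n N - {PoleA, PoleB}"
  shows "EE N (\<lambda>w. of_bool (ov PoleA w = ov PoleB w \<and> site_bad x w)) \<le> ell_s c"
proof -
  have "EE N (\<lambda>w. of_bool (ov PoleA w = ov PoleB w \<and> site_bad x w)) \<le> (\<Sum>k\<in>{N - N..<N}. 1/2 * wseq c k + 2 * rseq c k)"
  proof (rule EE_le)
    show "ens N J (\<lambda>w. of_bool (ov PoleA w = ov PoleB w \<and> site_bad x w)) \<le> loss site_loss n \<beta> N J x" for J
      by (rule ens_chain) (rule site_chain[OF assms])
    show "(\<lambda>J. loss site_loss n \<beta> N J x) \<in> borel_measurable (Q N)" by (rule loss_measurable[OF _ assms]) measurable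
    show "(\<integral>\<^sup>+J. ennreal (loss site_loss n \<beta> N J x) \<partial>Q N) \<le> ennreal (\<Sum>k\<in>{N - N..<N}. 1/2 * wseq c k + 2 * rseq c k)"
      by (rule expected_site_loss[OF assms order_refl])
  qed (intro loss_nonneg site_loss_bounds sum_nonneg site_term_nonneg)+
  then show ?thesis using partial_ell_s[of N] by simp
qed

lemma miss_skeleton_le:
  assumes x: "x \<in> verts n m - {PoleA, PoleB}" and m: "m \<le> N"
  shows "EE N (miss N x) \<le> (\<Sum>k\<in>{N - m..<N}. abar (rseq c k) (wseq c k))"
proof (rule EE_le)
  have x': "x \<in> verts n N - {PoleA, PoleB}" using x verts_mono[OF m] by blast
  show "ens N J (miss N x) \<le> loss blue_loss n \<beta> N J x" for J
  proof -
    have "ens N J (miss N x) \<le> ens N J (\<lambda>w. of_bool (ov PoleA w = ov PoleB w \<and> blue_bad n N x w))" by (rule ens_mono) (rule miss_le)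
    also have "... \<le> loss blue_loss n \<beta> N J x" by (rule ens_chain) (rule blue_chain[OF x'])
    finally show ?thesis .
  qed
  show "(\<lambda>J. loss blue_loss n \<beta> N J x) \<in> borel_measurable (Q N)" by (rule loss_measurable[OF _ x']) measurable
  show "(\<integral>\<^sup>+J. ennreal (loss blue_loss n \<beta> N J x) \<partial>Q N) \<le> ennreal (\<Sum>k\<in>{N - m..<N}. abar (rseq c k) (wseq c k))"
    by (rule expected_blue_loss[OF x m])
qed (intro loss_nonneg blue_loss_bounds sum_nonneg abar_nonneg)+

lemma miss_expectation_le: "x \<in> verts n N \<Longrightarrow> EE N (miss N x) \<le> ell_b c"
proof (cases "x \<in> {PoleA, PoleB}")
  case True
  then have "miss N x = (\<lambda>_. 0)" using miss_poles by auto
  then show ?thesis using constants_nonneg(2) EE_const[of N 0] by simp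
next
  case False
  assume "x \<in> verts n N"
  then show ?thesis using False miss_skeleton_le[of x N N] partial_ell_b[of N] by simp
qed

lemma mean_missing_le: "EE N (\<lambda>w. (\<Sum>x\<in>verts n N. miss N x w) / card (verts n N)) \<le> ell_b c"
proof -
  have "(\<Sum>x\<in>verts n N. EE N (miss N x)) \<le> (\<Sum>x\<in>verts n N. ell_b c)" by (intro sum_mono miss_expectation_le)
  then have "(1 / card (verts n N)) * (\<Sum>x\<in>verts n N. EE N (miss N x)) \<le> ell_b c" using card_verts_pos[of N] by (simp add: field_simps)
  moreover have "EE N (\<lambda>w. (\<Sum>x\<in>verts n N. miss N x w) / card (verts n N)) = (1 / card (verts n N)) * (\<Sum>x\<in>verts n N. EE N (miss N x))"
    using EE_cmult[of N "1 / card (verts n N)" "\<lambda>w. \<Sum>x\<in>verts n N. miss N x w"] unfolding EE_sum by simp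
  ultimately show ?thesis by simp
qed

theorem pole_order: "pole_order n \<beta> \<nu> c"
proof -
  have e: "pole_corr n N \<beta> \<nu> = 1 + (- 2) * EE N (\<lambda>w. of_bool (ov PoleA w \<noteq> ov PoleB w))" for N
  proof -
    have "ens N J (\<lambda>w. ov PoleA w * ov PoleB w) = ens N J (\<lambda>w. 1 + (- 2) * of_bool (ov PoleA w \<noteq> ov PoleB w))" for J
      unfolding ens_def tot_def
    proof (intro arg_cong2[where f = "(/)"] sum.cong refl)
      fix w assume "w \<in> samples n N"
      then have "ov PoleA w \<in> pm" "ov PoleB w \<in> pm" using ov_pm poles_in_verts[OF n] by blast+
      then show "W N J w * (ov PoleA w * ov PoleB w) = W N J w * (1 + (- 2) * of_bool (ov PoleA w \<noteq> ov PoleB w))" by auto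
    qed
    then show ?thesis unfolding pole_corr_def free_mean_sq by (simp only: EE_affine)
  qed
  have lo: "1 - (wseq c N + 2 * rseq c N) \<le> pole_corr n N \<beta> \<nu>" for N unfolding e using poles_differ_le[of N] by simp
  have hi: "pole_corr n N \<beta> \<nu> \<le> 1" for N
  proof -
    have "EE N (\<lambda>_. 0) \<le> EE N (\<lambda>w. of_bool (ov PoleA w \<noteq> ov PoleB w))" by (rule EE_mono) simp
    then show ?thesis unfolding e EE_const by simp
  qed
  have "(\<lambda>N. 1 - (wseq c N + 2 * rseq c N)) \<longlonglongrightarrow> 1 - (0 + 2 * 0)"
    by (intro tendsto_diff tendsto_add tendsto_mult tendsto_const
      summable_LIMSEQ_zero[OF certificate_summable(1)[OF cert]] summable_LIMSEQ_zero[OF certificate_summable(2)[OF cert]])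
  then have lim: "(\<lambda>N. 1 - (wseq c N + 2 * rseq c N)) \<longlonglongrightarrow> 1" by simp
  have "(\<lambda>N. pole_corr n N \<beta> \<nu>) \<longlonglongrightarrow> 1"
    by (rule tendsto_sandwich[OF always_eventually always_eventually lim tendsto_const]) (intro allI lo hi)+
  moreover have "1 - S_const c \<le> pole_corr n N \<beta> \<nu>" for N using lo[of N] wr_le_S[of N] by linarith
  ultimately show ?thesis by (simp add: pole_order_def)
qed

theorem EA_order: "EA_order n \<beta> \<nu> c"
proof -
  have "1 - 2 * ell_s c \<le> (\<integral>J. (measure_pmf.expectation (gibbs_fixed n N \<beta> a b J) (\<lambda>\<sigma>. \<sigma> x))\<^sup>2 \<partial>Q N)"
    if ab: "a \<in> pm" "b \<in> pm" and x: "x \<in> verts n N - {PoleA, PoleB}" for N a b x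
  proof -
    let ?l = "\<lambda>J. loss site_loss n \<beta> N J x" and ?q = "\<lambda>J. cex N J (a, a) (b, b) (ov x)"
    have p: "(a, a) \<in> pm2" "(b, b) \<in> pm2" "qsign (a, a) = qsign (b, b)" using ab by auto
    have lm: "?l \<in> borel_measurable (Q N)" by (rule loss_measurable[OF _ x]) measurable
    have l0: "0 \<le> ?l J" for J by (rule loss_nonneg[OF site_loss_bounds(1)])
    have s0: "0 \<le> (\<Sum>k\<in>{N - N..<N}. 1/2 * wseq c k + 2 * rseq c k)" by (intro sum_nonneg site_term_nonneg)
    note l = nn_expectation_le[OF lm l0 expected_site_loss[OF x order_refl] s0]
    have q: "?q J = 1 + (- 2) * cex N J (a, a) (b, b) (\<lambda>w. of_bool (site_bad x w))" for J
    proof -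
      have "?q J = cex N J (a, a) (b, b) (\<lambda>w. 1 + (- 2) * of_bool (site_bad x w))"
      proof (rule cex_cong)
        fix w assume w: "w \<in> poled n N (a, a) (b, b)"
        then have "ov PoleA w = 1" using ab by (auto simp: poled_def ov_def)
        moreover have "ov x w \<in> pm" using w x by (intro ov_pm[of _ N]) (auto simp: poled_def)
        ultimately show "ov x w = 1 + (- 2) * of_bool (site_bad x w)" by (auto simp: site_bad_def)
      qed
      then show ?thesis by (simp only: cex_add cex_cmult cex_one[OF p(1,2)])
    qed
    have b01: "0 \<le> cex N J (a, a) (b, b) (\<lambda>w. of_bool (site_bad x w))" "cex N J (a, a) (b, b) (\<lambda>w. of_bool (site_bad x w)) \<le> 1" for J
      by (intro cex_bounds p; simp)+
    have qi: "integrable (Q N) ?q"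
    proof (rule bounded_integrable[OF cex_measurable])
      show "\<bar>?q J\<bar> \<le> 1" for J unfolding q using b01[of J] by linarith
    qed
    have "(\<integral>J. 1 - 2 * ?l J \<partial>Q N) \<le> (\<integral>J. ?q J \<partial>Q N)"
    proof (rule integral_mono[OF _ qi])
      interpret prob_space "Q N" by (rule prob_Q)
      show "integrable (Q N) (\<lambda>J. 1 - 2 * ?l J)" using l(1) by simp
      show "1 - 2 * ?l J \<le> ?q J" for J unfolding q using site_chain[OF x p] by simp
    qed
    also have "(\<integral>J. 1 - 2 * ?l J \<partial>Q N) = 1 - 2 * (\<integral>J. ?l J \<partial>Q N)"
    proof -
      interpret prob_space "Q N" by (rule prob_Q)
      show ?thesis using l(1) by (simp add: prob_space)
    qed
    finally show ?thesis unfolding fixed_mean_sq[OF ab] using l(2) partial_ell_s[of N] by simp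
  qed
  then show ?thesis using fixed_mean_symmetric by (auto simp: EA_order_def)
qed

lemma overlap_with_pole:
  assumes x: "x \<in> verts n N"
  shows "1 - S_const c - 2 * ell_s c \<le> EE N (\<lambda>w. ov x w * ov PoleA w)"
proof -
  let ?D = "\<lambda>w. of_bool (ov PoleA w \<noteq> ov PoleB w) :: real"
  let ?B = "\<lambda>w. of_bool (x \<notin> {PoleA, PoleB} \<and> ov PoleA w = ov PoleB w \<and> site_bad x w) :: real"
  have "EE N ?B \<le> ell_s c"
  proof (cases "x \<in> {PoleA, PoleB}")
    case True
    then show ?thesis using EE_const[of N 0] constants_nonneg(1) by simp
  next
    case False
    then show ?thesis using site_bad_le[of x N] x by simp
  qed
  moreover have "EE N ?D \<le> S_const c / 2" using poles_differ_le[of N] wr_le_S[of N] by simp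
  moreover have "EE N (\<lambda>w. 1 + (- 2) * (?D w + ?B w)) \<le> EE N (\<lambda>w. ov x w * ov PoleA w)"
  proof (rule EE_mono)
    fix w assume "w \<in> samples n N"
    then have "ov PoleA w \<in> pm" "ov x w \<in> pm" using ov_pm poles_in_verts[OF n] x by blast+
    then show "1 + (- 2) * (?D w + ?B w) \<le> ov x w * ov PoleA w" by (auto simp: site_bad_def)
  qed
  ultimately show ?thesis unfolding EE_affine EE_add by simp
qed

text \<open>Expanding \<open>(R * q - s)\<^sup>2 \<ge> 0\<close>, where \<open>q\<close> is the overlap at the first pole and \<open>q\<^sup>2 = 1\<close>, reduces the second
  moment of the overlap \<open>R\<close> to correlations with the pole; \<open>s\<close> is the lower bound for these,
  truncated at \<open>0\<close>.\<close>
theorem site_overlap_order: "site_overlap_order n \<beta> \<nu> c"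
proof -
  have "(pos_part (1 - 2 * ell_s c - S_const c))\<^sup>2 \<le> EE N (\<lambda>w. (site_overlap n N w)\<^sup>2)" for N
  proof -
    define a where "a = 1 - 2 * ell_s c - S_const c"
    define s where "s = pos_part a"
    let ?R = "\<lambda>w. \<Sum>x\<in>verts n N. ov x w * ov PoleA w" and ?V = "real (card (verts n N))"
    have V: "0 < ?V" using card_verts_pos[of N] by simp
    have "(\<Sum>x\<in>verts n N. a) \<le> EE N ?R" unfolding EE_sum a_def using overlap_with_pole by (intro sum_mono) (simp add: algebra_simps)
    then have aR: "a \<le> 1 / ?V * EE N ?R" using V by (simp add: field_simps)
    have "- s\<^sup>2 + 2 * s * (1 / ?V * EE N ?R) = EE N (\<lambda>w. - s\<^sup>2 + (2 * s * (1 / ?V)) * ?R w)"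
      using EE_affine[of N "- s\<^sup>2" "2 * s * (1 / ?V)" ?R] by (simp only: mult.assoc)
    also have "... \<le> EE N (\<lambda>w. (site_overlap n N w)\<^sup>2)"
    proof (rule EE_mono)
      fix w assume w: "w \<in> samples n N"
      then have "ov PoleA w \<in> pm" using ov_pm poles_in_verts[OF n] by blast
      then have q: "(ov PoleA w)\<^sup>2 = 1" by auto
      obtain \<sigma> \<tau> b where o: "w = (\<sigma>, \<tau>, b)" by (metis prod_cases3)
      have R: "1 / ?V * ?R w = site_overlap n N w * ov PoleA w" by (simp add: site_overlap_def o ov_def spin_def sum_distrib_right[symmetric])
      have "0 \<le> (site_overlap n N w * ov PoleA w - s)\<^sup>2" by simp
      also have "... = (site_overlap n N w)\<^sup>2 * (ov PoleA w)\<^sup>2 - 2 * s * (site_overlap n N w * ov PoleA w) + s\<^sup>2"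
        by (simp add: power2_eq_square algebra_simps)
      finally show "- s\<^sup>2 + (2 * s * (1 / ?V)) * ?R w \<le> (site_overlap n N w)\<^sup>2" unfolding q R[symmetric] by (simp add: mult.assoc)
    qed
    finally have "- s\<^sup>2 + 2 * s * (1 / ?V * EE N ?R) \<le> EE N (\<lambda>w. (site_overlap n N w)\<^sup>2)" .
    moreover have "2 * s * a \<le> 2 * s * (1 / ?V * EE N ?R)" by (intro mult_left_mono aR) (simp add: s_def)
    moreover have "s * a = s\<^sup>2" by (simp add: s_def power2_eq_square max_def)
    ultimately show ?thesis unfolding a_def[symmetric] s_def[symmetric] by simp
  qed
  then show ?thesis by (simp add: site_overlap_order_def joint_expectation_ens)
qed

text \<open>If the poles are connected and their cluster is too small, the fraction of missing vertices is at
  least \<open>\<theta>\<close>; Markov's inequality applies.\<close>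
theorem giant_pole_cluster: "giant_pole_cluster n \<beta> \<nu> c"
proof -
  have "1 - ell_b c / \<theta> - P_const c \<le> EE N (\<lambda>w. of_bool (case w of (\<sigma>, \<tau>, b) \<Rightarrow>
      PoleB \<in> cluster n N b PoleA \<and> real (card (cluster n N b PoleA)) > (1 - \<theta>) * card (verts n N)))"
    (is "_ \<le> EE N ?E") if \<theta>: "0 < \<theta>" for N \<theta>
  proof -
    let ?D = "\<lambda>w. (\<Sum>x\<in>verts n N. miss N x w) / card (verts n N)"
    have "1 + (- 1) * (EE N (nc N) + (1 / \<theta>) * EE N ?D) = EE N (\<lambda>w. 1 + (- 1) * (nc N w + (1 / \<theta>) * ?D w))"
      by (simp only: EE_affine EE_add EE_cmult)
    also have "... \<le> EE N ?E"
    proof (rule EE_mono)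
      fix w :: sample
      obtain \<sigma> \<tau> b where o: "w = (\<sigma>, \<tau>, b)" by (metis prod_cases3)
      have V: "0 < real (card (verts n N))" using card_verts_pos[of N] by simp
      have D0: "0 \<le> (1 / \<theta>) * ?D w" using \<theta> by (auto intro!: divide_nonneg_nonneg sum_nonneg simp: miss_def)
      show "1 + (- 1) * (nc N w + (1 / \<theta>) * ?D w) \<le> ?E w"
      proof (cases "PoleB \<in> cluster n N b PoleA \<and> \<not> ?E w = 1")
        case True
        then have le: "real (card (cluster n N b PoleA)) \<le> (1 - \<theta>) * card (verts n N)" by (auto simp: o)
        have "\<theta> * card (verts n N) \<le> (\<Sum>x\<in>verts n N. miss N x w)"
          using count_missing[of N w] True le by (simp add: o algebra_simps)
        then have "\<theta> \<le> ?D w" using V by (simp add: field_simps)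
        then have "(1 / \<theta>) * \<theta> \<le> (1 / \<theta>) * ?D w" using \<theta> by (intro mult_left_mono) auto
        then have "1 \<le> (1 / \<theta>) * ?D w" using \<theta> by simp
        then show ?thesis using nc_bounds(1)[of N w] by (auto simp: of_bool_def)
      next
        case False
        then show ?thesis using D0 by (auto simp: o nc_def)
      qed
    qed
    finally have "1 - (EE N (nc N) + (1 / \<theta>) * EE N ?D) \<le> EE N ?E" by simp
    moreover have "(1 / \<theta>) * EE N ?D \<le> (1 / \<theta>) * ell_b c" using \<theta> by (intro mult_left_mono mean_missing_le) auto
    moreover have "EE N (nc N) \<le> P_const c" using disconnected_le[of N] wr_le_P[of N] by linarith
    ultimately show ?thesis by simp
  qed
  then show ?thesis by (simp add: giant_pole_cluster_def joint_prob_ens)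
qed

lemma eps_eq:
  assumes "m \<le> N"
  shows "eps n c N m = wseq c N + 2 * ln 2 * rseq c N + real (inner_count n m) * (\<Sum>k\<in>{N - m..<N}. abar (rseq c k) (wseq c k))"
proof -
  have "(\<Sum>k = N - m + 1..N. abar (rseq c (k - 1)) (wseq c (k - 1))) = (\<Sum>k\<in>{N - m..<N}. abar (rseq c k) (wseq c k))"
    by (rule sum.reindex_bij_witness[of _ Suc "\<lambda>k. k - 1"]) auto
  then show ?thesis by (simp add: eps_def)
qed

lemma eps_tendsto: "(\<lambda>N. eps n c N m) \<longlonglongrightarrow> 0"
proof (rule LIMSEQ_offset[of _ m])
  let ?a = "\<lambda>k. abar (rseq c k) (wseq c k)"
  have s: "(\<lambda>N. \<Sum>k\<in>{..<N}. ?a k) \<longlonglongrightarrow> suminf ?a" by (rule summable_LIMSEQ[OF certificate_summable(4)[OF cert]])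
  have "(\<lambda>N. (wseq c (N + m) + 2 * ln 2 * rseq c (N + m)) + real (inner_count n m) * ((\<Sum>k<N + m. ?a k) - (\<Sum>k<N. ?a k)))
      \<longlonglongrightarrow> (0 + 2 * ln 2 * 0) + real (inner_count n m) * (suminf ?a - suminf ?a)"
    by (intro tendsto_diff tendsto_add tendsto_mult tendsto_const LIMSEQ_ignore_initial_segment[OF s] s
      LIMSEQ_ignore_initial_segment[OF summable_LIMSEQ_zero[OF certificate_summable(1)[OF cert]]]
      LIMSEQ_ignore_initial_segment[OF summable_LIMSEQ_zero[OF certificate_summable(2)[OF cert]]])
  moreover have "(\<Sum>k<N + m. ?a k) - (\<Sum>k<N. ?a k) = (\<Sum>k\<in>{N + m - m..<N + m}. ?a k)" for N
    using sum.atLeastLessThan_concat[of 0 N "N + m" ?a] by (simp add: atLeast0LessThan)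
  ultimately show "(\<lambda>N. eps n c (N + m) m) \<longlonglongrightarrow> 0" unfolding eps_eq[OF le_add2] by simp
qed

text \<open>If the cluster of the poles contains the skeleton, every other cluster lies in the interior of one of
  the sub-lattices, which are \<open>(2 * n) ^ m\<close> times smaller than the lattice.\<close>
lemma max_nonpole_bounds:
  assumes m: "m \<le> N"
  shows "max_nonpole_cluster n N w \<le> card (verts n N)"
    and "real (max_nonpole_cluster n N w) > card (verts n N) / (2 * real n) ^ m
      \<Longrightarrow> 1 \<le> nc N w + (\<Sum>x\<in>verts n m - {PoleA, PoleB}. miss N x w)"
proof -
  obtain \<sigma> \<tau> b where o: "w = (\<sigma>, \<tau>, b)" by (metis prod_cases3)
  let ?S = "{C \<in> clusters n N b. PoleA \<notin> C}"
  have fin: "finite (insert 0 (card ` ?S))" by (simp add: clusters_def finite_verts)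
  have M: "max_nonpole_cluster n N w = Max (insert 0 (card ` ?S))" by (simp add: max_nonpole_cluster_def o)
  show "max_nonpole_cluster n N w \<le> card (verts n N)"
    unfolding M using fin by (auto simp: clusters_def intro!: card_mono finite_verts cluster_subset[OF n])
  assume big: "real (max_nonpole_cluster n N w) > card (verts n N) / (2 * real n) ^ m"
  have pow: "0 < (2 * real n) ^ m" using n by simp
  show "1 \<le> nc N w + (\<Sum>x\<in>verts n m - {PoleA, PoleB}. miss N x w)"
  proof (rule ccontr)
    assume not: "\<not> ?thesis"
    have ms: "0 \<le> (\<Sum>x\<in>verts n m - {PoleA, PoleB}. miss N x w)" by (intro sum_nonneg) (simp add: miss_def)
    have conn: "PoleB \<in> cluster n N b PoleA"
    proof (rule ccontr)
      assume "PoleB \<notin> cluster n N b PoleA"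
      then have "nc N w = 1" by (simp add: nc_def o)
      with ms not show False by linarith
    qed
    have skel: "x \<in> cluster n N b PoleA" if x: "x \<in> verts n m" for x
    proof (cases "x \<in> {PoleA, PoleB}")
      case True
      then show ?thesis using conn cluster_refl by auto
    next
      case False
      have "miss N x w \<le> (\<Sum>x\<in>verts n m - {PoleA, PoleB}. miss N x w)"
        using x False finite_verts by (intro member_le_sum) (auto simp: miss_def)
      then have "miss N x w < 1" using not nc_bounds(1)[of N w] by linarith
      then show ?thesis using conn by (auto simp: miss_def o split: if_splits)
    qed
    have "card C \<le> inner_count n (N - m)" if C: "C \<in> ?S" for C
    proof -
      obtain x where x: "x \<in> verts n N" "C = cluster n N b x" using C by (auto simp: clusters_def)
      have "C \<inter> verts n m = {}"
      proof (rule ccontr)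
        assume "C \<inter> verts n m \<noteq> {}"
        then obtain z where "z \<in> cluster n N b x" "z \<in> cluster n N b PoleA" using skel x by blast
        then have "C = cluster n N b PoleA" using cluster_disjoint x(2) by blast
        then show False using C cluster_refl by auto
      qed
      then show ?thesis unfolding x(2) by (intro cluster_card_le[OF n m x(1)]) (simp add: x(2))
    qed
    then have "max_nonpole_cluster n N w \<le> inner_count n (N - m)" unfolding M using fin by auto
    then have "(2 * n) ^ m * max_nonpole_cluster n N w \<le> (2 * n) ^ m * inner_count n (N - m)" by simp
    also have "... \<le> inner_count n N" by (rule inner_count_power[OF n m])
    also have "... \<le> card (verts n N)" unfolding inner_count_def by (intro card_mono finite_verts) auto
    finally have "real ((2 * n) ^ m * max_nonpole_cluster n N w) \<le> real (card (verts n N))" by (simp only: of_nat_le_iff)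
    then have "real (max_nonpole_cluster n N w) * (2 * real n) ^ m \<le> card (verts n N)" by (simp add: mult.commute)
    then show False using big pow by (simp add: pos_divide_less_eq)
  qed
qed

lemma nonpole_prob_le:
  assumes m: "m \<le> N"
  shows "EE N (\<lambda>w. of_bool (real (max_nonpole_cluster n N w) > card (verts n N) / (2 * real n) ^ m)) \<le> eps n c N m"
proof -
  let ?V = "verts n m - {PoleA, PoleB}"
  have "EE N (\<lambda>w. of_bool (real (max_nonpole_cluster n N w) > card (verts n N) / (2 * real n) ^ m))
      \<le> EE N (\<lambda>w. nc N w + (\<Sum>x\<in>?V. miss N x w))"
  proof (rule EE_mono)
    fix w :: sample
    have "0 \<le> nc N w + (\<Sum>x\<in>?V. miss N x w)" using nc_bounds by (intro add_nonneg_nonneg sum_nonneg) (auto simp: miss_def)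
    then show "of_bool (real (max_nonpole_cluster n N w) > card (verts n N) / (2 * real n) ^ m) \<le> nc N w + (\<Sum>x\<in>?V. miss N x w)"
      using max_nonpole_bounds(2)[OF m, of w] by (simp add: of_bool_def)
  qed
  also have "... = EE N (nc N) + (\<Sum>x\<in>?V. EE N (miss N x))" unfolding EE_add EE_sum ..
  also have "... \<le> (wseq c N + 2 * ln 2 * rseq c N) + (\<Sum>x\<in>?V. \<Sum>k\<in>{N - m..<N}. abar (rseq c k) (wseq c k))"
    by (intro add_mono disconnected_le sum_mono miss_skeleton_le m)
  also have "... = eps n c N m" unfolding eps_eq[OF m] by (simp add: inner_count_def)
  finally show ?thesis .
qed

lemma nonpole_mean_le:
  assumes m: "m \<le> N"
  shows "EE N (\<lambda>w. real (max_nonpole_cluster n N w)) / card (verts n N) \<le> 1 / (2 * real n) ^ m + eps n c N m"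
proof -
  let ?V = "real (card (verts n N))" and ?p = "(2 * real n) ^ m"
  let ?B = "\<lambda>w. of_bool (real (max_nonpole_cluster n N w) > ?V / ?p) :: real"
  have V: "0 < ?V" using card_verts_pos[of N] by simp
  have "EE N (\<lambda>w. real (max_nonpole_cluster n N w)) \<le> EE N (\<lambda>w. ?V / ?p + ?V * ?B w)"
  proof (rule EE_mono)
    fix w :: sample
    have "real (max_nonpole_cluster n N w) \<le> ?V" using max_nonpole_bounds(1)[OF m] by simp
    moreover have "0 \<le> ?V / ?p" by simp
    moreover have "?V * ?B w = (if real (max_nonpole_cluster n N w) > ?V / ?p then ?V else 0)" by simp
    ultimately show "real (max_nonpole_cluster n N w) \<le> ?V / ?p + ?V * ?B w" by (simp only: split: if_split) linarith
  qed
  also have "... = ?V / ?p + ?V * EE N ?B" by (rule EE_affine)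
  also have "... \<le> ?V / ?p + ?V * eps n c N m" using V by (intro add_left_mono mult_left_mono nonpole_prob_le m) auto
  also have "... = ?V * (1 / ?p + eps n c N m)" by (simp add: distrib_left)
  finally show ?thesis using V by (simp add: pos_divide_le_eq mult.commute)
qed

theorem unique_giant_cluster: "unique_giant_cluster n \<beta> \<nu> c"
proof -
  let ?M = "\<lambda>N w. real (max_nonpole_cluster n N w)" and ?V = "\<lambda>N. real (card (verts n N))"
  have V: "0 < ?V N" for N using card_verts_pos[of N] by simp
  have small: "\<exists>m\<ge>1. 1 / (2 * real n) ^ m < \<delta>" if "0 < \<delta>" for \<delta>
  proof -
    have "1 / (2 * real n) < 1" using n2 by simp
    from real_arch_pow_inv[OF that this] obtain m where m: "(1 / (2 * real n)) ^ m < \<delta>" by blast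
    have "(1 / (2 * real n)) ^ Suc m \<le> (1 / (2 * real n)) ^ m" using n2 by (intro power_decreasing) auto
    then show ?thesis using m by (intro exI[of _ "Suc m"]) (simp add: power_one_over)
  qed
  have "(\<lambda>N. EE N (\<lambda>w. of_bool (?M N w / ?V N > \<delta>))) \<longlonglongrightarrow> 0" if \<delta>: "0 < \<delta>" for \<delta>
  proof -
    obtain m where m: "1 / (2 * real n) ^ m < \<delta>" using small[OF \<delta>] by blast
    have le: "EE N (\<lambda>w. of_bool (?M N w / ?V N > \<delta>)) \<le> eps n c N m" if "m \<le> N" for N
    proof -
      have "EE N (\<lambda>w. of_bool (?M N w / ?V N > \<delta>)) \<le> EE N (\<lambda>w. of_bool (?M N w > ?V N / (2 * real n) ^ m))"
      proof (rule EE_mono)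
        fix w :: sample
        have "?V N / (2 * real n) ^ m < ?M N w" if "\<delta> < ?M N w / ?V N"
        proof -
          have "?V N * (1 / (2 * real n) ^ m) < ?V N * (?M N w / ?V N)" using m that V[of N] by (intro mult_strict_left_mono) auto
          then show ?thesis using V[of N] by simp
        qed
        then show "of_bool (?M N w / ?V N > \<delta>) \<le> (of_bool (?M N w > ?V N / (2 * real n) ^ m) :: real)" by (auto simp: of_bool_def)
      qed
      then show ?thesis using nonpole_prob_le[OF that] by linarith
    qed
    have "0 \<le> EE N (\<lambda>w. of_bool (?M N w / ?V N > \<delta>))" for N
      using EE_mono[of N "\<lambda>_. 0" "\<lambda>w. of_bool (?M N w / ?V N > \<delta>)"] EE_const[of N 0] by simp
    then show ?thesis
      by (intro tendsto_sandwich[OF _ _ tendsto_const eps_tendsto[of m]] always_eventually eventually_mono[OF eventually_ge_at_top[of m]]) (auto intro: le)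
  qed
  moreover have "(\<lambda>N. EE N (\<lambda>w. \<bar>?M N w / ?V N\<bar>)) \<longlonglongrightarrow> 0"
  proof (rule LIMSEQ_I)
    fix \<delta> :: real assume "0 < \<delta>"
    then obtain m where m: "1 / (2 * real n) ^ m < \<delta> / 2" using small[of "\<delta> / 2"] by auto
    have "\<forall>\<^sub>F N in sequentially. eps n c N m < \<delta> / 2"
      using eps_tendsto[of m] \<open>0 < \<delta>\<close> by (intro order_tendstoD(2)) auto
    then obtain N0 where N0: "\<And>N. N \<ge> N0 \<Longrightarrow> eps n c N m < \<delta> / 2" by (auto simp: eventually_sequentially)
    have "norm (EE N (\<lambda>w. \<bar>?M N w / ?V N\<bar>) - 0) < \<delta>" if N: "N \<ge> max N0 m" for N
    proof -
      have e: "EE N (\<lambda>w. \<bar>?M N w / ?V N\<bar>) = EE N (?M N) / ?V N" using EE_cmult[of N "1 / ?V N" "?M N"] V[of N] by simp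
      have "0 \<le> EE N (?M N)" using EE_mono[of N "\<lambda>_. 0" "?M N"] EE_const[of N 0] by simp
      then have "0 \<le> EE N (?M N) / ?V N" by simp
      moreover have "EE N (?M N) / ?V N < \<delta>" using nonpole_mean_le[of m N] N N0[of N] m by simp
      ultimately show ?thesis unfolding e by simp
    qed
    then show "\<exists>no. \<forall>N\<ge>no. norm (EE N (\<lambda>w. \<bar>?M N w / ?V N\<bar>) - 0) < \<delta>" by blast
  qed
  ultimately show ?thesis
    unfolding unique_giant_cluster_def joint_prob_ens joint_expectation_ens
    using nonpole_prob_le nonpole_mean_le eps_tendsto by blast
qed

text \<open>The cluster of the poles has the sign \<open>q\<close> of the pole and all clusters of sign \<open>- q\<close> are disjoint from
  it.\<close>
lemma imbalance_ge:
  assumes w: "w \<in> samples n N" "W N J w \<noteq> 0" and conn: "PoleB \<in> cluster n N (snd (snd w)) PoleA"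
  shows "1 - 2 * ((\<Sum>x\<in>verts n N. miss N x w) / card (verts n N)) \<le> ov PoleA w * blue_imbalance n N w"
proof -
  obtain \<sigma> \<tau> b where o: "w = (\<sigma>, \<tau>, b)" by (metis prod_cases3)
  let ?C = "cluster n N b PoleA" and ?V = "real (card (verts n N))"
  let ?S = "\<lambda>s. {C \<in> clusters n N b. \<forall>x\<in>C. \<sigma> x * \<tau> x = s}" and ?q = "ov PoleA w"
  have V: "0 < ?V" using card_verts_pos[of N] by simp
  have ovo: "ov x w = \<sigma> x * \<tau> x" for x by (simp add: ov_def spin_def o)
  have q: "?q \<in> pm" by (rule ov_pm[OF w(1) poles_in_verts(1)[OF n]])
  have fin: "finite (insert 0 (card ` ?S s))" for s by (simp add: clusters_def finite_verts)
  have M: "max_signed_cluster n N s w = Max (insert 0 (card ` ?S s))" for s by (simp add: max_signed_cluster_def o)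
  have C: "?C \<subseteq> verts n N" by (rule cluster_subset[OF n poles_in_verts(1)[OF n]])
  have "?C \<in> ?S ?q" using blue_ok[OF w(2,1)] poles_in_verts(1)[OF n, of N] by (auto simp: clusters_def ovo[symmetric] o)
  then have lo: "card ?C \<le> max_signed_cluster n N ?q w" unfolding M by (intro Max_ge[OF fin]) simp
  have hi: "max_signed_cluster n N (- ?q) w \<le> card (verts n N - ?C)" unfolding M
  proof (rule Max.boundedI[OF fin])
    fix k assume "k \<in> insert 0 (card ` ?S (- ?q))"
    then consider "k = 0" | D where "D \<in> ?S (- ?q)" "k = card D" by blast
    then show "k \<le> card (verts n N - ?C)"
    proof cases
      case 2
      obtain x where x: "x \<in> verts n N" "D = cluster n N b x" using 2(1) by (auto simp: clusters_def)
      have "D \<inter> ?C = {}"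
      proof (rule ccontr)
        assume "D \<inter> ?C \<noteq> {}"
        then have "D = ?C" using cluster_disjoint x(2) by blast
        then have "PoleA \<in> D" by (simp only: cluster_refl)
        then have "\<sigma> PoleA * \<tau> PoleA = - ?q" using 2(1) by blast
        then have "?q = - ?q" by (simp only: ovo)
        moreover have "u \<noteq> - u" if "u \<in> pm" for u :: real using that by auto
        ultimately show False using q by blast
      qed
      then show ?thesis unfolding 2(2) using cluster_subset[OF n x(1), of b] x(2) finite_verts by (intro card_mono) auto
    qed simp
  qed simp
  have "card (verts n N - ?C) = card (verts n N) - card ?C" by (rule card_Diff_subset[OF finite_subset[OF C finite_verts] C])
  then have rest: "real (card (verts n N - ?C)) = ?V - real (card ?C)" using card_mono[OF finite_verts C] by (simp add: of_nat_diff)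
  have "?q * blue_imbalance n N w = (real (max_signed_cluster n N ?q w) - real (max_signed_cluster n N (- ?q) w)) / ?V"
  proof -
    have "q * ((f 1 - f (- 1)) / v) = (f q - f (- q)) / v" if "q \<in> pm" for q v :: real and f :: "real \<Rightarrow> real"
      using that by (auto simp: minus_divide_left)
    from this[OF q] show ?thesis unfolding blue_imbalance_def .
  qed
  also have "... \<ge> (real (card ?C) - (?V - real (card ?C))) / ?V" using lo hi rest V by (intro divide_right_mono diff_mono) auto
  finally have "(real (card ?C) - (?V - real (card ?C))) / ?V \<le> ?q * blue_imbalance n N w" .
  moreover have "(\<Sum>x\<in>verts n N. miss N x w) = ?V - real (card ?C)" using count_missing[OF conn] by (simp add: o)
  moreover have "1 - 2 * ((v - k) / v) = (k - (v - k)) / v" if "0 < v" for v k :: real using that by (simp add: field_simps)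
  ultimately show ?thesis using V by (simp only:)
qed

text \<open>The square expansion of \<open>site_overlap_order\<close> is used on the event that the poles are connected; off this
  event the truncated bound \<open>2 * s - s\<^sup>2\<close> is at most \<open>1\<close>, which costs the probability of the event.\<close>
theorem blue_imbalance_order: "blue_imbalance_order n \<beta> \<nu> c"
proof -
  have "(pos_part (1 - 2 * ell_b c))\<^sup>2 - P_const c \<le> EE N (\<lambda>w. (blue_imbalance n N w)\<^sup>2)" for N
  proof -
    define a where "a = 1 - 2 * ell_b c"
    define s where "s = pos_part a"
    have s: "0 \<le> s" by (simp add: s_def)
    let ?D = "\<lambda>w. (\<Sum>x\<in>verts n N. miss N x w) / card (verts n N)"
    have "(2 * s - s\<^sup>2) + (- 1) * (4 * s * EE N ?D + EE N (nc N)) = EE N (\<lambda>w. (2 * s - s\<^sup>2) + (- 1) * (4 * s * ?D w + nc N w))"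
      by (simp only: EE_affine EE_add EE_cmult)
    also have "... \<le> EE N (\<lambda>w. (blue_imbalance n N w)\<^sup>2)"
    proof (rule EE_mono)
      fix J w assume w: "w \<in> samples n N" "W N J w \<noteq> 0"
      have q: "(ov PoleA w)\<^sup>2 = 1" using ov_pm[OF w(1) poles_in_verts(1)[OF n]] by auto
      have D0: "0 \<le> ?D w" by (auto intro!: divide_nonneg_nonneg sum_nonneg simp: miss_def)
      show "(2 * s - s\<^sup>2) + (- 1) * (4 * s * ?D w + nc N w) \<le> (blue_imbalance n N w)\<^sup>2"
      proof (cases "PoleB \<in> cluster n N (snd (snd w)) PoleA")
        case True
        have "2 * s * (1 - 2 * ?D w) \<le> 2 * s * (ov PoleA w * blue_imbalance n N w)" using s by (intro mult_left_mono imbalance_ge[OF w True]) auto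
        moreover have "0 \<le> (blue_imbalance n N w * ov PoleA w - s)\<^sup>2" by simp
        moreover have "(blue_imbalance n N w * ov PoleA w - s)\<^sup>2
            = (blue_imbalance n N w)\<^sup>2 * (ov PoleA w)\<^sup>2 - 2 * s * (ov PoleA w * blue_imbalance n N w) + s\<^sup>2"
          by (simp add: power2_eq_square algebra_simps)
        moreover have "nc N w = 0" using True by (simp add: nc_def)
        moreover have "(2 * s - s\<^sup>2) + (- 1) * (4 * s * d + 0) \<le> k"
          if "2 * s * (1 - 2 * d) \<le> 2 * s * i" "0 \<le> k * 1 - 2 * s * i + s\<^sup>2" for d i k :: real using that by (simp add: algebra_simps)
        ultimately show ?thesis unfolding q by (simp only:)
      next
        case False
        then have "nc N w = 1" by (simp add: nc_def)
        moreover have "2 * s - s\<^sup>2 \<le> 1" using zero_le_power2[of "s - 1"] by (simp add: power2_eq_square algebra_simps)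
        moreover have "0 \<le> 4 * s * ?D w" using s D0 by (intro mult_nonneg_nonneg) auto
        moreover have "0 \<le> (blue_imbalance n N w)\<^sup>2" by simp
        moreover have "(2 * s - s\<^sup>2) + (- 1) * (4 * s * d + 1) \<le> k" if "2 * s - s\<^sup>2 \<le> 1" "0 \<le> 4 * s * d" "0 \<le> k" for d k :: real
        proof -
          have "(- 1) * (4 * s * d + 1) = - (4 * s * d) - 1" by simp
          then show ?thesis using that by linarith
        qed
        ultimately show ?thesis by (simp only:)
      qed
    qed
    finally have "(2 * s - s\<^sup>2) + (- 1) * (4 * s * EE N ?D + EE N (nc N)) \<le> EE N (\<lambda>w. (blue_imbalance n N w)\<^sup>2)" .
    moreover have "4 * s * EE N ?D \<le> 4 * s * ell_b c" using s by (intro mult_left_mono mean_missing_le) auto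
    moreover have "EE N (nc N) \<le> P_const c" using disconnected_le[of N] wr_le_P[of N] by linarith
    moreover have "s * a = s\<^sup>2" by (simp add: s_def power2_eq_square max_def)
    moreover have "s * a = s - 2 * (s * ell_b c)" by (simp add: a_def algebra_simps)
    moreover have "s\<^sup>2 - P \<le> g"
      if "(2 * s - s\<^sup>2) + (- 1) * (4 * s * d + p) \<le> g" "4 * s * d \<le> 4 * s * l" "p \<le> P" "s * a = s\<^sup>2" "s * a = s - 2 * (s * l)"
      for d p g l P :: real
    proof -
      have "(- 1) * (4 * s * d + p) = - (4 * s * d) - p" "4 * s * l = 4 * (s * l)" by simp_all
      then show ?thesis using that by linarith
    qed
    ultimately show ?thesis unfolding a_def[symmetric] s_def[symmetric] by blast
  qed
  then show ?thesis by (simp add: blue_imbalance_order_def joint_expectation_ens)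
qed

theorem ordered: "ordered_phase n \<beta> \<nu> c"
  unfolding ordered_phase_def
  using pole_order EA_order site_overlap_order giant_pole_cluster unique_giant_cluster blue_imbalance_order by blast

end

section \<open>Existence of certificates\<close>

text \<open>Some law with bounded density is needed to instantiate the probabilistic part when only a certificate
  is given: that the constants are nonnegative is a property of the certificate alone.\<close>
lemma uniform_law:
  assumes "0 < \<phi>"
  shows "law_with_density_le \<phi> (density lborel (\<lambda>x. ennreal \<phi> * ind {0..1 / \<phi>} x))"
proof -
  let ?f = "\<lambda>x::real. ennreal \<phi> * ind {0..1 / \<phi>} x"
  have "(LI x. ?f x) = ennreal \<phi> * ennreal (1 / \<phi>)" using assms by (subst nn_integral_cmult_indicator) auto
  also have "... = 1" using assms by (subst ennreal_mult[symmetric]) auto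
  finally have "prob_space (density lborel ?f)" by (intro prob_spaceI) (subst emeasure_density, auto)
  moreover have "?f \<in> borel_measurable borel" by measurable
  moreover have "?f x \<le> ennreal \<phi>" for x by (simp split: split_indicator)
  ultimately show ?thesis unfolding law_with_density_le_def by blast
qed

lemma certificate_constants_nonneg:
  assumes "2 \<le> n" "0 < \<phi>" "is_certificate n \<phi> \<beta> c"
  shows "0 \<le> ell_s c" "0 \<le> ell_b c" "0 \<le> S_const c" "0 \<le> P_const c"
proof -
  interpret certified n \<beta> "density lborel (\<lambda>x. ennreal \<phi> * ind {0..1 / \<phi>} x)" c \<phi>
    by (rule certified.intro[OF assms uniform_law[OF assms(2)]])
  show "0 \<le> ell_s c" "0 \<le> ell_b c" "0 \<le> S_const c" "0 \<le> P_const c" by (rule constants_nonneg)+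
qed

lemma blue_gap:
  assumes "0 \<le> P" "2 * l + sqrt P < 1"
  shows "P < (pos_part (1 - 2 * l))\<^sup>2"
proof -
  have "sqrt P < pos_part (1 - 2 * l)" using assms(2) by simp
  moreover have "0 \<le> sqrt P" using assms(1) by simp
  ultimately have "(sqrt P)\<^sup>2 < (pos_part (1 - 2 * l))\<^sup>2" by (intro power_strict_mono) auto
  then show ?thesis using assms(1) by simp
qed

lemma blue_positivityI:
  assumes "0 \<le> ell_b c" "0 \<le> P_const c" "2 * ell_b c + sqrt (P_const c) < 1"
  shows "blue_positivity c"
proof -
  have "sqrt (P_const c) < 1" using assms(1,3) by linarith
  then have P: "P_const c < 1" by simp
  have "1 - ell_b c / \<theta> - P_const c > 0" if \<theta>: "ell_b c / (1 - P_const c) < \<theta>" for \<theta>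
  proof -
    have "0 \<le> ell_b c / (1 - P_const c)" using assms(1) P by simp
    then have "0 < \<theta>" using \<theta> by linarith
    moreover have "ell_b c < \<theta> * (1 - P_const c)" using \<theta> P by (simp add: pos_divide_less_eq)
    ultimately have "ell_b c / \<theta> < 1 - P_const c" by (simp add: pos_divide_less_eq mult.commute)
    then show ?thesis by simp
  qed
  then show ?thesis using blue_gap[OF assms(2,3)] by (simp add: blue_positivity_def)
qed

lemma certificate_mono:
  assumes "is_certificate n \<phi> \<beta>1 c" "\<beta>1 \<le> \<beta>" "0 < \<phi>"
  shows "is_certificate n \<phi> \<beta> c"
proof -
  have b: "0 < \<beta>1" "\<phi> / \<beta>1 \<le> cr c 0" using assms(1) by (auto simp: is_certificate_def Let_def)
  have "\<phi> / \<beta> \<le> \<phi> / \<beta>1" using b assms by (intro divide_left_mono) auto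
  then have "0 < \<beta>" "\<phi> / \<beta> \<le> cr c 0" using b assms by auto
  then show ?thesis using assms(1) by (simp add: is_certificate_def Let_def)
qed

text \<open>The certificate without initial steps. At low temperature the initial value \<open>\<phi> / \<beta>\<close> is small
  enough for the tail inequalities to hold at once, and the sequence is geometric.\<close>
definition geometric_certificate :: "real \<Rightarrow> real \<Rightarrow> real \<Rightarrow> certificate" where
  "geometric_certificate t \<gamma> r = \<lparr>depth = 0, cr = (\<lambda>_. r), cw = (\<lambda>_. 0), cL = (\<lambda>_. t), cR = (\<lambda>_. t),
     tailA = 1, tail\<gamma> = \<gamma>, tailL = t, tailR = t\<rparr>"

lemma geometric_seq:
  "rseq (geometric_certificate t \<gamma> r) k = r * \<gamma> ^ k"
  "wseq (geometric_certificate t \<gamma> r) k = (r * \<gamma> ^ k)\<^sup>2"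
  by (simp_all add: rseq_def wseq_def geometric_certificate_def power_mult_distrib power_even_eq)

lemma is_geometric_certificate:
  "is_certificate n \<phi> \<beta> (geometric_certificate t \<gamma> r) \<longleftrightarrow>
     0 < \<beta> \<and> \<phi> / \<beta> \<le> r \<and> 0 < \<gamma> \<and> 0 < t \<and> r\<^sup>2 < 1 \<and> Gam n r (r\<^sup>2) t t \<le> \<gamma> \<and> \<gamma> < 1 \<and> varpi r (r\<^sup>2) t t ^ n \<le> \<gamma>\<^sup>2 * r\<^sup>2"
  by (auto simp: is_certificate_def geometric_certificate_def Let_def)

lemma geometric_constants:
  assumes c: "is_certificate n \<phi> \<beta> (geometric_certificate t \<gamma> r)" and r: "0 \<le> r" "r \<le> 1"
  shows "ell_s (geometric_certificate t \<gamma> r) \<le> 7 / (1 - \<gamma>) * r"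
    "ell_b (geometric_certificate t \<gamma> r) \<le> 7 / (1 - \<gamma>) * r"
    "S_const (geometric_certificate t \<gamma> r) \<le> 7 / (1 - \<gamma>) * r"
    "P_const (geometric_certificate t \<gamma> r) \<le> 7 / (1 - \<gamma>) * r"
proof -
  let ?c = "geometric_certificate t \<gamma> r"
  have \<gamma>: "0 < \<gamma>" "\<gamma> < 1" using c by (auto simp: is_geometric_certificate)
  have ln2: "0 \<le> ln (2::real)" "ln (2::real) \<le> 1" using ln_2_less_1 by auto
  have x: "0 \<le> r * \<gamma> ^ k" "r * \<gamma> ^ k \<le> 1" "r * \<gamma> ^ k \<le> r" for k
    using r \<gamma> by (auto intro!: mult_le_one mult_left_le simp: power_le_one)
  have sq: "(r * \<gamma> ^ k)\<^sup>2 \<le> r * \<gamma> ^ k" for k using x[of k] by (simp add: power2_eq_square mult_left_le)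
  have geo: "(\<lambda>k. 7 * r * \<gamma> ^ k) sums (7 * r * (1 / (1 - \<gamma>)))" using \<gamma> by (intro sums_mult geometric_sums) simp
  have le: "suminf f \<le> 7 / (1 - \<gamma>) * r" if "summable f" "\<And>k. f k \<le> 7 * r * \<gamma> ^ k" for f
    using suminf_le[OF that(2,1) sums_summable[OF geo]] sums_unique[OF geo] by simp
  show "ell_s ?c \<le> 7 / (1 - \<gamma>) * r" unfolding ell_s_def
  proof (rule le[OF certificate_summable(3)[OF c]])
    show "1/2 * wseq ?c k + 2 * rseq ?c k \<le> 7 * r * \<gamma> ^ k" for k unfolding geometric_seq mult.assoc using sq[of k] x(1)[of k] by linarith
  qed
  show "ell_b ?c \<le> 7 / (1 - \<gamma>) * r" unfolding ell_b_def
  proof (rule le[OF certificate_summable(4)[OF c]])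
    fix k
    define y where "y = r * \<gamma> ^ k"
    have y: "0 \<le> y" "y \<le> 1" "y\<^sup>2 \<le> y" using x[of k] sq[of k] by (auto simp: y_def)
    have "(y\<^sup>2)\<^sup>2 \<le> 1 * y" unfolding power2_eq_square[of "y\<^sup>2"] using y by (intro mult_mono) auto
    moreover have "y\<^sup>2 * y \<le> 1 * y" using y by (intro mult_right_mono) auto
    moreover have "(1 + 2 * ln 2) * y \<le> 3 * y" using y ln2 by (intro mult_right_mono) auto
    ultimately have "abar y (y\<^sup>2) \<le> 7 * y" unfolding abar_def using y by linarith
    then show "abar (rseq ?c k) (wseq ?c k) \<le> 7 * r * \<gamma> ^ k" by (simp add: geometric_seq y_def)
  qed
  have "7 * r \<le> 7 * r * (1 / (1 - \<gamma>))"
    using \<gamma> r by (intro mult_left_le[THEN order_trans, rotated] mult_le_cancel_left1[THEN iffD2]) (auto simp: field_simps)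
  then have K: "7 * r \<le> 7 / (1 - \<gamma>) * r" by simp
  show "S_const ?c \<le> 7 / (1 - \<gamma>) * r" unfolding S_const_def
  proof (rule cSUP_least)
    show "wseq ?c N + 2 * rseq ?c N \<le> 7 / (1 - \<gamma>) * r" for N unfolding geometric_seq using sq[of N] x[of N] K r by linarith
  qed simp
  show "P_const ?c \<le> 7 / (1 - \<gamma>) * r" unfolding P_const_def
  proof (rule cSUP_least)
    fix N
    have "2 * ln 2 * (r * \<gamma> ^ N) \<le> 2 * (r * \<gamma> ^ N)" using ln2 x[of N] by (intro mult_right_mono) auto
    then show "wseq ?c N + 2 * ln 2 * rseq ?c N \<le> 7 / (1 - \<gamma>) * r" unfolding geometric_seq using sq[of N] x[of N] K r by linarith
  qed simp
qed

text \<open>As both parameters grow, the prefactor tends to \<open>1\<close>, and \<open>kappa n \<le> 302 / 315\<close> leaves room.\<close>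
lemma contraction_parameters:
  assumes "4 \<le> n"
  obtains t :: real where "0 < t" "(1 + exp (- 2 * t)) / tanh t * kappa n < 1"
proof -
  have "((\<lambda>t::real. (1 + exp (- 2 * t)) / tanh t) \<longlongrightarrow> (1 + 0) / 1) at_top"
    by (intro tendsto_divide tendsto_add tendsto_const tanh_real_at_top filterlim_compose[OF exp_at_bot]
              filterlim_tendsto_neg_mult_at_bot[OF tendsto_const] filterlim_ident) auto
  then have "\<forall>\<^sub>F t in at_top. (1 + exp (- 2 * t)) / tanh t < (315 / 302 :: real)" by (rule order_tendstoD(2)) simp
  then have "\<forall>\<^sub>F t::real in at_top. 0 < t \<and> (1 + exp (- 2 * t)) / tanh t < 315 / 302"
    using eventually_gt_at_top[of 0] by eventually_elim simp
  then obtain t :: real where t: "0 < t" "(1 + exp (- 2 * t)) / tanh t < 315 / 302"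
    using eventually_happens'[OF trivial_limit_at_top_linorder] by blast
  have "0 \<le> (1 + exp (- 2 * t)) / tanh t" using t(1) by (intro divide_nonneg_nonneg add_nonneg_nonneg) auto
  then have "(1 + exp (- 2 * t)) / tanh t * kappa n \<le> (1 + exp (- 2 * t)) / tanh t * (302 / 315)"
    using kappa_le[OF assms] by (intro mult_left_mono) auto
  also have "... < 315 / 302 * (302 / 315)" using t(2) by (rule mult_strict_right_mono) simp
  finally have "(1 + exp (- 2 * t)) / tanh t * kappa n < 1" by simp
  with t(1) show thesis by (rule that)
qed

lemma varpi_tendsto:
  assumes "(r \<longlongrightarrow> 0) F"
  shows "((\<lambda>x. varpi (r x) ((r x)\<^sup>2) L R) \<longlongrightarrow> 0) F"
proof -
  have "((\<lambda>x. 2 * (r x)\<^sup>2 + (2 * (r x / (1 - (r x)\<^sup>2)) * R)\<^sup>2 + 4 * (r x / (1 - (r x)\<^sup>2)) * L)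
      \<longlongrightarrow> 2 * 0\<^sup>2 + (2 * (0 / (1 - 0\<^sup>2)) * R)\<^sup>2 + 4 * (0 / (1 - 0\<^sup>2)) * L) F"
    by (intro tendsto_intros assms) simp_all
  then show ?thesis by (simp add: varpi_def Let_def)
qed

lemma Gam_tendsto:
  assumes "(r \<longlongrightarrow> 0) F" "1 \<le> n"
  shows "((\<lambda>x. Gam n (r x) ((r x)\<^sup>2) L R) \<longlongrightarrow> (1 + exp (- 2 * L)) / tanh R * kappa n) F"
proof -
  have "(\<Sum>g = 1..n. real (n choose g) * kappa g * 0 ^ (n - g)) = (\<Sum>g = 1..n. if g = n then kappa n else 0)" by (intro sum.cong) auto
  also have "... = kappa n" using assms(2) by simp
  finally have k: "(\<Sum>g = 1..n. real (n choose g) * kappa g * 0 ^ (n - g)) = kappa n" .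
  show ?thesis unfolding Gam_def k[symmetric]
    by (intro tendsto_mult tendsto_sum tendsto_power tendsto_const varpi_tendsto assms(1))
qed

text \<open>\<open>varpi\<close> is of order \<open>r\<close>, so its \<open>n\<close>-th power is of order \<open>r ^ 3\<close>, which is negligible against \<open>r\<^sup>2\<close>.\<close>
lemma varpi_power_le:
  assumes r: "0 < r" "r \<le> 1 / 2" and LR: "0 < L" "0 < R" and n: "3 \<le> n" and v1: "varpi r (r\<^sup>2) L R \<le> 1"
  shows "varpi r (r\<^sup>2) L R ^ n \<le> (2 + 16 * R\<^sup>2 + 8 * L) ^ 3 * r * r\<^sup>2"
proof -
  define \<rho> where "\<rho> = r / (1 - r\<^sup>2)"
  have r2: "r\<^sup>2 \<le> r" using r by (simp add: power2_eq_square mult_left_le)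
  then have "r\<^sup>2 \<le> 1 / 2" using r(2) by linarith
  note r2 = r2 this
  have \<rho>: "0 \<le> \<rho>" "\<rho> \<le> 2 * r"
  proof -
    have "r * 1 \<le> r * (2 * (1 - r\<^sup>2))" using r r2 by (intro mult_left_mono) auto
    then show "\<rho> \<le> 2 * r" using r2 by (simp add: \<rho>_def pos_divide_le_eq algebra_simps)
    show "0 \<le> \<rho>" using r r2 by (simp add: \<rho>_def)
  qed
  have "(2 * \<rho> * R)\<^sup>2 \<le> (2 * (2 * r) * R)\<^sup>2" using \<rho> LR by (intro power_mono mult_right_mono mult_left_mono) auto
  also have "... = 16 * R\<^sup>2 * r\<^sup>2" by (simp add: power2_eq_square)
  also have "... \<le> 16 * R\<^sup>2 * r" using r2 by (intro mult_left_mono) auto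
  finally have 1: "(2 * \<rho> * R)\<^sup>2 \<le> 16 * R\<^sup>2 * r" .
  have "4 * \<rho> * L \<le> 4 * (2 * r) * L" using \<rho> LR by (intro mult_right_mono mult_left_mono) auto
  then have 2: "4 * \<rho> * L \<le> 8 * L * r" by (simp add: mult_ac)
  have le: "varpi r (r\<^sup>2) L R \<le> (2 + 16 * R\<^sup>2 + 8 * L) * r"
    unfolding varpi_def Let_def \<rho>_def[symmetric] distrib_right using 1 2 r2 by linarith
  have v0: "0 \<le> varpi r (r\<^sup>2) L R"
    unfolding varpi_def Let_def \<rho>_def[symmetric] using \<rho> LR by (intro add_nonneg_nonneg mult_nonneg_nonneg) auto
  have "varpi r (r\<^sup>2) L R ^ n \<le> varpi r (r\<^sup>2) L R ^ 3" using v0 v1 n by (intro power_decreasing) auto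
  also have "... \<le> ((2 + 16 * R\<^sup>2 + 8 * L) * r) ^ 3" using le v0 by (rule power_mono)
  also have "... = (2 + 16 * R\<^sup>2 + 8 * L) ^ 3 * r * r\<^sup>2" by (simp add: power_mult_distrib power2_eq_square power3_eq_cube)
  finally show ?thesis .
qed

theorem certificates_exist:
  fixes n :: nat and \<phi> :: real
  assumes n: "4 \<le> n" and \<phi>: "0 < \<phi>"
  obtains t \<gamma> :: real where "\<gamma> < 1" "\<forall>\<^sub>F \<beta> in at_top. is_certificate n \<phi> \<beta> (geometric_certificate t \<gamma> (\<phi> / \<beta>))"
proof -
  obtain t :: real where t: "0 < t" "(1 + exp (- 2 * t)) / tanh t * kappa n < 1" by (rule contraction_parameters[OF n])
  define g where "g = (1 + exp (- 2 * t)) / tanh t * kappa n"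
  \<comment> \<open>Any rate strictly between the limit \<open>g\<close> of \<open>Gam\<close> and \<open>1\<close> would do.\<close>
  define \<gamma> where "\<gamma> = (1 + g) / 2"
  have "0 \<le> g" unfolding g_def using t(1) kappa_nonneg by (intro mult_nonneg_nonneg divide_nonneg_nonneg add_nonneg_nonneg) auto
  then have \<gamma>: "0 < \<gamma>" "g < \<gamma>" "\<gamma> < 1" using t(2)[folded g_def] by (auto simp: \<gamma>_def)
  define C where "C = (2 + 16 * t\<^sup>2 + 8 * t) ^ 3"
  have C: "0 < C" unfolding C_def using t(1) by (intro zero_less_power) (simp add: add_pos_nonneg)
  have r: "((\<lambda>\<beta>. \<phi> / \<beta>) \<longlongrightarrow> 0) at_top" by (intro tendsto_divide_0[OF tendsto_const]) (rule filterlim_at_top_imp_at_infinity[OF filterlim_ident])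
  have "\<forall>\<^sub>F \<beta> in at_top. \<phi> / \<beta> < min (1 / 2) (\<gamma>\<^sup>2 / C)"
    by (rule order_tendstoD(2)[OF r]) (use C \<gamma> in simp)
  moreover have "\<forall>\<^sub>F \<beta> in at_top. varpi (\<phi> / \<beta>) ((\<phi> / \<beta>)\<^sup>2) t t < 1"
    by (rule order_tendstoD(2)[OF varpi_tendsto[OF r]]) simp
  moreover have "\<forall>\<^sub>F \<beta> in at_top. Gam n (\<phi> / \<beta>) ((\<phi> / \<beta>)\<^sup>2) t t < \<gamma>"
    using \<gamma>(2) n unfolding g_def by (intro order_tendstoD(2)[OF Gam_tendsto[OF r]]) auto
  ultimately have "\<forall>\<^sub>F \<beta> in at_top. is_certificate n \<phi> \<beta> (geometric_certificate t \<gamma> (\<phi> / \<beta>))"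
    using eventually_gt_at_top[of 0]
  proof eventually_elim
    case (elim \<beta>)
    define s where "s = \<phi> / \<beta>"
    have s: "0 < s" "s < 1 / 2" "s < \<gamma>\<^sup>2 / C" using elim \<phi> by (auto simp: s_def)
    have "s\<^sup>2 < 1" using s by (simp add: power_less_one_iff)
    moreover have "varpi s (s\<^sup>2) t t ^ n \<le> C * s * s\<^sup>2"
      unfolding C_def using s t(1) n elim by (intro varpi_power_le) (auto simp: s_def)
    moreover have "C * s * s\<^sup>2 \<le> \<gamma>\<^sup>2 * s\<^sup>2" using s C by (intro mult_right_mono) (auto simp: pos_less_divide_eq mult.commute)
    ultimately show ?case unfolding is_geometric_certificate s_def[symmetric] using elim \<gamma> t(1) by (auto simp: s_def)
  qed
  with \<gamma>(3) show thesis by (rule that)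
qed

theorem theoremA:
  fixes n :: nat and \<phi> :: real
  assumes "4 \<le> n" and "0 < \<phi>"
  shows
    "(\<exists>\<beta>0 cert.
        (\<forall>\<beta>\<ge>\<beta>0.
           is_certificate n \<phi> \<beta> (cert \<beta>) \<and>
           ell_s (cert \<beta>) \<in> {0..<1} \<and> ell_b (cert \<beta>) \<in> {0..<1} \<and>
           S_const (cert \<beta>) \<in> {0..<1} \<and> P_const (cert \<beta>) \<in> {0..<1} \<and>
           2 * ell_s (cert \<beta>) + S_const (cert \<beta>) < 1 \<and>
           2 * ell_b (cert \<beta>) + sqrt (P_const (cert \<beta>)) < 1 \<and>
           (pos_part (1 - 2 * ell_b (cert \<beta>)))\<^sup>2 > P_const (cert \<beta>) \<and>
           (\<forall>\<nu>. law_with_density_le \<phi> \<nu> \<longrightarrow> ordered_phase n \<beta> \<nu> (cert \<beta>)) \<and>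
           site_positivity (cert \<beta>) \<and> blue_positivity (cert \<beta>)) \<and>
        (\<lambda>\<beta>. ell_s (cert \<beta>)) \<in> O(\<lambda>\<beta>. 1 / \<beta>) \<and>
        (\<lambda>\<beta>. ell_b (cert \<beta>)) \<in> O(\<lambda>\<beta>. 1 / \<beta>) \<and>
        (\<lambda>\<beta>. S_const (cert \<beta>)) \<in> O(\<lambda>\<beta>. 1 / \<beta>) \<and>
        (\<lambda>\<beta>. P_const (cert \<beta>)) \<in> O(\<lambda>\<beta>. 1 / \<beta>) \<and>
        ((\<lambda>\<beta>. 1 - S_const (cert \<beta>)) \<longlongrightarrow> 1) at_top \<and>
        ((\<lambda>\<beta>. 1 - 2 * ell_s (cert \<beta>)) \<longlongrightarrow> 1) at_top \<and>
        ((\<lambda>\<beta>. (pos_part (1 - 2 * ell_s (cert \<beta>) - S_const (cert \<beta>)))\<^sup>2) \<longlongrightarrow> 1) at_top \<and>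
        ((\<lambda>\<beta>. (pos_part (1 - 2 * ell_b (cert \<beta>)))\<^sup>2 - P_const (cert \<beta>)) \<longlongrightarrow> 1) at_top) \<and>
     (\<forall>\<beta> c. is_certificate n \<phi> \<beta> c \<longrightarrow>
        (\<forall>\<nu>. law_with_density_le \<phi> \<nu> \<longrightarrow> ordered_phase n \<beta> \<nu> c) \<and>
        (2 * ell_s c + S_const c < 1 \<longrightarrow> site_positivity c) \<and>
        (2 * ell_b c + sqrt (P_const c) < 1 \<longrightarrow> blue_positivity c)) \<and>
     (\<forall>\<beta>1 \<beta> c. is_certificate n \<phi> \<beta>1 c \<and> \<beta>1 \<le> \<beta> \<longrightarrow> is_certificate n \<phi> \<beta> c)"
proof -
  have n2: "2 \<le> n" using assms(1) by simp
  have ordered: "ordered_phase n \<beta> \<nu> c" if "is_certificate n \<phi> \<beta> c" "law_with_density_le \<phi> \<nu>" for \<beta> \<nu> c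
    using that n2 assms(2) by (intro certified.ordered certified.intro)
  note nonneg = certificate_constants_nonneg[OF n2 assms(2)]
  have site: "site_positivity c" if "2 * ell_s c + S_const c < 1" for c using that by (simp add: site_positivity_def)
  have blue: "blue_positivity c" if "is_certificate n \<phi> \<beta> c" "2 * ell_b c + sqrt (P_const c) < 1" for \<beta> c
    using nonneg[OF that(1)] that(2) by (intro blue_positivityI)
  obtain t \<gamma> where \<gamma>: "\<gamma> < 1" and ev: "\<forall>\<^sub>F \<beta> in at_top. is_certificate n \<phi> \<beta> (geometric_certificate t \<gamma> (\<phi> / \<beta>))"
    by (rule certificates_exist[OF assms])
  define cert where "cert \<beta> = geometric_certificate t \<gamma> (\<phi> / \<beta>)" for \<beta>
  define K where "K = 7 / (1 - \<gamma>) * \<phi>"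
  have K: "0 < K" using \<gamma> assms(2) by (simp add: K_def)
  have lim: "((\<lambda>\<beta>. K / \<beta>) \<longlongrightarrow> 0) at_top" for K :: real
    by (intro tendsto_divide_0[OF tendsto_const]) (rule filterlim_at_top_imp_at_infinity[OF filterlim_ident])
  \<comment> \<open>Constants below \<open>1 / 16\<close> satisfy both gap conditions, since \<open>3 / 16 < 1\<close> and \<open>2 / 16 + 1 / 4 < 1\<close>.\<close>
  have "\<forall>\<^sub>F \<beta> in at_top. K / \<beta> < 1 / 16" "\<forall>\<^sub>F \<beta> in at_top. \<phi> / \<beta> < 1"
    by (rule order_tendstoD(2)[OF lim], simp)+
  with ev have "\<forall>\<^sub>F \<beta> in at_top. is_certificate n \<phi> \<beta> (cert \<beta>) \<and> K / \<beta> < 1 / 16 \<and> \<phi> / \<beta> < 1"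
    unfolding cert_def by eventually_elim simp
  then obtain \<beta>0 where \<beta>0: "\<And>\<beta>. \<beta>0 \<le> \<beta> \<Longrightarrow> is_certificate n \<phi> \<beta> (cert \<beta>) \<and> K / \<beta> < 1 / 16 \<and> \<phi> / \<beta> < 1"
    by (auto simp: eventually_at_top_linorder)
  have bounds: "0 \<le> x \<and> x \<le> K / \<beta>" if \<beta>: "\<beta>0 \<le> \<beta>" and x: "x \<in> {ell_s (cert \<beta>), ell_b (cert \<beta>), S_const (cert \<beta>), P_const (cert \<beta>)}" for \<beta> x
  proof -
    have c: "is_certificate n \<phi> \<beta> (cert \<beta>)" using \<beta>0[OF \<beta>] by blast
    then have "0 < \<beta>" by (simp add: is_certificate_def Let_def)
    then have r: "0 \<le> \<phi> / \<beta>" "\<phi> / \<beta> \<le> 1" using \<beta>0[OF \<beta>] assms(2) by auto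
    have "7 / (1 - \<gamma>) * (\<phi> / \<beta>) = K / \<beta>" by (simp add: K_def)
    then show ?thesis using x nonneg[OF c] geometric_constants[OF c[unfolded cert_def] r] by (auto simp: cert_def)
  qed
  have bigo: "f \<in> O(\<lambda>\<beta>. 1 / \<beta>)" and tends: "(f \<longlongrightarrow> 0) at_top"
    if f: "\<And>\<beta>. \<beta>0 \<le> \<beta> \<Longrightarrow> 0 \<le> f \<beta> \<and> f \<beta> \<le> K / \<beta>" for f :: "real \<Rightarrow> real"
  proof -
    show "f \<in> O(\<lambda>\<beta>. 1 / \<beta>)"
    proof (rule bigoI[of _ K])
      show "\<forall>\<^sub>F \<beta> in at_top. norm (f \<beta>) \<le> K * norm (1 / \<beta>)"
        using eventually_ge_at_top[of \<beta>0] eventually_gt_at_top[of 0]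
        by eventually_elim (use f in \<open>auto simp: abs_of_nonneg\<close>)
    qed
    show "(f \<longlongrightarrow> 0) at_top"
    proof (rule tendsto_sandwich[OF _ _ tendsto_const lim[of K]])
      show "\<forall>\<^sub>F \<beta> in at_top. 0 \<le> f \<beta>" "\<forall>\<^sub>F \<beta> in at_top. f \<beta> \<le> K / \<beta>"
        using eventually_ge_at_top[of \<beta>0] by (eventually_elim, use f in blast)+
    qed
  qed
  let ?ls = "\<lambda>\<beta>. ell_s (cert \<beta>)" and ?lb = "\<lambda>\<beta>. ell_b (cert \<beta>)" and ?S = "\<lambda>\<beta>. S_const (cert \<beta>)" and ?P = "\<lambda>\<beta>. P_const (cert \<beta>)"
  have O: "?ls \<in> O(\<lambda>\<beta>. 1 / \<beta>)" "?lb \<in> O(\<lambda>\<beta>. 1 / \<beta>)" "?S \<in> O(\<lambda>\<beta>. 1 / \<beta>)" "?P \<in> O(\<lambda>\<beta>. 1 / \<beta>)"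
    by (rule bigo, rule bounds, assumption, simp)+
  have T: "(?ls \<longlongrightarrow> 0) at_top" "(?lb \<longlongrightarrow> 0) at_top" "(?S \<longlongrightarrow> 0) at_top" "(?P \<longlongrightarrow> 0) at_top"
    by (rule tends, rule bounds, assumption, simp)+
  have "((\<lambda>\<beta>. 1 - ?S \<beta>) \<longlongrightarrow> 1 - 0) at_top" "((\<lambda>\<beta>. 1 - 2 * ?ls \<beta>) \<longlongrightarrow> 1 - 2 * 0) at_top"
    "((\<lambda>\<beta>. (pos_part (1 - 2 * ?ls \<beta> - ?S \<beta>))\<^sup>2) \<longlongrightarrow> (pos_part (1 - 2 * 0 - 0))\<^sup>2) at_top"
    "((\<lambda>\<beta>. (pos_part (1 - 2 * ?lb \<beta>))\<^sup>2 - ?P \<beta>) \<longlongrightarrow> (pos_part (1 - 2 * 0))\<^sup>2 - 0) at_top"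
    by (intro tendsto_diff tendsto_mult tendsto_power tendsto_max tendsto_const T)+
  then have limits: "((\<lambda>\<beta>. 1 - ?S \<beta>) \<longlongrightarrow> 1) at_top" "((\<lambda>\<beta>. 1 - 2 * ?ls \<beta>) \<longlongrightarrow> 1) at_top"
    "((\<lambda>\<beta>. (pos_part (1 - 2 * ?ls \<beta> - ?S \<beta>))\<^sup>2) \<longlongrightarrow> 1) at_top"
    "((\<lambda>\<beta>. (pos_part (1 - 2 * ?lb \<beta>))\<^sup>2 - ?P \<beta>) \<longlongrightarrow> 1) at_top" by simp_all
  have "is_certificate n \<phi> \<beta> (cert \<beta>) \<and> ?ls \<beta> \<in> {0..<1} \<and> ?lb \<beta> \<in> {0..<1} \<and> ?S \<beta> \<in> {0..<1} \<and> ?P \<beta> \<in> {0..<1} \<and>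
      2 * ?ls \<beta> + ?S \<beta> < 1 \<and> 2 * ?lb \<beta> + sqrt (?P \<beta>) < 1 \<and> (pos_part (1 - 2 * ?lb \<beta>))\<^sup>2 > ?P \<beta> \<and>
      (\<forall>\<nu>. law_with_density_le \<phi> \<nu> \<longrightarrow> ordered_phase n \<beta> \<nu> (cert \<beta>)) \<and> site_positivity (cert \<beta>) \<and> blue_positivity (cert \<beta>)"
    if \<beta>: "\<beta>0 \<le> \<beta>" for \<beta>
  proof -
    have c: "is_certificate n \<phi> \<beta> (cert \<beta>)" and small: "K / \<beta> < 1 / 16" using \<beta>0[OF \<beta>] by auto
    have "0 \<le> ?ls \<beta> \<and> ?ls \<beta> \<le> K / \<beta>" "0 \<le> ?lb \<beta> \<and> ?lb \<beta> \<le> K / \<beta>" "0 \<le> ?S \<beta> \<and> ?S \<beta> \<le> K / \<beta>" "0 \<le> ?P \<beta> \<and> ?P \<beta> \<le> K / \<beta>"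
      by (rule bounds[OF \<beta>]; simp)+
    then have b: "0 \<le> ?ls \<beta>" "?ls \<beta> < 1 / 16" "0 \<le> ?lb \<beta>" "?lb \<beta> < 1 / 16" "0 \<le> ?S \<beta>" "?S \<beta> < 1 / 16" "0 \<le> ?P \<beta>" "?P \<beta> < 1 / 16"
      using small by linarith+
    have "sqrt (?P \<beta>) < sqrt ((1 / 4)\<^sup>2)" using b(8) by (intro real_sqrt_less_mono) (simp add: power2_eq_square)
    then have "sqrt (?P \<beta>) < 1 / 4" by simp
    then have gap: "2 * ?lb \<beta> + sqrt (?P \<beta>) < 1" using b by linarith
    have gap': "2 * ?ls \<beta> + ?S \<beta> < 1" using b by linarith
    show ?thesis using b c gap gap' blue_gap[OF b(7) gap] ordered[OF c] site[OF gap'] blue[OF c gap] by auto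
  qed
  then show ?thesis using O limits ordered site blue certificate_mono[OF _ _ assms(2)] by blast
qed

end
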